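(* Let $n\ge2$, $1\le k\le n-1$, $N\ge1$, let $U\subset\mathbb{R}^n$ be open, and let $\bar A\in\operatorname{Hom}(\varLambda^{k+1})$, $\bar B\in\operatorname{Hom}(\varLambda^k)$ be constant and Legendre elliptic with constants $\gamma_{\bar A}$ and $\gamma_{\bar B}$. Let $\alpha\in W^{1,2}(U;\varLambda^k)$ and assume one of the following holds: (i) $\int_U\langle\bar A\,d\alpha,d\psi\rangle+\int_U\langle d^\ast(\bar B\alpha),d^\ast(\bar B\psi)\rangle=0$ for all $\psi\in W^{1,2}_0(U;\varLambda^k)$; (ii) $\int_U\langle\bar A\,d(\bar B^{-1}\alpha),d(\bar B^{-1}\psi)\rangle+\int_U\langle d^\ast\alpha,d^\ast\psi\rangle=0$ for all $\psi\in W^{1,2}_0(U;\varLambda^k)$. Then there exists $C>0$ depending only on $\gamma_{\bar A},\gamma_{\bar B},\|\bar A\|,\|\bar B\|,k,n,N$ such that for any two concentric balls $B_\rho\subset B_r\subset\subset U$ with $0<\rho\le r$, $$\Big(\fint_{B_\rho}\big|\nabla^2\alpha-(\nabla^2\alpha)_{B_\rho}\big|^2\Big)^{1/2}\le C\Big(\frac{\rho}{r}\Big)\Big(\fint_{B_r}\big|\nabla^2\alpha-(\nabla^2\alpha)_{B_r}\big|^2\Big)^{1/2}.$$ Moreover, for any $1<\bar p<2$ there exists $C>0$ depending only on $\bar p,\gamma_{\bar A},\gamma_{\bar B},\|\bar A\|,\|\bar B\|,k,n,N$ such that for any ball $B_r\subset U$, $$\Big(\fint_{B_{r/2}}|\nabla^2\alpha|^2\Big)^{1/2}\le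 C\Big(\fint_{B_{3r/4}}|\nabla^2\alpha|^{\bar p}\Big)^{1/\bar p},$$ where $B_{r/2}\subset B_{3r/4}\subset B_r$ are concentric.
   Context: $\varLambda^j:=\Lambda^j\mathbb{R}^n\otimes\mathbb{R}^N$ ($N$-tuples of $j$-forms) with componentwise scalar product; $d$ is the exterior derivative and $d^\ast:=(-1)^{n(k+1)}\ast d\ast$. A linear map $M$ on $\varLambda^j$ is Legendre elliptic with constant $\gamma\in(0,1]$ if $\gamma|\xi|^2\le\langle M\xi,\xi\rangle\le\gamma^{-1}|\xi|^2$ for all $\xi$. $(g)_E$ denotes the average of $g$ over $E$. *)

theory Defs
  imports "HOL-Analysis.Analysis"
begin

text \<open>Values of N-tuples of forms on R^n (R^n = (real, 'n) vec, coordinates ordered by the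
linear order of 'n).  A value is a coefficient function on pairs (I, nu), where I is an
(increasing) multi-index, i.e. a subset of 'n, and nu < N is the tuple component.
An element of Lambda^j R^n (x) R^N is such a function vanishing off Ix j N.\<close>

type_synonym 'n fv = "'n set \<times> nat \<Rightarrow> real"

definition Ix :: "nat \<Rightarrow> nat \<Rightarrow> ('n::finite set \<times> nat) set" where
  "Ix j N = {(I, nu). card I = j \<and> nu < N}"

definition in_Lam :: "nat \<Rightarrow> nat \<Rightarrow> ('n::finite) fv \<Rightarrow> bool" where
  "in_Lam j N xi \<longleftrightarrow> (\<forall>c. c \<notin> Ix j N \<longrightarrow> xi c = 0)"

definition finner :: "nat \<Rightarrow> nat \<Rightarrow> ('n::finite) fv \<Rightarrow> 'n fv \<Rightarrow> real" where
  "finner j N xi eta = (\<Sum>c\<in>Ix j N. xi c * eta c)"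

definition fnorm :: "nat \<Rightarrow> nat \<Rightarrow> ('n::finite) fv \<Rightarrow> real" where
  "fnorm j N xi = sqrt (finner j N xi xi)"

definition mapp :: "nat \<Rightarrow> nat \<Rightarrow> ('n::finite set \<times> nat \<Rightarrow> 'n set \<times> nat \<Rightarrow> real)
    \<Rightarrow> 'n fv \<Rightarrow> 'n fv" where
  "mapp j N M xi = (\<lambda>c. if c \<in> Ix j N then (\<Sum>c'\<in>Ix j N. M c c' * xi c') else 0)"

definition legendre_elliptic :: "nat \<Rightarrow> nat \<Rightarrow> real
    \<Rightarrow> ('n::finite set \<times> nat \<Rightarrow> 'n set \<times> nat \<Rightarrow> real) \<Rightarrow> bool" where
  "legendre_elliptic j N \<gamma> M \<longleftrightarrow> 0 < \<gamma> \<and> \<gamma> \<le> 1 \<and>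
     (\<forall>xi. in_Lam j N xi \<longrightarrow>
        \<gamma> * finner j N xi xi \<le> finner j N (mapp j N M xi) xi \<and>
        finner j N (mapp j N M xi) xi \<le> finner j N xi xi / \<gamma>)"

definition opnorm :: "nat \<Rightarrow> nat \<Rightarrow> ('n::finite set \<times> nat \<Rightarrow> 'n set \<times> nat \<Rightarrow> real) \<Rightarrow> real" where
  "opnorm j N M = Sup {fnorm j N (mapp j N M xi) | xi. in_Lam j N xi \<and> fnorm j N xi \<le> 1}"

definition minv :: "nat \<Rightarrow> nat \<Rightarrow> ('n::finite set \<times> nat \<Rightarrow> 'n set \<times> nat \<Rightarrow> real)
    \<Rightarrow> 'n fv \<Rightarrow> 'n fv" where
  "minv j N M xi = (THE eta. in_Lam j N eta \<and> mapp j N M eta = xi)"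

text \<open>sign of the permutation listing I increasingly followed by K increasingly\<close>
definition eps :: "('n::{finite,linorder}) set \<Rightarrow> 'n set \<Rightarrow> real" where
  "eps I K = (-1) ^ card {(a, b). a \<in> I \<and> b \<in> K \<and> b < a}"

text \<open>Hodge star: *e_I = eps(I, I^c) e_(I^c)\<close>
definition hodge :: "('n::{finite,linorder}) fv \<Rightarrow> 'n fv" where
  "hodge xi = (\<lambda>(J, nu). eps (- J) J * xi (- J, nu))"

definition pd :: "'n::finite \<Rightarrow> ((real, 'n) vec \<Rightarrow> real) \<Rightarrow> (real, 'n) vec \<Rightarrow> real" where
  "pd i f x = frechet_derivative f (at x) (axis i 1)"

fun iter_pd :: "'n::finite list \<Rightarrow> ((real, 'n) vec \<Rightarrow> real) \<Rightarrow> (real, 'n) vec \<Rightarrow> real" where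
  "iter_pd [] f = f"
| "iter_pd (i # is) f = pd i (iter_pd is f)"

definition smooth :: "((real, 'n::finite) vec \<Rightarrow> real) \<Rightarrow> bool" where
  "smooth f \<longleftrightarrow> (\<forall>is. iter_pd is f differentiable_on UNIV)"

definition test_fun :: "((real, 'n::finite) vec) set \<Rightarrow> ((real, 'n) vec \<Rightarrow> real) \<Rightarrow> bool" where
  "test_fun U \<phi> \<longleftrightarrow> smooth \<phi> \<and> compact (closure {x. \<phi> x \<noteq> 0})
      \<and> closure {x. \<phi> x \<noteq> 0} \<subseteq> U"

definition loc_int :: "((real, 'n::finite) vec) set \<Rightarrow> ((real, 'n) vec \<Rightarrow> real) \<Rightarrow> bool" where
  "loc_int U f \<longleftrightarrow> (\<forall>K. compact K \<and> K \<subseteq> U \<longrightarrow> set_integrable lebesgue K f)"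

definition sq_int :: "((real, 'n::finite) vec) set \<Rightarrow> ((real, 'n) vec \<Rightarrow> real) \<Rightarrow> bool" where
  "sq_int U f \<longleftrightarrow> set_borel_measurable lebesgue U f \<and> set_integrable lebesgue U (\<lambda>x. (f x)\<^sup>2)"

definition weak_pd :: "((real, 'n::finite) vec) set \<Rightarrow> 'n \<Rightarrow> ((real, 'n) vec \<Rightarrow> real) \<Rightarrow> ((real, 'n) vec \<Rightarrow> real) \<Rightarrow> bool" where
  "weak_pd U i f g \<longleftrightarrow> loc_int U f \<and> loc_int U g \<and>
     (\<forall>\<phi>. test_fun U \<phi> \<longrightarrow>
        (LINT x:U|lebesgue. f x * pd i \<phi> x) = - (LINT x:U|lebesgue. g x * \<phi> x))"

definition wpd :: "((real, 'n::finite) vec) set \<Rightarrow> 'n \<Rightarrow> ((real, 'n) vec \<Rightarrow> real) \<Rightarrow> (real, 'n) vec \<Rightarrow> real" where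
  "wpd U i f = (SOME g. weak_pd U i f g)"

definition W12 :: "((real, 'n::finite) vec) set \<Rightarrow> nat \<Rightarrow> nat \<Rightarrow> ((real, 'n) vec \<Rightarrow> 'n fv) \<Rightarrow> bool" where
  "W12 U k N \<alpha> \<longleftrightarrow> (\<forall>x\<in>U. in_Lam k N (\<alpha> x)) \<and>
     (\<forall>c\<in>Ix k N. sq_int U (\<lambda>x. \<alpha> x c) \<and>
        (\<forall>i. \<exists>g. weak_pd U i (\<lambda>x. \<alpha> x c) g \<and> sq_int U g))"

definition w12dist2 :: "((real, 'n::finite) vec) set \<Rightarrow> nat \<Rightarrow> nat \<Rightarrow> ((real, 'n) vec \<Rightarrow> 'n fv)
    \<Rightarrow> ((real, 'n) vec \<Rightarrow> 'n fv) \<Rightarrow> real" where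
  "w12dist2 U k N \<phi> \<psi> = (\<Sum>c\<in>Ix k N.
      (LINT x:U|lebesgue. (\<phi> x c - \<psi> x c)\<^sup>2) +
      (\<Sum>i\<in>UNIV. LINT x:U|lebesgue. (pd i (\<lambda>y. \<phi> y c) x - wpd U i (\<lambda>y. \<psi> y c) x)\<^sup>2))"

definition W120 :: "((real, 'n::finite) vec) set \<Rightarrow> nat \<Rightarrow> nat \<Rightarrow> ((real, 'n) vec \<Rightarrow> 'n fv) \<Rightarrow> bool" where
  "W120 U k N \<psi> \<longleftrightarrow> W12 U k N \<psi> \<and>
     (\<exists>\<phi>s.
        (\<forall>m c. test_fun U (\<lambda>x. \<phi>s m x c)) \<and> (\<forall>m x. in_Lam k N (\<phi>s m x)) \<and>
        (\<lambda>m. w12dist2 U k N (\<phi>s m) \<psi>) \<longlonglongrightarrow> 0)"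

definition ext_d :: "((real, 'n::{finite,linorder}) vec) set \<Rightarrow> ((real, 'n) vec \<Rightarrow> 'n fv) \<Rightarrow> (real, 'n) vec \<Rightarrow> 'n fv" where
  "ext_d U \<omega> x = (\<lambda>(J, nu). \<Sum>i\<in>J. eps {i} (J - {i}) * wpd U i (\<lambda>y. \<omega> y (J - {i}, nu)) x)"

definition codiff :: "((real, 'n::{finite,linorder}) vec) set \<Rightarrow> nat \<Rightarrow> ((real, 'n) vec \<Rightarrow> 'n fv) \<Rightarrow> (real, 'n) vec \<Rightarrow> 'n fv" where
  "codiff U j \<omega> x = (\<lambda>c. (-1) ^ (CARD('n) * (j + 1)) *
      hodge (ext_d U (\<lambda>y. hodge (\<omega> y)) x) c)"

definition hess :: "((real, 'n::finite) vec) set \<Rightarrow> ((real, 'n) vec \<Rightarrow> 'n fv) \<Rightarrow> (real, 'n) vec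
    \<Rightarrow> 'n set \<times> nat \<Rightarrow> 'n \<Rightarrow> 'n \<Rightarrow> real" where
  "hess U \<alpha> x c i j = wpd U i (wpd U j (\<lambda>y. \<alpha> y c)) x"

definition hess_norm2 :: "((real, 'n::finite) vec) set \<Rightarrow> nat \<Rightarrow> nat \<Rightarrow> ((real, 'n) vec \<Rightarrow> 'n fv) \<Rightarrow> (real, 'n) vec \<Rightarrow> real" where
  "hess_norm2 U k N \<alpha> x = (\<Sum>c\<in>Ix k N. \<Sum>i\<in>UNIV. \<Sum>j\<in>UNIV. (hess U \<alpha> x c i j)\<^sup>2)"

definition avg :: "((real, 'n::finite) vec) set \<Rightarrow> ((real, 'n) vec \<Rightarrow> real) \<Rightarrow> real" where
  "avg E f = (LINT x:E|lebesgue. f x) / measure lebesgue E"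

definition hess_osc2 :: "((real, 'n::finite) vec) set \<Rightarrow> nat \<Rightarrow> nat \<Rightarrow> ((real, 'n) vec \<Rightarrow> 'n fv)
    \<Rightarrow> ((real, 'n) vec) set \<Rightarrow> real" where
  "hess_osc2 U k N \<alpha> E = avg E (\<lambda>x. \<Sum>c\<in>Ix k N. \<Sum>i\<in>UNIV. \<Sum>j\<in>UNIV.
      (hess U \<alpha> x c i j - avg E (\<lambda>y. hess U \<alpha> y c i j))\<^sup>2)"

definition sys_i :: "((real, 'n::{finite,linorder}) vec) set \<Rightarrow> nat \<Rightarrow> nat
    \<Rightarrow> ('n set \<times> nat \<Rightarrow> 'n set \<times> nat \<Rightarrow> real) \<Rightarrow> ('n set \<times> nat \<Rightarrow> 'n set \<times> nat \<Rightarrow> real)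
    \<Rightarrow> ((real, 'n) vec \<Rightarrow> 'n fv) \<Rightarrow> bool" where
  "sys_i U k N A B \<alpha> \<longleftrightarrow> (\<forall>\<psi>. W120 U k N \<psi> \<longrightarrow>
     (LINT x:U|lebesgue. finner (k+1) N (mapp (k+1) N A (ext_d U \<alpha> x)) (ext_d U \<psi> x)) +
     (LINT x:U|lebesgue. finner (k-1) N (codiff U k (\<lambda>y. mapp k N B (\<alpha> y)) x)
                                         (codiff U k (\<lambda>y. mapp k N B (\<psi> y)) x)) = 0)"

definition sys_ii :: "((real, 'n::{finite,linorder}) vec) set \<Rightarrow> nat \<Rightarrow> nat
    \<Rightarrow> ('n set \<times> nat \<Rightarrow> 'n set \<times> nat \<Rightarrow> real) \<Rightarrow> ('n set \<times> nat \<Rightarrow> 'n set \<times> nat \<Rightarrow> real)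
    \<Rightarrow> ((real, 'n) vec \<Rightarrow> 'n fv) \<Rightarrow> bool" where
  "sys_ii U k N A B \<alpha> \<longleftrightarrow> (\<forall>\<psi>. W120 U k N \<psi> \<longrightarrow>
     (LINT x:U|lebesgue. finner (k+1) N (mapp (k+1) N A (ext_d U (\<lambda>y. minv k N B (\<alpha> y)) x))
                                          (ext_d U (\<lambda>y. minv k N B (\<psi> y)) x)) +
     (LINT x:U|lebesgue. finner (k-1) N (codiff U k \<alpha> x) (codiff U k \<psi> x)) = 0)"

end

theory Submission
  imports Defs
begin

text \<open>
  Both systems have constant coefficients, and Cartan's identity
  \<open>|\<xi> \<and> y|\<^sup>2 + |\<xi> \<rfloor> y|\<^sup>2 = |\<xi>|\<^sup>2 |y|\<^sup>2\<close> together with the Legendre conditions shows that their symbols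
  are bounded below by a multiple of \<open>|\<xi>|\<^sup>2\<close>. For a distributional solution \<open>u\<close> of any such system and
  a cutoff \<open>\<eta>\<close>, testing with \<open>(\<partial>\<^sup>\<beta> \<eta>) cos (\<xi> \<bullet> x + \<theta>)\<close> bounds the Fourier coefficients of
  \<open>u \<partial>\<^sup>\<beta> \<eta>\<close> by \<open>1/|\<xi>|\<close> times those with more derivatives on \<open>\<eta>\<close>. Iterating, the coefficients of \<open>\<eta> u\<close>
  decay like \<open>|\<xi>|\<close> to any negative power times the \<open>L\<^sup>1\<close> norm of \<open>u\<close>, so \<open>\<eta> u\<close> equals almost
  everywhere an absolutely convergent Fourier series; this gives a \<open>C\<^sup>1\<close> representative whose values and gradient at a point are controlled
  by the \<open>L\<^sup>1\<close> norm of \<open>u\<close> on a ball around it. The second derivatives of \<open>\<alpha>\<close> are again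
  distributional solutions: the gradient bound, applied to them minus their averages, gives the decay
  for \<open>\<rho> \<le> r/2\<close> (it is trivial otherwise), and the bound on the values gives the
  \<open>L\<^sup>2\<close>-\<open>L\<^sup>1\<close> estimate behind the reverse Hoelder inequality.
\<close>

section \<open>Smooth functions and cutoffs\<close>

text \<open>The Legendre conditions control only d \<alpha> and d* (B \<alpha>), and these can
  vanish at a point where the gradient does not, so an energy argument would first need a
  Garding-type inequality. The Fourier route asks only for a quantitative inverse of the symbol. The
  obstacle there is B: Cartan's identity concerns one form, while here d sees y and d* sees z = B y.
  Polarising the identity and pairing z with y reduces the bound to coercivity of B. A second
  obstacle is that \<open>W12\<close> supplies first weak derivatives only, whereas the claim is
  about \<open>wpd\<close> of \<open>wpd\<close>, a choice that says nothing until a weak derivative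
  exists. Hence solutions are taken in the distributional sense: this class is closed under weak
  differentiation, and the C1 representative provides the next derivative. In the regularity lemmas
  the constant is quantified before the coefficients, the domain and the solution. They are
  therefore stated for all systems that share an index set and the bounds \<open>l\<close> and
  \<open>L\<close>, and the dependence of the final constants can be read off from the order of
  quantifiers.\<close>

lemma pd_eqI: "(f has_derivative f') (at x) \<Longrightarrow> pd i f x = f' (axis i 1)"
  unfolding pd_def by (metis frechet_derivative_at)

text \<open>Expanding h in the standard basis recovers the total derivative from the partial ones.
  The sum, product and chain rules for \<open>pd\<close> follow by applying the general rules to
  this form and evaluating at \<open>axis i 1\<close>.\<close>

lemma has_derivative_pd:
  fixes f :: "real^'n::finite \<Rightarrow> real"
  assumes "f differentiable at x"
  shows "(f has_derivative (\<lambda>h. \<Sum>i\<in>UNIV. h $ i * pd i f x)) (at x)"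
proof -
  let ?D = "frechet_derivative f (at x)"
  have D: "(f has_derivative ?D) (at x)"
    using assms frechet_derivative_works by blast
  have lin: "linear ?D" using D has_derivative_linear by blast
  have "?D h = (\<Sum>i\<in>UNIV. h $ i * pd i f x)" for h
  proof -
    have "h = (\<Sum>i\<in>UNIV. (h $ i) *\<^sub>R axis i 1)"
      by (metis (no_types, lifting) basis_expansion scalar_mult_eq_scaleR sum.cong)
    then have "?D h = ?D (\<Sum>i\<in>UNIV. (h $ i) *\<^sub>R axis i 1)" by simp
    also have "\<dots> = (\<Sum>i\<in>UNIV. (h $ i) *\<^sub>R ?D (axis i 1))"
      using lin by (simp add: linear_sum linear_scale)
    finally show ?thesis by (simp add: pd_def)
  qed
  then show ?thesis using D by presburger
qed

lemma pd_const: "pd i (\<lambda>x. c) x = 0"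
  by (rule pd_eqI[THEN trans]) (auto intro: derivative_intros)

lemma pd_add:
  assumes "f differentiable at x" "g differentiable at x"
  shows "pd i (\<lambda>x. f x + g x) x = pd i f x + pd i g x"
  using pd_eqI[OF has_derivative_add[OF has_derivative_pd[OF assms(1)] has_derivative_pd[OF assms(2)]], of i]
  by (simp add: axis_def if_distrib if_distribR cong: if_cong)

lemma pd_mult:
  assumes "f differentiable at x" "g differentiable at x"
  shows "pd i (\<lambda>x. f x * g x) x = f x * pd i g x + pd i f x * g x"
  using pd_eqI[OF has_derivative_mult[OF has_derivative_pd[OF assms(1)] has_derivative_pd[OF assms(2)]], of i]
  by (simp add: axis_def if_distrib if_distribR cong: if_cong)

lemma pd_cmult:
  fixes f :: "real^'n::finite \<Rightarrow> real"
  assumes "f differentiable at x"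
  shows "pd i (\<lambda>x. c * f x) x = c * pd i f x"
  using pd_mult[OF differentiable_const assms, of i c] by (simp add: pd_const)

lemma pd_comp:
  fixes g :: "real^'n::finite \<Rightarrow> real"
  assumes "g differentiable at x" "(H has_real_derivative H') (at (g x))"
  shows "pd i (\<lambda>x. H (g x)) x = H' * pd i g x" "(\<lambda>x. H (g x)) differentiable at x"
proof -
  have D: "((\<lambda>x. H (g x)) has_derivative (\<lambda>h. H' * (\<Sum>i\<in>UNIV. h $ i * pd i g x))) (at x)"
    using has_derivative_compose[OF has_derivative_pd[OF assms(1)], of H "\<lambda>z. H' * z"] assms(2)
    by (simp add: has_field_derivative_def)
  show "pd i (\<lambda>x. H (g x)) x = H' * pd i g x"
    using pd_eqI[OF D, of i] by (simp add: axis_def if_distrib if_distribR cong: if_cong)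
  show "(\<lambda>x. H (g x)) differentiable at x" using D differentiable_def by blast
qed

text \<open>\<open>frechet_derivative\<close> is a choice among the candidate derivatives. Functions
  that agree near x have the same candidates, hence the same choice, even where no derivative
  exists.\<close>

lemma pd_cong_open:
  assumes "open S" "x \<in> S" "\<And>y. y \<in> S \<Longrightarrow> f y = g y"
  shows "pd i f x = pd i g x"
proof -
  have "(f has_derivative D) (at x) \<longleftrightarrow> (g has_derivative D) (at x)" for D
    using has_derivative_transform_within_open[OF _ assms(1,2)] assms(3) by metis
  then show ?thesis unfolding pd_def frechet_derivative_def by presburger
qed

lemma differentiable_cong_open:
  assumes "open S" "x \<in> S" "\<And>y. y \<in> S \<Longrightarrow> f y = g y" "g differentiable at x"
  shows "f differentiable at x"
  using has_derivative_transform_within_open[OF _ assms(1,2), of g _ UNIV f] assms(3,4)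
  unfolding differentiable_def by metis

lemma pd_coord: "pd i (\<lambda>x. x $ j) x = (if i = j then 1 else 0)"
  using pd_eqI[OF bounded_linear_imp_has_derivative[OF bounded_linear_vec_nth], of i j x]
  by (simp add: axis_def)

section \<open>Closure properties of the class of smooth functions\<close>

lemma iter_pd_append: "iter_pd (is @ js) f = iter_pd is (iter_pd js f)"
  by (induction "is") auto

lemma smooth_iter_pd: "smooth f \<Longrightarrow> smooth (iter_pd js f)"
  unfolding smooth_def iter_pd_append[symmetric] by blast

lemma smooth_pd: "smooth f \<Longrightarrow> smooth (pd i f)"
  using smooth_iter_pd[of f "[i]"] by simp

lemma smooth_differentiable: "smooth f \<Longrightarrow> f differentiable at x"
  unfolding smooth_def differentiable_on_def by (metis UNIV_I iter_pd.simps(1))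

lemma smooth_continuous: "smooth f \<Longrightarrow> continuous_on S f"
  by (meson continuous_at_imp_continuous_on differentiable_imp_continuous_within smooth_differentiable)

text \<open>Smooth functions form the largest class of everywhere differentiable functions that is
  stable under \<open>pd\<close>, so any invariant with these two properties suffices and no
  iterated derivative has to be computed.\<close>

lemma smooth_coinduct:
  assumes "P f" and step: "\<And>g. P g \<Longrightarrow> (\<forall>x. g differentiable at x) \<and> (\<forall>i. P (pd i g))"
  shows "smooth f"
proof -
  have "P (iter_pd is f)" for "is"
    by (induction "is") (use assms in auto)
  then show ?thesis
    unfolding smooth_def using step by (simp add: differentiable_on_def)
qed

text \<open>Closed under partial derivatives (in \<open>comp\<close>, \<open>H\<close> lists the successive derivatives of \<open>H 0\<close>),
  so all members are smooth.\<close>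

inductive salg :: "(real^'n::finite \<Rightarrow> real) \<Rightarrow> bool" where
  base: "smooth f \<Longrightarrow> salg f"
| add: "salg f \<Longrightarrow> salg g \<Longrightarrow> salg (\<lambda>x. f x + g x)"
| mult: "salg f \<Longrightarrow> salg g \<Longrightarrow> salg (\<lambda>x. f x * g x)"
| inverse: "smooth g \<Longrightarrow> (\<And>x. g x \<noteq> 0) \<Longrightarrow> salg (\<lambda>x. inverse (g x))"
| comp: "(\<And>m t. (H m has_real_derivative H (Suc m) t) (at t)) \<Longrightarrow> smooth g \<Longrightarrow>
    salg (\<lambda>x. H (m::nat) (g x))"

lemma smooth_const: "smooth (\<lambda>x::real^'n::finite. c)"
proof (rule smooth_coinduct[where P = "\<lambda>f. \<exists>c. f = (\<lambda>x. c)"])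
  fix g :: "real^'n \<Rightarrow> real" assume "\<exists>c. g = (\<lambda>x. c)"
  then obtain c where g: "g = (\<lambda>x. c)" by blast
  have "pd i g = (\<lambda>x. 0)" for i
    unfolding g by (rule ext) (rule pd_const)
  then show "(\<forall>x. g differentiable at x) \<and> (\<forall>i. \<exists>c. pd i g = (\<lambda>x. c))"
    by (auto simp: g)
qed blast

lemma smooth_coord: "smooth (\<lambda>x::real^'n::finite. x $ j)"
proof (rule smooth_coinduct[where P = "\<lambda>f. f = (\<lambda>x. x $ j) \<or> smooth f"], goal_cases)
  case (2 g)
  have "smooth (pd i (\<lambda>x::real^'n. x $ j))" for i
    using smooth_const[of "if i = j then 1 else 0"] unfolding pd_coord[abs_def] .
  moreover have "(\<lambda>x::real^'n. x $ j) differentiable at x" for x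
    by (simp add: bounded_linear_imp_differentiable bounded_linear_vec_nth)
  ultimately show ?case using 2 smooth_differentiable smooth_pd by blast
qed simp

text \<open>\<open>salg\<close> is its own coinduction invariant. The reciprocal stays inside
  because its derivative is - (1/g) (1/g) \<open>pd i g\<close>, a product of members; in the
  \<open>comp\<close> case the index m moves on to \<open>Suc m\<close>.\<close>

lemma smooth_salg: "salg f \<Longrightarrow> smooth f"
proof (rule smooth_coinduct[where P = salg], assumption)
  fix g :: "real^'n::finite \<Rightarrow> real" assume "salg g"
  then show "(\<forall>x. g differentiable at x) \<and> (\<forall>i. salg (pd i g))"
  proof induction
    case (base f)
    then show ?case by (auto intro: salg.base smooth_pd smooth_differentiable)
  next
    case (add f g)
    then have "pd i (\<lambda>x. f x + g x) = (\<lambda>x. pd i f x + pd i g x)" for i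
      by (auto simp: pd_add)
    then show ?case using add by (auto intro: salg.add)
  next
    case (mult f g)
    then have "pd i (\<lambda>x. f x * g x) = (\<lambda>x. f x * pd i g x + pd i f x * g x)" for i
      by (auto simp: pd_mult)
    moreover have "salg (\<lambda>x. f x * pd i g x + pd i f x * g x)" for i
      by (intro salg.add salg.mult) (use mult in auto)
    ultimately show ?case using mult by auto
  next
    case (inverse g)
    have *: "(inverse has_real_derivative - (inverse (g x) * inverse (g x))) (at (g x))" for x
      using DERIV_inverse[of "g x" UNIV] inverse by (simp add: power2_eq_square)
    have "pd i (\<lambda>x. inverse (g x)) = (\<lambda>x. (-1) * (inverse (g x) * inverse (g x)) * pd i g x)" for i
      using pd_comp(1)[OF smooth_differentiable[OF inverse(1)] *, of i] by auto
    moreover have "salg (\<lambda>x. (-1) * (inverse (g x) * inverse (g x)) * pd i g x)" for i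
      by (intro salg.mult salg.inverse salg.base smooth_pd smooth_const inverse)
    ultimately show ?case using pd_comp(2)[OF smooth_differentiable[OF inverse(1)] *] by auto
  next
    case (comp H g m)
    have "pd i (\<lambda>x. H m (g x)) = (\<lambda>x. H (Suc m) (g x) * pd i g x)" for i
      by (rule ext) (rule pd_comp(1)[OF smooth_differentiable[OF comp(2)] comp(1)])
    moreover have "salg (\<lambda>x. H (Suc m) (g x) * pd i g x)" for i
      by (intro salg.mult salg.comp[where H = H] salg.base smooth_pd comp)
    ultimately show ?case using pd_comp(2)[OF smooth_differentiable[OF comp(2)] comp(1)] by auto
  qed
qed

lemma smooth_add: "smooth f \<Longrightarrow> smooth g \<Longrightarrow> smooth (\<lambda>x. f x + g x)"
  and smooth_mult: "smooth f \<Longrightarrow> smooth g \<Longrightarrow> smooth (\<lambda>x. f x * g x)"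
  and smooth_inverse: "smooth f \<Longrightarrow> (\<And>x. f x \<noteq> 0) \<Longrightarrow> smooth (\<lambda>x. inverse (f x))"
  by (rule smooth_salg, rule salg.add salg.mult salg.inverse; (rule salg.base)?; assumption)+

lemma smooth_comp:
  assumes "\<And>m t. (H m has_real_derivative H (Suc m) t) (at t)" "smooth g"
  shows "smooth (\<lambda>x. H (m::nat) (g x))"
  by (rule smooth_salg, rule salg.comp) (use assms in auto)

lemma smooth_sum: "(\<And>i. i \<in> S \<Longrightarrow> smooth (f i)) \<Longrightarrow> smooth (\<lambda>x. \<Sum>i\<in>S. f i x)"
  by (induction S rule: infinite_finite_induct) (auto intro: smooth_const smooth_add)

lemma smooth_diff: "smooth f \<Longrightarrow> smooth g \<Longrightarrow> smooth (\<lambda>x. f x - g x)"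
  using smooth_add[of f "\<lambda>x. (-1) * g x"] smooth_mult[OF smooth_const, of g "-1"] by simp

lemma smooth_cos:
  assumes "smooth g"
  shows "smooth (\<lambda>x. cos (g x))"
proof -
  \<comment> \<open>Each derivative of the cosine is a shift by a quarter period, so the shifted
    cosines list all derivatives.\<close>
  have D: "((\<lambda>t. cos (t + real m * (pi/2))) has_real_derivative cos (t + real (Suc m) * (pi/2))) (at t)" for m t
    by (auto intro!: derivative_eq_intros simp: algebra_simps add_divide_distrib cos_add sin_add)
  show ?thesis
    using smooth_comp[of "\<lambda>m t. cos (t + real m * (pi/2))" g 0, OF D assms] by simp
qed

text \<open>The derivatives of \<open>p(1/t) exp(-1/t)\<close> are again of this form.\<close>

definition flat :: "real poly \<Rightarrow> real \<Rightarrow> real" where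
  "flat p t = (if t > 0 then poly p (inverse t) * exp (- inverse t) else 0)"

lemma poly_exp_tendsto_0: "((\<lambda>y. poly p y * exp (- y)) \<longlongrightarrow> (0::real)) at_top"
proof -
  have "((\<lambda>y. \<Sum>i\<le>degree p. coeff p i * (y ^ i / exp y)) \<longlongrightarrow> (\<Sum>i\<le>degree p. coeff p i * 0)) at_top"
    by (intro tendsto_intros tendsto_power_div_exp_0)
  moreover have "(\<lambda>y. \<Sum>i\<le>degree p. coeff p i * (y ^ i / exp y)) = (\<lambda>y. poly p y * exp (- y))"
    by (simp add: poly_altdef exp_minus sum_distrib_right divide_inverse mult.assoc)
  ultimately show ?thesis by simp
qed

lemma flat_tendsto_0: "(flat p \<longlongrightarrow> 0) (at 0)"
proof (rule filterlim_split_at)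
  show "(flat p \<longlongrightarrow> 0) (at_left 0)"
    by (rule tendsto_eventually) (simp add: flat_def eventually_at_filter)
  have "((\<lambda>t. poly p (inverse t) * exp (- inverse t)) \<longlongrightarrow> 0) (at_right 0)"
    by (rule filterlim_compose[OF poly_exp_tendsto_0 filterlim_inverse_at_top_right])
  then show "(flat p \<longlongrightarrow> 0) (at_right 0)"
    by (rule Lim_transform_eventually)
       (simp add: flat_def eventually_at_filter)
qed

text \<open>With y = 1/t, the derivative of p(y) exp(-y) in t is y^2 (p - p')(y) exp(-y);
  \<open>[:0,0,1:]\<close> is the polynomial y^2. At t = 0 the difference quotient is again a
  \<open>flat\<close> function, for the polynomial y p(y), and tends to 0 because the exponential
  beats every polynomial.\<close>

lemma flat_deriv: "(flat p has_real_derivative flat ([:0,0,1:] * (p - pderiv p)) t) (at t)"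
proof -
  consider "t < 0" | "t = 0" | "t > 0" by linarith
  then show ?thesis
  proof cases
    case 1
    have "((\<lambda>t. 0) has_real_derivative 0) (at t)" by simp
    then have "(flat p has_real_derivative 0) (at t)"
      by (rule has_field_derivative_transform_within_open[of _ _ _ "{..<0}"])
         (use 1 in \<open>auto simp: flat_def\<close>)
    then show ?thesis using 1 by (simp add: flat_def)
  next
    case 2
    have "(flat ([:0,1:] * p) \<longlongrightarrow> 0) (at 0)" by (rule flat_tendsto_0)
    moreover have "flat ([:0,1:] * p) = (\<lambda>h. (flat p (0 + h) - flat p 0) / h)"
      by (rule ext) (simp add: flat_def divide_inverse del: mult_pCons_left)
    ultimately show ?thesis using 2 by (simp add: DERIV_def flat_def)
  next
    case 3
    have P: "(poly p has_real_derivative poly (pderiv p) y) (at y)" for y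
      by (rule poly_DERIV)
    have I: "(inverse has_real_derivative - (inverse t * inverse t)) (at t)"
      using DERIV_inverse[of t UNIV] 3 by (simp add: power2_eq_square)
    have E: "((\<lambda>t. exp (- inverse t)) has_real_derivative exp (- inverse t) * (inverse t * inverse t)) (at t)"
      using DERIV_chain2[OF DERIV_exp DERIV_minus[OF I]] by simp
    have "((\<lambda>t. poly p (inverse t) * exp (- inverse t)) has_real_derivative
        poly (pderiv p) (inverse t) * (- (inverse t * inverse t)) * exp (- inverse t)
        + exp (- inverse t) * (inverse t * inverse t) * poly p (inverse t)) (at t)"
      by (rule DERIV_mult[OF DERIV_chain2[OF P I] E])
    also have "poly (pderiv p) (inverse t) * (- (inverse t * inverse t)) * exp (- inverse t)
        + exp (- inverse t) * (inverse t * inverse t) * poly p (inverse t)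
      = (inverse t * inverse t) * (poly p (inverse t) - poly (pderiv p) (inverse t)) * exp (- inverse t)"
      by (simp add: algebra_simps)
    also have "\<dots> = flat ([:0,0,1:] * (p - pderiv p)) t"
      using 3 unfolding flat_def by (simp add: mult.assoc del: mult_pCons_left)
    finally have "((\<lambda>t. poly p (inverse t) * exp (- inverse t)) has_real_derivative
        flat ([:0,0,1:] * (p - pderiv p)) t) (at t)" .
    then show ?thesis
      by (rule has_field_derivative_transform_within_open[of _ _ _ "{0<..}"])
         (use 3 in \<open>auto simp: flat_def\<close>)
  qed
qed

lemma smooth_flat:
  assumes "smooth g" shows "smooth (\<lambda>x. flat 1 (g x))"
proof -
  define P where "P m = ((\<lambda>p. [:0,0,1:] * (p - pderiv p)) ^^ m) (1::real poly)" for m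
  have "smooth (\<lambda>x. flat (P 0) (g x))"
    by (rule smooth_comp[where H = "\<lambda>m. flat (P m)"]) (use assms in \<open>simp_all add: P_def flat_deriv del: mult_pCons_left\<close>)
  then show ?thesis by (simp add: P_def)
qed

section \<open>Bump and cutoff functions\<close>

text \<open>The bump is f / (f + g), where f is positive exactly inside the ball of radius s and g
  exactly outside the closed ball of radius r. Since r < s, one of them is positive at every point
  and the denominator never vanishes.\<close>

lemma bump_exists:
  fixes a :: "real^'n::finite" assumes "0 < r" "r < s"
  shows "\<exists>\<eta>. smooth \<eta> \<and> (\<forall>x. 0 \<le> \<eta> x \<and> \<eta> x \<le> 1) \<and> (\<forall>x\<in>cball a r. \<eta> x = 1) \<and> (\<forall>x. x \<notin> ball a s \<longrightarrow> \<eta> x = 0)"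
proof -
  \<comment> \<open>The squared distance is a polynomial in the coordinates, hence smooth at the
    centre as well.\<close>
  define q where "q x = (\<Sum>i\<in>UNIV. (x $ i - a $ i) * (x $ i - a $ i))" for x :: "real^'n"
  have q: "q x = (dist a x)\<^sup>2" for x
    by (simp add: q_def dist_norm norm_vec_def L2_set_def sum_nonneg power2_eq_square[symmetric] power2_commute)
  have "smooth q"
    unfolding q_def by (intro smooth_sum smooth_mult smooth_diff smooth_coord smooth_const)
  define f where "f x = flat 1 (s\<^sup>2 - q x)" for x
  define g where "g x = flat 1 (q x - r\<^sup>2)" for x
  have fg: "smooth f" "smooth g"
    unfolding f_def g_def by (intro smooth_flat smooth_diff smooth_const \<open>smooth q\<close>)+
  have f0: "f x \<ge> 0" "g x \<ge> 0" for x by (auto simp: f_def g_def flat_def)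
  have rs: "r\<^sup>2 < s\<^sup>2" using assms by (simp add: power_strict_mono)
  have pos: "f x + g x > 0" for x
    using rs f0[of x] by (cases "q x < s\<^sup>2") (auto simp: f_def g_def flat_def intro: add_pos_nonneg add_nonneg_pos)
  define \<eta> where "\<eta> x = f x * inverse (f x + g x)" for x
  have "smooth \<eta>"
    unfolding \<eta>_def by (intro smooth_mult smooth_inverse smooth_add fg) (use pos less_irrefl in metis)
  moreover have "0 \<le> \<eta> x \<and> \<eta> x \<le> 1" for x
    using f0[of x] pos[of x] by (auto simp: \<eta>_def field_simps)
  moreover have "\<eta> x = 1" if "x \<in> cball a r" for x
  proof -
    have "q x \<le> r\<^sup>2" using that by (simp add: q power_mono)
    then have "g x = 0" by (simp add: g_def flat_def)
    then show ?thesis using pos[of x] by (simp add: \<eta>_def)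
  qed
  moreover have "\<eta> x = 0" if "x \<notin> ball a s" for x
  proof -
    have "q x \<ge> s\<^sup>2" using that assms by (simp add: q power_mono)
    then show ?thesis by (simp add: \<eta>_def f_def flat_def)
  qed
  ultimately show ?thesis by blast
qed

lemma test_fun_smooth: "test_fun U \<phi> \<Longrightarrow> smooth \<phi>"
  by (simp add: test_fun_def)

lemma test_funI:
  assumes "smooth \<phi>" "compact K" "K \<subseteq> U" "\<And>x. x \<notin> K \<Longrightarrow> \<phi> x = 0"
  shows "test_fun U \<phi>"
proof -
  have "closure {x. \<phi> x \<noteq> 0} \<subseteq> K"
    using assms by (intro closure_minimal) (auto intro: compact_imp_closed)
  then show ?thesis
    using assms compact_Int_closed[OF assms(2) closed_closure, of "{x. \<phi> x \<noteq> 0}"]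
    unfolding test_fun_def by (simp add: Int_absorb1)
qed

lemma test_fun_support:
  "test_fun U \<phi> \<Longrightarrow> \<exists>K. compact K \<and> K \<subseteq> U \<and> (\<forall>x. x \<notin> K \<longrightarrow> \<phi> x = 0)"
  using closure_subset[of "{x. \<phi> x \<noteq> 0}"] unfolding test_fun_def by blast

lemma pd_zero_off_closed:
  assumes "closed K" "x \<notin> K" "\<And>x. x \<notin> K \<Longrightarrow> \<phi> x = 0"
  shows "pd i \<phi> x = 0"
  using pd_cong_open[of "- K" x \<phi> "\<lambda>_. 0" i] assms by (simp add: pd_const open_Compl)

lemma test_fun_pd:
  assumes "test_fun U \<phi>" shows "test_fun U (pd i \<phi>)"
proof -
  obtain K where K: "compact K" "K \<subseteq> U" "\<And>x. x \<notin> K \<Longrightarrow> \<phi> x = 0" using test_fun_support[OF assms] by blast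
  show ?thesis
    using pd_zero_off_closed[OF compact_imp_closed[OF K(1)]] K
    by (intro test_funI[OF _ K(1,2)] smooth_pd test_fun_smooth[OF assms]) auto
qed

lemma test_fun_mult:
  assumes "test_fun U \<phi>" "smooth g" shows "test_fun U (\<lambda>x. \<phi> x * g x)"
proof -
  obtain K where K: "compact K" "K \<subseteq> U" "\<And>x. x \<notin> K \<Longrightarrow> \<phi> x = 0" using test_fun_support[OF assms(1)] by blast
  show ?thesis
    by (intro test_funI[OF _ K(1,2)] smooth_mult test_fun_smooth[OF assms(1)] assms) (use K in auto)
qed

lemma test_fun_zero: "test_fun U (\<lambda>x. 0)"
  by (rule test_funI[of _ "{}"]) (auto intro: smooth_const)

lemma smooth_prod: "(\<And>i. i \<in> S \<Longrightarrow> smooth (f i)) \<Longrightarrow> smooth (\<lambda>x. \<Prod>i\<in>S. f i x)"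
  by (induction S rule: infinite_finite_induct) (simp_all add: smooth_const smooth_mult)

text \<open>Finitely many bumps, each supported in a ball inside V, are equal to 1 on smaller balls
  that cover K. The combination 1 - \<Prod> (1 - h) is 1 where one bump is 1 and 0 where all of them
  vanish, and it stays in [0, 1].\<close>

lemma cutoff_exists:
  fixes K :: "(real^'n::finite) set"
  assumes "compact K" "open V" "K \<subseteq> V"
  shows "\<exists>\<eta>. test_fun V \<eta> \<and> (\<forall>x. 0 \<le> \<eta> x \<and> \<eta> x \<le> 1) \<and> (\<forall>x\<in>K. \<eta> x = 1)"
proof -
  have "\<exists>e>0. cball x (2*e) \<subseteq> V" if xK: "x \<in> K" for x
  proof -
    obtain r where "r > 0" "cball x r \<subseteq> V"
      using assms(2) subsetD[OF assms(3) xK] open_contains_cball[of V] by meson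
    then show ?thesis by (intro exI[of _ "r / 2"]) simp
  qed
  then obtain e where e: "\<And>x. x \<in> K \<Longrightarrow> e x > 0 \<and> cball x (2 * e x) \<subseteq> V" by metis
  have "K \<subseteq> (\<Union>x\<in>K. ball x (e x))" using e by force
  from compactE_image[OF assms(1) _ this]
  obtain F where F: "F \<subseteq> K" "finite F" "K \<subseteq> (\<Union>x\<in>F. ball x (e x))"
    by (metis open_ball)
  have "\<forall>a\<in>K. \<exists>\<eta>. smooth \<eta> \<and> (\<forall>x. 0 \<le> \<eta> x \<and> \<eta> x \<le> 1) \<and> (\<forall>x\<in>cball a (e a). \<eta> x = 1) \<and> (\<forall>x. x \<notin> ball a (2 * e a) \<longrightarrow> \<eta> x = 0)"
  proof
    fix a assume "a \<in> K"
    then show "\<exists>\<eta>. smooth \<eta> \<and> (\<forall>x. 0 \<le> \<eta> x \<and> \<eta> x \<le> 1) \<and> (\<forall>x\<in>cball a (e a). \<eta> x = 1) \<and> (\<forall>x. x \<notin> ball a (2 * e a) \<longrightarrow> \<eta> x = 0)"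
      using bump_exists[of "e a" "2 * e a" a] e[of a] by simp
  qed
  from bchoice[OF this] obtain h where h: "\<And>a. a \<in> K \<Longrightarrow> smooth (h a)" "\<And>a x. a \<in> K \<Longrightarrow> 0 \<le> h a x \<and> h a x \<le> 1"
    "\<And>a x. a \<in> K \<Longrightarrow> x \<in> cball a (e a) \<Longrightarrow> h a x = 1" "\<And>a x. a \<in> K \<Longrightarrow> x \<notin> ball a (2 * e a) \<Longrightarrow> h a x = 0"
    by blast
  have FK: "a \<in> K" if "a \<in> F" for a using F(1) that by blast
  define \<eta> where "\<eta> x = 1 - (\<Prod>a\<in>F. (1 - h a x))" for x
  have "test_fun V \<eta>"
  proof (rule test_funI)
    show "smooth \<eta>" unfolding \<eta>_def
      by (intro smooth_diff smooth_const smooth_prod h(1) FK)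
    show "compact (\<Union>a\<in>F. cball a (2 * e a))" using F(2) by auto
    show "(\<Union>a\<in>F. cball a (2 * e a)) \<subseteq> V" using e FK by blast
    fix x assume x: "x \<notin> (\<Union>a\<in>F. cball a (2 * e a))"
    have "1 - h a x = 1" if "a \<in> F" for a
      using h(4)[OF FK[OF that], of x] x that by force
    then show "\<eta> x = 0" by (simp add: \<eta>_def)
  qed
  moreover have "0 \<le> \<eta> x \<and> \<eta> x \<le> 1" for x
    using h(2)[OF FK, of _ x] by (simp add: \<eta>_def prod_nonneg prod_le_1)
  moreover have "\<eta> x = 1" if xK: "x \<in> K" for x
  proof -
    obtain a where "a \<in> F" "x \<in> ball a (e a)" using F(3) xK by blast
    then have "1 - h a x = 0" using h(3)[OF FK, of a x] by simp
    then have "(\<Prod>a\<in>F. (1 - h a x)) = 0" using \<open>a \<in> F\<close> F(2) by (meson prod_zero)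
    then show ?thesis by (simp add: \<eta>_def)
  qed
  ultimately show ?thesis by blast
qed

section \<open>Integration by parts\<close>

text \<open>All integrals in the statement are with respect to \<open>lebesgue\<close>, while
  translation invariance is used for \<open>lborel\<close>; for continuous functions of compact
  support the two agree.\<close>

lemma compact_supp_integrable:
  fixes f :: "real^'n::finite \<Rightarrow> real"
  assumes "continuous_on UNIV f" "compact K" "\<And>x. x \<notin> K \<Longrightarrow> f x = 0"
  shows "integrable lborel f" "integrable lebesgue f" "integral\<^sup>L lebesgue f = integral\<^sup>L lborel f"
proof -
  have "integrable lborel (\<lambda>x. indicator K x *\<^sub>R f x)"
    by (intro borel_integrable_compact assms continuous_on_subset[OF assms(1)]) auto
  also have "(\<lambda>x. indicator K x *\<^sub>R f x) = f"
    using assms(3) by (force simp: indicator_def)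
  finally show I: "integrable lborel f" .
  have "f \<in> borel_measurable lborel" using I by auto
  then show "integrable lebesgue f" "integral\<^sup>L lebesgue f = integral\<^sup>L lborel f"
    using I by (simp_all add: integrable_completion integral_completion)
qed

lemma pd_line:
  fixes \<phi> :: "real^'n::finite \<Rightarrow> real"
  assumes "\<phi> differentiable at (x + t *\<^sub>R axis i 1)"
  shows "((\<lambda>t. \<phi> (x + t *\<^sub>R axis i 1)) has_real_derivative pd i \<phi> (x + t *\<^sub>R axis i 1)) (at t)"
proof -
  have "((\<lambda>t. x + t *\<^sub>R axis i 1) has_derivative (\<lambda>h. h *\<^sub>R (axis i 1 :: real^'n))) (at t)"
    by (auto intro!: derivative_eq_intros)
  from has_derivative_compose[OF this has_derivative_pd[OF assms]]
  have "((\<lambda>t. \<phi> (x + t *\<^sub>R axis i 1)) has_derivative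
     (\<lambda>h. \<Sum>j\<in>UNIV. (h *\<^sub>R axis i 1) $ j * pd j \<phi> (x + t *\<^sub>R axis i 1))) (at t)" .
  moreover have "(\<lambda>h. \<Sum>j\<in>UNIV. (h *\<^sub>R axis i 1) $ j * pd j \<phi> (x + t *\<^sub>R axis i 1))
      = (*) (pd i \<phi> (x + t *\<^sub>R axis i 1))"
    by (rule ext) (simp add: axis_def if_distrib if_distribR mult.commute cong: if_cong)
  ultimately show ?thesis by (simp only: has_field_derivative_def)
qed

lemma bounded_compact_supp:
  fixes f :: "real^'n::finite \<Rightarrow> real"
  assumes "continuous_on UNIV f" "compact K" "\<And>x. x \<notin> K \<Longrightarrow> f x = 0"
  shows "\<exists>M\<ge>0. \<forall>x. \<bar>f x\<bar> \<le> M"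
proof -
  have "bounded (f ` K)"
    by (intro compact_imp_bounded compact_continuous_image continuous_on_subset[OF assms(1)] assms) auto
  then obtain M where "\<And>x. x \<in> K \<Longrightarrow> \<bar>f x\<bar> \<le> M" by (auto simp: bounded_iff)
  then have "\<bar>f x\<bar> \<le> \<bar>M\<bar>" for x using assms(3) by (cases "x \<in> K") fastforce+
  then show ?thesis by (intro exI[of _ "\<bar>M\<bar>"]) simp
qed

text \<open>By translation invariance the integrals of the difference quotients vanish.\<close>

lemma integral_pd_eq_0:
  fixes \<phi> :: "real^'n::finite \<Rightarrow> real"
  assumes diff: "\<And>x. \<phi> differentiable at x" and cont: "continuous_on UNIV (pd i \<phi>)"
    and K: "compact K" "\<And>x. x \<notin> K \<Longrightarrow> \<phi> x = 0"
  shows "integral\<^sup>L lebesgue (pd i \<phi>) = 0"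
proof -
  have pd0: "pd i \<phi> x = 0" if "x \<notin> K" for x
    using pd_zero_off_closed[OF compact_imp_closed[OF K(1)] that K(2)] .
  have c\<phi>: "continuous_on UNIV \<phi>"
    using diff by (simp add: continuous_at_imp_continuous_on differentiable_imp_continuous_within)
  obtain M where M: "M \<ge> 0" "\<And>x. \<bar>pd i \<phi> x\<bar> \<le> M"
    using bounded_compact_supp[OF cont K(1) pd0] by blast
  obtain R where R: "\<And>x. x \<in> K \<Longrightarrow> norm x \<le> R"
    using compact_imp_bounded[OF K(1)] by (auto simp: bounded_iff)
  define e where "e = (axis i 1 :: real^'n)"
  define t where "t m = 1 / real (Suc m)" for m
  have t: "t m > 0" "t m \<le> 1" for m by (auto simp: t_def)
  define g where "g m x = (\<phi> (x + t m *\<^sub>R e) - \<phi> x) / t m" for m x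
  have I: "integrable lborel \<phi>" using compact_supp_integrable(1)[OF c\<phi> K] .
  have shift: "integrable lborel (\<lambda>x. \<phi> (x + a))" "(\<integral>x. \<phi> (x + a) \<partial>lborel) = integral\<^sup>L lborel \<phi>" for a
  proof -
    have "integrable (distr lborel borel ((+) a)) \<phi>" using I by (simp add: lborel_distr_plus)
    then show "integrable lborel (\<lambda>x. \<phi> (x + a))"
      by (subst (asm) integrable_distr_eq) (use I in \<open>auto simp: add.commute\<close>)
    have "integral\<^sup>L lborel \<phi> = integral\<^sup>L (distr lborel borel ((+) a)) \<phi>"
      by (simp add: lborel_distr_plus)
    also have "\<dots> = (\<integral>x. \<phi> (a + x) \<partial>lborel)"
      by (subst integral_distr) (use I in auto)
    finally show "(\<integral>x. \<phi> (x + a) \<partial>lborel) = integral\<^sup>L lborel \<phi>" by (simp add: add.commute)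
  qed
  have g0: "integral\<^sup>L lborel (g m) = 0" for m
    unfolding g_def using shift I by simp
  \<comment> \<open>The mean value theorem bounds all difference quotients by the supremum of the
    derivative. Since the increments are at most 1, they are also supported in one ball, and this
    gives an integrable majorant.\<close>
  have mvt: "\<bar>g m x\<bar> \<le> M" for m x
  proof -
    have "\<exists>z. 0 < z \<and> z < t m \<and> \<phi> (x + t m *\<^sub>R e) - \<phi> (x + 0 *\<^sub>R e) = (t m - 0) * pd i \<phi> (x + z *\<^sub>R e)"
      unfolding e_def by (rule MVT2) (use t in \<open>auto intro!: pd_line diff\<close>)
    then obtain z where "\<phi> (x + t m *\<^sub>R e) - \<phi> x = t m * pd i \<phi> (x + z *\<^sub>R e)" by auto
    then have "g m x = pd i \<phi> (x + z *\<^sub>R e)" using t[of m] by (simp add: g_def)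
    then show ?thesis using M by simp
  qed
  have supp: "g m x = 0" if "norm x > R + 1" for m x
  proof -
    have "norm (t m *\<^sub>R e) \<le> 1" using t[of m] by (simp add: e_def)
    then have "norm (x + t m *\<^sub>R e) > R" using that norm_triangle_ineq2[of x "- (t m *\<^sub>R e)"] by simp
    then have "x \<notin> K" "x + t m *\<^sub>R e \<notin> K" using R that by force+
    then show ?thesis using K by (simp add: g_def)
  qed
  have lim: "(\<lambda>m. g m x) \<longlonglongrightarrow> pd i \<phi> x" for x
  proof -
    have "((\<lambda>t. \<phi> (x + t *\<^sub>R e)) has_real_derivative pd i \<phi> x) (at 0)"
      using pd_line[of \<phi> x 0 i] diff by (simp add: e_def)
    then have "((\<lambda>h. (\<phi> (x + h *\<^sub>R e) - \<phi> x) / h) \<longlongrightarrow> pd i \<phi> x) (at 0)"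
      by (simp add: DERIV_def)
    moreover have "filterlim t (at 0) sequentially"
    proof -
      have "t \<longlonglongrightarrow> 0" using LIMSEQ_inverse_real_of_nat by (simp add: t_def[abs_def] inverse_eq_divide)
      moreover have "\<forall>m. t m \<noteq> 0" using t(1) by (metis less_irrefl)
      ultimately show ?thesis by (simp add: filterlim_at)
    qed
    ultimately show ?thesis unfolding g_def by (rule filterlim_compose)
  qed
  have "(\<lambda>m. integral\<^sup>L lborel (g m)) \<longlonglongrightarrow> integral\<^sup>L lborel (pd i \<phi>)"
  proof (rule integral_dominated_convergence[where w = "\<lambda>x. M * indicator (cball 0 (R+1)) x"])
    show "integrable lborel (\<lambda>x. M * indicator (cball 0 (R + 1)) x :: real)"
      by (intro integrable_mult_right integrable_real_indicator)
        (use emeasure_lborel_cball_finite[of 0 "R+1"] in auto)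
    show "pd i \<phi> \<in> borel_measurable lborel" using cont by (simp add: borel_measurable_continuous_onI)
    show "g m \<in> borel_measurable lborel" for m
      unfolding g_def using shift(1) I by (intro borel_measurable_divide borel_measurable_diff) auto
    show "AE x in lborel. norm (g m x) \<le> M * indicator (cball 0 (R + 1)) x" for m
      using mvt[of m] supp[of _ m] by (auto simp: indicator_def not_le)
    show "AE x in lborel. (\<lambda>m. g m x) \<longlonglongrightarrow> pd i \<phi> x" using lim by simp
  qed
  then have "integral\<^sup>L lborel (pd i \<phi>) = 0"
    unfolding g0 by (simp add: LIMSEQ_const_iff)
  then show ?thesis using compact_supp_integrable(3)[OF cont K(1) pd0] by simp
qed

text \<open>U and the complement of K are open and cover the space; the extension is the product on
  the first set and zero on the second.\<close>

lemma extend_by_zero: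
  fixes g \<psi> :: "real^'n::finite \<Rightarrow> real"
  assumes "open U" "compact K" "K \<subseteq> U" "\<And>x. x \<notin> K \<Longrightarrow> \<psi> x = 0"
    "continuous_on U g" "continuous_on U \<psi>"
  shows "continuous_on UNIV (\<lambda>x. indicator U x * (g x * \<psi> x))"
proof -
  have "continuous_on (U \<union> - K) (\<lambda>x. indicator U x * (g x * \<psi> x))"
  proof (rule continuous_on_open_Un)
    show "continuous_on U (\<lambda>x. indicator U x * (g x * \<psi> x))"
      by (rule continuous_on_eq[of _ "\<lambda>x. g x * \<psi> x"]) (auto intro!: continuous_intros assms)
    show "continuous_on (- K) (\<lambda>x. indicator U x * (g x * \<psi> x))"
      by (rule continuous_on_eq[of _ "\<lambda>x. 0"]) (use assms in auto)
  qed (use assms in \<open>auto simp: compact_imp_closed open_Compl\<close>)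
  moreover have "U \<union> - K = UNIV" using assms by auto
  ultimately show ?thesis by simp
qed

lemma set_integrable_compact_supp:
  fixes g \<psi> :: "real^'n::finite \<Rightarrow> real"
  assumes "open U" "compact K" "K \<subseteq> U" "\<And>x. x \<notin> K \<Longrightarrow> \<psi> x = 0"
    "continuous_on U g" "continuous_on U \<psi>"
  shows "set_integrable lebesgue U (\<lambda>x. g x * \<psi> x)"
  using compact_supp_integrable(2)[OF extend_by_zero[OF assms] assms(2)] assms(4)
  unfolding set_integrable_def by simp

text \<open>f is known on U only, so the product f \<phi> is first extended by zero. The extension
  is differentiable everywhere with continuous i-th derivative, so the integral of that derivative
  vanishes, and the product rule splits it into the two terms.\<close>

lemma integration_by_parts:
  fixes f \<phi> :: "real^'n::finite \<Rightarrow> real"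
  assumes U: "open U" and f: "\<And>x. x \<in> U \<Longrightarrow> f differentiable at x" "continuous_on U (pd i f)"
    and \<phi>: "test_fun U \<phi>"
  shows "(LINT x:U|lebesgue. f x * pd i \<phi> x) = - (LINT x:U|lebesgue. pd i f x * \<phi> x)"
proof -
  obtain K where K: "compact K" "K \<subseteq> U" "\<And>x. x \<notin> K \<Longrightarrow> \<phi> x = 0" using test_fun_support[OF \<phi>] by blast
  have K': "\<And>x. x \<notin> K \<Longrightarrow> pd i \<phi> x = 0"
    using pd_zero_off_closed[OF compact_imp_closed[OF K(1)]] K(3) by blast
  have cf: "continuous_on U f"
    using f(1) by (simp add: continuous_at_imp_continuous_on differentiable_imp_continuous_within)
  note s = test_fun_smooth[OF \<phi>]
  define h where "h x = indicator U x * (f x * \<phi> x)" for x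
  have hU: "h differentiable at x" "pd i h x = f x * pd i \<phi> x + pd i f x * \<phi> x" if "x \<in> U" for x
  proof -
    have eq: "\<And>y. y \<in> U \<Longrightarrow> h y = f y * \<phi> y" by (simp add: h_def)
    have "(\<lambda>y. f y * \<phi> y) differentiable at x"
      using f(1)[OF that] smooth_differentiable[OF s] by simp
    then show "h differentiable at x"
      by (rule differentiable_cong_open[OF U that eq, rotated])
    show "pd i h x = f x * pd i \<phi> x + pd i f x * \<phi> x"
      using pd_cong_open[OF U that eq] pd_mult[OF f(1)[OF that] smooth_differentiable[OF s]] by simp
  qed
  have h0: "h x = 0" if "x \<notin> K" for x using K that by (simp add: h_def)
  have hK: "h differentiable at x" "pd i h x = 0" if "x \<notin> K" for x
    using differentiable_cong_open[of "- K" x h "\<lambda>_. 0"] K(1) that h0 pd_zero_off_closed[OF compact_imp_closed[OF K(1)] that h0]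
    by (auto simp: compact_imp_closed open_Compl)
  have diff: "h differentiable at x" for x using hU hK K by blast
  have pdh: "pd i h = (\<lambda>x. indicator U x * (f x * pd i \<phi> x) + indicator U x * (pd i f x * \<phi> x))"
    using hU(2) hK(2) K K' by (auto simp: fun_eq_iff indicator_def)
  have cc: "continuous_on U \<phi>" "continuous_on U (pd i \<phi>)"
    using smooth_continuous s smooth_pd by blast+
  have "continuous_on UNIV (pd i h)"
    unfolding pdh by (intro continuous_on_add extend_by_zero[OF U K(1,2)] K K' cf f cc)
  from integral_pd_eq_0[OF diff this K(1) h0] have "integral\<^sup>L lebesgue (pd i h) = 0" .
  moreover have "integral\<^sup>L lebesgue (pd i h)
     = (LINT x:U|lebesgue. f x * pd i \<phi> x) + (LINT x:U|lebesgue. pd i f x * \<phi> x)"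
    using set_integrable_compact_supp[OF U K(1,2) K' cf cc(2)] set_integrable_compact_supp[OF U K f(2) cc(1)]
    unfolding pdh set_lebesgue_integral_def set_integrable_def by simp
  ultimately show ?thesis by simp
qed

section \<open>Weak derivatives\<close>

text \<open>A negligible exceptional set requires no measurability of f or g and passes at once to
  subsets, finite unions and local statements.\<close>

definition ae_eq :: "('a::euclidean_space) set \<Rightarrow> ('a \<Rightarrow> real) \<Rightarrow> ('a \<Rightarrow> real) \<Rightarrow> bool" where
  "ae_eq U f g \<longleftrightarrow> negligible {x \<in> U. f x \<noteq> g x}"

lemma ae_eqI: "negligible S \<Longrightarrow> (\<And>x. x \<in> U \<Longrightarrow> x \<notin> S \<Longrightarrow> f x = g x) \<Longrightarrow> ae_eq U f g"
  unfolding ae_eq_def by (erule negligible_subset) auto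

lemma ae_eq_refl: "(\<And>x. x \<in> U \<Longrightarrow> f x = g x) \<Longrightarrow> ae_eq U f g"
  by (rule ae_eqI[of "{}"]) auto

lemma ae_eq_sym: "ae_eq U f g \<Longrightarrow> ae_eq U g f"
  unfolding ae_eq_def by (erule negligible_subset) auto

lemma ae_eq_trans: "ae_eq U f g \<Longrightarrow> ae_eq U g h \<Longrightarrow> ae_eq U f h"
  unfolding ae_eq_def by (drule (1) negligible_Un, erule negligible_subset) auto

lemma ae_eq_subset: "ae_eq U f g \<Longrightarrow> V \<subseteq> U \<Longrightarrow> ae_eq V f g"
  unfolding ae_eq_def by (erule negligible_subset) auto

lemma ae_eq_fun2: "ae_eq U f g \<Longrightarrow> ae_eq U f' g' \<Longrightarrow> ae_eq U (\<lambda>x. F x (f x) (f' x)) (\<lambda>x. F x (g x) (g' x))"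
  unfolding ae_eq_def by (drule (1) negligible_Un, erule negligible_subset) auto

lemma ae_eq_fun: "ae_eq U f g \<Longrightarrow> ae_eq U (\<lambda>x. F x (f x)) (\<lambda>x. F x (g x))"
  unfolding ae_eq_def by (erule negligible_subset) auto

text \<open>F and G may be any expressions that are determined at each point by the values of
  finitely many functions; this is the shape of the components of \<open>ext_d\<close> and
  \<open>codiff\<close>.\<close>

lemma ae_eq_finite_fun:
  assumes "finite I" "\<And>i. i \<in> I \<Longrightarrow> ae_eq U (f i) (g i)"
    "\<And>x. x \<in> U \<Longrightarrow> (\<And>i. i \<in> I \<Longrightarrow> f i x = g i x) \<Longrightarrow> F x = G x"
  shows "ae_eq U F G"
proof (rule ae_eqI)
  show "negligible (\<Union>i\<in>I. {x \<in> U. f i x \<noteq> g i x})"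
    using assms by (intro negligible_Union) (auto simp: ae_eq_def)
qed (use assms(3) in blast)

lemma ae_eq_sum: "finite I \<Longrightarrow> (\<And>i. i \<in> I \<Longrightarrow> ae_eq U (f i) (g i)) \<Longrightarrow>
    ae_eq U (\<lambda>x. \<Sum>i\<in>I. f i x) (\<lambda>x. \<Sum>i\<in>I. g i x)"
  by (rule ae_eq_finite_fun[where f = f and g = g and I = I]) auto

text \<open>A set all of whose points have negligible neighbourhoods in it is negligible. This is
  how estimates on individual balls become statements on U.\<close>

lemma ae_eq_locally:
  assumes "\<And>x. x \<in> U \<Longrightarrow> \<exists>e>0. ae_eq (ball x e) f g"
  shows "ae_eq U f g"
  unfolding ae_eq_def
proof (subst locally_negligible_alt, rule ballI)
  let ?S = "{x \<in> U. f x \<noteq> g x}"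
  fix x assume "x \<in> ?S"
  then have xU: "x \<in> U" by simp
  from assms[OF this] obtain e where e: "e > 0" "ae_eq (ball x e) f g" by blast
  have "openin (top_of_set ?S) (?S \<inter> ball x e)" by (simp add: openin_open_Int)
  moreover have "negligible (?S \<inter> ball x e)"
    using e(2) unfolding ae_eq_def by (rule negligible_subset) auto
  ultimately show "\<exists>V. openin (top_of_set ?S) V \<and> x \<in> V \<and> negligible V"
    using \<open>x \<in> ?S\<close> e by (intro exI[of _ "?S \<inter> ball x e"] conjI) simp_all
qed

lemma set_integrable_ae_eq: "ae_eq U f g \<Longrightarrow> set_integrable lebesgue U f \<longleftrightarrow> set_integrable lebesgue U g"
  unfolding ae_eq_def
  by (rule absolutely_integrable_spike_eq[of "{x \<in> U. f x \<noteq> g x}"]) auto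

text \<open>Integrability is not assumed: if one side is not integrable, neither is the other, and
  both integrals take the default value 0.\<close>

lemma set_integral_ae_eq:
  assumes "ae_eq U f g"
  shows "(LINT x:U|lebesgue. f x) = (LINT x:U|lebesgue. g x)"
proof (cases "set_integrable lebesgue U f")
  case True
  then have "set_integrable lebesgue U g" using set_integrable_ae_eq[OF assms] by simp
  moreover have "AE x in lebesgue. indicator U x *\<^sub>R f x = indicator U x *\<^sub>R g x"
    using assms unfolding ae_eq_def negligible_iff_null_sets
    by (rule AE_I') (auto simp: indicator_def)
  ultimately show ?thesis
    using True unfolding set_lebesgue_integral_def set_integrable_def
    by (intro integral_cong_AE) auto
next
  case False
  then have "\<not> set_integrable lebesgue U g" using set_integrable_ae_eq[OF assms] by simp
  then show ?thesis
    using False unfolding set_lebesgue_integral_def set_integrable_def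
    by (simp add: not_integrable_integral_eq)
qed

lemma loc_int_ae_eq: "ae_eq U f g \<Longrightarrow> loc_int U f \<Longrightarrow> loc_int U g"
  unfolding loc_int_def using set_integrable_ae_eq ae_eq_subset by metis

lemma loc_int_add: "loc_int U f \<Longrightarrow> loc_int U g \<Longrightarrow> loc_int U (\<lambda>x. f x + g x)"
  unfolding loc_int_def by (auto intro: set_integral_add)

lemma loc_int_cmult: "loc_int U f \<Longrightarrow> loc_int U (\<lambda>x. c * f x)"
  unfolding loc_int_def by auto

lemma loc_int_sum: "finite I \<Longrightarrow> (\<And>i. i \<in> I \<Longrightarrow> loc_int U (f i)) \<Longrightarrow> loc_int U (\<lambda>x. \<Sum>i\<in>I. f i x)"
  by (induction I rule: finite_induct) (auto simp: loc_int_add, simp add: loc_int_def set_integrable_def)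

lemma loc_int_continuous:
  fixes f :: "real^'n::finite \<Rightarrow> real"
  shows "continuous_on U f \<Longrightarrow> loc_int U f"
  unfolding loc_int_def
proof (intro allI impI, elim conjE)
  fix K assume "continuous_on U f" "compact K" "K \<subseteq> U"
  then have I: "integrable lborel (\<lambda>x. indicator K x *\<^sub>R f x)"
    by (intro borel_integrable_compact) (auto intro: continuous_on_subset)
  then have "(\<lambda>x. indicator K x *\<^sub>R f x) \<in> borel_measurable lborel" by blast
  then show "set_integrable lebesgue K f"
    using I unfolding set_integrable_def by (simp add: integrable_completion)
qed

text \<open>The last claim is the quantitative input of the whole argument: a pairing with a bounded
  test function sees f only through its \<open>L^1\<close> norm on the support.\<close>

lemma loc_int_mult_compact_supp:
  fixes f \<psi> :: "real^'n::finite \<Rightarrow> real"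
  assumes f: "set_integrable lebesgue K f" and K: "compact K" "K \<subseteq> U" "\<And>x. x \<notin> K \<Longrightarrow> \<psi> x = 0"
    and c: "continuous_on UNIV \<psi>"
  shows "set_integrable lebesgue U (\<lambda>x. f x * \<psi> x)"
    and "(LINT x:U|lebesgue. f x * \<psi> x) = (LINT x:K|lebesgue. f x * \<psi> x)"
    and "(\<And>x. \<bar>\<psi> x\<bar> \<le> M) \<Longrightarrow> \<bar>LINT x:U|lebesgue. f x * \<psi> x\<bar> \<le> M * (LINT x:K|lebesgue. \<bar>f x\<bar>)"
proof -
  have "set_integrable lebesgue K (\<lambda>x. \<psi> x * f x)"
  proof (rule absolutely_integrable_bounded_measurable_product[OF bilinear_times _ _ _ f])
    have cK: "continuous_on K \<psi>" using c continuous_on_subset by blast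
    show "K \<in> sets lebesgue" using K(1) by (simp add: compact_imp_closed lmeasurable_compact fmeasurableD)
    then show "\<psi> \<in> borel_measurable (lebesgue_on K)"
      using continuous_imp_measurable_on_sets_lebesgue[OF cK] by blast
    show "bounded (\<psi> ` K)" using cK K(1) compact_continuous_image compact_imp_bounded by blast
  qed
  then have I: "set_integrable lebesgue K (\<lambda>x. f x * \<psi> x)" by (simp add: mult.commute)
  have eq: "(\<lambda>x. indicator U x *\<^sub>R (f x * \<psi> x)) = (\<lambda>x. indicator K x *\<^sub>R (f x * \<psi> x))"
    using K(2,3) by (auto simp: fun_eq_iff indicator_def)
  show "set_integrable lebesgue U (\<lambda>x. f x * \<psi> x)"
    using I unfolding set_integrable_def eq .
  show UK: "(LINT x:U|lebesgue. f x * \<psi> x) = (LINT x:K|lebesgue. f x * \<psi> x)"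
    unfolding set_lebesgue_integral_def eq ..
  show "\<bar>LINT x:U|lebesgue. f x * \<psi> x\<bar> \<le> M * (LINT x:K|lebesgue. \<bar>f x\<bar>)" if M: "\<And>x. \<bar>\<psi> x\<bar> \<le> M"
  proof -
    have "\<bar>LINT x:K|lebesgue. f x * \<psi> x\<bar> \<le> (LINT x:K|lebesgue. M * \<bar>f x\<bar>)"
      unfolding set_lebesgue_integral_def
    proof (rule integral_abs_bound_integral)
      show "integrable lebesgue (\<lambda>x. indicat_real K x *\<^sub>R (f x * \<psi> x))"
        using I unfolding set_integrable_def .
      show "integrable lebesgue (\<lambda>x. indicat_real K x *\<^sub>R (M * \<bar>f x\<bar>))"
        using set_integrable_abs[OF f] set_integrable_mult_right[of M] unfolding set_integrable_def
        by (metis (no_types) set_integrable_def set_integrable_mult_right)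
      show "\<bar>indicat_real K x *\<^sub>R (f x * \<psi> x)\<bar> \<le> indicat_real K x *\<^sub>R (M * \<bar>f x\<bar>)" for x
        using M[of x] by (auto simp: indicator_def abs_mult mult.commute mult_right_mono)
    qed
    then show ?thesis by (simp add: UK)
  qed
qed

lemma loc_int_test:
  assumes "loc_int U f" "test_fun U \<phi>"
  shows "set_integrable lebesgue U (\<lambda>x. f x * \<phi> x)"
  using test_fun_support[OF assms(2)] assms(1) loc_int_mult_compact_supp(1)[OF _ _ _ _ smooth_continuous[OF test_fun_smooth[OF assms(2)]]]
  unfolding loc_int_def by metis

section \<open>The fundamental lemma of the calculus of variations\<close>

text \<open>Test functions converge pointwise to the indicator of K. They are products of a fixed
  cutoff \<eta>, whose support L lies in U and carries the integrable majorant, with cutoffs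
  supported in shrinking neighbourhoods of K.\<close>

lemma integral_compact_eq_0:
  fixes f :: "real^'n::finite \<Rightarrow> real"
  assumes U: "open U" and f: "loc_int U f" and K: "compact K" "K \<subseteq> U"
    and 0: "\<And>\<phi>. test_fun U \<phi> \<Longrightarrow> (LINT x:U|lebesgue. f x * \<phi> x) = 0"
  shows "(LINT x:K|lebesgue. f x) = 0"
proof (cases "K = {}")
  case False
  obtain \<eta> where \<eta>: "test_fun U \<eta>" "\<And>x. 0 \<le> \<eta> x \<and> \<eta> x \<le> 1" "\<And>x. x \<in> K \<Longrightarrow> \<eta> x = 1"
    using cutoff_exists[OF K(1) U K(2)] by blast
  obtain L where L: "compact L" "L \<subseteq> U" "\<And>x. x \<notin> L \<Longrightarrow> \<eta> x = 0" using test_fun_support[OF \<eta>(1)] by blast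
  \<comment> \<open>The distance to the empty set is 0 by convention, so these neighbourhoods shrink
    to K only if K is nonempty.\<close>
  define V where "V m = {x. infdist x K < 1 / real (Suc m)}" for m
  have oV: "open (V m)" for m
    unfolding V_def by (intro open_Collect_less continuous_intros)
  have KV: "K \<subseteq> V m" for m unfolding V_def by (auto simp: infdist_zero)
  have "\<forall>m. \<exists>\<zeta>. test_fun (V m) \<zeta> \<and> (\<forall>x. 0 \<le> \<zeta> x \<and> \<zeta> x \<le> 1) \<and> (\<forall>x\<in>K. \<zeta> x = 1)"
    using cutoff_exists[OF K(1) oV KV] by blast
  then obtain \<zeta> where \<zeta>: "\<And>m. test_fun (V m) (\<zeta> m)" "\<And>m x. 0 \<le> \<zeta> m x \<and> \<zeta> m x \<le> 1" "\<And>m x. x \<in> K \<Longrightarrow> \<zeta> m x = 1"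
    by metis
  define \<phi> where "\<phi> m x = \<eta> x * \<zeta> m x" for m x
  have t: "test_fun U (\<phi> m)" for m
    unfolding \<phi>_def by (rule test_fun_mult[OF \<eta>(1) test_fun_smooth[OF \<zeta>(1)]])
  have fL: "set_integrable lebesgue L f" using f L by (auto simp: loc_int_def)
  have KL: "K \<subseteq> L" using L(3) \<eta>(3) by (metis subsetI zero_neq_one)
  have lim: "(\<lambda>m. \<phi> m x) \<longlonglongrightarrow> indicator K x" for x
  proof (cases "x \<in> K")
    case True
    then show ?thesis using \<eta>(3) \<zeta>(3) by (simp add: \<phi>_def)
  next
    case False
    then have "infdist x K > 0"
      using K(1) \<open>K \<noteq> {}\<close> by (metis compact_imp_closed in_closed_iff_infdist_zero infdist_nonneg less_eq_real_def)
    then obtain m0 where m0: "1 / real (Suc m0) < infdist x K" using nat_approx_posE by metis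
    have "\<zeta> m x = 0" if "m \<ge> m0" for m
    proof -
      have "1 / real (Suc m) \<le> 1 / real (Suc m0)" using that by (simp add: frac_le)
      then have "x \<notin> V m" using m0 by (simp add: V_def)
      then show ?thesis using test_fun_support[OF \<zeta>(1)[of m]] by blast
    qed
    then have "\<forall>\<^sub>F m in sequentially. \<phi> m x = indicator K x"
      using False unfolding eventually_sequentially \<phi>_def by (intro exI[of _ m0]) simp
    then show ?thesis by (rule tendsto_eventually)
  qed
  have "(\<lambda>m. \<integral>x. indicator U x *\<^sub>R (f x * \<phi> m x) \<partial>lebesgue) \<longlonglongrightarrow> (\<integral>x. indicator K x *\<^sub>R f x \<partial>lebesgue)"
  proof (rule integral_dominated_convergence[where w = "\<lambda>x. indicator L x *\<^sub>R \<bar>f x\<bar>"])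
    show "integrable lebesgue (\<lambda>x. indicator L x *\<^sub>R \<bar>f x\<bar>)"
      using set_integrable_abs[OF fL] unfolding set_integrable_def .
    show "(\<lambda>x. indicat_real K x *\<^sub>R f x) \<in> borel_measurable lebesgue"
      using f K unfolding loc_int_def set_integrable_def by blast
    show "(\<lambda>x. indicat_real U x *\<^sub>R (f x * \<phi> m x)) \<in> borel_measurable lebesgue" for m
      using loc_int_test[OF f t] unfolding set_integrable_def by blast
    show "AE x in lebesgue. (\<lambda>m. indicat_real U x *\<^sub>R (f x * \<phi> m x)) \<longlonglongrightarrow> indicat_real K x *\<^sub>R f x"
    proof (rule AE_I2)
      fix x
      have "(\<lambda>m. indicat_real U x *\<^sub>R (f x * \<phi> m x)) \<longlonglongrightarrow> indicat_real U x *\<^sub>R (f x * indicator K x)"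
        by (intro tendsto_intros lim)
      also have "indicat_real U x *\<^sub>R (f x * indicator K x) = indicat_real K x *\<^sub>R f x"
        using K(2) by (auto simp: indicator_def)
      finally show "(\<lambda>m. indicat_real U x *\<^sub>R (f x * \<phi> m x)) \<longlonglongrightarrow> indicat_real K x *\<^sub>R f x" .
    qed
    show "AE x in lebesgue. norm (indicat_real U x *\<^sub>R (f x * \<phi> m x)) \<le> indicat_real L x *\<^sub>R \<bar>f x\<bar>" for m
    proof (rule AE_I2)
      fix x
      have "\<bar>\<phi> m x\<bar> \<le> indicator L x"
        using \<eta>(2)[of x] \<zeta>(2)[of m x] L(3)[of x] by (auto simp: \<phi>_def indicator_def mult_le_one)
      then have "\<bar>f x\<bar> * \<bar>\<phi> m x\<bar> \<le> \<bar>f x\<bar> * indicator L x" by (intro mult_left_mono) auto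
      then show "norm (indicat_real U x *\<^sub>R (f x * \<phi> m x)) \<le> indicat_real L x *\<^sub>R \<bar>f x\<bar>"
        by (auto simp: indicator_def abs_mult)
    qed
  qed
  then show ?thesis
    using 0[OF t] unfolding set_lebesgue_integral_def by (simp add: LIMSEQ_const_iff)
qed (simp add: set_lebesgue_integral_def)

text \<open>Inner regularity: the set where f > 0 contains a closed set T up to measure e. Here T is
  compact and the integral of f over it is 0, so T is null, and the whole set has measure at most
  e.\<close>

lemma negligible_positive_part:
  fixes f :: "real^'n::finite \<Rightarrow> real"
  assumes L: "compact L" "set_integrable lebesgue L f"
    and 0: "\<And>T. compact T \<Longrightarrow> T \<subseteq> L \<Longrightarrow> (LINT x:T|lebesgue. f x) = 0"
  shows "negligible {x \<in> L. f x > 0}"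
proof -
  let ?E = "{x \<in> L. f x > 0}"
  have "(\<lambda>x. indicator L x *\<^sub>R f x) \<in> borel_measurable lebesgue"
    using L(2) by (auto simp: set_integrable_def)
  then have "{x \<in> space lebesgue. 0 < indicator L x *\<^sub>R f x} \<in> sets lebesgue"
    by measurable
  also have "{x \<in> space lebesgue. 0 < indicator L x *\<^sub>R f x} = ?E" by (auto simp: indicator_def split: if_splits)
  finally have E: "?E \<in> sets lebesgue" .
  have small: "emeasure lebesgue ?E \<le> ennreal e" if epos: "e > 0" for e
  proof -
    obtain T where T: "closed T" "T \<subseteq> ?E" "?E - T \<in> lmeasurable" "emeasure lebesgue (?E - T) < ennreal e"
      by (rule sets_lebesgue_inner_closed[OF E epos])
    have TL: "T \<subseteq> L" using T(2) by blast
    then have cT: "compact T" "T \<subseteq> L"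
      using compact_Int_closed[OF L(1) T(1)] by (simp_all add: Int_absorb1)
    have Ts: "T \<in> sets lebesgue" using cT by (simp add: lmeasurable_compact fmeasurableD)
    have fT: "set_integrable lebesgue T f" using set_integrable_subset[OF L(2) Ts cT(2)] .
    have "(\<integral>x. indicator T x *\<^sub>R f x \<partial>lebesgue) = 0"
      using 0[OF cT] by (simp add: set_lebesgue_integral_def)
    moreover have "AE x in lebesgue. 0 \<le> indicator T x *\<^sub>R f x"
    proof (rule AE_I2)
      fix x show "0 \<le> indicator T x *\<^sub>R f x" using T(2) by (cases "x \<in> T") auto
    qed
    ultimately have "AE x in lebesgue. indicator T x *\<^sub>R f x = 0"
      using fT by (subst integral_nonneg_eq_0_iff_AE[symmetric]) (auto simp: set_integrable_def)
    then have "AE x in lebesgue. x \<notin> T"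
    proof (rule AE_mp, intro AE_I2 impI)
      fix x assume "indicator T x *\<^sub>R f x = 0"
      then show "x \<notin> T" using T(2) by auto
    qed
    then have "T \<in> null_sets lebesgue" using Ts by (simp add: AE_iff_null_sets)
    then have "emeasure lebesgue ?E \<le> emeasure lebesgue (?E - T)"
      using emeasure_Diff_null_set[of T lebesgue ?E] E by simp
    with T(4) show ?thesis by simp
  qed
  have "emeasure lebesgue ?E \<le> 0"
    by (rule ennreal_le_epsilon) (simp only: add_0 small)
  then have "emeasure lebesgue ?E = 0" by (simp only: le_zero_eq)
  then have "?E \<in> null_sets lebesgue" using E by (rule null_setsI)
  then show ?thesis by (simp only: negligible_iff_null_sets)
qed

text \<open>On every closed ball in U all integrals of f over compact subsets vanish, so both f and
  - f have a negligible set of positivity there. The local statements are then combined.\<close>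

lemma fundamental_lemma:
  fixes f :: "real^'n::finite \<Rightarrow> real"
  assumes U: "open U" and f: "loc_int U f"
    and 0: "\<And>\<phi>. test_fun U \<phi> \<Longrightarrow> (LINT x:U|lebesgue. f x * \<phi> x) = 0"
  shows "ae_eq U f (\<lambda>x. 0)"
proof (rule ae_eq_locally)
  fix x assume "x \<in> U"
  then obtain e where e: "e > 0" "cball x e \<subseteq> U" using U open_contains_cball by blast
  let ?L = "cball x e"
  have fL: "set_integrable lebesgue ?L f" using f e by (simp add: loc_int_def)
  have T: "(LINT x:T|lebesgue. f x) = 0" if "compact T" "T \<subseteq> ?L" for T
    using integral_compact_eq_0[OF U f that(1) _ 0] that(2) e by blast
  have "negligible {x \<in> ?L. f x > 0}"
    by (rule negligible_positive_part[OF compact_cball fL T])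
  moreover have "negligible {x \<in> ?L. - f x > 0}"
    using fL T by (intro negligible_positive_part[OF compact_cball]) (auto simp: set_integrable_def set_lebesgue_integral_def)
  ultimately have "negligible ({x \<in> ?L. f x > 0} \<union> {x \<in> ?L. - f x > 0})" by (rule negligible_Un)
  then have "ae_eq (ball x e) f (\<lambda>x. 0)"
    unfolding ae_eq_def by (rule negligible_subset) auto
  then show "\<exists>e>0. ae_eq (ball x e) f (\<lambda>x. 0)" using e by blast
qed

lemma weak_pd_unique:
  fixes f :: "real^'n::finite \<Rightarrow> real"
  assumes U: "open U" and g: "weak_pd U i f g" and h: "weak_pd U i f h"
  shows "ae_eq U g h"
proof -
  have "ae_eq U (\<lambda>x. g x + (-1) * h x) (\<lambda>x. 0)"
  proof (rule fundamental_lemma[OF U])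
    have l: "loc_int U g" "loc_int U h" using g h by (auto simp: weak_pd_def)
    then show "loc_int U (\<lambda>x. g x + (-1) * h x)" by (intro loc_int_add loc_int_cmult)
    fix \<phi> assume \<phi>: "test_fun U \<phi>"
    have "(LINT x:U|lebesgue. (g x + (-1) * h x) * \<phi> x)
       = (LINT x:U|lebesgue. g x * \<phi> x - h x * \<phi> x)" by (simp add: algebra_simps)
    also have "\<dots> = (LINT x:U|lebesgue. g x * \<phi> x) - (LINT x:U|lebesgue. h x * \<phi> x)"
      using loc_int_test[OF l(1) \<phi>] loc_int_test[OF l(2) \<phi>] by (rule set_integral_diff)
    also have "\<dots> = 0" using g h \<phi> by (force simp: weak_pd_def)
    finally show "(LINT x:U|lebesgue. (g x + (-1) * h x) * \<phi> x) = 0" .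
  qed
  then show ?thesis unfolding ae_eq_def by (rule negligible_subset) auto
qed

text \<open>\<open>wpd\<close> is an unspecified choice. It carries information only after some weak
  derivative has been exhibited, and then only up to null sets.\<close>

lemma wpd_weak_pd: "weak_pd U i f g \<Longrightarrow> weak_pd U i f (wpd U i f)"
  unfolding wpd_def by (rule someI[of "weak_pd U i f"])

lemma wpd_ae_eq: "open U \<Longrightarrow> weak_pd U i f g \<Longrightarrow> ae_eq U (wpd U i f) g"
  by (blast intro: weak_pd_unique wpd_weak_pd)

lemma weak_pd_ae_eq:
  assumes "weak_pd U i f g" "ae_eq U f f'" "ae_eq U g g'"
  shows "weak_pd U i f' g'"
  using assms loc_int_ae_eq[OF assms(2)] loc_int_ae_eq[OF assms(3)]
    set_integral_ae_eq[OF ae_eq_fun[OF assms(2), of "\<lambda>x y. y * _ x"]]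
    set_integral_ae_eq[OF ae_eq_fun[OF assms(3), of "\<lambda>x y. y * _ x"]]
  unfolding weak_pd_def by simp

lemma set_integral_sum':
  fixes f :: "'i \<Rightarrow> 'a \<Rightarrow> real"
  assumes "finite I" "\<And>i. i \<in> I \<Longrightarrow> set_integrable M A (f i)"
  shows "set_integrable M A (\<lambda>x. \<Sum>i\<in>I. f i x)"
    and "(LINT x:A|M. \<Sum>i\<in>I. f i x) = (\<Sum>i\<in>I. LINT x:A|M. f i x)"
proof -
  have I: "integrable M (\<lambda>x. indicator A x *\<^sub>R f i x)" if "i \<in> I" for i
    using assms(2)[OF that] unfolding set_integrable_def .
  show "set_integrable M A (\<lambda>x. \<Sum>i\<in>I. f i x)"
    unfolding set_integrable_def scaleR_sum_right by (rule Bochner_Integration.integrable_sum[OF I])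
  show "(LINT x:A|M. \<Sum>i\<in>I. f i x) = (\<Sum>i\<in>I. LINT x:A|M. f i x)"
    unfolding set_lebesgue_integral_def scaleR_sum_right by (rule Bochner_Integration.integral_sum[OF I])
qed

lemma weak_pd_sum:
  assumes "finite I" "\<And>c. c \<in> I \<Longrightarrow> weak_pd U i (f c) (g c)"
  shows "weak_pd U i (\<lambda>x. \<Sum>c\<in>I. m c * f c x) (\<lambda>x. \<Sum>c\<in>I. m c * g c x)"
proof -
  have l: "loc_int U (f c)" "loc_int U (g c)" if "c \<in> I" for c using assms that by (auto simp: weak_pd_def)
  have *: "(LINT x:U|lebesgue. (\<Sum>c\<in>I. m c * h c x) * \<phi> x) = (\<Sum>c\<in>I. m c * (LINT x:U|lebesgue. h c x * \<phi> x))"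
    if "\<And>c. c \<in> I \<Longrightarrow> loc_int U (h c)" "test_fun U \<phi>" for h \<phi>
  proof -
    have "(LINT x:U|lebesgue. (\<Sum>c\<in>I. m c * h c x) * \<phi> x) = (LINT x:U|lebesgue. (\<Sum>c\<in>I. m c * (h c x * \<phi> x)))"
      by (simp add: sum_distrib_right mult.assoc)
    also have "\<dots> = (\<Sum>c\<in>I. (LINT x:U|lebesgue. m c * (h c x * \<phi> x)))"
      using that by (intro set_integral_sum'(2)[OF assms(1)] set_integrable_mult_right loc_int_test) auto
    finally show ?thesis by simp
  qed
  show ?thesis
    unfolding weak_pd_def
  proof (intro conjI allI impI)
    show "loc_int U (\<lambda>x. \<Sum>c\<in>I. m c * f c x)" "loc_int U (\<lambda>x. \<Sum>c\<in>I. m c * g c x)"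
      using assms(1) l by (intro loc_int_sum loc_int_cmult; simp)+
    fix \<phi> assume \<phi>: "test_fun U \<phi>"
    have "(LINT x:U|lebesgue. f c x * pd i \<phi> x) = - (LINT x:U|lebesgue. g c x * \<phi> x)" if "c \<in> I" for c
      using assms(2)[OF that] \<phi> by (auto simp: weak_pd_def)
    then show "(LINT x:U|lebesgue. (\<Sum>c\<in>I. m c * f c x) * pd i \<phi> x) = - (LINT x:U|lebesgue. (\<Sum>c\<in>I. m c * g c x) * \<phi> x)"
      by (simp add: *[OF l(1) test_fun_pd[OF \<phi>]] *[OF l(2) \<phi>] sum_negf)
  qed
qed

lemma weak_pd_C1:
  fixes f :: "real^'n::finite \<Rightarrow> real"
  assumes U: "open U" and f: "\<And>x. x \<in> U \<Longrightarrow> f differentiable at x" "continuous_on U (pd i f)"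
  shows "weak_pd U i f (pd i f)"
proof -
  have "continuous_on U f"
    using f(1) by (simp add: continuous_at_imp_continuous_on differentiable_imp_continuous_within)
  then show ?thesis
    unfolding weak_pd_def using integration_by_parts[OF U f] loc_int_continuous f(2) by blast
qed

section \<open>Decay of Fourier coefficients of localised solutions\<close>

text \<open>A lower bound for the symbol as a linear map, not for its quadratic form; it is stated with
  \<open>l\<^sup>1\<close> norms since these are what testing with the individual components yields.\<close>

definition elliptic :: "'c set \<Rightarrow> ('c \<Rightarrow> 'c \<Rightarrow> 'n::finite \<Rightarrow> 'n \<Rightarrow> real) \<Rightarrow> real \<Rightarrow> real \<Rightarrow> bool" where
  "elliptic I a l L \<longleftrightarrow> (\<forall>d\<in>I. \<forall>c\<in>I. \<forall>i j. \<bar>a d c i j\<bar> \<le> L) \<and>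
     (\<forall>(\<xi>::real^'n) b. l * (norm \<xi>)\<^sup>2 * (\<Sum>c\<in>I. \<bar>b c\<bar>)
        \<le> (\<Sum>d\<in>I. \<bar>\<Sum>c\<in>I. (\<Sum>i\<in>UNIV. \<Sum>j\<in>UNIV. a d c i j * (\<xi> $ i * \<xi> $ j)) * b c\<bar>))"

text \<open>The system in the sense of distributions: d numbers the equations and c the unknowns.
  Both derivatives fall on the test function, so local integrability of u is enough and weak
  derivatives of solutions are again solutions.\<close>

definition dsol :: "(real^'n::finite) set \<Rightarrow> 'c set \<Rightarrow> ('c \<Rightarrow> 'c \<Rightarrow> 'n \<Rightarrow> 'n \<Rightarrow> real) \<Rightarrow> ('c \<Rightarrow> real^'n \<Rightarrow> real) \<Rightarrow> bool" where
  "dsol U I a u \<longleftrightarrow> (\<forall>c\<in>I. loc_int U (u c)) \<and>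
     (\<forall>d\<in>I. \<forall>\<phi>. test_fun U \<phi> \<longrightarrow>
        (\<Sum>c\<in>I. \<Sum>i\<in>UNIV. \<Sum>j\<in>UNIV. a d c i j * (LINT x:U|lebesgue. u c x * pd i (pd j \<phi>) x)) = 0)"

section \<open>Real waves and Fourier coefficients of cut-off functions\<close>

text \<open>A real substitute for the complex exponential. The phase \<theta> covers sine and cosine
  at once, and a derivative costs a factor of \<xi> and a quarter period.\<close>

definition wave :: "real^'n::finite \<Rightarrow> real \<Rightarrow> real^'n \<Rightarrow> real" where
  "wave \<xi> \<theta> x = cos (\<xi> \<bullet> x + \<theta>)"

lemma smooth_inner: "smooth (\<lambda>x::real^'n::finite. \<xi> \<bullet> x)"
  unfolding inner_vec_def inner_real_def by (intro smooth_sum smooth_mult smooth_const smooth_coord)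

lemma smooth_wave: "smooth (wave \<xi> \<theta>)"
  unfolding wave_def[abs_def] by (intro smooth_cos smooth_add smooth_inner smooth_const)

lemma pd_wave: "pd i (wave \<xi> \<theta>) x = \<xi> $ i * wave \<xi> (\<theta> + pi/2) x"
proof -
  have "(wave \<xi> \<theta> has_derivative (\<lambda>h. - sin (\<xi> \<bullet> x + \<theta>) * (\<xi> \<bullet> h))) (at x)"
    unfolding wave_def[abs_def] by (auto intro!: derivative_eq_intros simp: mult.commute)
  from pd_eqI[OF this, of i] show ?thesis
    by (simp add: wave_def inner_axis cos_add sin_add)
qed

lemma wave_pi: "wave \<xi> (\<theta> + pi/2 + pi/2) x = - wave \<xi> \<theta> x"
proof -
  have "\<xi> \<bullet> x + (\<theta> + pi/2 + pi/2) = (\<xi> \<bullet> x + \<theta>) + pi" by simp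
  then show ?thesis unfolding wave_def by (simp only: cos_periodic_pi)
qed

lemma abs_wave_le_1: "\<bar>wave \<xi> \<theta> x\<bar> \<le> 1"
  by (simp add: wave_def)

lemma pd_pd_mult_wave:
  assumes "smooth \<psi>"
  shows "pd i (pd j (\<lambda>x. \<psi> x * wave \<xi> \<theta> x)) x =
    pd i (pd j \<psi>) x * wave \<xi> \<theta> x + \<xi> $ i * (pd j \<psi> x * wave \<xi> (\<theta> + pi/2) x)
    + \<xi> $ j * (pd i \<psi> x * wave \<xi> (\<theta> + pi/2) x) - \<xi> $ i * \<xi> $ j * (\<psi> x * wave \<xi> \<theta> x)"
proof -
  note d = smooth_differentiable
  have 1: "pd j (\<lambda>x. \<psi> x * wave \<xi> \<theta> x) = (\<lambda>x. pd j \<psi> x * wave \<xi> \<theta> x + \<xi> $ j * (\<psi> x * wave \<xi> (\<theta> + pi/2) x))"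
    by (rule ext) (simp add: pd_mult[OF d[OF assms] d[OF smooth_wave]] pd_wave)
  have "pd i (\<lambda>x. pd j \<psi> x * wave \<xi> \<theta> x + \<xi> $ j * (\<psi> x * wave \<xi> (\<theta> + pi/2) x)) x
    = pd i (\<lambda>x. pd j \<psi> x * wave \<xi> \<theta> x) x + \<xi> $ j * pd i (\<lambda>x. \<psi> x * wave \<xi> (\<theta> + pi/2) x) x"
    by (subst pd_add, intro d smooth_mult smooth_pd smooth_wave smooth_const assms,
        intro d smooth_mult smooth_pd smooth_wave smooth_const assms,
        subst pd_cmult, intro d smooth_mult smooth_pd smooth_wave smooth_const assms, rule refl)
  then show ?thesis
    unfolding 1 pd_mult[OF d[OF assms] d[OF smooth_wave]] pd_mult[OF d[OF smooth_pd[OF assms]] d[OF smooth_wave]] pd_wave wave_pi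
    by (simp add: algebra_simps)
qed

lemma test_fun_iter_pd: "test_fun U \<phi> \<Longrightarrow> test_fun U (iter_pd is \<phi>)"
  by (induction "is") (auto intro: test_fun_pd)

text \<open>Real Fourier coefficient of the product f \<psi>. The cutoff is a separate argument
  because the recursion differentiates it while f stays untouched.\<close>

definition fcoef :: "(real^'n::finite) set \<Rightarrow> (real^'n \<Rightarrow> real) \<Rightarrow> (real^'n \<Rightarrow> real) \<Rightarrow> real^'n \<Rightarrow> real \<Rightarrow> real" where
  "fcoef U f \<psi> \<xi> \<theta> = (LINT x:U|lebesgue. f x * (\<psi> x * wave \<xi> \<theta> x))"

lemma fcoef_integrable:
  "loc_int U f \<Longrightarrow> test_fun U \<psi> \<Longrightarrow> set_integrable lebesgue U (\<lambda>x. f x * (\<psi> x * wave \<xi> \<theta> x))"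
  by (rule loc_int_test[OF _ test_fun_mult[OF _ smooth_wave]])

lemma fcoef_bound:
  fixes f \<psi> :: "real^'n::finite \<Rightarrow> real"
  assumes "loc_int U f" "compact K" "K \<subseteq> U" "\<And>x. x \<notin> K \<Longrightarrow> \<psi> x = 0" "smooth \<psi>" "\<And>x. \<bar>\<psi> x\<bar> \<le> M"
  shows "\<bar>fcoef U f \<psi> \<xi> \<theta>\<bar> \<le> M * (LINT x:K|lebesgue. \<bar>f x\<bar>)"
  unfolding fcoef_def
proof (rule loc_int_mult_compact_supp(3)[OF _ assms(2,3)])
  show "set_integrable lebesgue K f" using assms by (simp add: loc_int_def)
  show "continuous_on UNIV (\<lambda>x. \<psi> x * wave \<xi> \<theta> x)"
    by (intro smooth_continuous smooth_mult smooth_wave assms)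
  show "\<bar>\<psi> x * wave \<xi> \<theta> x\<bar> \<le> M" for x
    using mult_mono[OF assms(6)[of x] abs_wave_le_1[of \<xi> \<theta> x]] assms(6)[of x] by (simp add: abs_mult)
qed (use assms in auto)

lemma iter_pd_zero_off_closed:
  "closed K \<Longrightarrow> (\<And>x. x \<notin> K \<Longrightarrow> \<phi> x = 0) \<Longrightarrow> x \<notin> K \<Longrightarrow> iter_pd is \<phi> x = 0"
proof (induction "is" arbitrary: x)
  case (Cons i js)
  have "pd i (iter_pd js \<phi>) x = 0"
    by (rule pd_zero_off_closed[OF Cons.prems(1,3)]) (rule Cons.IH[OF Cons.prems(1,2)])
  then show ?case by simp
qed simp

text \<open>Testing the system with \<open>\<psi> cos (\<xi> \<bullet> x + \<theta>)\<close> expresses the symbol at \<open>\<xi>\<close> applied to the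
  coefficients by coefficients with more derivatives on the cutoff but fewer powers of \<open>\<xi>\<close>.\<close>

lemma fcoef_identity:
  fixes u :: "'c \<Rightarrow> real^'n::finite \<Rightarrow> real"
  assumes u: "dsol U I a u" and d: "d \<in> I" and \<psi>: "test_fun U \<psi>"
  shows "(\<Sum>c\<in>I. (\<Sum>i\<in>UNIV. \<Sum>j\<in>UNIV. a d c i j * (\<xi> $ i * \<xi> $ j)) * fcoef U (u c) \<psi> \<xi> \<theta>)
    = (\<Sum>c\<in>I. \<Sum>i\<in>UNIV. \<Sum>j\<in>UNIV. a d c i j * (fcoef U (u c) (pd i (pd j \<psi>)) \<xi> \<theta>
         + \<xi> $ i * fcoef U (u c) (pd j \<psi>) \<xi> (\<theta> + pi/2) + \<xi> $ j * fcoef U (u c) (pd i \<psi>) \<xi> (\<theta> + pi/2)))"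
proof -
  let ?\<theta> = "\<theta> + pi/2"
  have s: "smooth \<psi>" using \<psi> by (rule test_fun_smooth)
  have *: "(LINT x:U|lebesgue. u c x * pd i (pd j (\<lambda>x. \<psi> x * wave \<xi> \<theta> x)) x)
     = fcoef U (u c) (pd i (pd j \<psi>)) \<xi> \<theta>
         + \<xi> $ i * fcoef U (u c) (pd j \<psi>) \<xi> ?\<theta> + \<xi> $ j * fcoef U (u c) (pd i \<psi>) \<xi> ?\<theta>
       - \<xi> $ i * \<xi> $ j * fcoef U (u c) \<psi> \<xi> \<theta>" if c: "c \<in> I" for c i j
  proof -
    have l: "loc_int U (u c)" using u c by (simp add: dsol_def)
    note I = fcoef_integrable[OF l]
    have I1: "set_integrable lebesgue U (\<lambda>x. u c x * (pd i (pd j \<psi>) x * wave \<xi> \<theta> x))"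
      and I2: "set_integrable lebesgue U (\<lambda>x. \<xi> $ i * (u c x * (pd j \<psi> x * wave \<xi> ?\<theta> x)))"
      and I3: "set_integrable lebesgue U (\<lambda>x. \<xi> $ j * (u c x * (pd i \<psi> x * wave \<xi> ?\<theta> x)))"
      and I4: "set_integrable lebesgue U (\<lambda>x. \<xi> $ i * \<xi> $ j * (u c x * (\<psi> x * wave \<xi> \<theta> x)))"
      by (intro I test_fun_pd \<psi> set_integrable_mult_right)+
    have "(LINT x:U|lebesgue. u c x * pd i (pd j (\<lambda>x. \<psi> x * wave \<xi> \<theta> x)) x)
      = (LINT x:U|lebesgue. u c x * (pd i (pd j \<psi>) x * wave \<xi> \<theta> x)
          + \<xi> $ i * (u c x * (pd j \<psi> x * wave \<xi> ?\<theta> x)) + \<xi> $ j * (u c x * (pd i \<psi> x * wave \<xi> ?\<theta> x))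
          - \<xi> $ i * \<xi> $ j * (u c x * (\<psi> x * wave \<xi> \<theta> x)))"
      by (simp add: pd_pd_mult_wave[OF s] algebra_simps)
    also have "\<dots> = fcoef U (u c) (pd i (pd j \<psi>)) \<xi> \<theta>
         + \<xi> $ i * fcoef U (u c) (pd j \<psi>) \<xi> ?\<theta> + \<xi> $ j * fcoef U (u c) (pd i \<psi>) \<xi> ?\<theta>
       - \<xi> $ i * \<xi> $ j * fcoef U (u c) \<psi> \<xi> \<theta>"
      unfolding fcoef_def
      by (simp only: set_integral_diff(2)[OF set_integral_add(1)[OF set_integral_add(1)[OF I1 I2] I3] I4]
          set_integral_add(2)[OF set_integral_add(1)[OF I1 I2] I3] set_integral_add(2)[OF I1 I2] set_integral_mult_right)
    finally show ?thesis .
  qed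
  have "(\<Sum>c\<in>I. \<Sum>i\<in>UNIV. \<Sum>j\<in>UNIV. a d c i j * (LINT x:U|lebesgue. u c x * pd i (pd j (\<lambda>x. \<psi> x * wave \<xi> \<theta> x)) x)) = 0"
    using u d test_fun_mult[OF \<psi> smooth_wave] unfolding dsol_def by blast
  then have "(\<Sum>c\<in>I. \<Sum>i\<in>UNIV. \<Sum>j\<in>UNIV. a d c i j * (fcoef U (u c) (pd i (pd j \<psi>)) \<xi> \<theta>
         + \<xi> $ i * fcoef U (u c) (pd j \<psi>) \<xi> ?\<theta> + \<xi> $ j * fcoef U (u c) (pd i \<psi>) \<xi> ?\<theta>)
       - (a d c i j * (\<xi> $ i * \<xi> $ j)) * fcoef U (u c) \<psi> \<xi> \<theta>) = 0"
    by (simp add: * algebra_simps)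
  then show ?thesis
    by (simp add: sum_subtractf sum_distrib_right)
qed

text \<open>Induction on the power m, for all derivatives \<open>js\<close> of the cutoff
  simultaneously, since one step puts up to two more derivatives on it. Ellipticity divides by
  |\<xi>|^2 while the other side of the identity grows at most like |\<xi>|, so each step gains one
  power.\<close>

lemma fcoef_decay:
  fixes K :: "(real^'n::finite) set" and I :: "'c set"
  assumes K: "compact K" and \<eta>: "smooth \<eta>" "\<And>x. x \<notin> K \<Longrightarrow> \<eta> x = 0" and l: "l > 0"
  shows "\<exists>C\<ge>0. \<forall>a U u \<xi> \<theta> c. elliptic I a l L \<and> dsol U I a u \<and> K \<subseteq> U \<and> norm \<xi> \<ge> 1 \<and> c \<in> I \<and> finite I \<longrightarrow>
     \<bar>fcoef U (u c) (iter_pd js \<eta>) \<xi> \<theta>\<bar> \<le> C / norm \<xi> ^ m * (\<Sum>c\<in>I. LINT x:K|lebesgue. \<bar>u c x\<bar>)"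
proof (induction m arbitrary: js)
  case 0
  have s: "smooth (iter_pd js \<eta>)" using \<eta>(1) by (rule smooth_iter_pd)
  have z: "\<And>x. x \<notin> K \<Longrightarrow> iter_pd js \<eta> x = 0"
    by (rule iter_pd_zero_off_closed[OF compact_imp_closed[OF K] \<eta>(2)])
  obtain M where M: "M \<ge> 0" "\<And>x. \<bar>iter_pd js \<eta> x\<bar> \<le> M"
    using bounded_compact_supp[OF smooth_continuous[OF s] K z] by blast
  have "\<bar>fcoef U (u c) (iter_pd js \<eta>) \<xi> \<theta>\<bar> \<le> M * (\<Sum>c\<in>I. LINT x:K|lebesgue. \<bar>u c x\<bar>)"
    if h: "dsol U I a u" "K \<subseteq> U" "c \<in> I" "finite I" for a U u \<xi> \<theta> c
  proof -
    have "\<bar>fcoef U (u c) (iter_pd js \<eta>) \<xi> \<theta>\<bar> \<le> M * (LINT x:K|lebesgue. \<bar>u c x\<bar>)"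
      using h by (intro fcoef_bound[OF _ K h(2) z s M(2)]) (simp add: dsol_def)
    also have "\<dots> \<le> M * (\<Sum>c\<in>I. LINT x:K|lebesgue. \<bar>u c x\<bar>)"
      using h M(1) by (intro mult_left_mono member_le_sum) (auto simp: set_lebesgue_integral_def)
    finally show ?thesis .
  qed
  then show ?case using M(1) by (intro exI[of _ M]) auto
next
  case (Suc m)
  from choice[OF allI[OF Suc.IH]] obtain C where C0: "\<forall>js. C js \<ge> 0 \<and> (\<forall>a U u \<xi> \<theta> c.
     elliptic I a l L \<and> dsol U I a u \<and> K \<subseteq> U \<and> norm \<xi> \<ge> 1 \<and> c \<in> I \<and> finite I \<longrightarrow>
     \<bar>fcoef U (u c) (iter_pd js \<eta>) \<xi> \<theta>\<bar> \<le> C js / norm \<xi> ^ m * (\<Sum>c\<in>I. LINT x:K|lebesgue. \<bar>u c x\<bar>))" ..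
  have C: "C js \<ge> 0" for js using C0 by simp
  have CF: "\<bar>fcoef U (u c) (iter_pd js \<eta>) \<xi> \<theta>\<bar> \<le> C js / norm \<xi> ^ m * (\<Sum>c\<in>I. LINT x:K|lebesgue. \<bar>u c x\<bar>)"
    if "elliptic I a l L" "dsol U I a u" "K \<subseteq> U" "norm \<xi> \<ge> 1" "c \<in> I" "finite I" for js a U u \<xi> \<theta> c
    using C0 that by simp
  \<comment> \<open>Sum of the constants available for the three kinds of coefficients on the right
    of the identity.\<close>
  define S where "S = (\<Sum>i\<in>UNIV. \<Sum>j\<in>UNIV. C (i # j # js) + C (j # js) + C (i # js))"
  have S0: "S \<ge> 0" unfolding S_def by (intro sum_nonneg add_nonneg_nonneg C)
  \<comment> \<open>One factor \<open>card I\<close> comes from summing over the unknowns, the other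
    from summing over the equations; \<open>L\<close> bounds the coefficients and 1/l comes from
    ellipticity.\<close>
  define D where "D = real (card I) * (real (card I) * (\<bar>L\<bar> * S)) / l"
  have D0: "D \<ge> 0" using S0 l by (simp add: D_def)
  have "\<bar>fcoef U (u c0) (iter_pd js \<eta>) \<xi> \<theta>\<bar> \<le> D / norm \<xi> ^ Suc m * (\<Sum>c\<in>I. LINT x:K|lebesgue. \<bar>u c x\<bar>)"
    if h: "elliptic I a l L" "dsol U I a u" "K \<subseteq> U" "norm \<xi> \<ge> 1" "c0 \<in> I" "finite I" for a U u \<xi> \<theta> c0
  proof -
    define N where "N = (\<Sum>c\<in>I. LINT x:K|lebesgue. \<bar>u c x\<bar>)"
    have N0: "N \<ge> 0" unfolding N_def by (intro sum_nonneg) (auto simp: set_lebesgue_integral_def)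
    define E where "E = N / norm \<xi> ^ m"
    have E0: "E \<ge> 0" using N0 by (simp add: E_def)
    let ?F = "\<lambda>c js. fcoef U (u c) (iter_pd js \<eta>) \<xi>"
    have F: "\<bar>?F c js \<theta>\<bar> \<le> C js * E" if "c \<in> I" for c js \<theta>
      using CF[OF h(1-4) that h(6), of js \<theta>] by (simp add: E_def N_def)
    have \<psi>: "test_fun U (iter_pd js \<eta>)"
      by (rule test_fun_iter_pd, rule test_funI[OF \<eta>(1) K h(3) \<eta>(2)])
    define T where "T d = (\<Sum>c\<in>I. \<Sum>i\<in>UNIV. \<Sum>j\<in>UNIV. a d c i j * (?F c (i # j # js) \<theta>
         + \<xi> $ i * ?F c (j # js) (\<theta> + pi/2) + \<xi> $ j * ?F c (i # js) (\<theta> + pi/2)))" for d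
    have T: "\<bar>T d\<bar> \<le> real (card I) * (\<bar>L\<bar> * S * (norm \<xi> * E))" if "d \<in> I" for d
    proof -
      have A: "\<bar>a d c i j * (?F c (i # j # js) \<theta>
         + \<xi> $ i * ?F c (j # js) (\<theta> + pi/2) + \<xi> $ j * ?F c (i # js) (\<theta> + pi/2))\<bar>
        \<le> \<bar>L\<bar> * ((C (i # j # js) + C (j # js) + C (i # js)) * (norm \<xi> * E))" if "c \<in> I" for c i j
      proof -
        \<comment> \<open>This term carries no factor of \<xi>; the assumption |\<xi>| \<ge> 1 puts
          it on the same scale as the other two.\<close>
        have "\<bar>?F c (i # j # js) \<theta>\<bar> \<le> norm \<xi> * (C (i # j # js) * E)"
          using F[OF that, of "i # j # js" \<theta>] mult_right_mono[OF h(4), of "C (i # j # js) * E"] C E0 by simp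
        moreover have "\<bar>\<xi> $ i * ?F c (j # js) (\<theta> + pi/2)\<bar> \<le> norm \<xi> * (C (j # js) * E)"
          unfolding abs_mult by (intro mult_mono F that component_le_norm_cart) auto
        moreover have "\<bar>\<xi> $ j * ?F c (i # js) (\<theta> + pi/2)\<bar> \<le> norm \<xi> * (C (i # js) * E)"
          unfolding abs_mult by (intro mult_mono F that component_le_norm_cart) auto
        ultimately have "\<bar>?F c (i # j # js) \<theta> + \<xi> $ i * ?F c (j # js) (\<theta> + pi/2) + \<xi> $ j * ?F c (i # js) (\<theta> + pi/2)\<bar>
           \<le> (C (i # j # js) + C (j # js) + C (i # js)) * (norm \<xi> * E)"
          by (simp add: algebra_simps)
        moreover have "\<bar>a d c i j\<bar> \<le> L" using h(1) \<open>d \<in> I\<close> that unfolding elliptic_def by blast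
        then have "\<bar>a d c i j\<bar> \<le> \<bar>L\<bar>" by simp
        ultimately show ?thesis unfolding abs_mult[of "a d c i j"] by (intro mult_mono) auto
      qed
      have "\<bar>T d\<bar> \<le> (\<Sum>c\<in>I. \<Sum>i\<in>UNIV. \<Sum>j\<in>UNIV. \<bar>L\<bar> * ((C (i # j # js) + C (j # js) + C (i # js)) * (norm \<xi> * E)))"
        unfolding T_def
        by (intro order_trans[OF sum_abs] sum_mono A)
      also have "\<dots> = real (card I) * (\<bar>L\<bar> * S * (norm \<xi> * E))"
        by (simp add: S_def sum_distrib_left sum_distrib_right mult.assoc)
      finally show ?thesis .
    qed
    have "l * (norm \<xi>)\<^sup>2 * \<bar>?F c0 js \<theta>\<bar> \<le> l * (norm \<xi>)\<^sup>2 * (\<Sum>c\<in>I. \<bar>?F c js \<theta>\<bar>)"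
      using h(5,6) l by (intro mult_left_mono member_le_sum) auto
    also have "\<dots> \<le> (\<Sum>d\<in>I. \<bar>\<Sum>c\<in>I. (\<Sum>i\<in>UNIV. \<Sum>j\<in>UNIV. a d c i j * (\<xi> $ i * \<xi> $ j)) * ?F c js \<theta>\<bar>)"
      using conjunct2[OF h(1)[unfolded elliptic_def], rule_format, of \<xi> "\<lambda>c. ?F c js \<theta>"] .
    also have "\<dots> = (\<Sum>d\<in>I. \<bar>T d\<bar>)"
      using fcoef_identity[OF h(2) _ \<psi>] by (simp add: T_def)
    also have "\<dots> \<le> (\<Sum>d\<in>I. real (card I) * (\<bar>L\<bar> * S * (norm \<xi> * E)))"
      by (rule sum_mono) (rule T)
    also have "\<dots> = l * norm \<xi> * (D * E)" using l by (simp add: D_def)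
    finally have "(l * norm \<xi>) * (norm \<xi> * \<bar>?F c0 js \<theta>\<bar>) \<le> (l * norm \<xi>) * (D * E)"
      by (simp add: power2_eq_square mult.assoc)
    moreover have "l * norm \<xi> > 0" using l h(4) by (intro mult_pos_pos) linarith+
    ultimately have "norm \<xi> * \<bar>?F c0 js \<theta>\<bar> \<le> D * E" using mult_le_cancel_left_pos by blast
    moreover have "norm \<xi> > 0" using h(4) by linarith
    ultimately have "\<bar>?F c0 js \<theta>\<bar> \<le> D * E / norm \<xi>" by (simp add: pos_le_divide_eq mult.commute)
    then show ?thesis by (simp add: E_def N_def mult.commute)
  qed
  then show ?case using D0 by (intro exI[of _ D]) auto
qed

section \<open>Fourier series on the cube\<close>

text \<open>The summable majorant gives uniform convergence of all partial derivatives. Termwise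
  differentiation needs the differentials to converge uniformly as linear maps, which follows by
  allowing each of the finitely many components an equal share of e.\<close>

lemma series_C1:
  fixes f :: "nat \<Rightarrow> real^'n::finite \<Rightarrow> real"
  assumes d: "\<And>n x. f n differentiable at x" and c: "\<And>n i. continuous_on UNIV (pd i (f n))"
    and b: "\<And>n x. \<bar>f n x\<bar> \<le> b n" "\<And>n i x. \<bar>pd i (f n) x\<bar> \<le> b n" and s: "summable b"
  defines "w \<equiv> \<lambda>x. \<Sum>n. f n x"
  shows "w differentiable at x" "continuous_on UNIV (pd i w)" "\<bar>w x\<bar> \<le> suminf b" "\<bar>pd i w x\<bar> \<le> suminf b"
    "continuous_on UNIV w"
proof -
  have sf: "summable (\<lambda>n. \<bar>f n x\<bar>)" "summable (\<lambda>n. f n x)" for x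
    using b(1) s by (auto intro: summable_comparison_test'[of b 0] simp: summable_rabs_cancel)
  have sp: "summable (\<lambda>n. \<bar>pd i (f n) x\<bar>)" "summable (\<lambda>n. pd i (f n) x)" for x i
    using b(2) s by (auto intro: summable_comparison_test'[of b 0] simp: summable_rabs_cancel)
  define g where "g i x = (\<Sum>n. pd i (f n) x)" for i x
  have ul: "uniform_limit UNIV (\<lambda>n x. \<Sum>m<n. pd i (f m) x) (g i) sequentially" for i
    unfolding g_def by (rule Weierstrass_m_test[OF _ s]) (use b(2) in simp)
  have bound: "\<bar>\<Sum>n. h n\<bar> \<le> suminf b" if "\<And>n. \<bar>h n\<bar> \<le> b n" for h :: "nat \<Rightarrow> real"
  proof -
    have "summable (\<lambda>n. \<bar>h n\<bar>)"
      using that by (intro summable_comparison_test'[OF s, of 0]) simp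
    then show ?thesis
      using summable_rabs[of h] suminf_le[OF that _ s] by linarith
  qed
  have "\<exists>G. \<forall>x\<in>UNIV. (\<lambda>n. f n x) sums (G x) \<and> (G has_derivative (\<lambda>h. \<Sum>i\<in>UNIV. h $ i * g i x)) (at x within UNIV)"
  proof (rule has_derivative_series[where f' = "\<lambda>n x h. \<Sum>i\<in>UNIV. h $ i * pd i (f n) x"])
    show "(f n has_derivative (\<lambda>h. \<Sum>i\<in>UNIV. h $ i * pd i (f n) x)) (at x within UNIV)" for n x
      using has_derivative_pd[OF d] by simp
    fix e :: real assume e: "e > 0"
    define e' where "e' = e / real CARD('n)"
    have e': "e' > 0" using e by (simp add: e'_def)
    have "\<forall>\<^sub>F n in sequentially. \<forall>i\<in>UNIV. \<forall>x\<in>UNIV. dist (\<Sum>m<n. pd i (f m) x) (g i x) < e'"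
      using ul e' by (intro eventually_ball_finite) (auto simp: uniform_limit_iff)
    then show "\<forall>\<^sub>F n in sequentially. \<forall>x\<in>UNIV. \<forall>h.
       norm ((\<Sum>m<n. \<Sum>i\<in>UNIV. h $ i * pd i (f m) x) - (\<Sum>i\<in>UNIV. h $ i * g i x)) \<le> e * norm h"
    proof (rule eventually_mono, intro ballI allI)
      fix n x and h :: "real^'n"
      assume D: "\<forall>i\<in>UNIV. \<forall>x\<in>UNIV. dist (\<Sum>m<n. pd i (f m) x) (g i x) < e'"
      have "(\<Sum>m<n. \<Sum>i\<in>UNIV. h $ i * pd i (f m) x) = (\<Sum>i\<in>UNIV. h $ i * (\<Sum>m<n. pd i (f m) x))"
        by (subst sum.swap) (simp add: sum_distrib_left)
      then have "(\<Sum>m<n. \<Sum>i\<in>UNIV. h $ i * pd i (f m) x) - (\<Sum>i\<in>UNIV. h $ i * g i x)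
         = (\<Sum>i\<in>UNIV. h $ i * ((\<Sum>m<n. pd i (f m) x) - g i x))"
        by (simp add: sum_subtractf right_diff_distrib)
      also have "norm \<dots> \<le> (\<Sum>i\<in>(UNIV::'n set). norm h * e')"
      proof (rule order_trans[OF norm_sum], rule sum_mono)
        fix i :: 'n
        have "\<bar>(\<Sum>m<n. pd i (f m) x) - g i x\<bar> \<le> e'" using D by (auto simp: dist_real_def less_imp_le)
        then show "norm (h $ i * ((\<Sum>m<n. pd i (f m) x) - g i x)) \<le> norm h * e'"
          using mult_mono[OF component_le_norm_cart[of h i]] by (simp add: abs_mult)
      qed
      also have "\<dots> = e * norm h" by (simp add: e'_def)
      finally show "norm ((\<Sum>m<n. \<Sum>i\<in>UNIV. h $ i * pd i (f m) x) - (\<Sum>i\<in>UNIV. h $ i * g i x)) \<le> e * norm h" .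
    qed
  qed (use summable_sums[OF sf(2)] in auto)
  then obtain G where G: "\<And>x. (\<lambda>n. f n x) sums (G x)"
    "\<And>x. (G has_derivative (\<lambda>h. \<Sum>i\<in>UNIV. h $ i * g i x)) (at x)" by auto
  have "G = w" unfolding w_def using sums_unique[OF G(1)] by auto
  with G(2) have Dw: "(w has_derivative (\<lambda>h. \<Sum>i\<in>UNIV. h $ i * g i x)) (at x)" for x by simp
  show dw: "w differentiable at x" for x using Dw differentiable_def by blast
  have pw: "pd i w = g i" for i
    using pd_eqI[OF Dw] by (simp add: fun_eq_iff axis_def if_distrib if_distribR cong: if_cong)
  show "continuous_on UNIV (pd i w)"
    unfolding pw by (rule uniform_limit_theorem[OF always_eventually ul]) (auto intro!: continuous_on_sum c)
  show "\<bar>w x\<bar> \<le> suminf b" unfolding w_def using b(1) by (rule bound)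
  show "\<bar>pd i w x\<bar> \<le> suminf b" unfolding pw g_def using b(2) by (rule bound)
  show "continuous_on UNIV w"
    using dw by (simp add: continuous_at_imp_continuous_on differentiable_imp_continuous_within)
qed

section \<open>Summation over the integer lattice\<close>

lemma abs_summable_inverse_int:
  "Infinite_Set_Sum.abs_summable_on (\<lambda>k::int. 1 / (1 + \<bar>real_of_int k\<bar>)\<^sup>2) UNIV"
proof -
  let ?f = "\<lambda>k::int. 1 / (1 + \<bar>real_of_int k\<bar>)\<^sup>2"
  have "summable (\<lambda>n::nat. 1 / (1 + real n)\<^sup>2)"
    using summable_Suc_iff[of "\<lambda>n. inverse (real n ^ 2)"] inverse_power_summable[of 2, where 'a = real]
    by (simp add: inverse_eq_divide)
  then have "Infinite_Set_Sum.abs_summable_on (\<lambda>n::nat. 1 / (1 + real n)\<^sup>2) UNIV"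
    by (simp add: abs_summable_on_nat_iff')
  then have "Infinite_Set_Sum.abs_summable_on ?f (range int)" "Infinite_Set_Sum.abs_summable_on ?f (range (\<lambda>n. - int n))"
    by (intro abs_summable_on_reindex; simp)+
  then have "Infinite_Set_Sum.abs_summable_on ?f (range int \<union> range (\<lambda>n. - int n))"
    by (rule abs_summable_on_union)
  moreover have "range int \<union> range (\<lambda>n. - int n) = UNIV"
  proof -
    have "k = int (nat k) \<or> k = - int (nat (- k))" for k by linarith
    then show ?thesis by blast
  qed
  ultimately show ?thesis by simp
qed

definition lat :: "('n::finite \<Rightarrow> int) \<Rightarrow> real^'n" where
  "lat k = (\<chi> i. real_of_int (k i))"

text \<open>A product of summable one-dimensional weights is summable over the lattice. It is at
  least (1 + |k|)^(-2n), where n is the dimension, so decay of order 2n is decay against a summable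
  weight.\<close>

definition lat_weight :: "('n::finite \<Rightarrow> int) \<Rightarrow> real" where
  "lat_weight k = (\<Prod>i\<in>UNIV. 1 / (1 + \<bar>real_of_int (k i)\<bar>)\<^sup>2)"

text \<open>Enumerating the lattice by natural numbers makes \<open>suminf\<close> and termwise
  differentiation of series applicable.\<close>

lemma lat_enum:
  obtains e :: "nat \<Rightarrow> 'n::finite \<Rightarrow> int" where "bij e" "summable (\<lambda>m. lat_weight (e m))"
proof -
  have "infinite (UNIV :: ('n \<Rightarrow> int) set)"
    using infinite_UNIV_int finite_fun_UNIVD2[where 'a = 'n and 'b = int] by blast
  then obtain e :: "nat \<Rightarrow> 'n \<Rightarrow> int" where e: "bij e"
    using bij_betw_from_nat_into[of "UNIV :: ('n \<Rightarrow> int) set"] by auto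
  have "Infinite_Set_Sum.abs_summable_on (\<lambda>k::'n \<Rightarrow> int. \<Prod>i\<in>UNIV. 1 / (1 + \<bar>real_of_int (k i)\<bar>)\<^sup>2) (PiE UNIV (\<lambda>_. UNIV))"
    by (rule abs_summable_on_prod_PiE) (auto intro: abs_summable_inverse_int)
  then have "Infinite_Set_Sum.abs_summable_on lat_weight (UNIV :: ('n \<Rightarrow> int) set)"
    by (simp add: lat_weight_def[abs_def] PiE_UNIV_domain)
  then have "Infinite_Set_Sum.abs_summable_on (\<lambda>m. lat_weight (e m)) UNIV"
    using abs_summable_on_reindex_bij_betw[OF e, of lat_weight] by simp
  then have "summable (\<lambda>m. \<bar>lat_weight (e m)\<bar>)" by (simp add: abs_summable_on_nat_iff')
  then have "summable (\<lambda>m. lat_weight (e m))" by (rule summable_rabs_cancel)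
  with e show ?thesis using that by blast
qed

lemma lat_weight_lower:
  fixes k :: "'n::finite \<Rightarrow> int"
  shows "1 \<le> (1 + norm (lat k)) ^ (2 * CARD('n)) * lat_weight k" "lat_weight k > 0"
proof -
  have "(\<Prod>i\<in>(UNIV::'n set). (1 + \<bar>real_of_int (k i)\<bar>)\<^sup>2) \<le> (\<Prod>i\<in>(UNIV::'n set). (1 + norm (lat k))\<^sup>2)"
  proof (rule prod_mono)
    fix i
    have "\<bar>real_of_int (k i)\<bar> \<le> norm (lat k)"
      using component_le_norm_cart[of "lat k" i] by (simp add: lat_def)
    then show "0 \<le> (1 + \<bar>real_of_int (k i)\<bar>)\<^sup>2 \<and> (1 + \<bar>real_of_int (k i)\<bar>)\<^sup>2 \<le> (1 + norm (lat k))\<^sup>2"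
      by (simp add: power_mono)
  qed
  also have "\<dots> = (1 + norm (lat k)) ^ (2 * CARD('n))" by (simp add: power_mult)
  finally have 1: "(\<Prod>i\<in>(UNIV::'n set). (1 + \<bar>real_of_int (k i)\<bar>)\<^sup>2) \<le> (1 + norm (lat k)) ^ (2 * CARD('n))" .
  have w: "lat_weight k = 1 / (\<Prod>i\<in>(UNIV::'n set). (1 + \<bar>real_of_int (k i)\<bar>)\<^sup>2)"
    by (simp add: lat_weight_def prod_dividef)
  have pos: "(\<Prod>i\<in>(UNIV::'n set). (1 + \<bar>real_of_int (k i)\<bar>)\<^sup>2) > 0"
    by (intro prod_pos) (auto simp: add_pos_nonneg zero_less_power)
  show "1 \<le> (1 + norm (lat k)) ^ (2 * CARD('n)) * lat_weight k" "lat_weight k > 0"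
    using 1 pos by (simp_all add: w field_simps)
qed

lemma norm_lat_ge_1: "k \<noteq> (\<lambda>_. 0) \<Longrightarrow> norm (lat k) \<ge> 1"
proof -
  assume "k \<noteq> (\<lambda>_. 0)"
  then obtain i where "k i \<noteq> 0" by auto
  then have "1 \<le> \<bar>real_of_int (k i)\<bar>" by linarith
  also have "\<dots> \<le> norm (lat k)" using component_le_norm_cart[of "lat k" i] by (simp add: lat_def)
  finally show ?thesis .
qed

section \<open>Orthogonality of waves on the period cube\<close>

definition cube :: "(real^'n::finite) set" where
  "cube = cbox (\<chi> i. - pi) (\<chi> i. pi)"

lemma cube_iff: "x \<in> cube \<longleftrightarrow> (\<forall>i. \<bar>x $ i\<bar> \<le> pi)"
  by (auto simp: cube_def mem_box_cart abs_le_iff minus_le_iff)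

text \<open>In coordinates \<open>lborel\<close> is a product measure, so the integral of a product
  of functions of single coordinates factorises.\<close>

lemma integral_lborel_prod:
  fixes f :: "'a::euclidean_space \<Rightarrow> real \<Rightarrow> complex"
  assumes "\<And>b. b \<in> Basis \<Longrightarrow> integrable lborel (f b)"
  shows "(\<integral>x. (\<Prod>b\<in>Basis. f b (x \<bullet> b)) \<partial>lborel) = (\<Prod>b\<in>Basis. \<integral>t. f b t \<partial>lborel)"
proof -
  interpret product_sigma_finite "\<lambda>_::'a. lborel :: real measure" ..
  have m: "(\<lambda>x::'a. \<Prod>b\<in>Basis. f b (x \<bullet> b)) \<in> borel_measurable borel"
  proof (rule borel_measurable_prod)
    fix b :: 'a assume "b \<in> Basis"
    then have fb: "f b \<in> borel_measurable borel"
      using borel_measurable_integrable[OF assms] by simp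
    have "(\<lambda>x::'a. x \<bullet> b) \<in> borel_measurable borel" by simp
    from measurable_compose[OF this fb] show "(\<lambda>x. f b (x \<bullet> b)) \<in> borel_measurable borel" .
  qed
  have "(\<integral>x. (\<Prod>b\<in>Basis. f b (x \<bullet> b)) \<partial>lborel)
      = (\<integral>y. (\<Prod>b\<in>Basis. f b ((\<Sum>b\<in>Basis. y b *\<^sub>R b) \<bullet> b)) \<partial>(\<Pi>\<^sub>M b\<in>Basis. lborel))"
    by (subst lborel_eq, subst integral_distr[OF _ m]) simp_all
  also have "\<dots> = (\<integral>y. (\<Prod>b\<in>Basis. f b (y b)) \<partial>(\<Pi>\<^sub>M b\<in>Basis. lborel))"
    by (simp add: inner_sum_left inner_Basis if_distrib cong: if_cong prod.cong)
  also have "\<dots> = (\<Prod>b\<in>Basis. \<integral>t. f b t \<partial>lborel)"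
    by (rule product_integral_prod) (use assms in auto)
  finally show ?thesis .
qed

lemma integral_cis_period:
  fixes k :: int
  shows "integrable lborel (\<lambda>t. indicator {-pi..pi} t *\<^sub>R cis (real_of_int k * t))"
    and "(\<integral>t. indicator {-pi..pi} t *\<^sub>R cis (real_of_int k * t) \<partial>lborel) = (if k = 0 then 2 * pi else 0)"
proof -
  have c: "continuous_on {-pi..pi} (\<lambda>t. cis (real_of_int k * t))" by (intro continuous_intros)
  show "integrable lborel (\<lambda>t. indicator {-pi..pi} t *\<^sub>R cis (real_of_int k * t))"
    using borel_integrable_compact[OF _ c] by simp
  show "(\<integral>t. indicator {-pi..pi} t *\<^sub>R cis (real_of_int k * t) \<partial>lborel) = (if k = 0 then 2 * pi else 0)"
  proof (cases "k = 0")
    case False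
    let ?F = "\<lambda>t. (1 / (\<i> * of_int k)) * cis (real_of_int k * t)"
    have "(\<integral>t. indicator {-pi..pi} t *\<^sub>R cis (real_of_int k * t) \<partial>lborel) = ?F pi - ?F (-pi)"
    proof (rule integral_FTC_Icc[OF _ _ c])
      fix t :: real
      have "((\<lambda>z. 1 / (\<i> * of_int k) * exp (\<i> * of_int k * z)) has_field_derivative
          exp (\<i> * of_int k * of_real t)) (at (of_real t))"
        using False by (auto intro!: derivative_eq_intros)
      from has_vector_derivative_real_field[OF this]
      show "(?F has_vector_derivative cis (real_of_int k * t)) (at t within {- pi..pi})"
        by (simp add: cis_conv_exp mult.assoc)
    qed simp
    also have "\<dots> = 0"
    proof -
      have "sin (real_of_int k * pi) = 0" by (auto simp: sin_zero_iff_int2)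
      then have "cis (real_of_int k * pi) = cis (real_of_int k * (- pi))"
        by (simp add: complex_eq_iff)
      then show ?thesis by simp
    qed
    finally show ?thesis using False by simp
  qed (simp add: scaleR_conv_of_real)
qed

lemma integral_cis_cube:
  fixes k :: "'n::finite \<Rightarrow> int"
  shows "(\<integral>x. indicator cube x *\<^sub>R cis (lat k \<bullet> x) \<partial>lborel) = (if k = (\<lambda>_. 0) then (2 * pi) ^ CARD('n) else 0)"
proof -
  \<comment> \<open>The product formula is indexed by basis vectors, so the frequencies are
    reindexed accordingly. The floor loses nothing, because the inner product of
    \<open>lat k\<close> with a basis vector is an integer.\<close>
  define kk where "kk b = \<lfloor>lat k \<bullet> b\<rfloor>" for b :: "real^'n"
  have kk: "real_of_int (kk b) = lat k \<bullet> b" if "b \<in> Basis" for b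
    using that by (auto simp: Basis_vec_def kk_def inner_axis lat_def)
  let ?f = "\<lambda>b t. indicator {-pi..pi} t *\<^sub>R cis (real_of_int (kk b) * t)"
  have "indicator cube x *\<^sub>R cis (lat k \<bullet> x) = (\<Prod>b\<in>Basis. ?f b (x \<bullet> b))" for x :: "real^'n"
  proof (cases "x \<in> cube")
    case True
    then have "indicator {-pi..pi} (x \<bullet> b) = (1::real)" if "b \<in> Basis" for b
      using that by (auto simp: Basis_vec_def inner_axis cube_iff abs_le_iff minus_le_iff)
    then have "(\<Prod>b\<in>Basis. ?f b (x \<bullet> b)) = (\<Prod>b\<in>Basis. exp (\<i> * of_real ((lat k \<bullet> b) * (x \<bullet> b))))"
      by (simp add: kk cis_conv_exp)
    also have "\<dots> = exp (\<Sum>b\<in>Basis. \<i> * of_real ((lat k \<bullet> b) * (x \<bullet> b)))" by (simp add: exp_sum)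
    also have "(\<Sum>b\<in>Basis. \<i> * of_real ((lat k \<bullet> b) * (x \<bullet> b))) = \<i> * of_real (lat k \<bullet> x)"
      by (simp add: euclidean_inner[of "lat k" x] sum_distrib_left)
    finally show ?thesis using True by (simp add: cis_conv_exp)
  next
    case False
    then obtain i where "\<not> \<bar>x $ i\<bar> \<le> pi" by (auto simp: cube_iff)
    then have "?f (axis i 1) (x \<bullet> axis i 1) = 0" by (auto simp: inner_axis indicator_def)
    moreover have "axis i 1 \<in> (Basis :: (real^'n) set)" by (simp add: axis_in_Basis_iff)
    ultimately have "(\<Prod>b\<in>Basis. ?f b (x \<bullet> b)) = 0" by (metis (no_types, lifting) finite_Basis prod_zero_iff)
    then show ?thesis using False by simp
  qed
  then have "(\<integral>x. indicator cube x *\<^sub>R cis (lat k \<bullet> x) \<partial>lborel) = (\<Prod>b\<in>(Basis::(real^'n) set). \<integral>t. ?f b t \<partial>lborel)"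
    by (simp add: integral_lborel_prod[OF integral_cis_period(1)])
  also have "\<dots> = (\<Prod>b\<in>(Basis::(real^'n) set). if kk b = 0 then 2 * pi else 0)"
    by (simp add: integral_cis_period(2))
  also have "\<dots> = (if k = (\<lambda>_. 0) then (2 * pi) ^ CARD('n) else 0)"
  proof (cases "k = (\<lambda>_. 0)")
    case True
    then have "kk b = 0" for b by (simp add: kk_def lat_def vec_eq_iff inner_vec_def)
    then show ?thesis using True by simp
  next
    case False
    then obtain i where "k i \<noteq> 0" by auto
    then have "kk (axis i 1) \<noteq> 0" by (simp add: kk_def lat_def inner_axis)
    moreover have "axis i 1 \<in> (Basis :: (real^'n) set)" by (simp add: axis_in_Basis_iff)
    ultimately show ?thesis using False by (auto intro!: bexI[of _ "axis i 1"])
  qed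
  finally show ?thesis .
qed

lemma compact_cube: "compact cube" by (simp add: cube_def)

lemma set_integral_continuous_compact:
  fixes f :: "real^'n::finite \<Rightarrow> real"
  assumes "compact K" "continuous_on K f"
  shows "set_integrable lebesgue K f" "(LINT x:K|lebesgue. f x) = (\<integral>x. indicator K x *\<^sub>R f x \<partial>lborel)"
proof -
  have I: "integrable lborel (\<lambda>x. indicator K x *\<^sub>R f x)" by (rule borel_integrable_compact[OF assms])
  then have "(\<lambda>x. indicator K x *\<^sub>R f x) \<in> borel_measurable lborel" by blast
  then show "set_integrable lebesgue K f" "(LINT x:K|lebesgue. f x) = (\<integral>x. indicator K x *\<^sub>R f x \<partial>lborel)"
    using I unfolding set_integrable_def set_lebesgue_integral_def by (simp_all add: integrable_completion integral_completion)
qed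

lemma integral_wave_cube:
  fixes k :: "'n::finite \<Rightarrow> int"
  shows "(LINT x:cube|lebesgue. wave (lat k) \<theta> x) = (if k = (\<lambda>_. 0) then (2 * pi) ^ CARD('n) * cos \<theta> else 0)"
proof -
  have I: "integrable lborel (\<lambda>x. indicator cube x *\<^sub>R cis (lat k \<bullet> x))"
    by (intro borel_integrable_compact compact_cube continuous_intros)
  have "(LINT x:cube|lebesgue. wave (lat k) \<theta> x) = (\<integral>x. indicator cube x *\<^sub>R wave (lat k) \<theta> x \<partial>lborel)"
    by (intro set_integral_continuous_compact(2) compact_cube smooth_continuous smooth_wave)
  also have "\<dots> = (\<integral>x. Re (cis \<theta> * (indicator cube x *\<^sub>R cis (lat k \<bullet> x))) \<partial>lborel)"
    by (intro Bochner_Integration.integral_cong refl) (simp add: wave_def cos_add algebra_simps)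
  also have "\<dots> = Re (cis \<theta> * (\<integral>x. indicator cube x *\<^sub>R cis (lat k \<bullet> x) \<partial>lborel))"
    using integral_Re[OF integrable_mult_right[OF I, of "cis \<theta>"]] Bochner_Integration.integral_mult_right[where M = lborel and c = "cis \<theta>", OF I]
    by (simp only:)
  also have "\<dots> = (if k = (\<lambda>_. 0) then (2 * pi) ^ CARD('n) * cos \<theta> else 0)"
  proof -
    have "(2 * complex_of_real pi) ^ CARD('n) = complex_of_real ((2 * pi) ^ CARD('n))" by simp
    then show ?thesis unfolding integral_cis_cube by (simp only: split: if_split) simp
  qed
  finally show ?thesis .
qed

lemma wave_mult:
  "wave (lat k) s x * wave (lat h) \<theta> x
    = (wave (lat (\<lambda>i. k i + h i)) (s + \<theta>) x + wave (lat (\<lambda>i. k i - h i)) (s - \<theta>) x) / 2"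
proof -
  have "lat (\<lambda>i. k i + h i) = lat k + lat h" "lat (\<lambda>i. k i - h i) = lat k - lat h"
    by (simp_all add: lat_def vec_eq_iff)
  moreover have "(lat k + lat h) \<bullet> x + (s + \<theta>) = (lat k \<bullet> x + s) + (lat h \<bullet> x + \<theta>)"
    "(lat k - lat h) \<bullet> x + (s - \<theta>) = (lat k \<bullet> x + s) - (lat h \<bullet> x + \<theta>)"
    by (simp_all add: inner_add_left inner_diff_left)
  ultimately show ?thesis
    unfolding wave_def by (simp only: cos_times_cos) (simp only: add.commute)
qed

text \<open>Frequencies k and - k span the same waves, hence two coincidence terms; for frequency 0
  both are present.\<close>

lemma wave_orthogonal:
  fixes k h :: "'n::finite \<Rightarrow> int"
  shows "(LINT x:cube|lebesgue. wave (lat k) s x * wave (lat h) \<theta> x) =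
     (2 * pi) ^ CARD('n) / 2 * ((if k = h then cos (s - \<theta>) else 0) + (if k = (\<lambda>i. - h i) then cos (s + \<theta>) else 0))"
proof -
  have I: "set_integrable lebesgue cube (wave (lat k) s)" for k :: "'n \<Rightarrow> int" and s
    by (intro set_integral_continuous_compact(1) compact_cube smooth_continuous smooth_wave)
  have e: "(\<lambda>i. k i + h i) = (\<lambda>_. 0) \<longleftrightarrow> k = (\<lambda>i. - h i)" "(\<lambda>i. k i - h i) = (\<lambda>_. 0) \<longleftrightarrow> k = h"
    by (auto simp: fun_eq_iff eq_neg_iff_add_eq_0)
  show ?thesis
    unfolding wave_mult set_integral_divide_zero set_integral_add(2)[OF I I] integral_wave_cube e
    by (simp add: algebra_simps)
qed

section \<open>Completeness of the trigonometric system\<close>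

inductive trig_poly :: "(real^'n::finite \<Rightarrow> real) \<Rightarrow> bool" where
  wave: "trig_poly (\<lambda>x. c * wave (lat k) \<theta> x)"
| add: "trig_poly p \<Longrightarrow> trig_poly q \<Longrightarrow> trig_poly (\<lambda>x. p x + q x)"

lemma trig_poly_mult:
  assumes "trig_poly p" "trig_poly q"
  shows "trig_poly (\<lambda>x. p x * q x)"
  using assms
proof (induction p)
  case (wave c k \<theta>)
  from wave show ?case
  proof (induction q)
    case (wave d h s)
    have eq: "(\<lambda>x. c * wave (lat k) \<theta> x * (d * wave (lat h) s x))
      = (\<lambda>x. (c * d / 2) * wave (lat (\<lambda>i. k i + h i)) (\<theta> + s) x + (c * d / 2) * wave (lat (\<lambda>i. k i - h i)) (\<theta> - s) x)"
    proof
      fix x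
      have "c * wave (lat k) \<theta> x * (d * wave (lat h) s x) = c * d * (wave (lat k) \<theta> x * wave (lat h) s x)" by simp
      also have "\<dots> = (c * d / 2) * wave (lat (\<lambda>i. k i + h i)) (\<theta> + s) x + (c * d / 2) * wave (lat (\<lambda>i. k i - h i)) (\<theta> - s) x"
        unfolding wave_mult by (simp add: algebra_simps add_divide_distrib)
      finally show "c * wave (lat k) \<theta> x * (d * wave (lat h) s x) = \<dots>" .
    qed
    show ?case unfolding eq by (intro trig_poly.intros)
  next
    case (add p q)
    then show ?case using trig_poly.add by (simp add: distrib_left)
  qed
next
  case (add p q)
  then show ?case using trig_poly.add by (simp add: distrib_right)
qed

lemma trig_poly_const: "trig_poly (\<lambda>x. c)"
  using trig_poly.wave[of c "\<lambda>_. 0" 0] by (simp add: wave_def lat_def inner_vec_def)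

lemma trig_poly_sum: "finite S \<Longrightarrow> (\<And>i. i \<in> S \<Longrightarrow> trig_poly (f i)) \<Longrightarrow> trig_poly (\<lambda>x. \<Sum>i\<in>S. f i x)"
  by (induction S rule: finite_induct) (simp_all add: trig_poly_const trig_poly.add)

text \<open>Periodic functions become functions on a compact torus in complex space, where
  polynomial approximation is available and polynomials restrict to trigonometric
  polynomials.\<close>

definition torus_map :: "real^'n::finite \<Rightarrow> complex^'n" where
  "torus_map x = (\<chi> i. cis (x $ i))"

text \<open>A real linear functional of the points cis (x i) is a combination of cos (x i) and sin
  (x i) = cos (x i - pi/2), both of which are waves. Products are handled by the product-to-sum
  formula.\<close>

lemma trig_poly_real_polynomial:
  fixes p :: "complex^'n::finite \<Rightarrow> real"
  assumes "real_polynomial_function p"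
  shows "trig_poly (\<lambda>x. p (torus_map x))"
  using assms
proof induction
  case (linear f)
  then interpret f: bounded_linear f .
  have w: "wave (lat (\<lambda>j. if j = i then 1 else 0)) \<theta> x = cos (x $ i + \<theta>)" for x :: "real^'n" and i \<theta>
    by (simp add: wave_def lat_def inner_vec_def if_distrib if_distribR cong: if_cong)
  have "f (torus_map x) = (\<Sum>i\<in>UNIV. f (axis i 1) * wave (lat (\<lambda>j. if j = i then 1 else 0)) 0 x
      + f (axis i \<i>) * wave (lat (\<lambda>j. if j = i then 1 else 0)) (- pi/2) x)" for x :: "real^'n"
  proof -
    have "torus_map x = (\<Sum>i\<in>UNIV. cos (x $ i) *\<^sub>R axis i 1 + sin (x $ i) *\<^sub>R axis i \<i>)"
    proof (rule vec_eq_iff[THEN iffD2], rule allI)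
      fix i
      have "(\<Sum>j\<in>UNIV. cos (x $ j) *\<^sub>R axis j 1 + sin (x $ j) *\<^sub>R axis j \<i>) $ i
        = (\<Sum>j\<in>UNIV. if j = i then cos (x $ i) *\<^sub>R 1 + sin (x $ i) *\<^sub>R \<i> else 0)"
        by (subst sum_component, rule sum.cong) (auto simp: axis_def)
      then show "torus_map x $ i = (\<Sum>j\<in>UNIV. cos (x $ j) *\<^sub>R axis j 1 + sin (x $ j) *\<^sub>R axis j \<i>) $ i"
        by (simp add: torus_map_def complex_eq_iff)
    qed
    then have "f (torus_map x) = (\<Sum>i\<in>UNIV. cos (x $ i) * f (axis i 1) + sin (x $ i) * f (axis i \<i>))"
      by (simp add: f.sum f.add f.scaleR)
    then show ?thesis by (simp add: w mult.commute cos_diff)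
  qed
  then have "(\<lambda>x. f (torus_map x)) = (\<lambda>x. \<Sum>i\<in>UNIV. f (axis i 1) * wave (lat (\<lambda>j. if j = i then 1 else 0)) 0 x
      + f (axis i \<i>) * wave (lat (\<lambda>j. if j = i then 1 else 0)) (- pi/2) x)" by blast
  moreover have "trig_poly \<dots>" by (intro trig_poly_sum trig_poly.add trig_poly.wave) simp
  ultimately show ?case by simp
next
  case (const c) show ?case by (rule trig_poly_const)
next
  case (add f g) show ?case by (rule trig_poly.add[OF add.IH])
next
  case (mult f g) show ?case by (rule trig_poly_mult[OF mult.IH])
qed

text \<open>The angles differ by a nonzero multiple of 2 pi, which in [- pi, pi] is possible only
  for the two endpoints.\<close>

lemma cis_eq_cube:
  assumes "cis s = cis t" "\<bar>s\<bar> \<le> pi" "\<bar>t\<bar> \<le> pi" "s \<noteq> t"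
  shows "\<bar>s\<bar> = pi" "\<bar>t\<bar> = pi"
proof -
  have "sin s = sin t \<and> cos s = cos t" using assms(1) by (simp add: complex_eq_iff)
  then obtain n :: int where n: "s = t + 2 * pi * n" using sin_cos_eq_iff by blast
  have "n \<noteq> 0" using n assms(4) by auto
  then have "n \<ge> 1 \<or> n \<le> -1" by linarith
  then have "2 * pi * n \<ge> 2 * pi \<or> 2 * pi * n \<le> - (2 * pi)"
  proof
    assume "n \<ge> 1"
    then have "2 * pi * 1 \<le> 2 * pi * real_of_int n" by (intro mult_left_mono) auto
    then show ?thesis by simp
  next
    assume "n \<le> -1"
    then have "2 * pi * real_of_int n \<le> 2 * pi * (-1)" by (intro mult_left_mono) auto
    then show ?thesis by simp
  qed
  then show "\<bar>s\<bar> = pi" "\<bar>t\<bar> = pi" using n assms(2,3) by linarith+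
qed

text \<open>Distinct points of the cube with the same image on the torus both lie on faces, where
  \<phi> vanishes. So \<phi> descends to a continuous function on the torus, to which
  Stone-Weierstrass applies.\<close>

lemma trig_poly_approx:
  fixes \<phi> :: "real^'n::finite \<Rightarrow> real"
  assumes c: "continuous_on cube \<phi>" and b: "\<And>x i. x \<in> cube \<Longrightarrow> \<bar>x $ i\<bar> = pi \<Longrightarrow> \<phi> x = 0" and e: "e > 0"
  shows "\<exists>p. trig_poly p \<and> (\<forall>x\<in>cube. \<bar>\<phi> x - p x\<bar> < e)"
proof -
  have wd: "\<phi> x = \<phi> y" if "x \<in> cube" "y \<in> cube" "torus_map x = torus_map y" for x y
  proof (cases "x = y")
    case False
    then obtain i where i: "x $ i \<noteq> y $ i" by (auto simp: vec_eq_iff)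
    have "cis (x $ i) = cis (y $ i)" using that(3) by (simp add: torus_map_def vec_eq_iff)
    then have "\<bar>x $ i\<bar> = pi" "\<bar>y $ i\<bar> = pi" using cis_eq_cube that(1,2) i by (metis cube_iff)+
    then show ?thesis using b that by metis
  qed simp
  have ct: "continuous_on S torus_map" for S :: "(real^'n) set"
    unfolding torus_map_def by (intro continuous_intros)
  let ?T = "torus_map ` (cube :: (real^'n) set)"
  have cT: "compact ?T" by (intro compact_continuous_image ct compact_cube)
  define f where "f z = \<phi> (SOME x. x \<in> cube \<and> torus_map x = z)" for z
  have f: "f (torus_map x) = \<phi> x" if "x \<in> cube" for x
  proof -
    have "(SOME y. y \<in> cube \<and> torus_map y = torus_map x) \<in> cube \<and>
      torus_map (SOME y. y \<in> cube \<and> torus_map y = torus_map x) = torus_map x"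
      by (rule someI[of "\<lambda>y. y \<in> cube \<and> torus_map y = torus_map x" x]) (use that in simp)
    then show ?thesis unfolding f_def using wd that by blast
  qed
  \<comment> \<open>On the compact cube \<open>torus_map\<close> sends closed sets to closed sets,
    so closed preimages under \<phi> have closed images; these are the preimages under f.\<close>
  have "continuous_on ?T f"
    unfolding continuous_on_closed_vimage[OF compact_imp_closed[OF cT]]
  proof (intro allI impI)
    fix B :: "real set" assume "closed B"
    then have "closed (\<phi> -` B \<inter> cube)"
      using c continuous_on_closed_vimage[OF compact_imp_closed[OF compact_cube]] by blast
    then have "compact (\<phi> -` B \<inter> cube)" using compact_cube by (metis Int_commute closed_Int_compact inf.right_idem)
    then have "compact (torus_map ` (\<phi> -` B \<inter> cube))" by (intro compact_continuous_image ct)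
    moreover have "f -` B \<inter> ?T = torus_map ` (\<phi> -` B \<inter> cube)" using f by auto
    ultimately show "closed (f -` B \<inter> ?T)" by (simp add: compact_imp_closed)
  qed
  then obtain g where g: "real_polynomial_function g" "\<And>z. z \<in> ?T \<Longrightarrow> \<bar>f z - g z\<bar> < e"
    using Stone_Weierstrass_real_polynomial_function[OF cT _ e] by metis
  show ?thesis
  proof (intro exI[of _ "\<lambda>x. g (torus_map x)"] conjI ballI)
    fix x :: "real^'n" assume "x \<in> cube"
    then show "\<bar>\<phi> x - g (torus_map x)\<bar> < e" using g(2)[of "torus_map x"] f by simp
  qed (rule trig_poly_real_polynomial[OF g(1)])
qed

lemma set_integrable_mult_continuous:
  fixes f \<psi> :: "real^'n::finite \<Rightarrow> real"
  assumes f: "set_integrable lebesgue K f" and K: "compact K" and c: "continuous_on K \<psi>"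
  shows "set_integrable lebesgue K (\<lambda>x. f x * \<psi> x)"
    and "(\<And>x. x \<in> K \<Longrightarrow> \<bar>\<psi> x\<bar> \<le> M) \<Longrightarrow> \<bar>LINT x:K|lebesgue. f x * \<psi> x\<bar> \<le> M * (LINT x:K|lebesgue. \<bar>f x\<bar>)"
proof -
  have "set_integrable lebesgue K (\<lambda>x. \<psi> x * f x)"
  proof (rule absolutely_integrable_bounded_measurable_product[OF bilinear_times _ _ _ f])
    show "K \<in> sets lebesgue" using K(1) by (simp add: compact_imp_closed lmeasurable_compact fmeasurableD)
    then show "\<psi> \<in> borel_measurable (lebesgue_on K)"
      using continuous_imp_measurable_on_sets_lebesgue[OF c] by blast
    show "bounded (\<psi> ` K)" using c K(1) compact_continuous_image compact_imp_bounded by blast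
  qed
  then show I: "set_integrable lebesgue K (\<lambda>x. f x * \<psi> x)" by (simp add: mult.commute)
  assume M: "\<And>x. x \<in> K \<Longrightarrow> \<bar>\<psi> x\<bar> \<le> M"
  have "\<bar>LINT x:K|lebesgue. f x * \<psi> x\<bar> \<le> (LINT x:K|lebesgue. M * \<bar>f x\<bar>)"
    unfolding set_lebesgue_integral_def
  proof (rule integral_abs_bound_integral)
    show "integrable lebesgue (\<lambda>x. indicat_real K x *\<^sub>R (f x * \<psi> x))"
      using I unfolding set_integrable_def .
    show "integrable lebesgue (\<lambda>x. indicat_real K x *\<^sub>R (M * \<bar>f x\<bar>))"
      using set_integrable_abs[OF f] by (metis (no_types) set_integrable_def set_integrable_mult_right)
    show "\<bar>indicat_real K x *\<^sub>R (f x * \<psi> x)\<bar> \<le> indicat_real K x *\<^sub>R (M * \<bar>f x\<bar>)" for x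
      using M[of x] by (auto simp: indicator_def abs_mult mult.commute mult_right_mono)
  qed
  then show "\<bar>LINT x:K|lebesgue. f x * \<psi> x\<bar> \<le> M * (LINT x:K|lebesgue. \<bar>f x\<bar>)" by simp
qed

definition open_cube :: "(real^'n::finite) set" where
  "open_cube = box (\<chi> i. - pi) (\<chi> i. pi)"

lemma open_cube_iff: "x \<in> open_cube \<longleftrightarrow> (\<forall>i. \<bar>x $ i\<bar> < pi)"
  by (auto simp: open_cube_def mem_box_cart abs_less_iff minus_less_iff)

lemma open_cube_subset: "open_cube \<subseteq> cube"
  by (auto simp: open_cube_iff cube_iff less_imp_le)

text \<open>Orthogonality to the waves extends to trigonometric polynomials, which approximate every
  test function of the open cube uniformly. The pairing of g with the error is small in terms of the
  \<open>L^1\<close> norm of g, and the fundamental lemma concludes.\<close>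

lemma trig_complete:
  fixes g :: "real^'n::finite \<Rightarrow> real"
  assumes g: "set_integrable lebesgue cube g"
    and 0: "\<And>k \<theta>. (LINT x:cube|lebesgue. g x * wave (lat k) \<theta> x) = 0"
  shows "ae_eq open_cube g (\<lambda>x. 0)"
proof (rule fundamental_lemma)
  show "open (open_cube :: (real^'n) set)" by (simp add: open_cube_def open_box)
  show "loc_int open_cube g"
    unfolding loc_int_def
  proof (intro allI impI, elim conjE)
    fix K :: "(real^'n) set" assume "compact K" "K \<subseteq> open_cube"
    then show "set_integrable lebesgue K g"
      using open_cube_subset by (intro set_integrable_subset[OF g]) (auto simp: lmeasurable_compact fmeasurableD)
  qed
  fix \<phi> :: "real^'n \<Rightarrow> real" assume \<phi>: "test_fun open_cube \<phi>"
  note cont = smooth_continuous[OF test_fun_smooth[OF \<phi>]]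
  have off: "\<phi> x = 0" if "x \<notin> open_cube" for x
    using test_fun_support[OF \<phi>] that by blast
  have eq: "(LINT x:open_cube|lebesgue. g x * \<phi> x) = (LINT x:cube|lebesgue. g x * \<phi> x)"
    unfolding set_lebesgue_integral_def
    using off open_cube_subset by (intro Bochner_Integration.integral_cong) (auto simp: indicator_def)
  have T: "continuous_on S p \<and> (LINT x:cube|lebesgue. g x * p x) = 0" if "trig_poly p" for p and S :: "(real^'n) set"
    using that
  proof (induction p arbitrary: S)
    case (wave c k \<theta>)
    have "(LINT x:cube|lebesgue. g x * (c * wave (lat k) \<theta> x)) = (LINT x:cube|lebesgue. c * (g x * wave (lat k) \<theta> x))"
      by (simp add: mult_ac)
    then have "(LINT x:cube|lebesgue. g x * (c * wave (lat k) \<theta> x)) = 0" using 0[of k \<theta>] by simp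
    moreover have "continuous_on S (\<lambda>x. c * wave (lat k) \<theta> x)"
      by (intro smooth_continuous smooth_mult smooth_const smooth_wave)
    ultimately show ?case by blast
  next
    case (add p q)
    have I: "set_integrable lebesgue cube (\<lambda>x. g x * p x)" "set_integrable lebesgue cube (\<lambda>x. g x * q x)"
      using add.IH by (blast intro: set_integrable_mult_continuous[OF g compact_cube])+
    have "(LINT x:cube|lebesgue. g x * (p x + q x)) = 0"
      using add.IH set_integral_add(2)[OF I] by (simp add: distrib_left)
    then show ?case using add.IH by (blast intro: continuous_on_add)
  qed
  define G where "G = (LINT x:cube|lebesgue. \<bar>g x\<bar>)"
  have G0: "G \<ge> 0" unfolding G_def by (simp add: set_lebesgue_integral_def)
  have "\<bar>LINT x:cube|lebesgue. g x * \<phi> x\<bar> \<le> e * G" if e: "e > 0" for e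
  proof -
    obtain p where p: "trig_poly p" "\<And>x. x \<in> cube \<Longrightarrow> \<bar>\<phi> x - p x\<bar> < e"
      using trig_poly_approx[OF cont _ e] off open_cube_iff by (metis less_irrefl)
    have cp: "continuous_on cube p" using T[OF p(1)] by blast
    have "(LINT x:cube|lebesgue. g x * \<phi> x) = (LINT x:cube|lebesgue. g x * (\<phi> x - p x))"
      using set_integral_diff(2)[OF set_integrable_mult_continuous(1)[OF g compact_cube cont]
          set_integrable_mult_continuous(1)[OF g compact_cube cp]] T[OF p(1)]
      by (simp add: right_diff_distrib)
    also have "\<bar>\<dots>\<bar> \<le> e * G"
      unfolding G_def using p(2) by (intro set_integrable_mult_continuous(2)[OF g compact_cube] continuous_on_diff cont cp) (simp add: less_imp_le)
    finally show ?thesis .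
  qed
  then have "\<bar>LINT x:cube|lebesgue. g x * \<phi> x\<bar> \<le> 0 + e" if "e > 0" for e
  proof -
    \<comment> \<open>Dividing by G + 1 keeps the tolerance meaningful when G = 0.\<close>
    have "e / (G + 1) * G \<le> e" using G0 that by (simp add: field_simps)
    moreover have "e / (G + 1) > 0" using G0 that by simp
    ultimately show ?thesis
      using \<open>\<And>e. e > 0 \<Longrightarrow> \<bar>LINT x:cube|lebesgue. g x * \<phi> x\<bar> \<le> e * G\<close>[of "e / (G + 1)"] by linarith
  qed
  then have "\<bar>LINT x:cube|lebesgue. g x * \<phi> x\<bar> \<le> 0" by (rule field_le_epsilon)
  then show "(LINT x:open_cube|lebesgue. g x * \<phi> x) = 0" using eq by simp
qed

text \<open>The Fourier series of v converges with its gradient by the majorant; the factor 1 + |k|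
  in the hypothesis pays for the derivative. By orthogonality its sum w has the same coefficients as
  v, so completeness identifies them on the open cube.\<close>

lemma fourier_inversion:
  "\<exists>c0\<ge>0. \<forall>(v :: real^'n::finite \<Rightarrow> real) B. set_integrable lebesgue cube v \<and>
     (\<forall>k \<theta>. (1 + norm (lat k)) * \<bar>LINT x:cube|lebesgue. v x * wave (lat k) \<theta> x\<bar> \<le> B * lat_weight k) \<longrightarrow>
     (\<exists>w. (\<forall>x. w differentiable at x) \<and> (\<forall>i. continuous_on UNIV (pd i w)) \<and>
        (\<forall>x. \<bar>w x\<bar> \<le> c0 * B) \<and> (\<forall>i x. \<bar>pd i w x\<bar> \<le> c0 * B) \<and> ae_eq open_cube v w)"
proof -
  obtain e :: "nat \<Rightarrow> 'n \<Rightarrow> int" where e: "bij e" and sw: "summable (\<lambda>m. lat_weight (e m))"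
    using lat_enum by blast
  define P where "P = (2 * pi) ^ CARD('n)"
  have P1: "P \<ge> 1" unfolding P_def using pi_gt3 by (intro one_le_power) linarith
  \<comment> \<open>The factor 2 stands for the two waves per frequency, with phases 0 and - pi/2;
    the normalisation 1/P is at most 1 and is dropped.\<close>
  define c0 where "c0 = 2 * (\<Sum>m. lat_weight (e m))"
  have "0 \<le> (\<Sum>m. lat_weight (e m))"
    by (rule suminf_nonneg[OF sw]) (rule less_imp_le[OF lat_weight_lower(2)])
  then have "c0 \<ge> 0" by (simp add: c0_def)
  moreover have "\<exists>w. (\<forall>x. w differentiable at x) \<and> (\<forall>i. continuous_on UNIV (pd i w)) \<and>
        (\<forall>x. \<bar>w x\<bar> \<le> c0 * B) \<and> (\<forall>i x. \<bar>pd i w x\<bar> \<le> c0 * B) \<and> ae_eq open_cube v w"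
    if v: "set_integrable lebesgue cube v" and
      dec: "\<And>k \<theta>. (1 + norm (lat k)) * \<bar>LINT x:cube|lebesgue. v x * wave (lat k) \<theta> x\<bar> \<le> B * lat_weight k"
    for v :: "real^'n \<Rightarrow> real" and B
  proof -
    define F where "F k \<theta> = (LINT x:cube|lebesgue. v x * wave (lat k) \<theta> x)" for k \<theta>
    note cw = smooth_continuous[OF smooth_wave]
    note I = set_integrable_mult_continuous(1)[OF v compact_cube cw]
    have F1: "\<bar>F k \<theta>\<bar> \<le> B * lat_weight k" "norm (lat k) * \<bar>F k \<theta>\<bar> \<le> B * lat_weight k" for k \<theta>
    proof -
      have "1 * \<bar>F k \<theta>\<bar> \<le> (1 + norm (lat k)) * \<bar>F k \<theta>\<bar>" "norm (lat k) * \<bar>F k \<theta>\<bar> \<le> (1 + norm (lat k)) * \<bar>F k \<theta>\<bar>"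
        by (intro mult_right_mono; simp)+
      then show "\<bar>F k \<theta>\<bar> \<le> B * lat_weight k" "norm (lat k) * \<bar>F k \<theta>\<bar> \<le> B * lat_weight k"
        using dec[of k \<theta>] by (simp_all add: F_def)
    qed
    have F2: "F k \<theta> = cos \<theta> * F k 0 - sin \<theta> * F k (- pi/2)" for k \<theta>
    proof -
      have "v x * wave (lat k) \<theta> x = cos \<theta> * (v x * wave (lat k) 0 x) - sin \<theta> * (v x * wave (lat k) (- pi/2) x)" for x
        by (simp add: wave_def cos_add cos_diff algebra_simps)
      then show ?thesis
        unfolding F_def by (simp add: set_integral_diff(2)[OF set_integrable_mult_right[OF I] set_integrable_mult_right[OF I]])
    qed
    have F3: "F (\<lambda>i. - k i) \<theta> = cos \<theta> * F k 0 + sin \<theta> * F k (- pi/2)" for k \<theta>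
    proof -
      have "lat (\<lambda>i. - k i) = - lat k" by (simp add: lat_def vec_eq_iff)
      then have "wave (lat (\<lambda>i. - k i)) \<theta> x = wave (lat k) (- \<theta>) x" for x
        using cos_minus[of "- (lat k \<bullet> x) + \<theta>"] by (simp add: wave_def)
      then have "F (\<lambda>i. - k i) \<theta> = F k (- \<theta>)" by (simp add: F_def)
      then show ?thesis using F2[of k "- \<theta>"] by simp
    qed
    \<comment> \<open>The enumeration meets both k and - k, which contribute the same wave, so the
      normalisation is by P and not by P / 2. Each of them accounts for half of the
      coefficient.\<close>
    define f where "f m x = (F (e m) 0 * wave (lat (e m)) 0 x + F (e m) (- pi/2) * wave (lat (e m)) (- pi/2) x) / P" for m x
    define b where "b m = 2 * B * lat_weight (e m)" for m
    have sb: "summable b" unfolding b_def by (intro summable_mult sw)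
    have bsum: "suminf b = c0 * B" unfolding b_def c0_def by (subst suminf_mult[OF sw]) simp
    have div: "\<bar>s / P\<bar> \<le> t" if "\<bar>s\<bar> \<le> t" for s t
    proof -
      have "\<bar>s\<bar> / P \<le> \<bar>s\<bar> / 1" using P1 by (intro divide_left_mono) auto
      moreover have "\<bar>s / P\<bar> = \<bar>s\<bar> / P" using P1 by (simp add: abs_divide)
      ultimately show ?thesis using that by linarith
    qed
    have sf: "smooth (f m)" for m
    proof -
      have "smooth (\<lambda>x. (1 / P) * (F (e m) 0 * wave (lat (e m)) 0 x + F (e m) (- pi/2) * wave (lat (e m)) (- pi/2) x))"
        by (intro smooth_mult smooth_add smooth_const smooth_wave)
      then show ?thesis by (simp add: f_def[abs_def])
    qed
    have pdf: "pd i (f m) x = ((lat (e m) $ i * F (e m) 0) * wave (lat (e m)) (0 + pi/2) x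
         + (lat (e m) $ i * F (e m) (- pi/2)) * wave (lat (e m)) (- pi/2 + pi/2) x) / P" for i m x
    proof -
      have fm: "f m = (\<lambda>x. (F (e m) 0 / P) * wave (lat (e m)) 0 x + (F (e m) (- pi/2) / P) * wave (lat (e m)) (- pi/2) x)"
        by (simp add: f_def[abs_def] add_divide_distrib)
      have d: "wave (lat (e m)) \<theta> differentiable at x" for \<theta> by (rule smooth_differentiable[OF smooth_wave])
      show ?thesis
        unfolding fm
        by (subst pd_add, (intro smooth_differentiable smooth_mult smooth_const smooth_wave)+,
            simp only: pd_cmult[OF d] pd_wave, simp add: add_divide_distrib mult_ac)
    qed
    have combo: "\<bar>(s * wave \<xi> \<theta> x + t * wave \<xi> \<theta>' x) / P\<bar> \<le> b m"
      if "\<bar>s\<bar> \<le> B * lat_weight (e m)" "\<bar>t\<bar> \<le> B * lat_weight (e m)" for s t m x \<theta> \<theta>' and \<xi> :: "real^'n"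
    proof (rule div)
      have "\<bar>s * wave \<xi> \<theta> x\<bar> \<le> \<bar>s\<bar> * 1" "\<bar>t * wave \<xi> \<theta>' x\<bar> \<le> \<bar>t\<bar> * 1"
        unfolding abs_mult by (intro mult_left_mono abs_wave_le_1 abs_ge_zero)+
      then show "\<bar>s * wave \<xi> \<theta> x + t * wave \<xi> \<theta>' x\<bar> \<le> b m" using that unfolding b_def by linarith
    qed
    have fb: "\<bar>f m x\<bar> \<le> b m" for m x
      unfolding f_def by (intro combo F1)
    have comp: "\<bar>lat k $ i * F k \<theta>\<bar> \<le> B * lat_weight k" for k i \<theta>
      using order_trans[OF mult_right_mono[OF component_le_norm_cart[of "lat k" i] abs_ge_zero[of "F k \<theta>"]] F1(2)]
      by (simp add: abs_mult)
    have pb: "\<bar>pd i (f m) x\<bar> \<le> b m" for i m x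
      unfolding pdf by (intro combo comp)
    define w where "w x = (\<Sum>m. f m x)" for x
    note C1 = series_C1[of f b, OF smooth_differentiable[OF sf] smooth_continuous[OF smooth_pd[OF sf]] fb pb sb, folded w_def]
    have ww: "(LINT x:cube|lebesgue. w x * wave (lat h) \<theta> x) = F h \<theta>" for h \<theta>
    proof -
      let ?g = "\<lambda>m x. indicator cube x *\<^sub>R (f m x * wave (lat h) \<theta> x)"
      have gi: "set_integrable lebesgue cube (\<lambda>x. f m x * wave (lat h) \<theta> x)" for m
        by (intro set_integral_continuous_compact(1) compact_cube smooth_continuous smooth_mult sf smooth_wave)
      have gb: "\<bar>?g m x\<bar> \<le> b m * indicator cube x" for m x
        using mult_mono[OF fb[of m x] abs_wave_le_1[of "lat h" \<theta> x] order_trans[OF abs_ge_zero fb]]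
        by (auto simp: indicator_def abs_mult)
      have "(\<lambda>m. LINT x|lebesgue. ?g m x) sums (LINT x|lebesgue. (\<Sum>m. ?g m x))"
      proof (rule sums_integral)
        show "integrable lebesgue (?g m)" for m using gi unfolding set_integrable_def .
        show "AE x in lebesgue. summable (\<lambda>m. norm (?g m x))"
        proof (rule AE_I2)
          fix x :: "real^'n"
          show "summable (\<lambda>m. norm (?g m x))"
            using gb by (intro summable_comparison_test'[OF summable_mult2[OF sb, of "indicator cube x"], of 0]) simp
        qed
        show "summable (\<lambda>m. LINT x|lebesgue. norm (?g m x))"
        proof (rule summable_comparison_test'[OF summable_mult2[OF sb, of "measure lebesgue (cube :: (real^'n) set)"], of 0])
          fix m
          have mc: "(cube :: (real^'n) set) \<in> lmeasurable" using compact_cube by (rule lmeasurable_compact)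
          have "(LINT x|lebesgue. norm (?g m x)) \<le> (LINT (x::real^'n)|lebesgue. b m * indicator cube x)"
          proof (rule Bochner_Integration.integral_mono)
            show "integrable lebesgue (\<lambda>x. norm (?g m x))"
              using gi[of m] unfolding set_integrable_def by (rule integrable_norm)
            show "integrable lebesgue (\<lambda>x::real^'n. b m * indicator cube x)"
              using mc by (intro integrable_mult_right integrable_real_indicator) (auto simp: fmeasurable_def)
            show "norm (?g m x) \<le> b m * indicator cube x" for x using gb by simp
          qed
          also have "\<dots> = b m * measure lebesgue (cube :: (real^'n) set)" by simp
          finally show "norm (LINT x|lebesgue. norm (?g m x)) \<le> b m * measure lebesgue (cube :: (real^'n) set)" by simp
        qed
      qed
      moreover have "(\<Sum>m. ?g m x) = indicator cube x *\<^sub>R (w x * wave (lat h) \<theta> x)" for x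
      proof -
        have "summable (\<lambda>m. f m x)"
          using fb by (intro summable_comparison_test'[OF sb, of 0]) simp
        then show ?thesis
          unfolding w_def real_scaleR_def
          by (simp only: suminf_mult2 suminf_mult[OF summable_mult2])
      qed
      ultimately have S1: "(\<lambda>m. LINT x:cube|lebesgue. f m x * wave (lat h) \<theta> x) sums (LINT x:cube|lebesgue. w x * wave (lat h) \<theta> x)"
        unfolding set_lebesgue_integral_def by simp
      have coef: "(LINT x:cube|lebesgue. f m x * wave (lat h) \<theta> x)
        = ((if e m = h then F h \<theta> else 0) + (if e m = (\<lambda>i. - h i) then F h \<theta> else 0)) / 2" for m
      proof -
        have W: "set_integrable lebesgue cube (\<lambda>x. c * (wave (lat k) s x * wave (lat h) \<theta> x))" for c k s
          by (intro set_integral_continuous_compact(1) compact_cube smooth_continuous smooth_mult smooth_const smooth_wave)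
        have "(LINT x:cube|lebesgue. f m x * wave (lat h) \<theta> x)
          = (LINT x:cube|lebesgue. F (e m) 0 / P * (wave (lat (e m)) 0 x * wave (lat h) \<theta> x)
             + F (e m) (- pi/2) / P * (wave (lat (e m)) (- pi/2) x * wave (lat h) \<theta> x))"
          by (simp add: f_def add_divide_distrib distrib_right mult.assoc)
        also have "\<dots> = F (e m) 0 / P * (LINT x:cube|lebesgue. wave (lat (e m)) 0 x * wave (lat h) \<theta> x)
             + F (e m) (- pi/2) / P * (LINT x:cube|lebesgue. wave (lat (e m)) (- pi/2) x * wave (lat h) \<theta> x)"
          unfolding set_integral_add(2)[OF W W] set_integral_mult_right ..
        also have "\<dots> = (F (e m) 0 * ((if e m = h then cos \<theta> else 0) + (if e m = (\<lambda>i. - h i) then cos \<theta> else 0))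
            + F (e m) (- pi/2) * ((if e m = h then - sin \<theta> else 0) + (if e m = (\<lambda>i. - h i) then sin \<theta> else 0))) / 2"
        proof -
          have c: "cos (0 - \<theta>) = cos \<theta>" "cos (0 + \<theta>) = cos \<theta>" "cos (- pi/2 - \<theta>) = - sin \<theta>" "cos (- pi/2 + \<theta>) = sin \<theta>"
            by (simp_all add: cos_diff cos_add)
          have "a / P * (P / 2 * X) = a * X / 2" for a X using P1 by simp
          then show ?thesis
            unfolding wave_orthogonal P_def[symmetric] c by (simp only: add_divide_distrib)
        qed
        also have "\<dots> = ((if e m = h then F h \<theta> else 0) + (if e m = (\<lambda>i. - h i) then F h \<theta> else 0)) / 2"
          using F2[of h \<theta>] F3[of h 0] F3[of h "- pi/2"] by (auto simp: algebra_simps)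
        finally show ?thesis .
      qed
      have single: "(\<lambda>m. if e m = k then c else 0) sums c" for k and c :: real
      proof -
        have "(\<lambda>m. if m = inv e k then c else 0) sums c" using sums_single[of "inv e k" "\<lambda>_. c"] by simp
        moreover have "m = inv e k \<longleftrightarrow> e m = k" for m using e by (metis bij_inv_eq_iff)
        ultimately show ?thesis by simp
      qed
      have "(\<lambda>m. LINT x:cube|lebesgue. f m x * wave (lat h) \<theta> x) sums ((F h \<theta> + F h \<theta>) / 2)"
        unfolding coef by (intro sums_divide sums_add single)
      with S1 show ?thesis using sums_unique2 by fastforce
    qed
    have wi: "set_integrable lebesgue cube w"
      by (intro set_integral_continuous_compact(1) compact_cube continuous_on_subset[OF C1(5)]) auto
    have "ae_eq open_cube (\<lambda>x. v x - w x) (\<lambda>x. 0)"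
    proof (rule trig_complete)
      show "set_integrable lebesgue cube (\<lambda>x. v x - w x)" using v wi by (rule set_integral_diff(1))
      show "(LINT x:cube|lebesgue. (v x - w x) * wave (lat k) \<theta> x) = 0" for k \<theta>
        using set_integral_diff(2)[OF I set_integrable_mult_continuous(1)[OF wi compact_cube cw]] ww[of k \<theta>]
        by (simp add: left_diff_distrib F_def)
    qed
    then have "ae_eq open_cube v w" unfolding ae_eq_def by simp
    then show ?thesis using C1 bsum by (intro exI[of _ w]) auto
  qed
  ultimately show ?thesis by (intro exI[of _ c0]) blast
qed

section \<open>Interior regularity of constant-coefficient systems\<close>

text \<open>The cutoff is 1 on the half ball and lives in the unit ball, which fits into the period
  cube because 1 < pi. Thus u \<eta> can be treated as a periodic function whose coefficients decay
  as required by the inversion.\<close>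

lemma unit_regularity:
  fixes I :: "'c set"
  assumes fin: "finite I" and l: "l > 0"
  shows "\<exists>C\<ge>0. \<forall>(a :: 'c \<Rightarrow> 'c \<Rightarrow> 'n::finite \<Rightarrow> 'n \<Rightarrow> real) U u c. elliptic I a l L \<and> dsol U I a u \<and> cball 0 1 \<subseteq> U \<and> c \<in> I \<longrightarrow>
     (\<exists>w. (\<forall>x. w differentiable at x) \<and> (\<forall>i. continuous_on UNIV (pd i w)) \<and>
        (\<forall>x. \<bar>w x\<bar> \<le> C * (\<Sum>c\<in>I. LINT x:cball 0 1|lebesgue. \<bar>u c x\<bar>)) \<and>
        (\<forall>i x. \<bar>pd i w x\<bar> \<le> C * (\<Sum>c\<in>I. LINT x:cball 0 1|lebesgue. \<bar>u c x\<bar>)) \<and>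
        ae_eq (ball 0 (1/2)) (u c) w)"
proof -
  obtain \<eta> :: "real^'n \<Rightarrow> real" where \<eta>: "smooth \<eta>" "\<And>x. 0 \<le> \<eta> x \<and> \<eta> x \<le> 1"
    "\<And>x. x \<in> cball 0 (1/2) \<Longrightarrow> \<eta> x = 1" "\<And>x. x \<notin> ball 0 1 \<Longrightarrow> \<eta> x = 0"
    using bump_exists[of "1/2" 1 "0 :: real^'n"] by auto
  let ?K = "cball 0 1 :: (real^'n) set"
  have \<eta>0: "\<eta> x = 0" if "x \<notin> ?K" for x using \<eta>(4)[of x] that by (auto simp: less_imp_le)
  \<comment> \<open>Order 2n makes the coefficients comparable with \<open>lat_weight\<close>; one
    more order compensates the factor 1 + |k| that controls the gradient.\<close>
  define m where "m = 2 * CARD('n) + 1"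
  have "\<exists>C\<ge>0. \<forall>(a :: 'c \<Rightarrow> 'c \<Rightarrow> 'n \<Rightarrow> 'n \<Rightarrow> real) U u \<xi> \<theta> c.
     elliptic I a l L \<and> dsol U I a u \<and> ?K \<subseteq> U \<and> norm \<xi> \<ge> 1 \<and> c \<in> I \<and> finite I \<longrightarrow>
     \<bar>fcoef U (u c) (iter_pd [] \<eta>) \<xi> \<theta>\<bar> \<le> C / norm \<xi> ^ m * (\<Sum>c\<in>I. LINT x:?K|lebesgue. \<bar>u c x\<bar>)"
    by (rule fcoef_decay[OF compact_cball \<eta>(1) _ l]) (rule \<eta>0)
  then obtain C1 where C1: "C1 \<ge> 0" and C1': "\<forall>(a :: 'c \<Rightarrow> 'c \<Rightarrow> 'n \<Rightarrow> 'n \<Rightarrow> real) U u \<xi> \<theta> c.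
     elliptic I a l L \<and> dsol U I a u \<and> ?K \<subseteq> U \<and> norm \<xi> \<ge> 1 \<and> c \<in> I \<and> finite I \<longrightarrow>
     \<bar>fcoef U (u c) (iter_pd [] \<eta>) \<xi> \<theta>\<bar> \<le> C1 / norm \<xi> ^ m * (\<Sum>c\<in>I. LINT x:?K|lebesgue. \<bar>u c x\<bar>)"
    by (elim exE conjE)
  from fourier_inversion[where 'n = 'n]
  obtain c0 where c0: "c0 \<ge> 0" and c0': "\<forall>(v :: real^'n \<Rightarrow> real) B. set_integrable lebesgue cube v \<and>
     (\<forall>k \<theta>. (1 + norm (lat k)) * \<bar>LINT x:cube|lebesgue. v x * wave (lat k) \<theta> x\<bar> \<le> B * lat_weight k) \<longrightarrow>
     (\<exists>w. (\<forall>x. w differentiable at x) \<and> (\<forall>i. continuous_on UNIV (pd i w)) \<and>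
        (\<forall>x. \<bar>w x\<bar> \<le> c0 * B) \<and> (\<forall>i x. \<bar>pd i w x\<bar> \<le> c0 * B) \<and> ae_eq open_cube v w)"
    by (elim exE conjE)
  have Kc: "?K \<subseteq> open_cube"
  proof
    fix x assume x: "x \<in> ?K"
    have "\<bar>x $ i\<bar> < pi" for i
      using component_le_norm_cart[of x i] x pi_gt3 by simp
    then show "x \<in> open_cube" by (simp add: open_cube_iff)
  qed
  \<comment> \<open>The power of 2 comes from 1 + s \<le> 2 s for nonzero frequencies. The summand 1
    covers frequency 0, where there is no decay and only the trivial \<open>L^1\<close> bound is
    available.\<close>
  let ?C = "c0 * (2 ^ m * C1 + 1)"
  have main: "\<exists>w. (\<forall>x. w differentiable at x) \<and> (\<forall>i. continuous_on UNIV (pd i w)) \<and>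
        (\<forall>x. \<bar>w x\<bar> \<le> ?C * (\<Sum>c\<in>I. LINT x:?K|lebesgue. \<bar>u c x\<bar>)) \<and>
        (\<forall>i x. \<bar>pd i w x\<bar> \<le> ?C * (\<Sum>c\<in>I. LINT x:?K|lebesgue. \<bar>u c x\<bar>)) \<and>
        ae_eq (ball 0 (1/2)) (u c) w"
    if h: "elliptic I a l L" "dsol U I a u" "?K \<subseteq> U" "c \<in> I"
    for a :: "'c \<Rightarrow> 'c \<Rightarrow> 'n \<Rightarrow> 'n \<Rightarrow> real" and U u c
  proof -
    define N where "N = (\<Sum>c\<in>I. LINT x:?K|lebesgue. \<bar>u c x\<bar>)"
    have N0: "N \<ge> 0" unfolding N_def by (intro sum_nonneg) (auto simp: set_lebesgue_integral_def)
    have l: "loc_int U (u c)" using h by (simp add: dsol_def)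
    then have uK: "set_integrable lebesgue ?K (u c)" using h(3) by (simp add: loc_int_def)
    define v where "v x = u c x * \<eta> x" for x
    have Kcube: "?K \<subseteq> cube" using Kc open_cube_subset by blast
    have vi: "set_integrable lebesgue cube v"
      unfolding v_def by (rule loc_int_mult_compact_supp(1)[OF uK compact_cball Kcube \<eta>0 smooth_continuous[OF \<eta>(1)]])
    have F: "(LINT x:cube|lebesgue. v x * wave \<xi> \<theta> x) = fcoef U (u c) \<eta> \<xi> \<theta>" for \<xi> \<theta>
    proof -
      have "(LINT x:cube|lebesgue. v x * wave \<xi> \<theta> x) = (LINT x:cube|lebesgue. u c x * (\<eta> x * wave \<xi> \<theta> x))"
        by (simp add: v_def mult.assoc)
      also have "\<dots> = (LINT x:?K|lebesgue. u c x * (\<eta> x * wave \<xi> \<theta> x))"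
        by (rule loc_int_mult_compact_supp(2)[OF uK compact_cball Kcube])
          (use \<eta>0 in \<open>auto intro!: smooth_continuous smooth_mult \<eta>(1) smooth_wave\<close>)
      also have "\<dots> = fcoef U (u c) \<eta> \<xi> \<theta>"
        unfolding fcoef_def
        by (rule loc_int_mult_compact_supp(2)[OF uK compact_cball h(3), symmetric])
          (use \<eta>0 in \<open>auto intro!: smooth_continuous smooth_mult \<eta>(1) smooth_wave\<close>)
      finally show ?thesis .
    qed
    have FN: "\<bar>fcoef U (u c) \<eta> \<xi> \<theta>\<bar> \<le> N" for \<xi> \<theta>
    proof -
      have "\<bar>fcoef U (u c) \<eta> \<xi> \<theta>\<bar> \<le> 1 * (LINT x:?K|lebesgue. \<bar>u c x\<bar>)"
        using \<eta>(2) by (intro fcoef_bound[OF l compact_cball h(3) \<eta>0 \<eta>(1)]) auto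
      also have "\<dots> \<le> N"
        unfolding N_def mult_1 using h(4) fin by (intro member_le_sum) (auto simp: set_lebesgue_integral_def)
      finally show ?thesis .
    qed
    define B where "B = (2 ^ m * C1 + 1) * N"
    have dec: "(1 + norm (lat k)) * \<bar>LINT x:cube|lebesgue. v x * wave (lat k) \<theta> x\<bar> \<le> B * lat_weight k" for k \<theta>
    proof (cases "k = (\<lambda>_. 0)")
      case True
      then have "lat k = 0" "lat_weight k = 1" by (simp_all add: lat_def lat_weight_def vec_eq_iff)
      moreover have "N \<le> B" unfolding B_def using N0 C1 by (simp add: distrib_right)
      ultimately show ?thesis using FN[of "lat k" \<theta>] by (simp add: F)
    next
      case False
      define s where "s = norm (lat k)"
      have s1: "s \<ge> 1" unfolding s_def by (rule norm_lat_ge_1[OF False])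
      have w0: "lat_weight k > 0" by (rule lat_weight_lower(2))
      have "(1 + s) ^ m \<le> (2 * s) ^ m" using s1 by (intro power_mono) auto
      then have q: "(1 + s) ^ m / s ^ m \<le> 2 ^ m" using s1 by (simp add: power_mult_distrib divide_le_eq)
      have "(1 + s) * \<bar>fcoef U (u c) \<eta> (lat k) \<theta>\<bar> \<le> (1 + s) * (C1 / s ^ m * N)"
        using C1'[rule_format, of a U u "lat k" c \<theta>] h fin s1 unfolding s_def N_def by (intro mult_left_mono) auto
      also have "\<dots> = (1 + s) * (C1 / s ^ m * N) * 1" by simp
      also have "\<dots> \<le> (1 + s) * (C1 / s ^ m * N) * ((1 + s) ^ (2 * CARD('n)) * lat_weight k)"
        using lat_weight_lower(1)[of k] C1 N0 s1 by (intro mult_left_mono) (auto simp: s_def)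
      also have "\<dots> = ((1 + s) ^ m / s ^ m) * (C1 * N * lat_weight k)" by (simp add: m_def)
      also have "\<dots> \<le> 2 ^ m * (C1 * N * lat_weight k)"
        using q C1 N0 w0 by (intro mult_right_mono) auto
      also have "\<dots> \<le> B * lat_weight k"
      proof -
        have "B * lat_weight k = 2 ^ m * (C1 * N * lat_weight k) + N * lat_weight k"
          by (simp add: B_def algebra_simps)
        then show ?thesis using N0 w0 by simp
      qed
      finally show ?thesis by (simp add: F s_def)
    qed
    obtain w where w: "\<And>x. w differentiable at x" "\<And>i. continuous_on UNIV (pd i w)"
      "\<And>x. \<bar>w x\<bar> \<le> c0 * B" "\<And>i x. \<bar>pd i w x\<bar> \<le> c0 * B" "ae_eq open_cube v w"
      using c0'[rule_format, OF conjI, of v B, OF vi] dec by auto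
    have "ae_eq (ball 0 (1/2)) v w"
    proof (rule ae_eq_subset[OF w(5)])
      show "(ball 0 (1/2) :: (real^'n) set) \<subseteq> open_cube" by (rule order_trans[OF _ Kc]) auto
    qed
    moreover have "ae_eq (ball 0 (1/2)) (u c) v"
      by (rule ae_eq_refl) (simp add: v_def \<eta>(3) less_imp_le)
    ultimately have "ae_eq (ball 0 (1/2)) (u c) w" using ae_eq_trans by blast
    moreover have cB: "c0 * B = ?C * N" by (simp add: B_def)
    ultimately show ?thesis
      using w(1,2) w(3,4)[unfolded cB] unfolding N_def[symmetric] by blast
  qed
  have "\<forall>(a :: 'c \<Rightarrow> 'c \<Rightarrow> 'n \<Rightarrow> 'n \<Rightarrow> real) U u c. elliptic I a l L \<and> dsol U I a u \<and> ?K \<subseteq> U \<and> c \<in> I \<longrightarrow>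
     (\<exists>w. (\<forall>x. w differentiable at x) \<and> (\<forall>i. continuous_on UNIV (pd i w)) \<and>
        (\<forall>x. \<bar>w x\<bar> \<le> ?C * (\<Sum>c\<in>I. LINT x:?K|lebesgue. \<bar>u c x\<bar>)) \<and>
        (\<forall>i x. \<bar>pd i w x\<bar> \<le> ?C * (\<Sum>c\<in>I. LINT x:?K|lebesgue. \<bar>u c x\<bar>)) \<and>
        ae_eq (ball 0 (1/2)) (u c) w)"
    by (intro allI impI, elim conjE) (rule main; assumption)
  moreover have "?C \<ge> 0" using c0 C1 by simp
  ultimately show ?thesis by (intro exI[of _ ?C] conjI)
qed

section \<open>Translation and scaling to arbitrary balls\<close>

lemma has_derivative_affine:
  "((\<lambda>x::real^'n::finite. b + s *\<^sub>R x) has_derivative (\<lambda>h. s *\<^sub>R h)) (at x)"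
  by (auto intro!: derivative_eq_intros)

lemma pd_affine:
  fixes f :: "real^'n::finite \<Rightarrow> real"
  assumes "f differentiable at (b + s *\<^sub>R x)"
  shows "pd i (\<lambda>x. f (b + s *\<^sub>R x)) x = s * pd i f (b + s *\<^sub>R x)"
    and "(\<lambda>x. f (b + s *\<^sub>R x)) differentiable at x"
proof -
  have D: "((\<lambda>x. f (b + s *\<^sub>R x)) has_derivative (\<lambda>h. \<Sum>i\<in>UNIV. (s *\<^sub>R h) $ i * pd i f (b + s *\<^sub>R x))) (at x)"
    using has_derivative_compose[OF has_derivative_affine has_derivative_pd[OF assms]] .
  show "pd i (\<lambda>x. f (b + s *\<^sub>R x)) x = s * pd i f (b + s *\<^sub>R x)"
    using pd_eqI[OF D, of i] by (simp add: axis_def if_distrib if_distribR cong: if_cong)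
  show "(\<lambda>x. f (b + s *\<^sub>R x)) differentiable at x" using D differentiable_def by blast
qed

lemma smooth_affine:
  fixes f :: "real^'n::finite \<Rightarrow> real"
  assumes "smooth f" shows "smooth (\<lambda>x. f (b + s *\<^sub>R x))"
proof (rule smooth_coinduct[where P = "\<lambda>F. \<exists>g c. smooth g \<and> F = (\<lambda>x. c * g (b + s *\<^sub>R x))"])
  show "\<exists>g c. smooth g \<and> (\<lambda>x. f (b + s *\<^sub>R x)) = (\<lambda>x. c * g (b + s *\<^sub>R x))"
    using assms by (intro exI[of _ f] exI[of _ 1]) simp
  fix F :: "real^'n \<Rightarrow> real" assume "\<exists>g c. smooth g \<and> F = (\<lambda>x. c * g (b + s *\<^sub>R x))"
  then obtain g c where g: "smooth g" and F: "F = (\<lambda>x. c * g (b + s *\<^sub>R x))" by blast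
  note d = pd_affine(1)[OF smooth_differentiable[OF g], where b = b and s = s] pd_affine(2)[OF smooth_differentiable[OF g], where b = b and s = s]
  have "pd i F = (\<lambda>x. (c * s) * pd i g (b + s *\<^sub>R x))" for i
    unfolding F by (rule ext) (simp add: pd_cmult[OF d(2)] d(1))
  moreover have "F differentiable at x" for x
    unfolding F using d(2) by simp
  ultimately show "(\<forall>x. F differentiable at x) \<and> (\<forall>i. \<exists>g c. smooth g \<and> pd i F = (\<lambda>x. c * g (b + s *\<^sub>R x)))"
    using smooth_pd[OF g] by blast
qed

text \<open>The change of variables is proved for integrable f; applied to the inverse map it gives
  the converse for integrability. If f is not integrable, both integrals have the default value
  0.\<close>

lemma lebesgue_integral_affine:
  fixes f :: "real^'n::finite \<Rightarrow> real"
  assumes r: "r > 0"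
  shows "integrable lebesgue (\<lambda>x. f (t + r *\<^sub>R x)) \<longleftrightarrow> integrable lebesgue f"
    and "(\<integral>x. f (t + r *\<^sub>R x) \<partial>lebesgue) = (\<integral>x. f x \<partial>lebesgue) / r ^ CARD('n)"
proof -
  have *: "integrable lebesgue (\<lambda>x. f (t + r *\<^sub>R x)) \<and>
      (\<integral>x. f x \<partial>lebesgue) = r ^ CARD('n) * (\<integral>x. f (t + r *\<^sub>R x) \<partial>lebesgue)"
    if r: "r > 0" and f: "integrable lebesgue f" for r t and f :: "real^'n \<Rightarrow> real"
  proof -
    let ?T = "\<lambda>x::real^'n. t + r *\<^sub>R x"
    have Teq: "(\<lambda>x. t + (\<Sum>j\<in>Basis. (r * (x \<bullet> j)) *\<^sub>R j)) = ?T"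
      by (simp add: scaleR_scaleR[symmetric] scaleR_sum_right[symmetric] euclidean_representation del: scaleR_scaleR)
    have leb: "lebesgue = density (distr lebesgue lebesgue ?T) (\<lambda>_. ennreal (r ^ CARD('n)))"
      using lebesgue_affine_euclidean[of "\<lambda>_. r" t] r unfolding Teq by simp
    have mT: "?T \<in> lebesgue \<rightarrow>\<^sub>M lebesgue"
      using lebesgue_affine_measurable[of "\<lambda>_. r" t] r unfolding Teq by simp
    have mf: "f \<in> borel_measurable lebesgue" using f by blast
    then have mf': "f \<in> borel_measurable (distr lebesgue lebesgue ?T)" by simp
    have rn: "AE x in distr lebesgue lebesgue ?T. 0 \<le> r ^ CARD('n)" using r by simp
    have "integrable (density (distr lebesgue lebesgue ?T) (\<lambda>_. ennreal (r ^ CARD('n)))) f"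
      using f leb by simp
    then have "integrable (distr lebesgue lebesgue ?T) (\<lambda>x. r ^ CARD('n) *\<^sub>R f x)"
      by (subst (asm) integrable_density[OF mf' _ rn]) auto
    then have 1: "integrable lebesgue (\<lambda>x. r ^ CARD('n) *\<^sub>R f (?T x))"
      by (subst (asm) integrable_distr_eq[OF mT]) (use mf in auto)
    then have "integrable lebesgue (\<lambda>x. (1 / r ^ CARD('n)) * (r ^ CARD('n) *\<^sub>R f (?T x)))"
      by (rule integrable_mult_right)
    then have 2: "integrable lebesgue (\<lambda>x. f (?T x))" using r by simp
    have "(\<integral>x. f x \<partial>lebesgue) = (\<integral>x. f x \<partial>density (distr lebesgue lebesgue ?T) (\<lambda>_. ennreal (r ^ CARD('n))))"
      using leb by simp
    also have "\<dots> = (\<integral>x. r ^ CARD('n) *\<^sub>R f x \<partial>distr lebesgue lebesgue ?T)"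
      by (rule integral_density[OF mf' _ rn]) simp
    also have "\<dots> = (\<integral>x. r ^ CARD('n) *\<^sub>R f (?T x) \<partial>lebesgue)"
      by (rule integral_distr[OF mT]) (use mf in simp)
    finally show ?thesis using 2 by simp
  qed
  have inv: "f = (\<lambda>x. f (t + r *\<^sub>R (- (1 / r) *\<^sub>R t + (1 / r) *\<^sub>R x)))"
    using r by (simp add: scaleR_right_distrib scaleR_right_diff_distrib)
  have conv: "integrable lebesgue f" if "integrable lebesgue (\<lambda>x. f (t + r *\<^sub>R x))"
    using *[of "1 / r" "\<lambda>x. f (t + r *\<^sub>R x)" "- (1 / r) *\<^sub>R t"] that r inv by simp
  show iff: "integrable lebesgue (\<lambda>x. f (t + r *\<^sub>R x)) \<longleftrightarrow> integrable lebesgue f"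
    using *[OF r] conv by blast
  show "(\<integral>x. f (t + r *\<^sub>R x) \<partial>lebesgue) = (\<integral>x. f x \<partial>lebesgue) / r ^ CARD('n)"
  proof (cases "integrable lebesgue f")
    case True
    then show ?thesis using *[OF r True, of t] r by simp
  next
    case False
    then show ?thesis using iff by (simp add: not_integrable_integral_eq)
  qed
qed

lemma set_integral_affine:
  fixes f :: "real^'n::finite \<Rightarrow> real"
  assumes r: "r > 0"
  shows "set_integrable lebesgue {y. t + r *\<^sub>R y \<in> A} (\<lambda>y. f (t + r *\<^sub>R y)) \<longleftrightarrow> set_integrable lebesgue A f"
    and "(LINT y:{y. t + r *\<^sub>R y \<in> A}|lebesgue. f (t + r *\<^sub>R y)) = (LINT x:A|lebesgue. f x) / r ^ CARD('n)"
proof -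
  have eq: "indicator {y. t + r *\<^sub>R y \<in> A} y = indicator A (t + r *\<^sub>R y)" for y by (simp add: indicator_def)
  show "set_integrable lebesgue {y. t + r *\<^sub>R y \<in> A} (\<lambda>y. f (t + r *\<^sub>R y)) \<longleftrightarrow> set_integrable lebesgue A f"
    unfolding set_integrable_def eq by (rule lebesgue_integral_affine(1)[OF r, of "\<lambda>x. indicator A x *\<^sub>R f x"])
  show "(LINT y:{y. t + r *\<^sub>R y \<in> A}|lebesgue. f (t + r *\<^sub>R y)) = (LINT x:A|lebesgue. f x) / r ^ CARD('n)"
    unfolding set_lebesgue_integral_def eq by (rule lebesgue_integral_affine(2)[OF r, of "\<lambda>x. indicator A x *\<^sub>R f x"])
qed

lemma loc_int_affine:
  fixes f :: "real^'n::finite \<Rightarrow> real"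
  assumes r: "r > 0" and f: "loc_int U f"
  shows "loc_int {y. t + r *\<^sub>R y \<in> U} (\<lambda>y. f (t + r *\<^sub>R y))"
  unfolding loc_int_def
proof (intro allI impI, elim conjE)
  fix K assume K: "compact K" "K \<subseteq> {y. t + r *\<^sub>R y \<in> U}"
  let ?S = "\<lambda>y. t + r *\<^sub>R y"
  have "compact (?S ` K)" by (intro compact_continuous_image continuous_intros K)
  then have "set_integrable lebesgue (?S ` K) f" using f K by (auto simp: loc_int_def)
  then have "set_integrable lebesgue {y. ?S y \<in> ?S ` K} (\<lambda>y. f (?S y))" by (subst set_integral_affine(1)[OF r])
  moreover have "{y. ?S y \<in> ?S ` K} = K" using r by auto
  ultimately show "set_integrable lebesgue K (\<lambda>y. f (?S y))" by simp
qed

text \<open>The operator has constant coefficients and is homogeneous of order two, so translation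
  changes nothing and scaling multiplies all terms of an equation by the same factor r^2 /
  r^n.\<close>

lemma dsol_affine:
  fixes u :: "'c \<Rightarrow> real^'n::finite \<Rightarrow> real"
  assumes r: "r > 0" and u: "dsol U I a u"
  shows "dsol {y. t + r *\<^sub>R y \<in> U} I a (\<lambda>c y. u c (t + r *\<^sub>R y))"
  unfolding dsol_def
proof (intro conjI ballI allI impI)
  show "loc_int {y. t + r *\<^sub>R y \<in> U} (\<lambda>y. u c (t + r *\<^sub>R y))" if "c \<in> I" for c
    using u that by (intro loc_int_affine[OF r]) (simp add: dsol_def)
  fix d \<phi> assume d: "d \<in> I" and \<phi>: "test_fun {y. t + r *\<^sub>R y \<in> U} \<phi>"
  define s where "s = 1 / r"
  define b where "b = - s *\<^sub>R t"
  have inv: "b + s *\<^sub>R (t + r *\<^sub>R y) = y" "t + r *\<^sub>R (b + s *\<^sub>R y) = y" for y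
    using r by (simp_all add: b_def s_def scaleR_right_distrib scaleR_right_diff_distrib)
  define \<psi> where "\<psi> x = \<phi> (b + s *\<^sub>R x)" for x
  have sm: "smooth \<phi>" using \<phi> by (rule test_fun_smooth)
  have t\<psi>: "test_fun U \<psi>"
  proof -
    obtain K where K: "compact K" "K \<subseteq> {y. t + r *\<^sub>R y \<in> U}" "\<And>y. y \<notin> K \<Longrightarrow> \<phi> y = 0"
      using test_fun_support[OF \<phi>] by blast
    have "smooth \<psi>" unfolding \<psi>_def by (rule smooth_affine[OF sm])
    moreover have "compact ((\<lambda>y. t + r *\<^sub>R y) ` K)" by (intro compact_continuous_image continuous_intros K)
    moreover have "(\<lambda>y. t + r *\<^sub>R y) ` K \<subseteq> U" using K(2) by blast
    moreover have "\<psi> x = 0" if "x \<notin> (\<lambda>y. t + r *\<^sub>R y) ` K" for x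
      using K(3)[of "b + s *\<^sub>R x"] that inv(2)[of x] unfolding \<psi>_def by (metis imageI)
    ultimately show ?thesis by (rule test_funI)
  qed
  have p1: "pd j \<psi> = (\<lambda>x. s * pd j \<phi> (b + s *\<^sub>R x))" for j
    unfolding \<psi>_def by (rule ext) (rule pd_affine(1)[OF smooth_differentiable[OF sm]])
  have p2: "pd i (pd j \<psi>) x = s * (s * pd i (pd j \<phi>) (b + s *\<^sub>R x))" for i j x
    unfolding p1
    by (subst pd_cmult[OF pd_affine(2)[OF smooth_differentiable[OF smooth_pd[OF sm]]]])
       (simp add: pd_affine(1)[OF smooth_differentiable[OF smooth_pd[OF sm]]])
  have p3: "pd i (pd j \<phi>) y = r\<^sup>2 * pd i (pd j \<psi>) (t + r *\<^sub>R y)" for i j y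
    using r by (simp add: p2 inv(1)) (simp add: s_def power2_eq_square)
  have "(LINT y:{y. t + r *\<^sub>R y \<in> U}|lebesgue. u c (t + r *\<^sub>R y) * pd i (pd j \<phi>) y)
     = r\<^sup>2 / r ^ CARD('n) * (LINT x:U|lebesgue. u c x * pd i (pd j \<psi>) x)" for c i j
  proof -
    have "(LINT y:{y. t + r *\<^sub>R y \<in> U}|lebesgue. u c (t + r *\<^sub>R y) * pd i (pd j \<phi>) y)
      = (LINT y:{y. t + r *\<^sub>R y \<in> U}|lebesgue. r\<^sup>2 * (u c (t + r *\<^sub>R y) * pd i (pd j \<psi>) (t + r *\<^sub>R y)))"
      by (simp add: p3 mult_ac)
    then show ?thesis
      using set_integral_affine(2)[OF r, of t U "\<lambda>x. u c x * pd i (pd j \<psi>) x"] by simp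
  qed
  then have "(\<Sum>c\<in>I. \<Sum>i\<in>UNIV. \<Sum>j\<in>UNIV. a d c i j *
      (LINT y:{y. t + r *\<^sub>R y \<in> U}|lebesgue. u c (t + r *\<^sub>R y) * pd i (pd j \<phi>) y))
    = r\<^sup>2 / r ^ CARD('n) * (\<Sum>c\<in>I. \<Sum>i\<in>UNIV. \<Sum>j\<in>UNIV. a d c i j * (LINT x:U|lebesgue. u c x * pd i (pd j \<psi>) x))"
    by (simp add: sum_distrib_left mult_ac)
  also have "(\<Sum>c\<in>I. \<Sum>i\<in>UNIV. \<Sum>j\<in>UNIV. a d c i j * (LINT x:U|lebesgue. u c x * pd i (pd j \<psi>) x)) = 0"
    using u d t\<psi> unfolding dsol_def by blast
  finally show "(\<Sum>c\<in>I. \<Sum>i\<in>UNIV. \<Sum>j\<in>UNIV. a d c i j *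
      (LINT y:{y. t + r *\<^sub>R y \<in> U}|lebesgue. u c (t + r *\<^sub>R y) * pd i (pd j \<phi>) y)) = 0" by simp
qed

text \<open>The unit estimate is applied to y \<mapsto> u (x0 + r y). The change of variables in the
  \<open>L^1\<close> norm produces 1 / r^n, and undoing the scaling in the gradient produces the
  further 1 / r.\<close>

lemma ball_regularity:
  fixes I :: "'c set"
  assumes fin: "finite I" and l: "l > 0"
  shows "\<exists>C\<ge>0. \<forall>(a :: 'c \<Rightarrow> 'c \<Rightarrow> 'n::finite \<Rightarrow> 'n \<Rightarrow> real) U u c x0 r. elliptic I a l L \<and> dsol U I a u \<and> r > 0 \<and> cball x0 r \<subseteq> U \<and> c \<in> I \<longrightarrow>
     (\<exists>w. (\<forall>x. w differentiable at x) \<and> (\<forall>i. continuous_on UNIV (pd i w)) \<and>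
        (\<forall>x. \<bar>w x\<bar> \<le> C / r ^ CARD('n) * (\<Sum>c\<in>I. LINT x:cball x0 r|lebesgue. \<bar>u c x\<bar>)) \<and>
        (\<forall>i x. \<bar>pd i w x\<bar> \<le> C / r ^ (CARD('n) + 1) * (\<Sum>c\<in>I. LINT x:cball x0 r|lebesgue. \<bar>u c x\<bar>)) \<and>
        ae_eq (ball x0 (r/2)) (u c) w)"
proof -
  from unit_regularity[OF fin l, where L = L and 'n = 'n]
  obtain C where C: "C \<ge> 0" and C': "\<forall>(a :: 'c \<Rightarrow> 'c \<Rightarrow> 'n::finite \<Rightarrow> 'n \<Rightarrow> real) U u c. elliptic I a l L \<and> dsol U I a u \<and> cball 0 1 \<subseteq> U \<and> c \<in> I \<longrightarrow>
     (\<exists>w. (\<forall>x. w differentiable at x) \<and> (\<forall>i. continuous_on UNIV (pd i w)) \<and>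
        (\<forall>x. \<bar>w x\<bar> \<le> C * (\<Sum>c\<in>I. LINT x:cball 0 1|lebesgue. \<bar>u c x\<bar>)) \<and>
        (\<forall>i x. \<bar>pd i w x\<bar> \<le> C * (\<Sum>c\<in>I. LINT x:cball 0 1|lebesgue. \<bar>u c x\<bar>)) \<and>
        ae_eq (ball 0 (1/2)) (u c) w)"
    by (elim exE conjE)
  have main: "\<exists>w. (\<forall>x. w differentiable at x) \<and> (\<forall>i. continuous_on UNIV (pd i w)) \<and>
        (\<forall>x. \<bar>w x\<bar> \<le> C / r ^ CARD('n) * (\<Sum>c\<in>I. LINT x:cball x0 r|lebesgue. \<bar>u c x\<bar>)) \<and>
        (\<forall>i x. \<bar>pd i w x\<bar> \<le> C / r ^ (CARD('n) + 1) * (\<Sum>c\<in>I. LINT x:cball x0 r|lebesgue. \<bar>u c x\<bar>)) \<and>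
        ae_eq (ball x0 (r/2)) (u c) w"
    if h: "elliptic I a l L" "dsol U I a u" "r > 0" "cball x0 r \<subseteq> U" "c \<in> I"
    for a :: "'c \<Rightarrow> 'c \<Rightarrow> 'n \<Rightarrow> 'n \<Rightarrow> real" and U u c x0 r
  proof -
    have r: "r > 0" by (rule h(3))
    let ?S = "\<lambda>y. x0 + r *\<^sub>R y"
    have cb: "{y. ?S y \<in> cball x0 r} = cball 0 1"
      using r by (auto simp: dist_norm)
    have "dsol {y. ?S y \<in> U} I a (\<lambda>c y. u c (?S y))" by (rule dsol_affine[OF r h(2)])
    moreover have "cball 0 1 \<subseteq> {y. ?S y \<in> U}" unfolding cb[symmetric] using h(4) by blast
    ultimately obtain v where v: "\<And>x. v differentiable at x" "\<And>i. continuous_on UNIV (pd i v)"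
        "\<And>x. \<bar>v x\<bar> \<le> C * (\<Sum>c\<in>I. LINT y:cball 0 1|lebesgue. \<bar>u c (?S y)\<bar>)"
        "\<And>i x. \<bar>pd i v x\<bar> \<le> C * (\<Sum>c\<in>I. LINT y:cball 0 1|lebesgue. \<bar>u c (?S y)\<bar>)"
        "ae_eq (ball 0 (1/2)) (\<lambda>y. u c (?S y)) v"
      using C'[rule_format, of a "{y. ?S y \<in> U}" "\<lambda>c y. u c (?S y)" c] h(1,5) by auto
    have N: "C * (\<Sum>c\<in>I. LINT y:cball 0 1|lebesgue. \<bar>u c (?S y)\<bar>)
       = C / r ^ CARD('n) * (\<Sum>c\<in>I. LINT x:cball x0 r|lebesgue. \<bar>u c x\<bar>)"
      unfolding cb[symmetric] using set_integral_affine(2)[OF r, of x0 "cball x0 r" "\<lambda>x. \<bar>u _ x\<bar>"]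
      by (simp add: sum_divide_distrib[symmetric])
    define s where "s = 1 / r"
    define b where "b = - s *\<^sub>R x0"
    have inv: "b + s *\<^sub>R (?S y) = y" "x0 + r *\<^sub>R (b + s *\<^sub>R y) = y" for y
      using r by (simp_all add: b_def s_def scaleR_right_distrib scaleR_right_diff_distrib)
    define w where "w x = v (b + s *\<^sub>R x)" for x
    have dw: "w differentiable at x" for x unfolding w_def by (rule pd_affine(2)[OF v(1)])
    have pw: "pd i w = (\<lambda>x. s * pd i v (b + s *\<^sub>R x))" for i
      unfolding w_def by (rule ext) (rule pd_affine(1)[OF v(1)])
    have cw: "continuous_on UNIV (pd i w)" for i
      unfolding pw by (intro continuous_intros continuous_on_compose2[OF v(2)]) auto
    have bw: "\<bar>w x\<bar> \<le> C / r ^ CARD('n) * (\<Sum>c\<in>I. LINT x:cball x0 r|lebesgue. \<bar>u c x\<bar>)" for x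
      using v(3) unfolding w_def N by blast
    have bp: "\<bar>pd i w x\<bar> \<le> C / r ^ (CARD('n) + 1) * (\<Sum>c\<in>I. LINT x:cball x0 r|lebesgue. \<bar>u c x\<bar>)" for i x
    proof -
      have "\<bar>pd i w x\<bar> = s * \<bar>pd i v (b + s *\<^sub>R x)\<bar>" using r by (simp add: pw s_def abs_mult)
      also have "\<dots> \<le> s * (C / r ^ CARD('n) * (\<Sum>c\<in>I. LINT x:cball x0 r|lebesgue. \<bar>u c x\<bar>))"
        using v(4)[unfolded N] r by (intro mult_left_mono) (auto simp: s_def)
      finally show ?thesis by (simp add: s_def)
    qed
    have "ae_eq (ball x0 (r/2)) (u c) w"
      unfolding ae_eq_def
    proof (rule negligible_subset)
      show "negligible (?S ` {y \<in> ball 0 (1/2). u c (?S y) \<noteq> v y})"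
        using v(5) unfolding ae_eq_def
        by (intro negligible_differentiable_image_negligible)
          (auto simp: differentiable_on_def intro!: differentiable_at_withinI differentiableI has_derivative_affine)
      show "{x \<in> ball x0 (r/2). u c x \<noteq> w x} \<subseteq> ?S ` {y \<in> ball 0 (1/2). u c (?S y) \<noteq> v y}"
      proof
        fix x assume x: "x \<in> {x \<in> ball x0 (r/2). u c x \<noteq> w x}"
        define y where "y = b + s *\<^sub>R x"
        have xy: "x = ?S y" by (simp add: y_def inv)
        then have "r * norm y < r / 2" using x r by (simp add: dist_norm)
        then have "norm y < 1/2" using r by simp
        moreover have "u c (?S y) \<noteq> v y" 
        proof -
          have "w x = v y" by (simp add: w_def y_def)
          moreover have "u c x \<noteq> w x" using x by simp
          ultimately show ?thesis using xy by simp
        qed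
        ultimately show "x \<in> ?S ` {y \<in> ball 0 (1/2). u c (?S y) \<noteq> v y}" using xy by auto
      qed
    qed
    then show ?thesis using dw cw bw bp by blast
  qed
  have "\<forall>(a :: 'c \<Rightarrow> 'c \<Rightarrow> 'n \<Rightarrow> 'n \<Rightarrow> real) U u c x0 r. elliptic I a l L \<and> dsol U I a u \<and> r > 0 \<and> cball x0 r \<subseteq> U \<and> c \<in> I \<longrightarrow>
     (\<exists>w. (\<forall>x. w differentiable at x) \<and> (\<forall>i. continuous_on UNIV (pd i w)) \<and>
        (\<forall>x. \<bar>w x\<bar> \<le> C / r ^ CARD('n) * (\<Sum>c\<in>I. LINT x:cball x0 r|lebesgue. \<bar>u c x\<bar>)) \<and>
        (\<forall>i x. \<bar>pd i w x\<bar> \<le> C / r ^ (CARD('n) + 1) * (\<Sum>c\<in>I. LINT x:cball x0 r|lebesgue. \<bar>u c x\<bar>)) \<and>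
        ae_eq (ball x0 (r/2)) (u c) w)"
    by (intro allI impI, elim conjE) (rule main; assumption)
  then show ?thesis using C by (intro exI[of _ C] conjI)
qed

section \<open>Gluing of local representatives\<close>

text \<open>The set where two continuous functions differ is open, and a nonempty open set is not
  negligible.\<close>

lemma continuous_ae_eq_imp_eq:
  fixes f g :: "real^'n::finite \<Rightarrow> real"
  assumes "continuous_on UNIV f" "continuous_on UNIV g" "ae_eq (ball x e) f g" "e > 0"
  shows "f x = g x"
proof (rule ccontr)
  assume ne: "f x \<noteq> g x"
  have "open {y. f y \<noteq> g y}" by (intro open_Collect_neq assms)
  then have "open ({y. f y \<noteq> g y} \<inter> ball x e)" by (intro open_Int open_ball)
  moreover have "x \<in> {y. f y \<noteq> g y} \<inter> ball x e" using ne assms(4) by simp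
  ultimately have "\<not> negligible ({y. f y \<noteq> g y} \<inter> ball x e)" using open_not_negligible by blast
  moreover have "{y. f y \<noteq> g y} \<inter> ball x e = {y \<in> ball x e. f y \<noteq> g y}" by auto
  ultimately show False using assms(3) by (simp add: ae_eq_def)
qed

text \<open>The representative is glued from the local ones, which agree where they overlap by continuity.\<close>

lemma C1_representative:
  fixes I :: "'c set"
  assumes fin: "finite I" and l: "l > 0"
  shows "\<exists>C\<ge>0. \<forall>(a :: 'c \<Rightarrow> 'c \<Rightarrow> 'n::finite \<Rightarrow> 'n \<Rightarrow> real) U u. elliptic I a l L \<and> dsol U I a u \<and> open U \<longrightarrow>
     (\<exists>v. \<forall>c\<in>I. ae_eq U (u c) (v c) \<and> (\<forall>x\<in>U. v c differentiable at x) \<and> (\<forall>i. continuous_on U (pd i (v c))) \<and>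
        (\<forall>x r. r > 0 \<and> cball x r \<subseteq> U \<longrightarrow>
          \<bar>v c x\<bar> \<le> C / r ^ CARD('n) * (\<Sum>c\<in>I. LINT x:cball x r|lebesgue. \<bar>u c x\<bar>) \<and>
          (\<forall>i. \<bar>pd i (v c) x\<bar> \<le> C / r ^ (CARD('n) + 1) * (\<Sum>c\<in>I. LINT x:cball x r|lebesgue. \<bar>u c x\<bar>))))"
proof -
  from ball_regularity[OF fin l, where L = L and 'n = 'n]
  obtain C where C: "C \<ge> 0" and C': "\<forall>(a :: 'c \<Rightarrow> 'c \<Rightarrow> 'n::finite \<Rightarrow> 'n \<Rightarrow> real) U u c x0 r. elliptic I a l L \<and> dsol U I a u \<and> r > 0 \<and> cball x0 r \<subseteq> U \<and> c \<in> I \<longrightarrow>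
     (\<exists>w. (\<forall>x. w differentiable at x) \<and> (\<forall>i. continuous_on UNIV (pd i w)) \<and>
        (\<forall>x. \<bar>w x\<bar> \<le> C / r ^ CARD('n) * (\<Sum>c\<in>I. LINT x:cball x0 r|lebesgue. \<bar>u c x\<bar>)) \<and>
        (\<forall>i x. \<bar>pd i w x\<bar> \<le> C / r ^ (CARD('n) + 1) * (\<Sum>c\<in>I. LINT x:cball x0 r|lebesgue. \<bar>u c x\<bar>)) \<and>
        ae_eq (ball x0 (r/2)) (u c) w)"
    by (elim exE conjE)
  have main: "\<exists>v. \<forall>c\<in>I. ae_eq U (u c) (v c) \<and> (\<forall>x\<in>U. v c differentiable at x) \<and> (\<forall>i. continuous_on U (pd i (v c))) \<and>
        (\<forall>x r. r > 0 \<and> cball x r \<subseteq> U \<longrightarrow>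
          \<bar>v c x\<bar> \<le> C / r ^ CARD('n) * (\<Sum>c\<in>I. LINT x:cball x r|lebesgue. \<bar>u c x\<bar>) \<and>
          (\<forall>i. \<bar>pd i (v c) x\<bar> \<le> C / r ^ (CARD('n) + 1) * (\<Sum>c\<in>I. LINT x:cball x r|lebesgue. \<bar>u c x\<bar>)))"
    if h: "elliptic I a l L" "dsol U I a u" "open U" for a :: "'c \<Rightarrow> 'c \<Rightarrow> 'n \<Rightarrow> 'n \<Rightarrow> real" and U u
  proof -
    define good where "good c x r w \<longleftrightarrow> (\<forall>x. w differentiable at x) \<and> (\<forall>i. continuous_on UNIV (pd i w)) \<and>
        (\<forall>y. \<bar>w y\<bar> \<le> C / r ^ CARD('n) * (\<Sum>c\<in>I. LINT x:cball x r|lebesgue. \<bar>u c x\<bar>)) \<and>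
        (\<forall>i y. \<bar>pd i w y\<bar> \<le> C / r ^ (CARD('n) + 1) * (\<Sum>c\<in>I. LINT x:cball x r|lebesgue. \<bar>u c x\<bar>)) \<and>
        ae_eq (ball x (r/2)) (u c) w" for c x r and w :: "real^'n \<Rightarrow> real"
    have ex: "\<exists>w. good c x r w" if "r > 0" "cball x r \<subseteq> U" "c \<in> I" for c x r
      using C'[rule_format, of a U u r x c] h(1,2) that unfolding good_def by simp
    have cont: "continuous_on UNIV w" if "good c x r w" for c x r w
      using that unfolding good_def by (simp add: continuous_at_imp_continuous_on differentiable_imp_continuous_within)
    have rad: "\<exists>r>0. cball x r \<subseteq> U" if "x \<in> U" for x
      using h(3) that open_contains_cball by blast
    define R where "R x = (SOME r. r > 0 \<and> cball x r \<subseteq> U)" for x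
    have R: "R x > 0" "cball x (R x) \<subseteq> U" if "x \<in> U" for x
      using someI_ex[OF rad[OF that, unfolded Bex_def]] rad[OF that] unfolding R_def by (metis (mono_tags, lifting) someI_ex)+
    define W where "W c x = (SOME w. good c x (R x) w)" for c x
    have W: "good c x (R x) (W c x)" if "x \<in> U" "c \<in> I" for c x
      unfolding W_def by (rule someI_ex[OF ex[OF R[OF that(1)] that(2)]])
    \<comment> \<open>The value at x is taken from the representative centred at x. The next fact
      shows that every admissible local representative has the same values on its half ball, so v
      inherits differentiability and each of the bounds.\<close>
    define v where "v c x = W c x x" for c x
    have vw: "v c y = w y" if g: "good c x r w" and r: "r > 0" "cball x r \<subseteq> U" and c: "c \<in> I" and y: "y \<in> ball x (r/2)" for c x r w y
    proof -
      have yU: "y \<in> U" using y r by auto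
      define e where "e = min (R y / 2) (r/2 - dist x y)"
      have e: "e > 0" using R(1)[OF yU] y by (simp add: e_def)
      have sub: "ball y e \<subseteq> ball x (r/2)" "ball y e \<subseteq> ball y (R y / 2)"
      proof -
        show "ball y e \<subseteq> ball y (R y / 2)" by (auto simp: e_def)
        show "ball y e \<subseteq> ball x (r/2)"
        proof
          fix z assume "z \<in> ball y e"
          then have "dist y z < r/2 - dist x y" by (simp add: e_def)
          then show "z \<in> ball x (r/2)" using dist_triangle[of x z y] by simp
        qed
      qed
      have "ae_eq (ball y e) (u c) w" using g ae_eq_subset sub(1) unfolding good_def by blast
      moreover have "ae_eq (ball y e) (u c) (W c y)" using W[OF yU c] ae_eq_subset sub(2) unfolding good_def by blast
      ultimately have "ae_eq (ball y e) (W c y) w" using ae_eq_trans ae_eq_sym by blast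
      then show ?thesis unfolding v_def
        using continuous_ae_eq_imp_eq[OF cont[OF W[OF yU c]] cont[OF g] _ e] by blast
    qed
    have "ae_eq U (u c) (v c) \<and> (\<forall>x\<in>U. v c differentiable at x) \<and> (\<forall>i. continuous_on U (pd i (v c))) \<and>
        (\<forall>x r. r > 0 \<and> cball x r \<subseteq> U \<longrightarrow>
          \<bar>v c x\<bar> \<le> C / r ^ CARD('n) * (\<Sum>c\<in>I. LINT x:cball x r|lebesgue. \<bar>u c x\<bar>) \<and>
          (\<forall>i. \<bar>pd i (v c) x\<bar> \<le> C / r ^ (CARD('n) + 1) * (\<Sum>c\<in>I. LINT x:cball x r|lebesgue. \<bar>u c x\<bar>)))"
      if c: "c \<in> I" for c
    proof (intro conjI allI impI ballI)
      show "ae_eq U (u c) (v c)"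
      proof (rule ae_eq_locally)
        fix x assume x: "x \<in> U"
        have "ae_eq (ball x (R x / 2)) (u c) (W c x)" using W[OF x c] unfolding good_def by blast
        moreover have "ae_eq (ball x (R x / 2)) (W c x) (v c)"
          by (rule ae_eq_refl) (rule vw[OF W[OF x c] R[OF x] c, symmetric])
        ultimately have "ae_eq (ball x (R x / 2)) (u c) (v c)" by (rule ae_eq_trans)
        then show "\<exists>e>0. ae_eq (ball x e) (u c) (v c)" using R(1)[OF x] half_gt_zero by blast
      qed
      show "v c differentiable at x" if x: "x \<in> U" for x
      proof (rule differentiable_cong_open[OF open_ball[of x "R x / 2"]])
        show "x \<in> ball x (R x / 2)" using R(1)[OF x] by simp
        show "v c y = W c x y" if "y \<in> ball x (R x / 2)" for y by (rule vw[OF W[OF x c] R[OF x] c that])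
        show "W c x differentiable at x" using W[OF x c] unfolding good_def by blast
      qed
      show "continuous_on U (pd i (v c))" for i
        unfolding continuous_on_eq_continuous_at[OF h(3)]
      proof
        fix x assume x: "x \<in> U"
        have eq: "pd i (v c) y = pd i (W c x) y" if "y \<in> ball x (R x / 2)" for y
          using pd_cong_open[OF open_ball that] vw[OF W[OF x c] R[OF x] c] by blast
        have "isCont (pd i (W c x)) x"
          using W[OF x c] unfolding good_def by (simp add: continuous_on_eq_continuous_at)
        moreover have "\<forall>\<^sub>F y in nhds x. pd i (v c) y = pd i (W c x) y"
          using eq R(1)[OF x] eventually_nhds_in_open[OF open_ball, of x x "R x / 2"] by (simp add: eventually_mono)
        ultimately show "isCont (pd i (v c)) x" using isCont_cong by blast
      qed
      fix x r assume xr: "r > 0 \<and> cball x r \<subseteq> U"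
      then obtain w where g: "good c x r w" using ex c by blast
      have eq: "v c y = w y" if "y \<in> ball x (r/2)" for y using vw[OF g _ _ c that] xr by blast
      have xb: "x \<in> ball x (r/2)" using xr by simp
      show "\<bar>v c x\<bar> \<le> C / r ^ CARD('n) * (\<Sum>c\<in>I. LINT x:cball x r|lebesgue. \<bar>u c x\<bar>)"
        using eq[OF xb] g unfolding good_def by simp
      show "\<bar>pd i (v c) x\<bar> \<le> C / r ^ (CARD('n) + 1) * (\<Sum>c\<in>I. LINT x:cball x r|lebesgue. \<bar>u c x\<bar>)" for i
      proof -
        have "pd i (v c) x = pd i w x" by (rule pd_cong_open[OF open_ball xb]) (rule eq)
        then show ?thesis using g unfolding good_def by simp
      qed
    qed
    then show ?thesis by (intro exI[of _ v]) blast
  qed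
  show ?thesis using C by (intro exI[of _ C] conjI allI impI, assumption, elim conjE) (rule main; assumption)
qed

section \<open>Symmetry of second derivatives and differentiation of the system\<close>

text \<open>The mean value theorem is used twice: in direction i for the difference of f along j,
  then in direction j for \<open>pd i f\<close>.\<close>

lemma second_difference:
  fixes f :: "real^'n::finite \<Rightarrow> real"
  assumes f: "smooth f" and t: "t > 0"
  shows "\<exists>p. dist p x \<le> 2 * t \<and> f (x + t *\<^sub>R axis i 1 + t *\<^sub>R axis j 1) - f (x + t *\<^sub>R axis i 1)
     - (f (x + t *\<^sub>R axis j 1) - f x) = t * (t * pd j (pd i f) p)"
proof -
  note d = smooth_differentiable[OF f] smooth_differentiable[OF smooth_pd[OF f]]
  let ?g = "\<lambda>s. f (x + t *\<^sub>R axis j 1 + s *\<^sub>R axis i 1) - f (x + s *\<^sub>R axis i 1)"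
  have "\<exists>\<sigma>. 0 < \<sigma> \<and> \<sigma> < t \<and> ?g t - ?g 0 = (t - 0) * (pd i f (x + t *\<^sub>R axis j 1 + \<sigma> *\<^sub>R axis i 1) - pd i f (x + \<sigma> *\<^sub>R axis i 1))"
    by (rule MVT2[OF t]) (intro DERIV_diff pd_line d)
  then obtain \<sigma> where \<sigma>: "0 < \<sigma>" "\<sigma> < t" "?g t - ?g 0 = t * (pd i f (x + t *\<^sub>R axis j 1 + \<sigma> *\<^sub>R axis i 1) - pd i f (x + \<sigma> *\<^sub>R axis i 1))"
    by auto
  let ?y = "x + \<sigma> *\<^sub>R axis i 1"
  have "\<exists>\<tau>. 0 < \<tau> \<and> \<tau> < t \<and> pd i f (?y + t *\<^sub>R axis j 1) - pd i f (?y + 0 *\<^sub>R axis j 1) = (t - 0) * pd j (pd i f) (?y + \<tau> *\<^sub>R axis j 1)"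
    by (rule MVT2[OF t]) (intro pd_line d)
  then obtain \<tau> where \<tau>: "0 < \<tau>" "\<tau> < t" "pd i f (?y + t *\<^sub>R axis j 1) - pd i f ?y = t * pd j (pd i f) (?y + \<tau> *\<^sub>R axis j 1)"
    by auto
  have "dist (?y + \<tau> *\<^sub>R axis j 1) x \<le> 2 * t"
    using norm_triangle_ineq[of "\<sigma> *\<^sub>R axis i (1::real)" "\<tau> *\<^sub>R axis j 1"] \<sigma>(1,2) \<tau>(1,2) by (simp add: dist_norm)
  moreover have "?g t - ?g 0 = t * (t * pd j (pd i f) (?y + \<tau> *\<^sub>R axis j 1))"
    using \<sigma>(3) \<tau>(3) by (simp add: add_ac)
  ultimately show ?thesis
    by (intro exI[of _ "?y + \<tau> *\<^sub>R axis j 1"]) (simp add: add_ac)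
qed

text \<open>The second difference does not change when i and j are exchanged. Evaluating it in both
  orders gives equal mixed derivatives at points p n and q n that converge to x, and continuity
  concludes.\<close>

lemma pd_commute:
  fixes f :: "real^'n::finite \<Rightarrow> real"
  assumes f: "smooth f"
  shows "pd i (pd j f) x = pd j (pd i f) x"
proof -
  define t where "t n = 1 / real (Suc n)" for n
  have t: "t n > 0" for n by (simp add: t_def)
  have t0: "(\<lambda>n. 2 * t n) \<longlonglongrightarrow> 0"
    using LIMSEQ_inverse_real_of_nat tendsto_mult_right_zero[of t sequentially 2] by (simp add: t_def[abs_def] inverse_eq_divide)
  have "\<forall>n. \<exists>p q. dist p x \<le> 2 * t n \<and> dist q x \<le> 2 * t n \<and> pd j (pd i f) p = pd i (pd j f) q"
  proof
    fix n
    obtain p where p: "dist p x \<le> 2 * t n" "f (x + t n *\<^sub>R axis i 1 + t n *\<^sub>R axis j 1) - f (x + t n *\<^sub>R axis i 1)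
      - (f (x + t n *\<^sub>R axis j 1) - f x) = t n * (t n * pd j (pd i f) p)" using second_difference[OF f t] by blast
    obtain q where q: "dist q x \<le> 2 * t n" "f (x + t n *\<^sub>R axis j 1 + t n *\<^sub>R axis i 1) - f (x + t n *\<^sub>R axis j 1)
      - (f (x + t n *\<^sub>R axis i 1) - f x) = t n * (t n * pd i (pd j f) q)" using second_difference[OF f t] by blast
    have "x + t n *\<^sub>R axis j 1 + t n *\<^sub>R axis i 1 = x + t n *\<^sub>R axis i 1 + t n *\<^sub>R axis j (1::real)" by (simp add: add_ac)
    then have "f (x + t n *\<^sub>R axis j 1 + t n *\<^sub>R axis i 1) = f (x + t n *\<^sub>R axis i 1 + t n *\<^sub>R axis j 1)" by (rule arg_cong)
    with p(2) q(2) have "t n * (t n * pd j (pd i f) p) = t n * (t n * pd i (pd j f) q)" by linarith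
    then have "pd j (pd i f) p = pd i (pd j f) q" using t[of n] by simp
    then show "\<exists>p q. dist p x \<le> 2 * t n \<and> dist q x \<le> 2 * t n \<and> pd j (pd i f) p = pd i (pd j f) q" using p(1) q(1) by blast
  qed
  then obtain p q where pq: "\<And>n. dist (p n) x \<le> 2 * t n" "\<And>n. dist (q n) x \<le> 2 * t n" "\<And>n. pd j (pd i f) (p n) = pd i (pd j f) (q n)"
    by metis
  have lim: "s \<longlonglongrightarrow> x" if "\<And>n. dist (s n) x \<le> 2 * t n" for s
    unfolding tendsto_dist_iff[of s]
    by (rule tendsto_sandwich[OF _ _ tendsto_const t0]) (use that in auto)
  have c: "isCont (pd a (pd b f)) x" for a b
    by (rule differentiable_imp_continuous_within[OF smooth_differentiable[OF smooth_pd[OF smooth_pd[OF f]]]])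
  have "(\<lambda>n. pd j (pd i f) (p n)) \<longlonglongrightarrow> pd j (pd i f) x" by (rule isCont_tendsto_compose[OF c lim[OF pq(1)]])
  moreover have "(\<lambda>n. pd i (pd j f) (q n)) \<longlonglongrightarrow> pd i (pd j f) x" by (rule isCont_tendsto_compose[OF c lim[OF pq(2)]])
  ultimately show ?thesis using pq(3) LIMSEQ_unique by simp
qed

text \<open>Since the coefficients are constant, testing the differentiated system with \<phi>
  amounts, up to sign, to testing the original one with \<open>pd k \<phi>\<close>, once the
  derivatives on the test function have been commuted.\<close>

lemma dsol_weak_pd:
  assumes u: "dsol U I a u" and w: "\<And>c. c \<in> I \<Longrightarrow> weak_pd U k (u c) (g c)"
  shows "dsol U I a g"
  unfolding dsol_def
proof (intro conjI ballI allI impI)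
  show "loc_int U (g c)" if "c \<in> I" for c using w[OF that] by (simp add: weak_pd_def)
  fix d \<phi> assume d: "d \<in> I" and \<phi>: "test_fun U \<phi>"
  have "(LINT x:U|lebesgue. g c x * pd i (pd j \<phi>) x) = - (LINT x:U|lebesgue. u c x * pd i (pd j (pd k \<phi>)) x)"
    if "c \<in> I" for c i j
  proof -
    have 1: "pd k (pd i (pd j \<phi>)) = pd i (pd j (pd k \<phi>))"
    proof
      fix x
      have "pd k (pd j \<phi>) = pd j (pd k \<phi>)" using pd_commute[OF test_fun_smooth[OF \<phi>]] by blast
      then show "pd k (pd i (pd j \<phi>)) x = pd i (pd j (pd k \<phi>)) x"
        using pd_commute[OF smooth_pd[OF test_fun_smooth[OF \<phi>]], of k i j x] by simp
    qed
    have "(LINT x:U|lebesgue. u c x * pd k (pd i (pd j \<phi>)) x) = - (LINT x:U|lebesgue. g c x * pd i (pd j \<phi>) x)"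
      using w[OF that] test_fun_pd[OF test_fun_pd[OF \<phi>]] unfolding weak_pd_def by blast
    then show ?thesis unfolding 1 by simp
  qed
  then have "(\<Sum>c\<in>I. \<Sum>i\<in>UNIV. \<Sum>j\<in>UNIV. a d c i j * (LINT x:U|lebesgue. g c x * pd i (pd j \<phi>) x))
     = - (\<Sum>c\<in>I. \<Sum>i\<in>UNIV. \<Sum>j\<in>UNIV. a d c i j * (LINT x:U|lebesgue. u c x * pd i (pd j (pd k \<phi>)) x))"
    by (simp add: sum_negf)
  also have "\<dots> = 0" using u d test_fun_pd[OF \<phi>] unfolding dsol_def by simp
  finally show "(\<Sum>c\<in>I. \<Sum>i\<in>UNIV. \<Sum>j\<in>UNIV. a d c i j * (LINT x:U|lebesgue. g c x * pd i (pd j \<phi>) x)) = 0" .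
qed

section \<open>The symbol of the Hodge systems\<close>

lemma eps_Un_left:
  "I \<inter> I' = {} \<Longrightarrow> eps (I \<union> I') K = eps I K * eps I' (K :: 'n::{finite,linorder} set)"
proof -
  assume d: "I \<inter> I' = {}"
  have "{(a, b). a \<in> I \<union> I' \<and> b \<in> K \<and> b < a} = {(a, b). a \<in> I \<and> b \<in> K \<and> b < a} \<union> {(a, b). a \<in> I' \<and> b \<in> K \<and> b < a}"
    by auto
  moreover have "{(a, b). a \<in> I \<and> b \<in> K \<and> b < a} \<inter> {(a, b). a \<in> I' \<and> b \<in> K \<and> b < a} = {}" using d by auto
  ultimately show ?thesis unfolding eps_def by (simp add: card_Un_disjoint power_add)
qed

lemma eps_Un_right:
  "K \<inter> K' = {} \<Longrightarrow> eps I (K \<union> K') = eps I K * eps I (K' :: 'n::{finite,linorder} set)"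
proof -
  assume d: "K \<inter> K' = {}"
  have "{(a, b). a \<in> I \<and> b \<in> K \<union> K' \<and> b < a} = {(a, b). a \<in> I \<and> b \<in> K \<and> b < a} \<union> {(a, b). a \<in> I \<and> b \<in> K' \<and> b < a}"
    by auto
  moreover have "{(a, b). a \<in> I \<and> b \<in> K \<and> b < a} \<inter> {(a, b). a \<in> I \<and> b \<in> K' \<and> b < a} = {}" using d by auto
  ultimately show ?thesis unfolding eps_def by (simp add: card_Un_disjoint power_add)
qed

lemma eps_square: "eps I K * eps I K = 1"
  by (simp add: eps_def flip: power_add)

lemma abs_eps: "\<bar>eps I K\<bar> = 1"
  by (simp add: eps_def power_abs)

lemma eps_singletons: "eps {i} {j} = (if j < i then - 1 else 1)"
proof -
  have "{(a, b). a \<in> {i} \<and> b \<in> {j} \<and> b < a} = (if j < i then {(i, j)} else {})" by auto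
  then show ?thesis by (simp add: eps_def)
qed

text \<open>Every element of J forms an inversion with i in exactly one of the two orders, so the
  two counts add up to the size of J.\<close>

lemma eps_swap_singleton:
  fixes J :: "'n::{finite,linorder} set"
  assumes "i \<notin> J" shows "eps J {i} * eps {i} J = (-1) ^ card J"
proof -
  have 1: "{(a, b). a \<in> J \<and> b \<in> {i} \<and> b < a} = (\<lambda>a. (a, i)) ` {a \<in> J. i < a}" by auto
  have 2: "{(a, b). a \<in> {i} \<and> b \<in> J \<and> b < a} = (\<lambda>b. (i, b)) ` {b \<in> J. b < i}" by auto
  have "J = {a \<in> J. i < a} \<union> {b \<in> J. b < i}" using assms linorder_less_linear by blast
  then have "card J = card {a \<in> J. i < a} + card {b \<in> J. b < i}"
    using card_Un_disjoint[of "{a \<in> J. i < a}" "{b \<in> J. b < i}"] by fastforce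
  then show ?thesis
    unfolding eps_def 1 2 by (simp add: card_image inj_on_def flip: power_add)
qed

text \<open>The signs arising in * d * reduce to the sign \<open>eps {i} J\<close> of the interior
  product, up to a factor that depends on J alone.\<close>

lemma eps_hodge:
  fixes J :: "'n::{finite,linorder} set"
  assumes i: "i \<notin> J"
  shows "eps {i} (- J - {i}) * eps (insert i J) (- J - {i}) = eps J (- J) * (-1) ^ card J * eps {i} J"
proof -
  let ?K = "- J - {i}"
  have a: "eps (insert i J) ?K = eps {i} ?K * eps J ?K"
    using eps_Un_left[of "{i}" J ?K] i by simp
  have "- J = ?K \<union> {i}" using i by auto
  then have b: "eps J (- J) = eps J ?K * eps J {i}"
    using eps_Un_right[of ?K "{i}" J] by simp
  have "eps J (- J) * (-1) ^ card J * eps {i} J = eps J ?K * (eps J {i} * eps J {i}) * (eps {i} J * eps {i} J)"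
    unfolding b eps_swap_singleton[OF i, symmetric] by (simp add: mult_ac)
  then show ?thesis unfolding a eps_square by (simp add: eps_square mult.assoc[symmetric])
qed

text \<open>Moving i past j and j past i gives opposite signs. This is the source of the
  cancellation in Cartan's identity.\<close>

lemma eps_cross:
  fixes L :: "'n::{finite,linorder} set"
  assumes "i \<notin> L" "j \<notin> L" "i \<noteq> j"
  shows "eps {i} (insert j L) * eps {j} (insert i L) = - (eps {i} L * eps {j} L)"
proof -
  have "eps {i} (insert j L) = eps {i} {j} * eps {i} L" "eps {j} (insert i L) = eps {j} {i} * eps {j} L"
    using eps_Un_right[of "{j}" L "{i}"] eps_Un_right[of "{i}" L "{j}"] assms by simp_all
  moreover have "eps {i} {j} * eps {j} {i} = - 1" using assms(3) by (auto simp: eps_singletons)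
  ultimately show ?thesis by (simp add: mult_ac)
qed

section \<open>Exterior and interior multiplication\<close>

definition wedge :: "('n::{finite,linorder} \<Rightarrow> real) \<Rightarrow> ('n set \<Rightarrow> real) \<Rightarrow> 'n set \<Rightarrow> real" where
  "wedge \<xi> f J = (\<Sum>i\<in>J. eps {i} (J - {i}) * \<xi> i * f (J - {i}))"

definition contract :: "('n::{finite,linorder} \<Rightarrow> real) \<Rightarrow> ('n set \<Rightarrow> real) \<Rightarrow> 'n set \<Rightarrow> real" where
  "contract \<xi> f J = (\<Sum>i\<in>- J. eps {i} J * \<xi> i * f (insert i J))"

text \<open>Both sides are expanded over pairs i, j. Off the diagonal the contributions cancel
  through J = L \<union> {i, j}. On the diagonal, exterior multiplication by i accounts for the sets
  K without i and contraction for those with i. The polarised form is what allows two different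
  forms y and z later on.\<close>

lemma cartan_identity:
  fixes f g :: "'n::{finite,linorder} set \<Rightarrow> real"
  assumes k: "k \<ge> 1"
  shows "(\<Sum>J | card J = k + 1. wedge \<xi> f J * wedge \<xi> g J) + (\<Sum>J | card J = k - 1. contract \<xi> f J * contract \<xi> g J)
    = (\<Sum>i\<in>UNIV. (\<xi> i)\<^sup>2) * (\<Sum>K | card K = k. f K * g K)"
proof -
  define w where "w i j = (\<Sum>J | card J = k + 1 \<and> i \<in> J \<and> j \<in> J.
     (eps {i} (J - {i}) * \<xi> i * f (J - {i})) * (eps {j} (J - {j}) * \<xi> j * g (J - {j})))" for i j
  define c where "c i j = (\<Sum>L | card L = k - 1 \<and> i \<notin> L \<and> j \<notin> L.
     (eps {i} L * \<xi> i * f (insert i L)) * (eps {j} L * \<xi> j * g (insert j L)))" for i j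
  have W: "(\<Sum>J | card J = k + 1. wedge \<xi> f J * wedge \<xi> g J) = (\<Sum>i\<in>UNIV. \<Sum>j\<in>UNIV. w i j)"
  proof -
    let ?t = "\<lambda>J i j. (eps {i} (J - {i}) * \<xi> i * f (J - {i})) * (eps {j} (J - {j}) * \<xi> j * g (J - {j}))"
    have "(\<Sum>J | card J = k + 1. wedge \<xi> f J * wedge \<xi> g J)
      = (\<Sum>J | card J = k + 1. \<Sum>i\<in>UNIV. \<Sum>j\<in>UNIV. if i \<in> J \<and> j \<in> J then ?t J i j else 0)"
    proof (rule sum.cong[OF refl])
      fix J
      have "wedge \<xi> f J * wedge \<xi> g J = (\<Sum>i\<in>J. \<Sum>j\<in>J. ?t J i j)"
        unfolding wedge_def by (rule sum_product)
      also have "\<dots> = (\<Sum>i\<in>UNIV. if i \<in> J then (\<Sum>j\<in>UNIV. if j \<in> J then ?t J i j else 0) else 0)"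
        by (simp add: sum.inter_restrict[symmetric])
      also have "\<dots> = (\<Sum>i\<in>UNIV. \<Sum>j\<in>UNIV. if i \<in> J \<and> j \<in> J then ?t J i j else 0)"
        by (intro sum.cong refl) auto
      finally show "wedge \<xi> f J * wedge \<xi> g J = \<dots>" .
    qed
    also have "\<dots> = (\<Sum>i\<in>UNIV. \<Sum>j\<in>UNIV. \<Sum>J | card J = k + 1. if i \<in> J \<and> j \<in> J then ?t J i j else 0)"
      by (subst sum.swap, rule sum.cong[OF refl], rule sum.swap)
    also have "\<dots> = (\<Sum>i\<in>UNIV. \<Sum>j\<in>UNIV. w i j)"
      unfolding w_def by (intro sum.cong refl sum.mono_neutral_cong_right) auto
    finally show ?thesis .
  qed
  have C: "(\<Sum>J | card J = k - 1. contract \<xi> f J * contract \<xi> g J) = (\<Sum>i\<in>UNIV. \<Sum>j\<in>UNIV. c i j)"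
  proof -
    let ?t = "\<lambda>L i j. (eps {i} L * \<xi> i * f (insert i L)) * (eps {j} L * \<xi> j * g (insert j L))"
    have "(\<Sum>J | card J = k - 1. contract \<xi> f J * contract \<xi> g J)
      = (\<Sum>J | card J = k - 1. \<Sum>i\<in>UNIV. \<Sum>j\<in>UNIV. if i \<notin> J \<and> j \<notin> J then ?t J i j else 0)"
    proof (rule sum.cong[OF refl])
      fix J
      have "contract \<xi> f J * contract \<xi> g J = (\<Sum>i\<in>- J. \<Sum>j\<in>- J. ?t J i j)"
        unfolding contract_def by (rule sum_product)
      also have "\<dots> = (\<Sum>i\<in>UNIV. if i \<in> - J then (\<Sum>j\<in>UNIV. if j \<in> - J then ?t J i j else 0) else 0)"
        by (simp only: sum.inter_restrict[OF finite, symmetric] Int_UNIV_left)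
      also have "\<dots> = (\<Sum>i\<in>UNIV. \<Sum>j\<in>UNIV. if i \<notin> J \<and> j \<notin> J then ?t J i j else 0)"
        by (intro sum.cong refl) auto
      finally show "contract \<xi> f J * contract \<xi> g J = \<dots>" .
    qed
    also have "\<dots> = (\<Sum>i\<in>UNIV. \<Sum>j\<in>UNIV. \<Sum>J | card J = k - 1. if i \<notin> J \<and> j \<notin> J then ?t J i j else 0)"
      by (subst sum.swap, rule sum.cong[OF refl], rule sum.swap)
    also have "\<dots> = (\<Sum>i\<in>UNIV. \<Sum>j\<in>UNIV. c i j)"
      unfolding c_def by (intro sum.cong refl sum.mono_neutral_cong_right) auto
    finally show ?thesis .
  qed
  \<comment> \<open>The contraction term enters with its indices exchanged: for i \<noteq> j it is
    \<open>c j i\<close> that cancels \<open>w i j\<close>.\<close>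
  have pair: "w i j + c j i = (if i = j then (\<xi> i)\<^sup>2 * (\<Sum>K | card K = k. f K * g K) else 0)" for i j
  proof (cases "i = j")
    case True
    have sq: "(eps {i} L * \<xi> i * s) * (eps {i} L * \<xi> i * t) = (\<xi> i)\<^sup>2 * (s * t)" for L s t
      using eps_square[of "{i}" L] by (simp add: power2_eq_square mult_ac)
    have "w i i = (\<Sum>K | card K = k \<and> i \<notin> K. (\<xi> i)\<^sup>2 * (f K * g K))"
      unfolding w_def sq
      by (rule sum.reindex_bij_witness[where i = "insert i" and j = "\<lambda>J. J - {i}"]) (auto simp: insert_absorb)
    moreover have "c i i = (\<Sum>K | card K = k \<and> i \<in> K. (\<xi> i)\<^sup>2 * (f K * g K))"
      unfolding c_def sq using k
      by (intro sum.reindex_bij_witness[where j = "insert i" and i = "\<lambda>J. J - {i}"]) (auto simp: insert_absorb)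
    moreover have "(\<Sum>K | card K = k. (\<xi> i)\<^sup>2 * (f K * g K))
      = (\<Sum>K | card K = k \<and> i \<notin> K. (\<xi> i)\<^sup>2 * (f K * g K)) + (\<Sum>K | card K = k \<and> i \<in> K. (\<xi> i)\<^sup>2 * (f K * g K))"
      by (subst sum.union_disjoint[symmetric]) (auto intro!: sum.cong)
    ultimately show ?thesis using True by (simp add: sum_distrib_left)
  next
    case False
    have "w i j = (\<Sum>L | card L = k - 1 \<and> j \<notin> L \<and> i \<notin> L.
       - ((eps {j} L * \<xi> j * f (insert j L)) * (eps {i} L * \<xi> i * g (insert i L))))"
      unfolding w_def
    proof (rule sum.reindex_bij_witness[where j = "\<lambda>J. J - {i, j}" and i = "\<lambda>L. insert i (insert j L)"])
      fix J assume J: "J \<in> {J. card J = k + 1 \<and> i \<in> J \<and> j \<in> J}"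
      then show "insert i (insert j (J - {i, j})) = J" by auto
      have "card (J - {i, j}) = card J - card {i, j}" using J by (intro card_Diff_subset) auto
      then show "J - {i, j} \<in> {L. card L = k - 1 \<and> j \<notin> L \<and> i \<notin> L}" using J False by simp
      let ?L = "J - {i, j}"
      have e: "J - {i} = insert j ?L" "J - {j} = insert i ?L" using J False by auto
      have "eps {i} (insert j ?L) * eps {j} (insert i ?L) = - (eps {i} ?L * eps {j} ?L)"
        by (rule eps_cross) (use False in auto)
      then show "- ((eps {j} ?L * \<xi> j * f (insert j ?L)) * (eps {i} ?L * \<xi> i * g (insert i ?L)))
        = (eps {i} (J - {i}) * \<xi> i * f (J - {i})) * (eps {j} (J - {j}) * \<xi> j * g (J - {j}))"
        unfolding e by algebra
    next
      fix L assume L: "L \<in> {L. card L = k - 1 \<and> j \<notin> L \<and> i \<notin> L}"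
      then show "insert i (insert j L) - {i, j} = L" by auto
      show "insert i (insert j L) \<in> {J. card J = k + 1 \<and> i \<in> J \<and> j \<in> J}"
        using L False k by simp
    qed
    then show ?thesis using False by (simp add: c_def sum_negf)
  qed
  have "(\<Sum>i\<in>UNIV. \<Sum>j\<in>UNIV. w i j) + (\<Sum>i\<in>UNIV. \<Sum>j\<in>UNIV. c i j)
     = (\<Sum>i\<in>UNIV. \<Sum>j\<in>UNIV. w i j + c j i)"
    by (subst (2) sum.swap) (simp add: sum.distrib)
  also have "\<dots> = (\<Sum>i\<in>UNIV. (\<xi> i)\<^sup>2) * (\<Sum>K | card K = k. f K * g K)"
    unfolding pair by (simp add: sum_distrib_right)
  finally show ?thesis unfolding W C .
qed

lemma sum_Ix: "(\<Sum>c\<in>Ix j N. h c) = (\<Sum>\<nu><N. \<Sum>J | card J = j. h (J, \<nu>))"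
proof -
  have I: "Ix j N = (\<lambda>(\<nu>, J). (J, \<nu>)) ` ({..<N} \<times> {J. card J = j})" by (auto simp: Ix_def)
  have inj: "inj_on (\<lambda>(\<nu>, J). (J, \<nu>)) ({..<N} \<times> {J. card J = j})" by (auto simp: inj_on_def)
  have "(\<Sum>c\<in>Ix j N. h c) = (\<Sum>(\<nu>, J)\<in>{..<N} \<times> {J. card J = j}. h (J, \<nu>))"
    unfolding I sum.reindex[OF inj] by (simp add: comp_def case_prod_unfold)
  then show ?thesis by (simp add: sum.cartesian_product)
qed

lemma finite_Ix: "finite (Ix j N :: ('n::finite set \<times> nat) set)"
proof (rule finite_subset)
  show "Ix j N \<subseteq> (UNIV :: 'n set set) \<times> {..<N}" by (auto simp: Ix_def)
qed simp

lemma cartan_Ix: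
  fixes y z :: "'n::{finite,linorder} set \<times> nat \<Rightarrow> real"
  assumes "k \<ge> 1"
  shows "(\<Sum>e\<in>Ix (k + 1) N. wedge \<xi> (\<lambda>K. y (K, snd e)) (fst e) * wedge \<xi> (\<lambda>K. z (K, snd e)) (fst e))
     + (\<Sum>e\<in>Ix (k - 1) N. contract \<xi> (\<lambda>K. y (K, snd e)) (fst e) * contract \<xi> (\<lambda>K. z (K, snd e)) (fst e))
    = (\<Sum>i\<in>UNIV. (\<xi> i)\<^sup>2) * (\<Sum>c\<in>Ix k N. y c * z c)"
  unfolding sum_Ix fst_conv snd_conv sum.distrib[symmetric] cartan_identity[OF assms] sum_distrib_left ..

section \<open>Linear algebra of Legendre elliptic maps\<close>

text \<open>Elimination of one index s, without any symmetry of M. The Schur complement \<sigma> of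
  the block S is the value of the quadratic form at the vector that is 1 at s and whose S part y
  solves the block with right-hand side - M c s; hence it is positive and one may divide by
  it.\<close>

lemma posdef_solve:
  fixes M :: "'c \<Rightarrow> 'c \<Rightarrow> real"
  assumes "finite S" and "\<And>x. \<exists>c\<in>S. x c \<noteq> 0 \<Longrightarrow> 0 < (\<Sum>c\<in>S. (\<Sum>c'\<in>S. M c c' * x c') * x c)"
  shows "\<exists>x. \<forall>c\<in>S. (\<Sum>c'\<in>S. M c c' * x c') = \<xi> c"
  using assms
proof (induction S arbitrary: \<xi> rule: finite_induct)
  case (insert s S)
  have eqS: "(\<Sum>c'\<in>S. M c c' * (x(s := t)) c') = (\<Sum>c'\<in>S. M c c' * x c')" for c x t
    by (rule sum.cong) (use insert.hyps in auto)
  have posS: "0 < (\<Sum>c\<in>S. (\<Sum>c'\<in>S. M c c' * x c') * x c)" if "\<exists>c\<in>S. x c \<noteq> 0" for x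
  proof -
    have "\<exists>c\<in>insert s S. (x(s := 0)) c \<noteq> 0" using that insert.hyps by (auto simp: fun_upd_def)
    from insert.prems[OF this]
    have "0 < (\<Sum>c\<in>S. (\<Sum>c'\<in>S. M c c' * x c') * (x(s := 0)) c)"
      using insert.hyps by (simp add: eqS del: fun_upd_apply) simp
    also have "\<dots> = (\<Sum>c\<in>S. (\<Sum>c'\<in>S. M c c' * x c') * x c)"
      by (rule sum.cong) (use insert.hyps in auto)
    finally show ?thesis .
  qed
  note IH = insert.IH[OF posS]
  obtain y where y: "\<And>c. c \<in> S \<Longrightarrow> (\<Sum>c'\<in>S. M c c' * y c') = - M c s" using IH[of "\<lambda>c. - M c s"] by auto
  obtain z where z: "\<And>c. c \<in> S \<Longrightarrow> (\<Sum>c'\<in>S. M c c' * z c') = \<xi> c" using IH[of \<xi>] by auto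
  define \<sigma> where "\<sigma> = M s s + (\<Sum>c'\<in>S. M s c' * y c')"
  have "\<exists>c\<in>insert s S. (y(s := 1)) c \<noteq> 0" by auto
  from insert.prems[OF this]
  have "0 < \<sigma> + (\<Sum>c\<in>S. (M c s + (\<Sum>c'\<in>S. M c c' * y c')) * (y(s := 1)) c)"
    using insert.hyps by (simp add: eqS \<sigma>_def fun_upd_same del: fun_upd_apply)
  then have \<sigma>: "\<sigma> > 0" using y by simp
  define \<tau> where "\<tau> = (\<xi> s - (\<Sum>c'\<in>S. M s c' * z c')) / \<sigma>"
  define x where "x = (\<lambda>c. z c + \<tau> * y c)(s := \<tau>)"
  have row: "(\<Sum>c'\<in>insert s S. M c c' * x c') = \<tau> * (M c s + (\<Sum>c'\<in>S. M c c' * y c')) + (\<Sum>c'\<in>S. M c c' * z c')" for c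
  proof -
    have "(\<Sum>c'\<in>S. M c c' * x c') = (\<Sum>c'\<in>S. M c c' * (z c' + \<tau> * y c'))"
      unfolding x_def by (rule eqS)
    then show ?thesis using insert.hyps
      by (simp add: x_def sum.distrib sum_distrib_left algebra_simps)
  qed
  have "\<forall>c\<in>insert s S. (\<Sum>c'\<in>insert s S. M c c' * x c') = \<xi> c"
    unfolding row using y z \<sigma> by (auto simp: \<sigma>_def[symmetric] \<tau>_def)
  then show ?case by blast
qed simp

lemma fnorm_L2_set: "fnorm j N x = L2_set x (Ix j N)"
  by (simp add: fnorm_def finner_def L2_set_def power2_eq_square)

lemma finner_self: "finner j N x x = (fnorm j N x)\<^sup>2"
  by (simp add: fnorm_def finner_def sum_nonneg)

lemma finner_le: "\<bar>finner j N x y\<bar> \<le> fnorm j N x * fnorm j N y"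
proof -
  have "\<bar>finner j N x y\<bar> \<le> (\<Sum>c\<in>Ix j N. \<bar>x c\<bar> * \<bar>y c\<bar>)"
    unfolding finner_def by (rule order_trans[OF sum_abs]) (simp add: abs_mult)
  also have "\<dots> \<le> fnorm j N x * fnorm j N y"
    unfolding fnorm_L2_set by (rule L2_set_mult_ineq)
  finally show ?thesis .
qed

lemma abs_le_fnorm: "c \<in> Ix j N \<Longrightarrow> \<bar>x c\<bar> \<le> fnorm j N x"
proof -
  assume c: "c \<in> Ix j N"
  have "\<bar>x c\<bar> = sqrt ((x c)\<^sup>2)" by simp
  also have "\<dots> \<le> fnorm j N x"
    unfolding fnorm_L2_set L2_set_def
    using c finite_Ix by (intro real_sqrt_le_mono member_le_sum) auto
  finally show ?thesis .
qed

lemma in_Lam_mapp: "in_Lam j N (mapp j N M x)"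
  by (simp add: in_Lam_def mapp_def)

text \<open>\<open>opnorm\<close> is a \<open>Sup\<close> of reals, which bounds its elements only
  if the set is bounded above; a crude sum of all entries serves as a bound.\<close>

lemma opnorm_bdd:
  fixes M :: "'n::finite set \<times> nat \<Rightarrow> 'n set \<times> nat \<Rightarrow> real"
  shows "bdd_above {fnorm j N (mapp j N M x) | x. in_Lam j N x \<and> fnorm j N x \<le> 1}"
proof (rule bdd_aboveI)
  fix t assume "t \<in> {fnorm j N (mapp j N M x) | x. in_Lam j N x \<and> fnorm j N x \<le> 1}"
  then obtain x where x: "t = fnorm j N (mapp j N M x)" "fnorm j N x \<le> 1" by blast
  have "t \<le> (\<Sum>c\<in>Ix j N. \<bar>mapp j N M x c\<bar>)"
    unfolding x(1) fnorm_L2_set by (rule L2_set_le_sum_abs)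
  also have "\<dots> \<le> (\<Sum>c\<in>(Ix j N :: ('n set \<times> nat) set). \<Sum>c'\<in>Ix j N. \<bar>M c c'\<bar>)"
  proof (rule sum_mono)
    fix c :: "'n set \<times> nat" assume "c \<in> Ix j N"
    then have "\<bar>mapp j N M x c\<bar> \<le> (\<Sum>c'\<in>Ix j N. \<bar>M c c' * x c'\<bar>)" by (simp add: mapp_def sum_abs)
    also have "\<dots> \<le> (\<Sum>c'\<in>Ix j N. \<bar>M c c'\<bar>)"
    proof (rule sum_mono)
      fix c' :: "'n set \<times> nat" assume "c' \<in> Ix j N"
      then have "\<bar>x c'\<bar> \<le> 1" using abs_le_fnorm[of c' j N x] x(2) by linarith
      then show "\<bar>M c c' * x c'\<bar> \<le> \<bar>M c c'\<bar>" by (simp add: abs_mult mult_left_le)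
    qed
    finally show "\<bar>mapp j N M x c\<bar> \<le> (\<Sum>c'\<in>Ix j N. \<bar>M c c'\<bar>)" .
  qed
  finally show "t \<le> (\<Sum>c\<in>(Ix j N :: ('n set \<times> nat) set). \<Sum>c'\<in>Ix j N. \<bar>M c c'\<bar>)" .
qed

lemma fnorm_scale: "fnorm j N (\<lambda>c. t * x c) = \<bar>t\<bar> * fnorm j N x"
proof -
  have "finner j N (\<lambda>c. t * x c) (\<lambda>c. t * x c) = t\<^sup>2 * finner j N x x"
    by (simp add: finner_def sum_distrib_left power2_eq_square mult_ac)
  then show ?thesis by (simp add: fnorm_def real_sqrt_mult)
qed

lemma mapp_scale: "mapp j N M (\<lambda>c. t * x c) = (\<lambda>c. t * mapp j N M x c)"
  by (auto simp: mapp_def sum_distrib_left mult_ac)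

lemma fnorm_mapp_le:
  assumes "in_Lam j N x"
  shows "fnorm j N (mapp j N M x) \<le> opnorm j N M * fnorm j N x"
proof (cases "fnorm j N x = 0")
  case True
  then have "x c = 0" if "c \<in> Ix j N" for c using abs_le_fnorm[OF that, of x] by simp
  then have z: "(\<Sum>c'\<in>Ix j N. M c c' * x c') = 0" for c by (intro sum.neutral ballI) simp
  have "mapp j N M x = (\<lambda>c. 0)" unfolding mapp_def by (rule ext) (simp only: z if_cancel)
  then show ?thesis using True by (simp add: fnorm_def finner_def)
next
  case False
  then have pos: "fnorm j N x > 0" using L2_set_nonneg[of x "Ix j N"] by (simp add: fnorm_L2_set less_le)
  let ?t = "1 / fnorm j N x"
  have "fnorm j N (\<lambda>c. ?t * x c) \<le> 1" unfolding fnorm_scale using pos by simp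
  moreover have "in_Lam j N (\<lambda>c. ?t * x c)" using assms unfolding in_Lam_def by simp
  ultimately have "fnorm j N (mapp j N M (\<lambda>c. ?t * x c)) \<le> opnorm j N M"
    unfolding opnorm_def by (intro cSup_upper[OF _ opnorm_bdd]) blast
  then show ?thesis unfolding mapp_scale fnorm_scale using pos by (simp add: pos_divide_le_eq)
qed

definition unit_fv :: "'c \<Rightarrow> 'c \<Rightarrow> real" where
  "unit_fv c = (\<lambda>c'. if c' = c then 1 else 0)"

lemma fnorm_unit: "c \<in> Ix j N \<Longrightarrow> fnorm j N (unit_fv c) = 1"
  by (simp add: fnorm_def finner_def unit_fv_def if_distrib if_distribR finite_Ix cong: if_cong)

lemma in_Lam_unit: "c \<in> Ix j N \<Longrightarrow> in_Lam j N (unit_fv c)"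
  by (auto simp: in_Lam_def unit_fv_def)

lemma entry_le_opnorm:
  assumes "c \<in> Ix j N" "c' \<in> Ix j N"
  shows "\<bar>M c c'\<bar> \<le> opnorm j N M"
proof -
  have "M c c' = mapp j N M (unit_fv c') c"
    using assms by (simp add: mapp_def unit_fv_def if_distrib finite_Ix cong: if_cong)
  then have "\<bar>M c c'\<bar> \<le> fnorm j N (mapp j N M (unit_fv c'))" using abs_le_fnorm[OF assms(1)] by metis
  also have "\<dots> \<le> opnorm j N M" using fnorm_mapp_le[OF in_Lam_unit[OF assms(2)], of M] fnorm_unit[OF assms(2)] by simp
  finally show ?thesis .
qed

text \<open>Coercivity makes the quadratic form positive on nonzero vectors. Existence is then
  elimination, and the difference of two solutions has vanishing quadratic form. This is what gives
  the definite description in \<open>minv\<close> a meaning.\<close>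

lemma mapp_ex1:
  assumes B: "legendre_elliptic j N \<gamma> B" and \<xi>: "in_Lam j N \<xi>"
  shows "\<exists>!x. in_Lam j N x \<and> mapp j N B x = \<xi>"
proof -
  have \<gamma>: "\<gamma> > 0" using B by (simp add: legendre_elliptic_def)
  have pos: "0 < (\<Sum>c\<in>Ix j N. (\<Sum>c'\<in>Ix j N. B c c' * x c') * x c)" if ex: "\<exists>c\<in>Ix j N. x c \<noteq> 0" for x
  proof -
    define x' where "x' c = (if c \<in> Ix j N then x c else 0)" for c
    have "in_Lam j N x'" by (simp add: in_Lam_def x'_def)
    then have "\<gamma> * finner j N x' x' \<le> finner j N (mapp j N B x') x'" using B by (simp add: legendre_elliptic_def)
    moreover have "finner j N (mapp j N B x') x' = (\<Sum>c\<in>Ix j N. (\<Sum>c'\<in>Ix j N. B c c' * x c') * x c)"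
      unfolding finner_def mapp_def x'_def by (intro sum.cong refl) simp
    moreover have "finner j N x' x' > 0"
    proof -
      obtain c where "c \<in> Ix j N" "x c \<noteq> 0" using ex by blast
      then have "0 < x' c * x' c" by (auto simp: x'_def zero_less_mult_iff linorder_neq_iff)
      then show ?thesis unfolding finner_def
        using \<open>c \<in> Ix j N\<close> finite_Ix by (intro sum_pos2[of _ c]) auto
    qed
    ultimately show ?thesis using \<gamma> by (metis mult_pos_pos less_le_trans)
  qed
  obtain x where x: "\<forall>c\<in>Ix j N. (\<Sum>c'\<in>Ix j N. B c c' * x c') = \<xi> c"
    using posdef_solve[OF finite_Ix pos] by blast
  define x' where "x' c = (if c \<in> Ix j N then x c else 0)" for c
  have x': "in_Lam j N x' \<and> mapp j N B x' = \<xi>"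
  proof
    show "in_Lam j N x'" by (simp add: in_Lam_def x'_def)
    have "(\<Sum>c'\<in>Ix j N. B c c' * x' c') = (\<Sum>c'\<in>Ix j N. B c c' * x c')" for c
      unfolding x'_def by (intro sum.cong refl) simp
    then show "mapp j N B x' = \<xi>" using x \<xi> by (auto simp: mapp_def in_Lam_def)
  qed
  moreover have "u = v" if u: "in_Lam j N u \<and> mapp j N B u = \<xi>" and v: "in_Lam j N v \<and> mapp j N B v = \<xi>" for u v
  proof -
    have "(\<Sum>c'\<in>Ix j N. B c c' * (u c' - v c')) = 0" if "c \<in> Ix j N" for c
    proof -
      have "mapp j N B u c = mapp j N B v c" using u v by simp
      then show ?thesis using that by (simp add: mapp_def right_diff_distrib sum_subtractf)
    qed
    then have "\<not> (\<exists>c\<in>Ix j N. u c - v c \<noteq> 0)" using pos[of "\<lambda>c. u c - v c"] by auto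
    then show ?thesis using u v by (intro ext) (metis in_Lam_def right_minus_eq)
  qed
  ultimately show ?thesis by blast
qed

lemma minv_props:
  assumes "legendre_elliptic j N \<gamma> B" "in_Lam j N \<xi>"
  shows "in_Lam j N (minv j N B \<xi>)" "mapp j N B (minv j N B \<xi>) = \<xi>"
  using theI'[OF mapp_ex1[OF assms]] unfolding minv_def by blast+

lemma minv_eqI:
  assumes "legendre_elliptic j N \<gamma> B" "in_Lam j N x" "mapp j N B x = \<xi>"
  shows "minv j N B \<xi> = x"
  using mapp_ex1[OF assms(1), of \<xi>] minv_props[OF assms(1), of \<xi>] assms(2,3) in_Lam_mapp by metis

text \<open>\<open>minv\<close> is defined vector by vector, so its linearity has to be proved. The
  matrix whose columns are the inverse images of the unit vectors produces a solution, and
  uniqueness identifies it with \<open>minv\<close>.\<close>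

lemma minv_matrix:
  assumes B: "legendre_elliptic j N \<gamma> B" and \<xi>: "in_Lam j N \<xi>"
  shows "minv j N B \<xi> c = (\<Sum>c'\<in>Ix j N. minv j N B (unit_fv c') c * \<xi> c')"
proof -
  define x where "x c = (\<Sum>c'\<in>Ix j N. minv j N B (unit_fv c') c * \<xi> c')" for c
  have "in_Lam j N x"
    unfolding in_Lam_def x_def using minv_props(1)[OF B in_Lam_unit] by (auto simp: in_Lam_def intro!: sum.neutral)
  moreover have "mapp j N B x = \<xi>"
  proof
    fix c
    show "mapp j N B x c = \<xi> c"
    proof (cases "c \<in> Ix j N")
      case True
      have "mapp j N B x c = (\<Sum>d\<in>Ix j N. \<Sum>c'\<in>Ix j N. B c d * minv j N B (unit_fv c') d * \<xi> c')"
        using True by (simp add: mapp_def x_def sum_distrib_left mult.assoc)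
      also have "\<dots> = (\<Sum>c'\<in>Ix j N. \<Sum>d\<in>Ix j N. B c d * minv j N B (unit_fv c') d * \<xi> c')" by (rule sum.swap)
      also have "\<dots> = (\<Sum>c'\<in>Ix j N. mapp j N B (minv j N B (unit_fv c')) c * \<xi> c')"
        using True by (simp add: mapp_def sum_distrib_right)
      also have "\<dots> = (\<Sum>c'\<in>Ix j N. unit_fv c' c * \<xi> c')"
        by (intro sum.cong refl) (simp add: minv_props(2)[OF B in_Lam_unit])
      also have "\<dots> = \<xi> c" using True by (simp add: unit_fv_def if_distrib if_distribR finite_Ix cong: if_cong)
      finally show ?thesis .
    next
      case False
      then have "\<xi> c = 0" using \<xi> unfolding in_Lam_def by blast
      then show ?thesis using False by (simp add: mapp_def)
    qed
  qed
  ultimately have "minv j N B \<xi> = x" by (rule minv_eqI[OF B])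
  then show ?thesis by (simp add: x_def)
qed

text \<open>For x with B x = e and e a unit vector, coercivity gives \<gamma> |x|^2 \<le>
  \<langle>e, x\<rangle> \<le> |x|, so the inverse is bounded through the ellipticity constant
  alone.\<close>

lemma minv_entry_le:
  assumes B: "legendre_elliptic j N \<gamma> B" and c: "c \<in> Ix j N" "c' \<in> Ix j N"
  shows "\<bar>minv j N B (unit_fv c') c\<bar> \<le> 1 / \<gamma>"
proof -
  have \<gamma>: "\<gamma> > 0" using B by (simp add: legendre_elliptic_def)
  let ?x = "minv j N B (unit_fv c')"
  note p = minv_props[OF B in_Lam_unit[OF c(2)]]
  have "\<gamma> * (fnorm j N ?x)\<^sup>2 \<le> finner j N (unit_fv c') ?x"
    using B p unfolding legendre_elliptic_def finner_self[symmetric] by metis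
  also have "\<dots> \<le> fnorm j N ?x"
    using finner_le[of j N "unit_fv c'" ?x] fnorm_unit[OF c(2)] by simp
  finally have "\<gamma> * (fnorm j N ?x)\<^sup>2 \<le> fnorm j N ?x" .
  then have "fnorm j N ?x \<le> 1 / \<gamma>"
    using \<gamma> L2_set_nonneg[of ?x "Ix j N"] unfolding fnorm_L2_set
    by (cases "L2_set ?x (Ix j N) = 0") (auto simp: power2_eq_square field_simps)
  then show ?thesis using abs_le_fnorm[OF c(1), of ?x] by linarith
qed

text \<open>If \<open>\<omega> c = (\<Sum>c'. M c c' * \<alpha> c')\<close>, then \<open>dcf M\<close> and \<open>scf M\<close> are the coefficients of
  \<open>d \<omega>\<close> and \<open>d* \<omega>\<close> as linear forms in the first derivatives of \<open>\<alpha>\<close>.\<close>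

definition dcf :: "('n::{finite,linorder} set \<times> nat \<Rightarrow> 'n set \<times> nat \<Rightarrow> real) \<Rightarrow> 'n set \<times> nat \<Rightarrow> 'n set \<times> nat \<Rightarrow> 'n \<Rightarrow> real" where
  "dcf M e c i = (if i \<in> fst e then eps {i} (fst e - {i}) * M (fst e - {i}, snd e) c else 0)"

definition scf :: "nat \<Rightarrow> ('n::{finite,linorder} set \<times> nat \<Rightarrow> 'n set \<times> nat \<Rightarrow> real) \<Rightarrow> 'n set \<times> nat \<Rightarrow> 'n set \<times> nat \<Rightarrow> 'n \<Rightarrow> real" where
  "scf k M e c i = (if i \<notin> fst e then (-1) ^ (CARD('n) * (k + 1)) * (eps (- fst e) (fst e) *
      (eps {i} (- fst e - {i}) * (eps (insert i (fst e)) (- fst e - {i}) * M (insert i (fst e), snd e) c))) else 0)"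

text \<open>Coefficient, in the equation obtained by testing component d, of the product of the i-th
  derivative of the unknown c and the j-th derivative of the test function. M acts before d and M'
  before d*.\<close>

definition acf :: "nat \<Rightarrow> nat \<Rightarrow> ('n::{finite,linorder} set \<times> nat \<Rightarrow> 'n set \<times> nat \<Rightarrow> real) \<Rightarrow>
    ('n set \<times> nat \<Rightarrow> 'n set \<times> nat \<Rightarrow> real) \<Rightarrow> ('n set \<times> nat \<Rightarrow> 'n set \<times> nat \<Rightarrow> real) \<Rightarrow>
    'n set \<times> nat \<Rightarrow> 'n set \<times> nat \<Rightarrow> 'n \<Rightarrow> 'n \<Rightarrow> real" where
  "acf k N A M M' d c i j = (\<Sum>e\<in>Ix (k + 1) N. \<Sum>e'\<in>Ix (k + 1) N. A e e' * dcf M e' c i * dcf M e d j)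
     + (\<Sum>e\<in>Ix (k - 1) N. scf k M' e c i * scf k M' e d j)"

lemma dcf_sum:
  assumes "finite I"
  shows "(\<Sum>c\<in>I. \<Sum>i\<in>UNIV. dcf M e c i * (\<xi> i * b c)) = wedge \<xi> (\<lambda>K. \<Sum>c\<in>I. M (K, snd e) c * b c) (fst e)"
proof -
  have "(\<Sum>c\<in>I. \<Sum>i\<in>UNIV. dcf M e c i * (\<xi> i * b c)) = (\<Sum>i\<in>UNIV. \<Sum>c\<in>I. dcf M e c i * (\<xi> i * b c))" by (rule sum.swap)
  also have "\<dots> = (\<Sum>i\<in>fst e. \<Sum>c\<in>I. dcf M e c i * (\<xi> i * b c))"
    by (rule sum.mono_neutral_right) (auto simp: dcf_def)
  also have "\<dots> = (\<Sum>i\<in>fst e. eps {i} (fst e - {i}) * \<xi> i * (\<Sum>c\<in>I. M (fst e - {i}, snd e) c * b c))"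
    by (intro sum.cong refl) (simp add: dcf_def sum_distrib_left mult_ac)
  finally show ?thesis by (simp add: wedge_def)
qed

text \<open>The Hodge signs depend on e only and combine into one factor s. It is left unspecified,
  because the contraction enters the quadratic form squared.\<close>

lemma scf_sum:
  assumes "finite I"
  shows "\<exists>s. s * s = 1 \<and> (\<Sum>c\<in>I. \<Sum>i\<in>UNIV. scf k M e c i * (\<xi> i * b c))
     = s * contract \<xi> (\<lambda>K. \<Sum>c\<in>I. M (K, snd e) c * b c) (fst (e :: 'n::{finite,linorder} set \<times> nat))"
proof -
  let ?J = "fst e"
  define s where "s = (-1) ^ (CARD('n) * (k + 1)) * eps (- ?J) ?J * (eps ?J (- ?J) * (-1) ^ card ?J)"
  have s: "s * s = 1"
  proof -
    have "s * s = ((-1) ^ (CARD('n) * (k + 1)) * (-1) ^ (CARD('n) * (k + 1))) * (eps (- ?J) ?J * eps (- ?J) ?J)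
      * ((eps ?J (- ?J) * eps ?J (- ?J)) * ((-1) ^ card ?J * (-1) ^ card ?J))"
      unfolding s_def by (simp only: mult_ac)
    then show ?thesis by (simp only: eps_square flip: power_mult_distrib) simp
  qed
  have sc: "scf k M e c i = s * (eps {i} ?J * M (insert i ?J, snd e) c)" if "i \<notin> ?J" for c i
  proof -
    have "scf k M e c i = (-1) ^ (CARD('n) * (k + 1)) * eps (- ?J) ?J *
       (eps {i} (- ?J - {i}) * eps (insert i ?J) (- ?J - {i})) * M (insert i ?J, snd e) c"
      using that by (simp add: scf_def mult.assoc)
    then show ?thesis unfolding eps_hodge[OF that] s_def by (simp only: mult_ac)
  qed
  have "(\<Sum>c\<in>I. \<Sum>i\<in>UNIV. scf k M e c i * (\<xi> i * b c)) = (\<Sum>i\<in>UNIV. \<Sum>c\<in>I. scf k M e c i * (\<xi> i * b c))" by (rule sum.swap)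
  also have "\<dots> = (\<Sum>i\<in>- ?J. \<Sum>c\<in>I. scf k M e c i * (\<xi> i * b c))"
    by (rule sum.mono_neutral_right) (auto simp: scf_def)
  also have "\<dots> = (\<Sum>i\<in>- ?J. s * (eps {i} ?J * \<xi> i * (\<Sum>c\<in>I. M (insert i ?J, snd e) c * b c)))"
    by (intro sum.cong refl) (simp add: sc sum_distrib_left mult_ac)
  finally show ?thesis using s by (intro exI[of _ s]) (simp add: contract_def sum_distrib_left)
qed

lemma sum_swap_22:
  "(\<Sum>e\<in>E. \<Sum>e'\<in>E'. \<Sum>c\<in>P. \<Sum>i\<in>Q. \<Sum>j\<in>R. T e e' c i j) = (\<Sum>c\<in>P. \<Sum>i\<in>Q. \<Sum>j\<in>R. \<Sum>e\<in>E. \<Sum>e'\<in>E'. (T e e' c i j :: real))"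
proof -
  have s3: "(\<Sum>e\<in>E. \<Sum>c\<in>P. \<Sum>i\<in>Q. \<Sum>j\<in>R. F e c i j) = (\<Sum>c\<in>P. \<Sum>i\<in>Q. \<Sum>j\<in>R. \<Sum>e\<in>E. (F e c i j :: real))" for E :: "'z set" and F
  proof -
    have "(\<Sum>e\<in>E. \<Sum>c\<in>P. \<Sum>i\<in>Q. \<Sum>j\<in>R. F e c i j) = (\<Sum>c\<in>P. \<Sum>e\<in>E. \<Sum>i\<in>Q. \<Sum>j\<in>R. F e c i j)" by (rule sum.swap)
    also have "\<dots> = (\<Sum>c\<in>P. \<Sum>i\<in>Q. \<Sum>e\<in>E. \<Sum>j\<in>R. F e c i j)" by (rule sum.cong[OF refl], rule sum.swap)
    also have "\<dots> = (\<Sum>c\<in>P. \<Sum>i\<in>Q. \<Sum>j\<in>R. \<Sum>e\<in>E. F e c i j)"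
      by (rule sum.cong[OF refl], rule sum.cong[OF refl], rule sum.swap)
    finally show ?thesis .
  qed
  show ?thesis unfolding s3 ..
qed

lemma sum_swap_12:
  "(\<Sum>e\<in>E. \<Sum>c\<in>P. \<Sum>i\<in>Q. \<Sum>j\<in>R. T e c i j) = (\<Sum>c\<in>P. \<Sum>i\<in>Q. \<Sum>j\<in>R. \<Sum>e\<in>E. (T e c i j :: real))"
  using sum_swap_22[where E' = "{()}" and T = "\<lambda>e e' c i j. T e c i j" and E = E and P = P and Q = Q and R = R] by simp

text \<open>Used in two ways: with G c i = \<xi> i * b c and h = \<xi> it computes the symbol, and
  with pointwise derivatives of the unknown and of the test function it computes the integrands of
  the weak formulation.\<close>

lemma acf_bilinear:
  fixes G :: "'n::{finite,linorder} set \<times> nat \<Rightarrow> 'n \<Rightarrow> real" and h :: "'n \<Rightarrow> real"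
  shows "(\<Sum>c\<in>I. \<Sum>i\<in>UNIV. \<Sum>j\<in>UNIV. acf k N A M M' d c i j * (G c i * h j))
    = (\<Sum>e\<in>Ix (k + 1) N. \<Sum>e'\<in>Ix (k + 1) N. A e e' * (\<Sum>c\<in>I. \<Sum>i\<in>UNIV. dcf M e' c i * G c i) * (\<Sum>j\<in>UNIV. dcf M e d j * h j))
    + (\<Sum>e\<in>Ix (k - 1) N. (\<Sum>c\<in>I. \<Sum>i\<in>UNIV. scf k M' e c i * G c i) * (\<Sum>j\<in>UNIV. scf k M' e d j * h j))"
proof -
  have 1: "(\<Sum>e\<in>Ix (k + 1) N. \<Sum>e'\<in>Ix (k + 1) N. A e e' * (\<Sum>c\<in>I. \<Sum>i\<in>UNIV. dcf M e' c i * G c i) * (\<Sum>j\<in>UNIV. dcf M e d j * h j))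
    = (\<Sum>c\<in>I. \<Sum>i\<in>UNIV. \<Sum>j\<in>UNIV. (\<Sum>e\<in>Ix (k + 1) N. \<Sum>e'\<in>Ix (k + 1) N. A e e' * dcf M e' c i * dcf M e d j) * (G c i * h j))"
  proof -
    have "A e e' * (\<Sum>c\<in>I. \<Sum>i\<in>UNIV. dcf M e' c i * G c i) * (\<Sum>j\<in>UNIV. dcf M e d j * h j)
      = (\<Sum>c\<in>I. \<Sum>i\<in>UNIV. \<Sum>j\<in>UNIV. A e e' * dcf M e' c i * dcf M e d j * (G c i * h j))" for e e'
      by (simp add: sum_distrib_left sum_distrib_right mult_ac)
    then have "(\<Sum>e\<in>Ix (k + 1) N. \<Sum>e'\<in>Ix (k + 1) N. A e e' * (\<Sum>c\<in>I. \<Sum>i\<in>UNIV. dcf M e' c i * G c i) * (\<Sum>j\<in>UNIV. dcf M e d j * h j))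
      = (\<Sum>e\<in>Ix (k + 1) N. \<Sum>e'\<in>Ix (k + 1) N. \<Sum>c\<in>I. \<Sum>i\<in>UNIV. \<Sum>j\<in>UNIV. A e e' * dcf M e' c i * dcf M e d j * (G c i * h j))"
      by (simp only:)
    also have "\<dots> = (\<Sum>c\<in>I. \<Sum>i\<in>UNIV. \<Sum>j\<in>UNIV. \<Sum>e\<in>Ix (k + 1) N. \<Sum>e'\<in>Ix (k + 1) N. A e e' * dcf M e' c i * dcf M e d j * (G c i * h j))"
      by (rule sum_swap_22)
    finally show ?thesis by (simp only: sum_distrib_right)
  qed
  have 2: "(\<Sum>e\<in>Ix (k - 1) N. (\<Sum>c\<in>I. \<Sum>i\<in>UNIV. scf k M' e c i * G c i) * (\<Sum>j\<in>UNIV. scf k M' e d j * h j))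
    = (\<Sum>c\<in>I. \<Sum>i\<in>UNIV. \<Sum>j\<in>UNIV. (\<Sum>e\<in>Ix (k - 1) N. scf k M' e c i * scf k M' e d j) * (G c i * h j))"
  proof -
    have "(\<Sum>c\<in>I. \<Sum>i\<in>UNIV. scf k M' e c i * G c i) * (\<Sum>j\<in>UNIV. scf k M' e d j * h j)
      = (\<Sum>c\<in>I. \<Sum>i\<in>UNIV. \<Sum>j\<in>UNIV. scf k M' e c i * scf k M' e d j * (G c i * h j))" for e
      by (simp add: sum_distrib_left sum_distrib_right mult_ac)
    then have "(\<Sum>e\<in>Ix (k - 1) N. (\<Sum>c\<in>I. \<Sum>i\<in>UNIV. scf k M' e c i * G c i) * (\<Sum>j\<in>UNIV. scf k M' e d j * h j))
      = (\<Sum>e\<in>Ix (k - 1) N. \<Sum>c\<in>I. \<Sum>i\<in>UNIV. \<Sum>j\<in>UNIV. scf k M' e c i * scf k M' e d j * (G c i * h j))"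
      by (simp only:)
    also have "\<dots> = (\<Sum>c\<in>I. \<Sum>i\<in>UNIV. \<Sum>j\<in>UNIV. \<Sum>e\<in>Ix (k - 1) N. scf k M' e c i * scf k M' e d j * (G c i * h j))"
      by (rule sum_swap_12)
    finally show ?thesis by (simp only: sum_distrib_right)
  qed
  show ?thesis unfolding 1 2 by (simp add: acf_def distrib_right sum.distrib)
qed

lemma sum_mult_le_L2: "\<bar>\<Sum>c\<in>S. f c * g c\<bar> \<le> L2_set f S * L2_set (g :: 'a \<Rightarrow> real) S"
proof -
  have "\<bar>\<Sum>c\<in>S. f c * g c\<bar> \<le> (\<Sum>c\<in>S. \<bar>f c\<bar> * \<bar>g c\<bar>)"
    by (rule order_trans[OF sum_abs]) (simp add: abs_mult)
  also have "\<dots> \<le> L2_set f S * L2_set g S" by (rule L2_set_mult_ineq)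
  finally show ?thesis .
qed

lemma L2_set_power2: "(L2_set f S)\<^sup>2 = (\<Sum>c\<in>S. (f c)\<^sup>2)"
  by (simp add: L2_set_def sum_nonneg)

text \<open>Quantitative form of: \<open>\<xi> \<and> y = 0\<close> and \<open>\<xi>\<close> contracted with \<open>z\<close> vanishing force \<open>\<langle>z, y\<rangle> = 0\<close>.\<close>

lemma symbol_lower:
  fixes y z :: "'n::{finite,linorder} set \<times> nat \<Rightarrow> real"
  assumes k: "k \<ge> 1" and g: "g > 0" and \<beta>: "\<beta> \<ge> 1"
    and zy: "g * (\<Sum>c\<in>Ix k N. (y c)\<^sup>2) \<le> (\<Sum>c\<in>Ix k N. z c * y c)"
    and zle: "(\<Sum>c\<in>Ix k N. (z c)\<^sup>2) \<le> \<beta>\<^sup>2 * (\<Sum>c\<in>Ix k N. (y c)\<^sup>2)"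
  shows "g\<^sup>2 * (\<Sum>i\<in>UNIV. (\<xi> i)\<^sup>2) * (\<Sum>c\<in>Ix k N. (y c)\<^sup>2) \<le> 2 * \<beta>\<^sup>2 *
     ((\<Sum>e\<in>Ix (k + 1) N. (wedge \<xi> (\<lambda>K. y (K, snd e)) (fst e))\<^sup>2) + (\<Sum>e\<in>Ix (k - 1) N. (contract \<xi> (\<lambda>K. z (K, snd e)) (fst e))\<^sup>2))"
proof -
  let ?w = "\<lambda>y e. wedge \<xi> (\<lambda>K. y (K, snd e)) (fst e)" and ?c = "\<lambda>y e. contract \<xi> (\<lambda>K. y (K, snd e)) (fst e)"
  let ?I1 = "Ix (k + 1) N :: ('n set \<times> nat) set" and ?I2 = "Ix (k - 1) N :: ('n set \<times> nat) set" and ?I = "Ix k N :: ('n set \<times> nat) set"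
  define n where "n = sqrt (\<Sum>i\<in>UNIV. (\<xi> i)\<^sup>2)"
  have n: "n \<ge> 0" "n\<^sup>2 = (\<Sum>i\<in>UNIV. (\<xi> i)\<^sup>2)" by (simp_all add: n_def sum_nonneg)
  define Y where "Y = L2_set y ?I"
  define X where "X = L2_set (?w y) ?I1"
  define Z where "Z = L2_set (?c z) ?I2"
  have nn: "Y \<ge> 0" "X \<ge> 0" "Z \<ge> 0" by (simp_all add: Y_def X_def Z_def)
  have car: "(L2_set (?w v) ?I1)\<^sup>2 + (L2_set (?c v) ?I2)\<^sup>2 = n\<^sup>2 * (L2_set v ?I)\<^sup>2" for v
    unfolding L2_set_power2 n(2) power2_eq_square[of "v _"] power2_eq_square[of "?w v _"] power2_eq_square[of "?c v _"]
    by (rule cartan_Ix[OF k])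
  have le: "L2_set (?w v) ?I1 \<le> n * L2_set v ?I" "L2_set (?c v) ?I2 \<le> n * L2_set v ?I" for v
  proof -
    have "(L2_set (?w v) ?I1)\<^sup>2 \<le> (n * L2_set v ?I)\<^sup>2" "(L2_set (?c v) ?I2)\<^sup>2 \<le> (n * L2_set v ?I)\<^sup>2"
      using car[of v] zero_le_power2[of "L2_set (?w v) ?I1"] zero_le_power2[of "L2_set (?c v) ?I2"]
      unfolding power_mult_distrib by linarith+
    moreover have "0 \<le> n * L2_set v ?I" using n by simp
    ultimately show "L2_set (?w v) ?I1 \<le> n * L2_set v ?I" "L2_set (?c v) ?I2 \<le> n * L2_set v ?I"
      using power2_le_imp_le by blast+
  qed
  have zY: "L2_set z ?I \<le> \<beta> * Y"
  proof (rule power2_le_imp_le)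
    show "(L2_set z ?I)\<^sup>2 \<le> (\<beta> * Y)\<^sup>2" using zle by (simp add: power_mult_distrib Y_def L2_set_power2)
    show "0 \<le> \<beta> * Y" using \<beta> nn by simp
  qed
  have "g * n\<^sup>2 * Y\<^sup>2 \<le> n\<^sup>2 * (\<Sum>c\<in>?I. z c * y c)"
    using mult_left_mono[OF zy, of "n\<^sup>2"] by (simp add: Y_def L2_set_power2 mult_ac)
  \<comment> \<open>In each of the two sums one factor is a quantity that the system controls, X or
    Z, and the other is bounded by n times the norm of its form. Cauchy-Schwarz therefore gives a
    bound linear in X and Z, from which one factor n Y can be cancelled.\<close>
  also have "\<dots> = (\<Sum>e\<in>?I1. ?w z e * ?w y e) + (\<Sum>e\<in>?I2. ?c z e * ?c y e)"
    unfolding n(2) by (rule cartan_Ix[OF k, symmetric])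
  also have "\<dots> \<le> L2_set (?w z) ?I1 * X + Z * L2_set (?c y) ?I2"
    using sum_mult_le_L2[of "?w z" "?w y" ?I1] sum_mult_le_L2[of "?c z" "?c y" ?I2] unfolding X_def Z_def by linarith
  also have "\<dots> \<le> (n * (\<beta> * Y)) * X + Z * (n * Y)"
  proof (intro add_mono mult_mono)
    show "L2_set (?w z) ?I1 \<le> n * (\<beta> * Y)" using le(1)[of z] mult_left_mono[OF zY n(1)] by linarith
    show "L2_set (?c y) ?I2 \<le> n * Y" using le(2)[of y] by (simp add: Y_def)
  qed (use nn n(1) \<beta> in auto)
  also have "\<dots> = (n * Y) * (\<beta> * X + Z)" by (simp add: algebra_simps)
  finally have *: "(n * Y) * (g * (n * Y)) \<le> (n * Y) * (\<beta> * X + Z)" by (simp add: power2_eq_square mult_ac)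
  have b: "g * (n * Y) \<le> \<beta> * X + Z"
  proof (cases "n * Y = 0")
    case True
    then have "g * (n * Y) = 0" by (simp only: mult_zero_right)
    moreover have "0 \<le> \<beta> * X + Z" using nn \<beta> by simp
    ultimately show ?thesis by linarith
  next
    case False
    then have "n * Y > 0" using n(1) nn(1) by (metis less_eq_real_def mult_nonneg_nonneg)
    then show ?thesis using * by (simp only: mult_le_cancel_left_pos)
  qed
  have "(g * (n * Y))\<^sup>2 \<le> (\<beta> * X + Z)\<^sup>2"
    using b g n nn by (intro power_mono) auto
  \<comment> \<open>From (a + b)^2 \<le> 2 a^2 + 2 b^2; this is the factor 2 in the
    conclusion.\<close>
  also have "\<dots> \<le> 2 * (\<beta> * X)\<^sup>2 + 2 * Z\<^sup>2"
    using zero_le_power2[of "\<beta> * X - Z"] by (simp add: power2_sum power2_diff)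
  also have "\<dots> \<le> 2 * \<beta>\<^sup>2 * (X\<^sup>2 + Z\<^sup>2)"
  proof -
    have "1 * Z\<^sup>2 \<le> \<beta>\<^sup>2 * Z\<^sup>2" using \<beta> by (intro mult_right_mono) auto
    then show ?thesis by (simp add: power_mult_distrib distrib_left)
  qed
  finally have "g\<^sup>2 * n\<^sup>2 * Y\<^sup>2 \<le> 2 * \<beta>\<^sup>2 * (X\<^sup>2 + Z\<^sup>2)" by (simp add: power_mult_distrib mult.assoc)
  then show ?thesis unfolding X_def Y_def Z_def L2_set_power2 n(2) .
qed

lemma abs_dcf_le:
  assumes "\<And>c' c. \<bar>M c' c\<bar> \<le> \<mu>" shows "\<bar>dcf M e c i\<bar> \<le> \<mu>"
proof -
  have "\<mu> \<ge> 0" using order_trans[OF abs_ge_zero assms] .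
  then show ?thesis using assms[of "(fst e - {i}, snd e)" c] by (simp add: dcf_def abs_mult abs_eps)
qed

lemma abs_scf_le:
  assumes "\<And>c' c. \<bar>M c' c\<bar> \<le> \<mu>" shows "\<bar>scf k M e c i\<bar> \<le> \<mu>"
proof -
  have "\<mu> \<ge> 0" using order_trans[OF abs_ge_zero assms] .
  then show ?thesis using assms[of "(insert i (fst e), snd e)" c] by (simp add: scf_def abs_mult abs_eps power_abs)
qed

text \<open>Here y = M b enters d and z = M' b enters d*; the last three hypotheses express that y
  \<mapsto> z is coercive and bounded and that y controls b. The lower bound comes from pairing the
  symbol at \<xi>, applied to b, with b. One factor \<beta>^2 is lost from b to y and one in the
  bound for the symbol; the cardinality comes from comparing the l1 and l2 norms of b.\<close>

lemma elliptic_acf: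
  fixes A M M' :: "'n::{finite,linorder} set \<times> nat \<Rightarrow> 'n set \<times> nat \<Rightarrow> real"
  assumes k: "k \<ge> 1" and gA: "gA > 0" "gA \<le> 1" and g: "g > 0" and \<beta>: "\<beta> \<ge> 1"
    and A: "legendre_elliptic (k + 1) N gA A"
    and Ab: "\<And>e e'. e \<in> Ix (k + 1) N \<Longrightarrow> e' \<in> Ix (k + 1) N \<Longrightarrow> \<bar>A e e'\<bar> \<le> \<nu>"
    and Mb: "\<And>c' c. \<bar>M c' c\<bar> \<le> \<mu>" "\<And>c' c. \<bar>M' c' c\<bar> \<le> \<mu>"
    and zy: "\<And>b. g * (\<Sum>c\<in>Ix k N. (\<Sum>c'\<in>Ix k N. M c c' * b c')\<^sup>2)
        \<le> (\<Sum>c\<in>Ix k N. (\<Sum>c'\<in>Ix k N. M' c c' * b c') * (\<Sum>c'\<in>Ix k N. M c c' * b c'))"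
    and zle: "\<And>b. (\<Sum>c\<in>Ix k N. (\<Sum>c'\<in>Ix k N. M' c c' * b c')\<^sup>2) \<le> \<beta>\<^sup>2 * (\<Sum>c\<in>Ix k N. (\<Sum>c'\<in>Ix k N. M c c' * b c')\<^sup>2)"
    and ble: "\<And>b. (\<Sum>c\<in>Ix k N. (b c)\<^sup>2) \<le> \<beta>\<^sup>2 * (\<Sum>c\<in>Ix k N. (\<Sum>c'\<in>Ix k N. M c c' * b c')\<^sup>2)"
  shows "elliptic (Ix k N) (acf k N A M M') (gA * g\<^sup>2 / (2 * \<beta> ^ 4 * (real (card (Ix k N :: ('n set \<times> nat) set)) + 1)))
    (real (card (Ix (k + 1) N :: ('n set \<times> nat) set)) * (real (card (Ix (k + 1) N :: ('n set \<times> nat) set)) * (\<nu> * \<mu> * \<mu>))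
      + real (card (Ix (k - 1) N :: ('n set \<times> nat) set)) * (\<mu> * \<mu>))"
  unfolding elliptic_def
proof (intro conjI ballI allI)
  let ?I = "Ix k N :: ('n set \<times> nat) set" and ?I1 = "Ix (k + 1) N :: ('n set \<times> nat) set" and ?I2 = "Ix (k - 1) N :: ('n set \<times> nat) set"
  have \<mu>: "\<mu> \<ge> 0" using order_trans[OF abs_ge_zero Mb(1)] .
  fix d c :: "'n set \<times> nat" and i j
  have "\<bar>acf k N A M M' d c i j\<bar> \<le> (\<Sum>e\<in>?I1. \<Sum>e'\<in>?I1. \<bar>A e e' * dcf M e' c i * dcf M e d j\<bar>)
     + (\<Sum>e\<in>?I2. \<bar>scf k M' e c i * scf k M' e d j\<bar>)"
    unfolding acf_def
    by (intro order_trans[OF abs_triangle_ineq] add_mono order_trans[OF sum_abs] sum_mono) auto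
  also have "\<dots> \<le> (\<Sum>e\<in>?I1. \<Sum>e'\<in>?I1. \<nu> * \<mu> * \<mu>) + (\<Sum>e\<in>?I2. \<mu> * \<mu>)"
  proof (intro add_mono sum_mono)
    fix e e' assume e: "e \<in> ?I1" "e' \<in> ?I1"
    then have "\<nu> \<ge> 0" using order_trans[OF abs_ge_zero Ab] by blast
    then show "\<bar>A e e' * dcf M e' c i * dcf M e d j\<bar> \<le> \<nu> * \<mu> * \<mu>"
      unfolding abs_mult using \<mu> Ab[OF e] by (intro mult_mono abs_dcf_le Mb) auto
  next
    fix e
    show "\<bar>scf k M' e c i * scf k M' e d j\<bar> \<le> \<mu> * \<mu>"
      unfolding abs_mult using \<mu> by (intro mult_mono abs_scf_le Mb) auto
  qed
  finally show "\<bar>acf k N A M M' d c i j\<bar> \<le> real (card ?I1) * (real (card ?I1) * (\<nu> * \<mu> * \<mu>)) + real (card ?I2) * (\<mu> * \<mu>)"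
    by simp
next
  let ?I = "Ix k N :: ('n set \<times> nat) set" and ?I1 = "Ix (k + 1) N :: ('n set \<times> nat) set" and ?I2 = "Ix (k - 1) N :: ('n set \<times> nat) set"
  fix \<xi> :: "(real, 'n) vec" and b :: "'n set \<times> nat \<Rightarrow> real"
  define P where "P d = (\<Sum>c\<in>?I. (\<Sum>i\<in>UNIV. \<Sum>j\<in>UNIV. acf k N A M M' d c i j * (\<xi> $ i * \<xi> $ j)) * b c)" for d
  define y where "y c = (\<Sum>c'\<in>?I. M c c' * b c')" for c
  define z where "z c = (\<Sum>c'\<in>?I. M' c c' * b c')" for c
  let ?w = "\<lambda>e. wedge (($) \<xi>) (\<lambda>K. y (K, snd e)) (fst e)" and ?c = "\<lambda>e. contract (($) \<xi>) (\<lambda>K. z (K, snd e)) (fst e)"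
  define v where "v e = (\<Sum>c\<in>?I. \<Sum>i\<in>UNIV. scf k M' e c i * (\<xi> $ i * b c))" for e
  have w: "(\<Sum>c\<in>?I. \<Sum>i\<in>UNIV. dcf M e c i * (\<xi> $ i * b c)) = ?w e" for e
    unfolding y_def by (rule dcf_sum[OF finite_Ix])
  have v2: "(v e)\<^sup>2 = (?c e)\<^sup>2" for e
    using scf_sum[OF finite_Ix, of k M' e "($) \<xi>" b k N] unfolding v_def z_def
    by (metis (no_types, lifting) mult_1 power2_eq_square power_mult_distrib)
  have Pd: "P d = (\<Sum>e\<in>?I1. \<Sum>e'\<in>?I1. A e e' * ?w e' * (\<Sum>j\<in>UNIV. dcf M e d j * \<xi> $ j))
     + (\<Sum>e\<in>?I2. v e * (\<Sum>j\<in>UNIV. scf k M' e d j * \<xi> $ j))" for d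
  proof -
    have "P d = (\<Sum>c\<in>?I. \<Sum>i\<in>UNIV. \<Sum>j\<in>UNIV. acf k N A M M' d c i j * ((\<xi> $ i * b c) * \<xi> $ j))"
      unfolding P_def by (simp add: sum_distrib_right sum_distrib_left mult_ac)
    then show ?thesis unfolding acf_bilinear w v_def .
  qed
  \<comment> \<open>Pairing with b also contracts the equation index, so both factors of each
    product become the same form and Q is the quadratic form of A at \<xi> \<and> y plus the square
    of \<xi> contracted with z.\<close>
  define Q where "Q = (\<Sum>d\<in>?I. b d * P d)"
  have Q: "Q = (\<Sum>e\<in>?I1. (\<Sum>e'\<in>?I1. A e e' * ?w e') * ?w e) + (\<Sum>e\<in>?I2. (v e)\<^sup>2)"
  proof -
    have "Q = (\<Sum>d\<in>?I. \<Sum>e\<in>?I1. (\<Sum>e'\<in>?I1. A e e' * ?w e') * (\<Sum>j\<in>UNIV. dcf M e d j * (\<xi> $ j * b d)))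
       + (\<Sum>d\<in>?I. \<Sum>e\<in>?I2. v e * (\<Sum>j\<in>UNIV. scf k M' e d j * (\<xi> $ j * b d)))"
      unfolding Q_def Pd sum.distrib[symmetric]
      by (intro sum.cong refl) (simp add: distrib_left sum_distrib_left sum_distrib_right mult_ac)
    also have "\<dots> = (\<Sum>e\<in>?I1. (\<Sum>e'\<in>?I1. A e e' * ?w e') * (\<Sum>d\<in>?I. \<Sum>j\<in>UNIV. dcf M e d j * (\<xi> $ j * b d)))
       + (\<Sum>e\<in>?I2. v e * (\<Sum>d\<in>?I. \<Sum>j\<in>UNIV. scf k M' e d j * (\<xi> $ j * b d)))"
      by (subst (1) sum.swap, subst (2) sum.swap) (simp only: sum_distrib_left)
    finally show ?thesis unfolding w v_def[symmetric] power2_eq_square .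
  qed
  have QA: "gA * ((\<Sum>e\<in>?I1. (?w e)\<^sup>2) + (\<Sum>e\<in>?I2. (?c e)\<^sup>2)) \<le> Q"
  proof -
    \<comment> \<open>The Legendre condition speaks of vectors that vanish off the index set, so the
      exterior product is truncated first.\<close>
    define w' where "w' e = (if e \<in> ?I1 then ?w e else 0)" for e
    have "in_Lam (k + 1) N w'" by (simp add: in_Lam_def w'_def)
    then have "gA * finner (k + 1) N w' w' \<le> finner (k + 1) N (mapp (k + 1) N A w') w'"
      using A by (simp add: legendre_elliptic_def)
    moreover have "finner (k + 1) N w' w' = (\<Sum>e\<in>?I1. (?w e)\<^sup>2)"
      unfolding finner_def by (intro sum.cong refl) (simp add: w'_def power2_eq_square)
    moreover have "finner (k + 1) N (mapp (k + 1) N A w') w' = (\<Sum>e\<in>?I1. (\<Sum>e'\<in>?I1. A e e' * ?w e') * ?w e)"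
      unfolding finner_def mapp_def by (intro sum.cong refl) (simp add: w'_def)
    \<comment> \<open>The contraction part has constant 1; because \<open>gA\<close> \<le> 1 it may
      be weakened to \<open>gA\<close>, so that both parts share one constant.\<close>
    moreover have "gA * (\<Sum>e\<in>?I2. (?c e)\<^sup>2) \<le> (\<Sum>e\<in>?I2. (v e)\<^sup>2)"
      unfolding v2 using gA by (intro mult_left_le_one_le sum_nonneg) auto
    ultimately show ?thesis unfolding Q by (simp only: distrib_left)
  qed
  define n where "n = (norm \<xi>)\<^sup>2"
  have n: "n = (\<Sum>i\<in>UNIV. (\<xi> $ i)\<^sup>2)" by (simp add: n_def norm_vec_def L2_set_def sum_nonneg)
  have n0: "n \<ge> 0" by (simp add: n_def)
  define B where "B = (\<Sum>c\<in>?I. \<bar>b c\<bar>)"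
  define R where "R = (\<Sum>d\<in>?I. \<bar>P d\<bar>)"
  have BR: "B \<ge> 0" "R \<ge> 0" unfolding B_def R_def by (simp_all add: sum_nonneg)
  have "gA * (g\<^sup>2 * n * (\<Sum>c\<in>?I. (b c)\<^sup>2)) \<le> gA * (g\<^sup>2 * n * (\<beta>\<^sup>2 * (\<Sum>c\<in>?I. (y c)\<^sup>2)))"
    using ble[of b] gA n0 unfolding y_def by (intro mult_left_mono) auto
  also have "\<dots> = gA * \<beta>\<^sup>2 * (g\<^sup>2 * n * (\<Sum>c\<in>?I. (y c)\<^sup>2))" by (simp only: mult_ac)
  also have "\<dots> \<le> gA * \<beta>\<^sup>2 * (2 * \<beta>\<^sup>2 * ((\<Sum>e\<in>?I1. (?w e)\<^sup>2) + (\<Sum>e\<in>?I2. (?c e)\<^sup>2)))"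
    unfolding n using gA zy[of b] zle[of b] unfolding y_def[symmetric] z_def[symmetric]
    by (intro mult_left_mono symbol_lower[OF k g \<beta>]) auto
  also have "\<dots> = 2 * \<beta> ^ 4 * (gA * ((\<Sum>e\<in>?I1. (?w e)\<^sup>2) + (\<Sum>e\<in>?I2. (?c e)\<^sup>2)))"
    by (simp add: power2_eq_square power4_eq_xxxx mult_ac)
  also have "\<dots> \<le> 2 * \<beta> ^ 4 * Q" using QA by (intro mult_left_mono) auto
  also have "\<dots> \<le> 2 * \<beta> ^ 4 * (B * R)"
  proof (rule mult_left_mono)
    have "Q \<le> (\<Sum>d\<in>?I. \<bar>b d\<bar> * R)"
      unfolding Q_def
    proof (rule sum_mono)
      fix d assume d: "d \<in> ?I"
      have "b d * P d \<le> \<bar>b d\<bar> * \<bar>P d\<bar>" by (metis abs_ge_self abs_mult)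
      also have "\<dots> \<le> \<bar>b d\<bar> * R"
        unfolding R_def using d finite_Ix by (intro mult_left_mono member_le_sum) auto
      finally show "b d * P d \<le> \<bar>b d\<bar> * R" .
    qed
    then show "Q \<le> B * R" by (simp add: B_def sum_distrib_right)
  qed (use \<beta> in auto)
  finally have 1: "gA * (g\<^sup>2 * n * (\<Sum>c\<in>?I. (b c)\<^sup>2)) \<le> 2 * \<beta> ^ 4 * (B * R)" .
  \<comment> \<open>The summand 1 keeps the later division by m legitimate whatever the size of the
    index set.\<close>
  define m where "m = real (card ?I) + 1"
  have m: "m > 0" by (simp add: m_def)
  have "B\<^sup>2 \<le> m * (\<Sum>c\<in>?I. (b c)\<^sup>2)"
  proof -
    have "B\<^sup>2 \<le> (\<Sum>c\<in>?I. \<bar>b c\<bar>\<^sup>2) * real (card ?I)"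
      unfolding B_def using sum_squared_le_sum_of_squares[of "\<lambda>c. \<bar>b c\<bar>" ?I] by simp
    also have "\<dots> \<le> (\<Sum>c\<in>?I. (b c)\<^sup>2) * m" unfolding m_def by (simp add: mult_left_mono sum_nonneg)
    finally show ?thesis by (simp add: mult.commute)
  qed
  then have "gA * (g\<^sup>2 * n) * B\<^sup>2 \<le> gA * (g\<^sup>2 * n) * (m * (\<Sum>c\<in>?I. (b c)\<^sup>2))"
    using gA n0 by (intro mult_left_mono) auto
  also have "\<dots> = m * (gA * (g\<^sup>2 * n * (\<Sum>c\<in>?I. (b c)\<^sup>2)))" by (simp only: mult_ac)
  also have "\<dots> \<le> m * (2 * \<beta> ^ 4 * (B * R))" using 1 m by (intro mult_left_mono) auto
  finally have 2: "B * (gA * g\<^sup>2 * n * B) \<le> B * (2 * \<beta> ^ 4 * m * R)" by (simp add: power2_eq_square mult_ac)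
  have "gA * g\<^sup>2 * n * B \<le> 2 * \<beta> ^ 4 * m * R"
  proof (cases "B = 0")
    case True
    then show ?thesis using BR m \<beta> by simp
  next
    case False
    then have "B > 0" using BR by simp
    then show ?thesis using 2 by (simp only: mult_le_cancel_left_pos)
  qed
  moreover have "2 * \<beta> ^ 4 * m > 0" using \<beta> m by simp
  ultimately have "gA * g\<^sup>2 * n * B / (2 * \<beta> ^ 4 * m) \<le> R" by (simp add: pos_divide_le_eq mult.commute)
  then show "gA * g\<^sup>2 / (2 * \<beta> ^ 4 * (real (card ?I) + 1)) * (norm \<xi>)\<^sup>2 * (\<Sum>c\<in>?I. \<bar>b c\<bar>)
     \<le> (\<Sum>d\<in>?I. \<bar>\<Sum>c\<in>?I. (\<Sum>i\<in>UNIV. \<Sum>j\<in>UNIV. acf k N A M M' d c i j * (\<xi> $ i * \<xi> $ j)) * b c\<bar>)"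
    unfolding n_def B_def R_def P_def m_def by (simp add: mult_ac)
qed

section \<open>Both systems are elliptic\<close>

lemma wpd_linear_combination:
  fixes f :: "real^'n::finite \<Rightarrow> real"
  assumes U: "open U" and I: "finite I" and w: "\<And>c. c \<in> I \<Longrightarrow> weak_pd U i (\<alpha> c) (g c)"
    and f: "\<And>y. y \<in> U \<Longrightarrow> f y = (\<Sum>c\<in>I. m c * \<alpha> c y)"
  shows "ae_eq U (wpd U i f) (\<lambda>x. \<Sum>c\<in>I. m c * g c x)"
proof (rule wpd_ae_eq[OF U])
  have "weak_pd U i (\<lambda>x. \<Sum>c\<in>I. m c * \<alpha> c x) (\<lambda>x. \<Sum>c\<in>I. m c * g c x)"
    by (rule weak_pd_sum[OF I w])
  then show "weak_pd U i f (\<lambda>x. \<Sum>c\<in>I. m c * g c x)"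
    by (rule weak_pd_ae_eq) (auto intro: ae_eq_refl simp: f)
qed

text \<open>\<open>ext_d\<close> is built from the choice \<open>wpd\<close>, so it can be computed
  only up to null sets. The relation between \<omega> and \<alpha> is demanded on U alone, where
  \<open>W12\<close> constrains the values.\<close>

lemma ext_d_ae_eq:
  fixes \<omega> :: "(real, 'n::{finite,linorder}) vec \<Rightarrow> 'n fv"
  assumes U: "open U" and e: "e \<in> Ix (k + 1) N"
    and w: "\<And>c i. c \<in> Ix k N \<Longrightarrow> weak_pd U i (\<lambda>y. \<alpha> y c) (g c i)"
    and \<omega>: "\<And>y c. y \<in> U \<Longrightarrow> c \<in> Ix k N \<Longrightarrow> \<omega> y c = (\<Sum>c'\<in>Ix k N. M c c' * \<alpha> y c')"
  shows "ae_eq U (\<lambda>x. ext_d U \<omega> x e) (\<lambda>x. \<Sum>c\<in>Ix k N. \<Sum>i\<in>UNIV. dcf M e c i * g c i x)"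
proof -
  let ?J = "fst e" and ?I = "Ix k N :: ('n set \<times> nat) set"
  have "ae_eq U (wpd U i (\<lambda>y. \<omega> y (?J - {i}, snd e))) (\<lambda>x. \<Sum>c\<in>?I. M (?J - {i}, snd e) c * g c i x)" if i: "i \<in> ?J" for i
  proof (rule wpd_linear_combination[OF U finite_Ix w])
    have "(?J - {i}, snd e) \<in> ?I" using e i by (auto simp: Ix_def)
    then show "\<omega> y (?J - {i}, snd e) = (\<Sum>c\<in>?I. M (?J - {i}, snd e) c * \<alpha> y c)" if "y \<in> U" for y
      using \<omega> that by blast
  qed
  then show ?thesis
  proof (rule ae_eq_finite_fun[rotated])
    fix x assume h: "\<And>i. i \<in> ?J \<Longrightarrow> wpd U i (\<lambda>y. \<omega> y (?J - {i}, snd e)) x = (\<Sum>c\<in>?I. M (?J - {i}, snd e) c * g c i x)"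
    have "ext_d U \<omega> x e = (\<Sum>i\<in>?J. eps {i} (?J - {i}) * wpd U i (\<lambda>y. \<omega> y (?J - {i}, snd e)) x)"
      by (simp add: ext_d_def case_prod_unfold)
    also have "\<dots> = (\<Sum>i\<in>?J. \<Sum>c\<in>?I. dcf M e c i * g c i x)"
      by (intro sum.cong refl) (simp add: h dcf_def sum_distrib_left mult.assoc)
    also have "\<dots> = (\<Sum>i\<in>UNIV. \<Sum>c\<in>?I. dcf M e c i * g c i x)"
      by (rule sum.mono_neutral_left) (auto simp: dcf_def)
    also have "\<dots> = (\<Sum>c\<in>?I. \<Sum>i\<in>UNIV. dcf M e c i * g c i x)" by (rule sum.swap)
    finally show "ext_d U \<omega> x e = (\<Sum>c\<in>?I. \<Sum>i\<in>UNIV. dcf M e c i * g c i x)" .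
  qed (assumption, rule finite)
qed

lemma hodge_apply: "hodge \<xi> e = eps (- fst e) (fst e) * \<xi> (- fst e, snd e)"
  by (simp add: hodge_def case_prod_unfold)

text \<open>The star of \<omega> at the complement of J without i is, up to a sign, the component of
  \<omega> at J with i added. The derivative is therefore taken of a multiple of a component of
  \<omega>, and the remaining signs are those collected in \<open>scf\<close>.\<close>

lemma codiff_ae_eq:
  fixes \<omega> :: "(real, 'n::{finite,linorder}) vec \<Rightarrow> 'n fv"
  assumes U: "open U" and k: "k \<ge> 1" and e: "e \<in> Ix (k - 1) N"
    and w: "\<And>c i. c \<in> Ix k N \<Longrightarrow> weak_pd U i (\<lambda>y. \<alpha> y c) (g c i)"
    and \<omega>: "\<And>y c. y \<in> U \<Longrightarrow> c \<in> Ix k N \<Longrightarrow> \<omega> y c = (\<Sum>c'\<in>Ix k N. M c c' * \<alpha> y c')"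
  shows "ae_eq U (\<lambda>x. codiff U k \<omega> x e) (\<lambda>x. \<Sum>c\<in>Ix k N. \<Sum>i\<in>UNIV. scf k M e c i * g c i x)"
proof -
  let ?J = "fst e" and ?I = "Ix k N :: ('n set \<times> nat) set"
  let ?h = "\<lambda>i y. hodge (\<omega> y) (- ?J - {i}, snd e)"
  have hodge: "?h i y = eps (insert i ?J) (- ?J - {i}) * \<omega> y (insert i ?J, snd e)" for i y
  proof -
    have "- (- ?J - {i}) = insert i ?J" by auto
    then show ?thesis by (simp add: hodge_def)
  qed
  have "ae_eq U (wpd U i (?h i)) (\<lambda>x. \<Sum>c\<in>?I. (eps (insert i ?J) (- ?J - {i}) * M (insert i ?J, snd e) c) * g c i x)" if i: "i \<in> - ?J" for i
  proof (rule wpd_linear_combination[OF U finite_Ix w])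
    have "(insert i ?J, snd e) \<in> ?I" using e i k by (auto simp: Ix_def)
    then show "?h i y = (\<Sum>c\<in>?I. (eps (insert i ?J) (- ?J - {i}) * M (insert i ?J, snd e) c) * \<alpha> y c)" if "y \<in> U" for y
      using \<omega>[OF that] by (simp add: hodge sum_distrib_left mult.assoc)
  qed
  then show ?thesis
  proof (rule ae_eq_finite_fun[rotated])
    fix x assume h: "\<And>i. i \<in> - ?J \<Longrightarrow> wpd U i (?h i) x = (\<Sum>c\<in>?I. (eps (insert i ?J) (- ?J - {i}) * M (insert i ?J, snd e) c) * g c i x)"
    have "codiff U k \<omega> x e = (-1) ^ (CARD('n) * (k + 1)) * (eps (- ?J) ?J * (\<Sum>i\<in>- ?J. eps {i} (- ?J - {i}) * wpd U i (?h i) x))"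
      unfolding codiff_def hodge_apply[of "ext_d U (\<lambda>y. hodge (\<omega> y)) x"] by (simp add: ext_d_def)
    also have "\<dots> = (\<Sum>i\<in>- ?J. (-1) ^ (CARD('n) * (k + 1)) * (eps (- ?J) ?J * (eps {i} (- ?J - {i}) * wpd U i (?h i) x)))"
      by (simp only: sum_distrib_left)
    also have "\<dots> = (\<Sum>i\<in>- ?J. \<Sum>c\<in>?I. scf k M e c i * g c i x)"
    proof (intro sum.cong refl)
      fix i assume i: "i \<in> - ?J"
      then show "(-1) ^ (CARD('n) * (k + 1)) * (eps (- ?J) ?J * (eps {i} (- ?J - {i}) * wpd U i (?h i) x)) = (\<Sum>c\<in>?I. scf k M e c i * g c i x)"
        unfolding h[OF i] sum_distrib_left by (intro sum.cong refl) (simp add: scf_def mult.assoc)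
    qed
    also have "\<dots> = (\<Sum>i\<in>UNIV. \<Sum>c\<in>?I. scf k M e c i * g c i x)"
      by (rule sum.mono_neutral_left) (auto simp: scf_def)
    also have "\<dots> = (\<Sum>c\<in>?I. \<Sum>i\<in>UNIV. scf k M e c i * g c i x)" by (rule sum.swap)
    finally show "codiff U k \<omega> x e = (\<Sum>c\<in>?I. \<Sum>i\<in>UNIV. scf k M e c i * g c i x)" .
  qed (assumption, rule finite)
qed

lemma weak_pd_test:
  fixes \<phi> :: "real^'n::finite \<Rightarrow> real"
  assumes "open U" "smooth \<phi>"
  shows "weak_pd U i \<phi> (pd i \<phi>)"
  by (rule weak_pd_C1[OF assms(1) smooth_differentiable[OF assms(2)] smooth_continuous[OF smooth_pd[OF assms(2)]]])

lemma sq_int_test: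
  fixes \<phi> :: "real^'n::finite \<Rightarrow> real"
  assumes U: "open U" and \<phi>: "test_fun U \<phi>"
  shows "sq_int U \<phi>"
proof -
  obtain K where K: "compact K" "K \<subseteq> U" "\<And>x. x \<notin> K \<Longrightarrow> \<phi> x = 0" using test_fun_support[OF \<phi>] by blast
  note c = smooth_continuous[OF test_fun_smooth[OF \<phi>]]
  have "set_integrable lebesgue U (\<lambda>x. 1 * \<phi> x)"
    by (rule set_integrable_compact_supp[OF U K continuous_on_const c])
  moreover have "set_integrable lebesgue U (\<lambda>x. \<phi> x * \<phi> x)"
    by (rule set_integrable_compact_supp[OF U K c c])
  ultimately show ?thesis
    unfolding sq_int_def set_integrable_def set_borel_measurable_def power2_eq_square by auto
qed

definition single_fv :: "'c \<Rightarrow> ('x \<Rightarrow> real) \<Rightarrow> 'x \<Rightarrow> 'c \<Rightarrow> real" where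
  "single_fv d \<phi> y c = (if c = d then \<phi> y else 0)"

lemma test_fun_single: "test_fun U \<phi> \<Longrightarrow> test_fun U (\<lambda>y. single_fv d \<phi> y c)"
  by (cases "c = d") (simp_all add: single_fv_def test_fun_zero)

text \<open>The field itself serves as constant approximating sequence. Its distance to itself is 0
  because the classical derivative and the chosen weak one agree almost everywhere.\<close>

lemma W120_single:
  fixes \<phi> :: "real^'n::finite \<Rightarrow> real"
  assumes U: "open U" and \<phi>: "test_fun U \<phi>" and d: "d \<in> Ix k N"
  shows "W120 U k N (single_fv d \<phi>)"
proof -
  let ?\<psi> = "single_fv d \<phi>"
  have L: "in_Lam k N (?\<psi> x)" for x using d by (auto simp: in_Lam_def single_fv_def)
  have t: "test_fun U (\<lambda>x. ?\<psi> x c)" for c by (rule test_fun_single[OF \<phi>])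
  have w: "weak_pd U i (\<lambda>x. ?\<psi> x c) (pd i (\<lambda>x. ?\<psi> x c))" for i c
    by (rule weak_pd_test[OF U test_fun_smooth[OF t]])
  have "W12 U k N ?\<psi>"
    unfolding W12_def
  proof (intro conjI ballI allI)
    fix c i
    show "sq_int U (\<lambda>x. ?\<psi> x c)" by (rule sq_int_test[OF U t])
    show "\<exists>g. weak_pd U i (\<lambda>x. ?\<psi> x c) g \<and> sq_int U g"
      using w sq_int_test[OF U test_fun_pd[OF t]] by blast
  qed (rule L)
  moreover have "w12dist2 U k N ?\<psi> ?\<psi> = 0"
  proof -
    have "(LINT x:U|lebesgue. (pd i (\<lambda>y. ?\<psi> y c) x - wpd U i (\<lambda>y. ?\<psi> y c) x)\<^sup>2) = 0" for i c
    proof -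
      have "ae_eq U (\<lambda>x. (pd i (\<lambda>y. ?\<psi> y c) x - wpd U i (\<lambda>y. ?\<psi> y c) x)\<^sup>2)
          (\<lambda>x. (pd i (\<lambda>y. ?\<psi> y c) x - pd i (\<lambda>y. ?\<psi> y c) x)\<^sup>2)"
        using ae_eq_fun[OF wpd_ae_eq[OF U w[of i c]], of "\<lambda>x t. (pd i (\<lambda>y. ?\<psi> y c) x - t)\<^sup>2"] .
      from set_integral_ae_eq[OF this] show ?thesis by simp
    qed
    then show ?thesis by (simp add: w12dist2_def)
  qed
  ultimately show ?thesis
    unfolding W120_def using t L by (intro conjI exI[of _ "\<lambda>m. ?\<psi>"]) auto
qed

lemma integral_bilinear:
  fixes g :: "'c \<Rightarrow> 'n::finite \<Rightarrow> real^'n \<Rightarrow> real" and h :: "'n \<Rightarrow> real^'n \<Rightarrow> real"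
  assumes I: "finite I" and i: "\<And>c i j. c \<in> I \<Longrightarrow> set_integrable lebesgue U (\<lambda>x. g c i x * h j x)"
  shows "set_integrable lebesgue U (\<lambda>x. \<Sum>c\<in>I. \<Sum>i\<in>UNIV. \<Sum>j\<in>UNIV. a c i j * (g c i x * h j x))"
    "(LINT x:U|lebesgue. \<Sum>c\<in>I. \<Sum>i\<in>UNIV. \<Sum>j\<in>UNIV. a c i j * (g c i x * h j x))
      = (\<Sum>c\<in>I. \<Sum>i\<in>UNIV. \<Sum>j\<in>UNIV. a c i j * (LINT x:U|lebesgue. g c i x * h j x))"
proof -
  have 1: "set_integrable lebesgue U (\<lambda>x. \<Sum>j\<in>UNIV. a c i j * (g c i x * h j x))"
    "(LINT x:U|lebesgue. \<Sum>j\<in>UNIV. a c i j * (g c i x * h j x)) = (\<Sum>j\<in>UNIV. a c i j * (LINT x:U|lebesgue. g c i x * h j x))"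
    if "c \<in> I" for c i
    using set_integral_sum'[OF finite, of UNIV lebesgue U "\<lambda>j x. a c i j * (g c i x * h j x)"] i[OF that] by simp_all
  have 2: "set_integrable lebesgue U (\<lambda>x. \<Sum>i\<in>UNIV. \<Sum>j\<in>UNIV. a c i j * (g c i x * h j x))"
    "(LINT x:U|lebesgue. \<Sum>i\<in>UNIV. \<Sum>j\<in>UNIV. a c i j * (g c i x * h j x))
       = (\<Sum>i\<in>UNIV. \<Sum>j\<in>UNIV. a c i j * (LINT x:U|lebesgue. g c i x * h j x))"
    if "c \<in> I" for c
    using set_integral_sum'[OF finite, of UNIV lebesgue U "\<lambda>i x. \<Sum>j\<in>UNIV. a c i j * (g c i x * h j x)"] 1[OF that] by simp_all
  show "set_integrable lebesgue U (\<lambda>x. \<Sum>c\<in>I. \<Sum>i\<in>UNIV. \<Sum>j\<in>UNIV. a c i j * (g c i x * h j x))"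
    "(LINT x:U|lebesgue. \<Sum>c\<in>I. \<Sum>i\<in>UNIV. \<Sum>j\<in>UNIV. a c i j * (g c i x * h j x))
      = (\<Sum>c\<in>I. \<Sum>i\<in>UNIV. \<Sum>j\<in>UNIV. a c i j * (LINT x:U|lebesgue. g c i x * h j x))"
    using set_integral_sum'[OF I, of lebesgue U "\<lambda>c x. \<Sum>i\<in>UNIV. \<Sum>j\<in>UNIV. a c i j * (g c i x * h j x)"] 2 by simp_all
qed

lemma W12_weak_pd:
  "W12 U k N \<alpha> \<Longrightarrow> c \<in> Ix k N \<Longrightarrow> weak_pd U i (\<lambda>y. \<alpha> y c) (wpd U i (\<lambda>y. \<alpha> y c))"
  unfolding W12_def using wpd_weak_pd by blast

text \<open>The d-th equation results from testing with the field whose only component is \<phi> at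
  d; the definition of the weak derivative, used with the test function \<open>pd j \<phi>\<close>,
  then moves the remaining derivative off the solution. \<Omega> and \<Omega>' stand for the
  pointwise maps inside d and d*.\<close>

lemma system_imp_dsol:
  fixes \<alpha> :: "(real, 'n::{finite,linorder}) vec \<Rightarrow> 'n fv"
  assumes U: "open U" and k: "k \<ge> 1" and \<alpha>: "W12 U k N \<alpha>"
    and \<Omega>: "\<And>\<xi> c. in_Lam k N \<xi> \<Longrightarrow> c \<in> Ix k N \<Longrightarrow> \<Omega> \<xi> c = (\<Sum>c'\<in>Ix k N. M c c' * \<xi> c')"
    and \<Omega>': "\<And>\<xi> c. in_Lam k N \<xi> \<Longrightarrow> c \<in> Ix k N \<Longrightarrow> \<Omega>' \<xi> c = (\<Sum>c'\<in>Ix k N. M' c c' * \<xi> c')"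
    and sys: "\<And>\<psi>. W120 U k N \<psi> \<Longrightarrow>
      (LINT x:U|lebesgue. finner (k+1) N (mapp (k+1) N A (ext_d U (\<lambda>y. \<Omega> (\<alpha> y)) x)) (ext_d U (\<lambda>y. \<Omega> (\<psi> y)) x)) +
      (LINT x:U|lebesgue. finner (k-1) N (codiff U k (\<lambda>y. \<Omega>' (\<alpha> y)) x) (codiff U k (\<lambda>y. \<Omega>' (\<psi> y)) x)) = 0"
  shows "dsol U (Ix k N) (acf k N A M M') (\<lambda>c y. \<alpha> y c)"
  unfolding dsol_def
proof (intro conjI ballI allI impI)
  let ?I = "Ix k N :: ('n set \<times> nat) set"
  note w = W12_weak_pd[OF \<alpha>]
  show "loc_int U (\<lambda>y. \<alpha> y c)" if "c \<in> ?I" for c using w[OF that] by (simp add: weak_pd_def)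
  fix d :: "'n set \<times> nat" and \<phi> :: "(real, 'n) vec \<Rightarrow> real" assume d: "d \<in> ?I" and \<phi>: "test_fun U \<phi>"
  let ?\<psi> = "single_fv d \<phi>"
  define g where "g c i = wpd U i (\<lambda>y. \<alpha> y c)" for c i
  have \<alpha>L: "in_Lam k N (\<alpha> y)" if "y \<in> U" for y using \<alpha> that by (simp add: W12_def)
  have \<psi>L: "in_Lam k N (?\<psi> y)" for y using d by (auto simp: in_Lam_def single_fv_def)
  have w\<psi>: "weak_pd U i (\<lambda>y. ?\<psi> y c) (\<lambda>x. if c = d then pd i \<phi> x else 0)" for c i
  proof -
    have "pd i (\<lambda>y. ?\<psi> y c) = (\<lambda>x. if c = d then pd i \<phi> x else 0)"
      by (cases "c = d") (auto simp: single_fv_def pd_const)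
    then show ?thesis using weak_pd_test[OF U test_fun_smooth[OF test_fun_single[OF \<phi>]], of i d c] by simp
  qed
  have delta: "(\<Sum>c\<in>?I. \<Sum>i\<in>UNIV. F c i * (if c = d then pd i \<phi> x else 0)) = (\<Sum>i\<in>UNIV. F d i * pd i \<phi> x)" for F x
  proof -
    have "(\<Sum>c\<in>?I. \<Sum>i\<in>UNIV. F c i * (if c = d then pd i \<phi> x else 0)) = (\<Sum>c\<in>?I. if c = d then (\<Sum>i\<in>UNIV. F d i * pd i \<phi> x) else 0)"
      by (intro sum.cong refl) simp
    then show ?thesis using d by (simp add: finite_Ix)
  qed
  have ext\<alpha>: "ae_eq U (\<lambda>x. ext_d U (\<lambda>y. \<Omega> (\<alpha> y)) x e) (\<lambda>x. \<Sum>c\<in>?I. \<Sum>i\<in>UNIV. dcf M e c i * g c i x)" if "e \<in> Ix (k + 1) N" for e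
    unfolding g_def by (rule ext_d_ae_eq[OF U that w \<Omega>]) (use \<alpha>L in auto)
  have ext\<psi>: "ae_eq U (\<lambda>x. ext_d U (\<lambda>y. \<Omega> (?\<psi> y)) x e) (\<lambda>x. \<Sum>i\<in>UNIV. dcf M e d i * pd i \<phi> x)" if "e \<in> Ix (k + 1) N" for e
    using ext_d_ae_eq[OF U that w\<psi> \<Omega>[OF \<psi>L]] unfolding delta .
  have cod\<alpha>: "ae_eq U (\<lambda>x. codiff U k (\<lambda>y. \<Omega>' (\<alpha> y)) x e) (\<lambda>x. \<Sum>c\<in>?I. \<Sum>i\<in>UNIV. scf k M' e c i * g c i x)" if "e \<in> Ix (k - 1) N" for e
    unfolding g_def by (rule codiff_ae_eq[OF U k that w \<Omega>']) (use \<alpha>L in auto)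
  have cod\<psi>: "ae_eq U (\<lambda>x. codiff U k (\<lambda>y. \<Omega>' (?\<psi> y)) x e) (\<lambda>x. \<Sum>i\<in>UNIV. scf k M' e d i * pd i \<phi> x)" if "e \<in> Ix (k - 1) N" for e
    using codiff_ae_eq[OF U k that w\<psi> \<Omega>'[OF \<psi>L]] unfolding delta .
  \<comment> \<open>With a zero matrix in place of M' or of A, \<open>acf\<close> retains only its d
    part or only its d* part, so the bilinear expansion applies to each of the two integrals
    separately.\<close>
  have z: "dcf (\<lambda>_ _. 0) e c i = 0" "scf k (\<lambda>_ _. 0) e c i = 0" for e :: "'n set \<times> nat" and c i by (simp_all add: dcf_def scf_def)
  have 1: "ae_eq U (\<lambda>x. finner (k+1) N (mapp (k+1) N A (ext_d U (\<lambda>y. \<Omega> (\<alpha> y)) x)) (ext_d U (\<lambda>y. \<Omega> (?\<psi> y)) x))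
     (\<lambda>x. \<Sum>c\<in>?I. \<Sum>i\<in>UNIV. \<Sum>j\<in>UNIV. acf k N A M (\<lambda>_ _. 0) d c i j * (g c i x * pd j \<phi> x))"
    unfolding acf_bilinear z mult_zero_left sum.neutral_const add_0_right finner_def
  proof (rule ae_eq_sum[OF finite_Ix])
    fix e :: "'n set \<times> nat" assume e: "e \<in> Ix (k + 1) N"
    have "ae_eq U (\<lambda>x. \<Sum>e'\<in>Ix (k + 1) N. A e e' * ext_d U (\<lambda>y. \<Omega> (\<alpha> y)) x e')
        (\<lambda>x. \<Sum>e'\<in>Ix (k + 1) N. A e e' * (\<Sum>c\<in>?I. \<Sum>i\<in>UNIV. dcf M e' c i * g c i x))"
      by (rule ae_eq_sum[OF finite_Ix]) (rule ae_eq_fun[OF ext\<alpha>])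
    from ae_eq_fun2[OF this ext\<psi>[OF e], of "\<lambda>x. (*)"]
    show "ae_eq U (\<lambda>x. mapp (k + 1) N A (ext_d U (\<lambda>y. \<Omega> (\<alpha> y)) x) e * ext_d U (\<lambda>y. \<Omega> (?\<psi> y)) x e)
        (\<lambda>x. \<Sum>e'\<in>Ix (k + 1) N. A e e' * (\<Sum>c\<in>?I. \<Sum>i\<in>UNIV. dcf M e' c i * g c i x) * (\<Sum>j\<in>UNIV. dcf M e d j * pd j \<phi> x))"
      using e by (simp add: mapp_def sum_distrib_right)
  qed
  have 2: "ae_eq U (\<lambda>x. finner (k-1) N (codiff U k (\<lambda>y. \<Omega>' (\<alpha> y)) x) (codiff U k (\<lambda>y. \<Omega>' (?\<psi> y)) x))
     (\<lambda>x. \<Sum>c\<in>?I. \<Sum>i\<in>UNIV. \<Sum>j\<in>UNIV. acf k N (\<lambda>_ _. 0) M M' d c i j * (g c i x * pd j \<phi> x))"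
    unfolding acf_bilinear z mult_zero_left sum.neutral_const add_0_left finner_def
    by (rule ae_eq_sum[OF finite_Ix]) (rule ae_eq_fun2[OF cod\<alpha> cod\<psi>])
  have int: "set_integrable lebesgue U (\<lambda>x. g c i x * pd j \<phi> x)" if "c \<in> ?I" for c i j
    using w[OF that] unfolding g_def by (intro loc_int_test test_fun_pd \<phi>) (simp add: weak_pd_def)
  have lint: "(LINT x:U|lebesgue. \<Sum>c\<in>?I. \<Sum>i\<in>UNIV. \<Sum>j\<in>UNIV. a c i j * (g c i x * pd j \<phi> x))
      = (\<Sum>c\<in>?I. \<Sum>i\<in>UNIV. \<Sum>j\<in>UNIV. a c i j * (LINT x:U|lebesgue. g c i x * pd j \<phi> x))" for a
    by (rule integral_bilinear(2)[OF finite_Ix]) (rule int)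
  have "0 = (\<Sum>c\<in>?I. \<Sum>i\<in>UNIV. \<Sum>j\<in>UNIV. acf k N A M (\<lambda>_ _. 0) d c i j * (LINT x:U|lebesgue. g c i x * pd j \<phi> x))
     + (\<Sum>c\<in>?I. \<Sum>i\<in>UNIV. \<Sum>j\<in>UNIV. acf k N (\<lambda>_ _. 0) M M' d c i j * (LINT x:U|lebesgue. g c i x * pd j \<phi> x))"
    using sys[OF W120_single[OF U \<phi> d]] unfolding set_integral_ae_eq[OF 1] set_integral_ae_eq[OF 2]
      lint by simp
  also have "\<dots> = (\<Sum>c\<in>?I. \<Sum>i\<in>UNIV. \<Sum>j\<in>UNIV. acf k N A M M' d c i j * (LINT x:U|lebesgue. g c i x * pd j \<phi> x))"
    unfolding sum.distrib[symmetric] by (intro sum.cong refl) (simp add: acf_def z distrib_right)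
  also have "\<dots> = (\<Sum>c\<in>?I. \<Sum>i\<in>UNIV. \<Sum>j\<in>UNIV. - (acf k N A M M' d c i j * (LINT x:U|lebesgue. \<alpha> x c * pd i (pd j \<phi>) x)))"
  proof (intro sum.cong refl)
    fix c i j assume c: "c \<in> ?I"
    have "(LINT x:U|lebesgue. \<alpha> x c * pd i (pd j \<phi>) x) = - (LINT x:U|lebesgue. g c i x * pd j \<phi> x)"
      using w[OF c, of i] test_fun_pd[OF \<phi>] unfolding weak_pd_def g_def by blast
    then show "acf k N A M M' d c i j * (LINT x:U|lebesgue. g c i x * pd j \<phi> x)
      = - (acf k N A M M' d c i j * (LINT x:U|lebesgue. \<alpha> x c * pd i (pd j \<phi>) x))" by simp
  qed
  finally show "(\<Sum>c\<in>?I. \<Sum>i\<in>UNIV. \<Sum>j\<in>UNIV. acf k N A M M' d c i j * (LINT x:U|lebesgue. \<alpha> x c * pd i (pd j \<phi>) x)) = 0"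
    by (simp add: sum_negf)
qed

text \<open>Both systems are instances of one form: (i) with matrices \<open>I, B\<close>, (ii) with \<open>B\<inverse>, I\<close>.\<close>

lemma system_elliptic_dsol:
  fixes k N :: nat
  assumes k: "1 \<le> k" and gA: "0 < gA" "gA \<le> 1" and gB: "0 < gB"
  shows "\<exists>l L. l > 0 \<and> (\<forall>(U :: ((real, 'n::{finite,linorder}) vec) set) A B \<alpha>.
     open U \<and> legendre_elliptic (k+1) N gA A \<and> legendre_elliptic k N gB B \<and>
     opnorm (k+1) N A = nA \<and> opnorm k N B = nB \<and> W12 U k N \<alpha> \<and> (sys_i U k N A B \<alpha> \<or> sys_ii U k N A B \<alpha>)
     \<longrightarrow> (\<exists>a. elliptic (Ix k N) a l L \<and> dsol U (Ix k N) a (\<lambda>c y. \<alpha> y c)))"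
proof -
  let ?I = "Ix k N :: ('n set \<times> nat) set"
  \<comment> \<open>Bounds the norm of B and is at least 1, so that it can also serve where a vector
    is compared with itself.\<close>
  define \<beta> where "\<beta> = max 1 nB"
  have \<beta>: "\<beta> \<ge> 1" by (simp add: \<beta>_def)
  \<comment> \<open>Bounds the entries of the identity, of B and of its inverse together, so that
    one \<open>L\<close> serves both systems.\<close>
  define \<mu> where "\<mu> = 1 + \<bar>nB\<bar> + 1 / gB"
  define l where "l = gA * gB\<^sup>2 / (2 * \<beta> ^ 4 * (real (card ?I) + 1))"
  define L where "L = real (card (Ix (k + 1) N :: ('n set \<times> nat) set)) * (real (card (Ix (k + 1) N :: ('n set \<times> nat) set)) * (nA * \<mu> * \<mu>))
      + real (card (Ix (k - 1) N :: ('n set \<times> nat) set)) * (\<mu> * \<mu>)"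
  have lpos: "l > 0" unfolding l_def using gA gB \<beta> by simp
  have main: "\<exists>a. elliptic ?I a l L \<and> dsol U ?I a (\<lambda>c y. \<alpha> y c)"
    if h: "open U" "legendre_elliptic (k+1) N gA A" "legendre_elliptic k N gB B"
      "opnorm (k+1) N A = nA" "opnorm k N B = nB" "W12 U k N \<alpha>" "sys_i U k N A B \<alpha> \<or> sys_ii U k N A B \<alpha>"
    for U :: "((real, 'n) vec) set" and A B \<alpha>
  proof -
    have Ab: "\<bar>A e e'\<bar> \<le> nA" if "e \<in> Ix (k + 1) N" "e' \<in> Ix (k + 1) N" for e e'
      using entry_le_opnorm[OF that, of A] h(4) by simp
    define \<delta> :: "'n set \<times> nat \<Rightarrow> 'n set \<times> nat \<Rightarrow> real" where "\<delta> c c' = (if c' = c then 1 else 0)" for c c'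
    \<comment> \<open>Entries outside the index set are replaced by 0, so that the entry bounds hold
      for all pairs of indices.\<close>
    define B' where "B' c c' = (if c \<in> ?I \<and> c' \<in> ?I then B c c' else 0)" for c c'
    define Bi where "Bi c c' = (if c \<in> ?I \<and> c' \<in> ?I then minv k N B (unit_fv c') c else 0)" for c c'
    have \<delta>sum: "(\<Sum>c'\<in>?I. \<delta> c c' * x c') = x c" if "c \<in> ?I" for c x
      using that by (simp add: \<delta>_def if_distrib if_distribR finite_Ix cong: if_cong)
    have B'sum: "(\<Sum>c'\<in>?I. B' c c' * x c') = mapp k N B x c" if "c \<in> ?I" for c x
      using that by (simp add: B'_def mapp_def cong: sum.cong)
    have Bisum: "(\<Sum>c'\<in>?I. Bi c c' * x c') = minv k N B x c" if "c \<in> ?I" "in_Lam k N x" for c x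
      using that by (subst minv_matrix[OF h(3) that(2)]) (simp add: Bi_def cong: sum.cong)
    have \<mu>: "\<bar>\<delta> c c'\<bar> \<le> \<mu>" "\<bar>B' c c'\<bar> \<le> \<mu>" "\<bar>Bi c c'\<bar> \<le> \<mu>" for c c'
    proof -
      have p: "0 < 1 / gB" using gB by simp
      show "\<bar>\<delta> c c'\<bar> \<le> \<mu>" using p by (simp add: \<delta>_def \<mu>_def)
      show "\<bar>B' c c'\<bar> \<le> \<mu>"
      proof (cases "c \<in> ?I \<and> c' \<in> ?I")
        case True
        then have "\<bar>B c c'\<bar> \<le> nB" using entry_le_opnorm[of c k N c' B] h(5) by simp
        moreover have "nB \<le> \<bar>nB\<bar>" by simp
        ultimately have "\<bar>B c c'\<bar> \<le> \<mu>" using p unfolding \<mu>_def by linarith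
        then show ?thesis using True by (simp add: B'_def)
      next
        case False
        then show ?thesis using p by (auto simp: B'_def \<mu>_def)
      qed
      show "\<bar>Bi c c'\<bar> \<le> \<mu>"
      proof (cases "c \<in> ?I \<and> c' \<in> ?I")
        case True
        then have "\<bar>minv k N B (unit_fv c') c\<bar> \<le> 1 / gB" using minv_entry_le[OF h(3), of c c'] by simp
        moreover have "0 \<le> \<bar>nB\<bar>" by simp
        ultimately have "\<bar>minv k N B (unit_fv c') c\<bar> \<le> \<mu>" unfolding \<mu>_def by linarith
        then show ?thesis using True by (simp add: Bi_def)
      next
        case False
        then show ?thesis using p by (auto simp: Bi_def \<mu>_def)
      qed
    qed
    have ell: "gB * (fnorm k N y)\<^sup>2 \<le> finner k N (mapp k N B y) y" if "in_Lam k N y" for y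
      using h(3) that unfolding legendre_elliptic_def finner_self[symmetric] by blast
    have op: "(fnorm k N (mapp k N B y))\<^sup>2 \<le> \<beta>\<^sup>2 * (fnorm k N y)\<^sup>2" if "in_Lam k N y" for y
    proof -
      have "fnorm k N (mapp k N B y) \<le> nB * fnorm k N y" using fnorm_mapp_le[OF that, of B] h(5) by simp
      also have "\<dots> \<le> \<beta> * fnorm k N y"
        by (intro mult_right_mono) (simp_all add: \<beta>_def fnorm_L2_set)
      finally have "(fnorm k N (mapp k N B y))\<^sup>2 \<le> (\<beta> * fnorm k N y)\<^sup>2"
        by (intro power_mono) (simp_all add: fnorm_L2_set)
      then show ?thesis by (simp add: power_mult_distrib)
    qed
    have sq: "(\<Sum>c\<in>?I. (y c)\<^sup>2) = (fnorm k N y)\<^sup>2" for y by (simp add: fnorm_L2_set L2_set_power2)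
    define cut where "cut b c = (if c \<in> ?I then b c else 0)" for b :: "'n set \<times> nat \<Rightarrow> real" and c
    have cut: "in_Lam k N (cut b)" for b by (simp add: in_Lam_def cut_def)
    have cutsum: "(\<Sum>c'\<in>?I. f c' * b c') = (\<Sum>c'\<in>?I. f c' * cut b c')" for f b
      by (intro sum.cong refl) (simp add: cut_def)
    have beta1: "x \<le> \<beta>\<^sup>2 * x" if "x \<ge> 0" for x
      using mult_right_mono[of 1 "\<beta>\<^sup>2" x] \<beta> that by simp
    from h(7) show ?thesis
    proof
      assume s: "sys_i U k N A B \<alpha>"
      have "elliptic ?I (acf k N A \<delta> B') l L"
        unfolding l_def L_def
      proof (rule elliptic_acf[OF k gA gB \<beta> h(2) Ab \<mu>(1,2)])
        fix b :: "'n set \<times> nat \<Rightarrow> real"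
        have y: "(\<Sum>c'\<in>?I. \<delta> c c' * b c') = cut b c" if "c \<in> ?I" for c using \<delta>sum[OF that] that by (simp add: cut_def)
        have z: "(\<Sum>c'\<in>?I. B' c c' * b c') = mapp k N B (cut b) c" if "c \<in> ?I" for c
          by (rule trans[OF cutsum B'sum[OF that]])
        show "gB * (\<Sum>c\<in>?I. (\<Sum>c'\<in>?I. \<delta> c c' * b c')\<^sup>2) \<le> (\<Sum>c\<in>?I. (\<Sum>c'\<in>?I. B' c c' * b c') * (\<Sum>c'\<in>?I. \<delta> c c' * b c'))"
          using ell[OF cut, of b] by (simp add: y z sq finner_def cong: sum.cong)
        show "(\<Sum>c\<in>?I. (\<Sum>c'\<in>?I. B' c c' * b c')\<^sup>2) \<le> \<beta>\<^sup>2 * (\<Sum>c\<in>?I. (\<Sum>c'\<in>?I. \<delta> c c' * b c')\<^sup>2)"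
          using op[OF cut, of b] by (simp add: y z sq cong: sum.cong)
        have "(\<Sum>c\<in>?I. (b c)\<^sup>2) = (\<Sum>c\<in>?I. (cut b c)\<^sup>2)" by (intro sum.cong refl) (simp add: cut_def)
        then show "(\<Sum>c\<in>?I. (b c)\<^sup>2) \<le> \<beta>\<^sup>2 * (\<Sum>c\<in>?I. (\<Sum>c'\<in>?I. \<delta> c c' * b c')\<^sup>2)"
          using beta1[of "\<Sum>c\<in>?I. (cut b c)\<^sup>2"] by (simp add: y sum_nonneg cong: sum.cong)
      qed
      moreover have "dsol U ?I (acf k N A \<delta> B') (\<lambda>c y. \<alpha> y c)"
      proof (rule system_imp_dsol[OF h(1) k h(6), where \<Omega> = "\<lambda>\<xi>. \<xi>" and \<Omega>' = "mapp k N B"])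
        show "(LINT x:U|lebesgue. finner (k+1) N (mapp (k+1) N A (ext_d U (\<lambda>y. \<alpha> y) x)) (ext_d U (\<lambda>y. \<psi> y) x)) +
          (LINT x:U|lebesgue. finner (k-1) N (codiff U k (\<lambda>y. mapp k N B (\<alpha> y)) x) (codiff U k (\<lambda>y. mapp k N B (\<psi> y)) x)) = 0"
          if "W120 U k N \<psi>" for \<psi>
          using s that unfolding sys_i_def by blast
      qed (simp_all add: \<delta>sum B'sum)
      ultimately show ?thesis by blast
    next
      assume s: "sys_ii U k N A B \<alpha>"
      have "elliptic ?I (acf k N A Bi \<delta>) l L"
        unfolding l_def L_def
      proof (rule elliptic_acf[OF k gA gB \<beta> h(2) Ab \<mu>(3,1)])
        fix b :: "'n set \<times> nat \<Rightarrow> real"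
        \<comment> \<open>For y, the inverse image of b under B, one has z = b = B y. The required
          inequalities are then the Legendre condition and the operator bound of B at y; in the
          other system they are used at y = b itself.\<close>
        let ?y = "minv k N B (cut b)"
        note p = minv_props[OF h(3) cut, of b]
        have y: "(\<Sum>c'\<in>?I. Bi c c' * b c') = ?y c" if "c \<in> ?I" for c
          by (rule trans[OF cutsum Bisum[OF that cut]])
        have z: "(\<Sum>c'\<in>?I. \<delta> c c' * b c') = cut b c" if "c \<in> ?I" for c using \<delta>sum[OF that] that by (simp add: cut_def)
        show "gB * (\<Sum>c\<in>?I. (\<Sum>c'\<in>?I. Bi c c' * b c')\<^sup>2) \<le> (\<Sum>c\<in>?I. (\<Sum>c'\<in>?I. \<delta> c c' * b c') * (\<Sum>c'\<in>?I. Bi c c' * b c'))"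
          using ell[OF p(1)] unfolding p(2) by (simp add: y z sq finner_def cong: sum.cong)
        show le: "(\<Sum>c\<in>?I. (\<Sum>c'\<in>?I. \<delta> c c' * b c')\<^sup>2) \<le> \<beta>\<^sup>2 * (\<Sum>c\<in>?I. (\<Sum>c'\<in>?I. Bi c c' * b c')\<^sup>2)"
          using op[OF p(1)] unfolding p(2) by (simp add: y z sq cong: sum.cong)
        have "(\<Sum>c\<in>?I. (b c)\<^sup>2) = (\<Sum>c\<in>?I. (\<Sum>c'\<in>?I. \<delta> c c' * b c')\<^sup>2)" by (intro sum.cong refl) (simp add: z cut_def)
        then show "(\<Sum>c\<in>?I. (b c)\<^sup>2) \<le> \<beta>\<^sup>2 * (\<Sum>c\<in>?I. (\<Sum>c'\<in>?I. Bi c c' * b c')\<^sup>2)" using le by simp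
      qed
      moreover have "dsol U ?I (acf k N A Bi \<delta>) (\<lambda>c y. \<alpha> y c)"
      proof (rule system_imp_dsol[OF h(1) k h(6), where \<Omega> = "minv k N B" and \<Omega>' = "\<lambda>\<xi>. \<xi>"])
        show "(LINT x:U|lebesgue. finner (k+1) N (mapp (k+1) N A (ext_d U (\<lambda>y. minv k N B (\<alpha> y)) x)) (ext_d U (\<lambda>y. minv k N B (\<psi> y)) x)) +
          (LINT x:U|lebesgue. finner (k-1) N (codiff U k (\<lambda>y. \<alpha> y) x) (codiff U k (\<lambda>y. \<psi> y) x)) = 0"
          if "W120 U k N \<psi>" for \<psi>
          using s that unfolding sys_ii_def by blast
      qed (simp_all add: \<delta>sum Bisum)
      ultimately show ?thesis by blast
    qed
  qed
  show ?thesis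
    by (intro exI[of _ l] exI[of _ L] conjI allI impI, rule lpos, elim conjE, rule main; assumption)
qed

section \<open>Oscillation decay and interior bounds\<close>

text \<open>The C1 representative shows that a weak derivative exists; only then is
  \<open>wpd\<close> one, and as a weak derivative of a solution it solves the same system.\<close>

lemma dsol_wpd:
  fixes a :: "'c \<Rightarrow> 'c \<Rightarrow> 'n::finite \<Rightarrow> 'n \<Rightarrow> real"
  assumes fin: "finite I" and l: "l > 0" and a: "elliptic I a l L" and U: "open U" and u: "dsol U I a u"
  shows "dsol U I a (\<lambda>c. wpd U i (u c))"
proof -
  from C1_representative[OF fin l, where L = L and 'n = 'n]
  obtain C where C: "C \<ge> 0" and C': "\<forall>(a :: 'c \<Rightarrow> 'c \<Rightarrow> 'n::finite \<Rightarrow> 'n \<Rightarrow> real) U u. elliptic I a l L \<and> dsol U I a u \<and> open U \<longrightarrow>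
     (\<exists>v. \<forall>c\<in>I. ae_eq U (u c) (v c) \<and> (\<forall>x\<in>U. v c differentiable at x) \<and> (\<forall>i. continuous_on U (pd i (v c))) \<and>
        (\<forall>x r. r > 0 \<and> cball x r \<subseteq> U \<longrightarrow>
          \<bar>v c x\<bar> \<le> C / r ^ CARD('n) * (\<Sum>c\<in>I. LINT x:cball x r|lebesgue. \<bar>u c x\<bar>) \<and>
          (\<forall>i. \<bar>pd i (v c) x\<bar> \<le> C / r ^ (CARD('n) + 1) * (\<Sum>c\<in>I. LINT x:cball x r|lebesgue. \<bar>u c x\<bar>))))"
    by (elim exE conjE)
  from C'[rule_format, of a U u] a U u obtain v where v0: "\<forall>c\<in>I. ae_eq U (u c) (v c) \<and> (\<forall>x\<in>U. v c differentiable at x) \<and> (\<forall>i. continuous_on U (pd i (v c)))"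
    by blast
  have v: "ae_eq U (u c) (v c)" "\<And>x. x \<in> U \<Longrightarrow> v c differentiable at x" "continuous_on U (pd i (v c))" if "c \<in> I" for c
    using v0 that by blast+
  have "weak_pd U i (u c) (pd i (v c))" if "c \<in> I" for c
  proof (rule weak_pd_ae_eq[OF _ ae_eq_sym[OF v(1)[OF that]]])
    show "weak_pd U i (v c) (pd i (v c))" by (rule weak_pd_C1[OF U]) (use v[OF that] in auto)
  qed (rule ae_eq_refl[OF refl])
  then show ?thesis by (intro dsol_weak_pd[OF u]) (rule wpd_weak_pd)
qed

text \<open>Constants solve the system because the derivative of a test function has integral 0.
  This allows averages to be subtracted before the gradient bound is used.\<close>

lemma dsol_diff_const:
  fixes u :: "'c \<Rightarrow> real^'n::finite \<Rightarrow> real"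
  assumes U: "open U" and u: "dsol U I a u"
  shows "dsol U I a (\<lambda>c x. u c x - m c)"
proof -
  have "loc_int U (\<lambda>x. u c x + (- m c))" if "c \<in> I" for c
    using u that by (intro loc_int_add[OF _ loc_int_continuous[OF continuous_on_const]]) (simp add: dsol_def)
  moreover have "(LINT x:U|lebesgue. (u c x - m c) * pd i (pd j \<phi>) x) = (LINT x:U|lebesgue. u c x * pd i (pd j \<phi>) x)"
    if c: "c \<in> I" and \<phi>: "test_fun U \<phi>" for c i j \<phi>
  proof -
    have t: "test_fun U (pd i (pd j \<phi>))" by (intro test_fun_pd \<phi>)
    have l: "loc_int U (u c)" "loc_int U (\<lambda>x. m c)"
      using u c by (simp_all add: dsol_def loc_int_continuous)
    have "(LINT x:U|lebesgue. m c * pd i (pd j \<phi>) x) = - (LINT x:U|lebesgue. pd i (\<lambda>x. m c) x * pd j \<phi> x)"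
      by (rule integration_by_parts[OF U _ _ test_fun_pd[OF \<phi>]]) (simp_all add: pd_const[abs_def])
    then have "(LINT x:U|lebesgue. m c * pd i (pd j \<phi>) x) = 0" by (simp add: pd_const)
    then show ?thesis
      using set_integral_diff(2)[OF loc_int_test[OF l(1) t] loc_int_test[OF l(2) t]] by (simp add: left_diff_distrib)
  qed
  ultimately show ?thesis using u unfolding dsol_def by simp
qed

section \<open>Averages and mean squared deviations\<close>

lemma set_integral_const_lebesgue:
  fixes c :: real
  assumes "E \<in> lmeasurable"
  shows "set_integrable lebesgue E (\<lambda>x. c)" "(LINT x:E|lebesgue. c) = c * measure lebesgue E"
  using assms by (auto simp: set_integrable_def set_lebesgue_integral_def fmeasurable_def intro!: integrable_real_mult_indicator)

lemma set_integral_le: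
  fixes f g :: "'a::euclidean_space \<Rightarrow> real"
  assumes "set_integrable lebesgue E f" "set_integrable lebesgue E g" "\<And>x. x \<in> E \<Longrightarrow> f x \<le> g x"
  shows "(LINT x:E|lebesgue. f x) \<le> (LINT x:E|lebesgue. g x)"
  using assms unfolding set_integrable_def set_lebesgue_integral_def
  by (intro Bochner_Integration.integral_mono) (auto simp: indicator_def)

lemma set_integral_subset_le:
  fixes f :: "'a::euclidean_space \<Rightarrow> real"
  assumes "set_integrable lebesgue F f" "E \<in> sets lebesgue" "E \<subseteq> F" "\<And>x. x \<in> F \<Longrightarrow> 0 \<le> f x"
  shows "(LINT x:E|lebesgue. f x) \<le> (LINT x:F|lebesgue. f x)"
  using set_integrable_subset[OF assms(1-3)] assms(1,3,4) unfolding set_integrable_def set_lebesgue_integral_def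
  by (intro Bochner_Integration.integral_mono) (auto simp: indicator_def)

lemma set_integral_nonneg_lebesgue: "(\<And>x. x \<in> E \<Longrightarrow> 0 \<le> f x) \<Longrightarrow> 0 \<le> (LINT x:E|lebesgue. (f x :: real))"
  unfolding set_lebesgue_integral_def by (intro integral_nonneg_AE AE_I2) (auto simp: indicator_def)

lemma integral_square_diff:
  fixes f :: "real^'n::finite \<Rightarrow> real"
  assumes E: "E \<in> lmeasurable" and f: "set_integrable lebesgue E f" "set_integrable lebesgue E (\<lambda>x. (f x)\<^sup>2)"
  shows "(LINT x:E|lebesgue. (f x - c)\<^sup>2) = (LINT x:E|lebesgue. (f x)\<^sup>2) - 2 * c * (LINT x:E|lebesgue. f x) + c\<^sup>2 * measure lebesgue E"
    and "set_integrable lebesgue E (\<lambda>x. (f x - c)\<^sup>2)"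
proof -
  have eq: "(f x - c)\<^sup>2 = (f x)\<^sup>2 - 2 * c * f x + c\<^sup>2" for x by (simp add: power2_diff)
  have I: "set_integrable lebesgue E (\<lambda>x. (f x)\<^sup>2 - 2 * c * f x)"
    using f by (intro set_integral_diff(1)) auto
  show "(LINT x:E|lebesgue. (f x - c)\<^sup>2) = (LINT x:E|lebesgue. (f x)\<^sup>2) - 2 * c * (LINT x:E|lebesgue. f x) + c\<^sup>2 * measure lebesgue E"
    unfolding eq set_integral_add(2)[OF I set_integral_const_lebesgue(1)[OF E]] set_integral_const_lebesgue(2)[OF E]
    using set_integral_diff(2)[OF f(2) set_integrable_mult_right[OF f(1), of "2 * c"]] by simp
  show "set_integrable lebesgue E (\<lambda>x. (f x - c)\<^sup>2)"
    unfolding eq by (rule set_integral_add(1)[OF I set_integral_const_lebesgue(1)[OF E]])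
qed

definition vari :: "(real^'n::finite) set \<Rightarrow> (real^'n \<Rightarrow> real) \<Rightarrow> real" where
  "vari E f = avg E (\<lambda>x. (f x - avg E f)\<^sup>2)"

lemma vari_nonneg: "0 \<le> vari E f"
  unfolding vari_def avg_def by (intro divide_nonneg_nonneg set_integral_nonneg_lebesgue) auto

text \<open>The mean is the best constant: after expanding the squares the two sides differ by (c -
  mean)^2.\<close>

lemma vari_le:
  fixes f :: "real^'n::finite \<Rightarrow> real"
  assumes E: "E \<in> lmeasurable" "measure lebesgue E > 0" and f: "set_integrable lebesgue E f" "set_integrable lebesgue E (\<lambda>x. (f x)\<^sup>2)"
  shows "vari E f \<le> avg E (\<lambda>x. (f x - c)\<^sup>2)"
proof -
  define m where "m = measure lebesgue E"
  define A where "A = (LINT x:E|lebesgue. f x)"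
  have m: "m > 0" using E by (simp add: m_def)
  have "0 \<le> m * (c - A / m)\<^sup>2" using m by simp
  also have "\<dots> = (- 2 * c * A + c\<^sup>2 * m) - (- 2 * (A / m) * A + (A / m)\<^sup>2 * m)"
    using m by (simp add: power2_eq_square field_simps)
  finally show ?thesis
    unfolding vari_def avg_def integral_square_diff(1)[OF E(1) f] A_def[symmetric] m_def[symmetric]
    using m by (intro divide_right_mono) auto
qed

text \<open>The mean squared deviation of |f| is nonnegative.\<close>

lemma avg_abs_square_le:
  fixes f :: "real^'n::finite \<Rightarrow> real"
  assumes E: "E \<in> lmeasurable" "measure lebesgue E > 0" and f: "set_integrable lebesgue E f" "set_integrable lebesgue E (\<lambda>x. (f x)\<^sup>2)"
  shows "(avg E (\<lambda>x. \<bar>f x\<bar>))\<^sup>2 \<le> avg E (\<lambda>x. (f x)\<^sup>2)"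
proof -
  define m where "m = measure lebesgue E"
  define A where "A = (LINT x:E|lebesgue. \<bar>f x\<bar>)"
  have m: "m > 0" using E by (simp add: m_def)
  have "0 \<le> (LINT x:E|lebesgue. (\<bar>f x\<bar> - A / m)\<^sup>2)" by (rule set_integral_nonneg_lebesgue) simp
  also have "\<dots> = (LINT x:E|lebesgue. (f x)\<^sup>2) - 2 * (A / m) * A + (A / m)\<^sup>2 * m"
    using integral_square_diff(1)[OF E(1) set_integrable_abs[OF f(1)]] f(2) by (simp add: A_def m_def)
  also have "\<dots> = (LINT x:E|lebesgue. (f x)\<^sup>2) - (A / m)\<^sup>2 * m"
    using m by (simp add: power2_eq_square field_simps)
  finally show ?thesis
    unfolding avg_def A_def[symmetric] m_def[symmetric] using m by (simp add: pos_le_divide_eq)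
qed

lemma measure_ball_scale:
  fixes x :: "real^'n::finite"
  assumes "r > 0"
  shows "measure lebesgue (ball x r) = measure lebesgue (ball (0::real^'n) 1) * r ^ CARD('n)"
  using content_ball_conv_unit_ball[of r x] assms by (simp add: mult.commute)

lemma measure_unit_ball_pos: "measure lebesgue (ball (0::real^'n::finite) 1) > 0"
  using content_ball_pos[of 1 "0::real^'n"] by simp

lemma pd_lipschitz:
  fixes f :: "real^'n::finite \<Rightarrow> real"
  assumes d: "\<And>y. y \<in> ball x0 r \<Longrightarrow> f differentiable at y" and b: "\<And>i y. y \<in> ball x0 r \<Longrightarrow> \<bar>pd i f y\<bar> \<le> G"
    and x: "x \<in> ball x0 r"
  shows "\<bar>f x - f x0\<bar> \<le> real CARD('n) * G * r"
proof -
  have r: "r > 0" using x by (metis dist_self dist_not_less_zero mem_ball not_less_iff_gr_or_eq order_less_trans zero_le_dist order_le_less_trans)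
  have G: "G \<ge> 0" using order_trans[OF abs_ge_zero b[OF x]] .
  have "norm (f x - f x0) \<le> real CARD('n) * G * norm (x - x0)"
  proof (rule differentiable_bound[OF convex_ball[of x0 r]])
    fix y assume y: "y \<in> ball x0 r"
    show "(f has_derivative (\<lambda>h. \<Sum>i\<in>UNIV. h $ i * pd i f y)) (at y within ball x0 r)"
      using has_derivative_pd[OF d[OF y]] by (rule has_derivative_at_withinI)
    show "onorm (\<lambda>h. \<Sum>i\<in>UNIV. h $ i * pd i f y) \<le> real CARD('n) * G"
    proof (rule onorm_le)
      fix h :: "real^'n"
      have "norm (\<Sum>i\<in>UNIV. h $ i * pd i f y) \<le> (\<Sum>i\<in>(UNIV::'n set). norm h * G)"
      proof (rule order_trans[OF norm_sum], rule sum_mono)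
        fix i show "norm (h $ i * pd i f y) \<le> norm h * G"
          using mult_mono[OF component_le_norm_cart[of h i] b[OF y, of i]] by (simp add: abs_mult)
      qed
      then show "norm (\<Sum>i\<in>UNIV. h $ i * pd i f y) \<le> real CARD('n) * G * norm h" by (simp add: mult_ac)
    qed
  qed (use x r in auto)
  also have "\<dots> \<le> real CARD('n) * G * r"
    using x G by (intro mult_left_mono) (auto simp: dist_norm norm_minus_commute)
  finally show ?thesis by simp
qed

section \<open>Decay and interior bounds for general systems\<close>

lemma osc_decay:
  fixes I :: "'c set"
  assumes fin: "finite I" and l: "l > 0"
  shows "\<exists>K\<ge>0. \<forall>(a :: 'c \<Rightarrow> 'c \<Rightarrow> 'n::finite \<Rightarrow> 'n \<Rightarrow> real) U u x0 \<rho> r. elliptic I a l L \<and> dsol U I a u \<and> open U \<and>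
     0 < \<rho> \<and> \<rho> \<le> r \<and> cball x0 r \<subseteq> U \<and> (\<forall>c\<in>I. set_integrable lebesgue (ball x0 r) (\<lambda>x. (u c x)\<^sup>2)) \<longrightarrow>
     (\<Sum>c\<in>I. vari (ball x0 \<rho>) (u c)) \<le> (K * (\<rho> / r))\<^sup>2 * (\<Sum>c\<in>I. vari (ball x0 r) (u c))"
proof -
  from C1_representative[OF fin l, where L = L and 'n = 'n]
  obtain C where C: "C \<ge> 0" and C': "\<forall>(a :: 'c \<Rightarrow> 'c \<Rightarrow> 'n::finite \<Rightarrow> 'n \<Rightarrow> real) U u. elliptic I a l L \<and> dsol U I a u \<and> open U \<longrightarrow>
     (\<exists>v. \<forall>c\<in>I. ae_eq U (u c) (v c) \<and> (\<forall>x\<in>U. v c differentiable at x) \<and> (\<forall>i. continuous_on U (pd i (v c))) \<and>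
        (\<forall>x r. r > 0 \<and> cball x r \<subseteq> U \<longrightarrow>
          \<bar>v c x\<bar> \<le> C / r ^ CARD('n) * (\<Sum>c\<in>I. LINT x:cball x r|lebesgue. \<bar>u c x\<bar>) \<and>
          (\<forall>i. \<bar>pd i (v c) x\<bar> \<le> C / r ^ (CARD('n) + 1) * (\<Sum>c\<in>I. LINT x:cball x r|lebesgue. \<bar>u c x\<bar>))))"
    by (elim exE conjE)
  define \<omega> where "\<omega> = measure lebesgue (ball (0::real^'n) 1)"
  have \<omega>: "\<omega> > 0" unfolding \<omega>_def by (rule measure_unit_ball_pos)
  let ?n = "CARD('n)"
  \<comment> \<open>\<open>card I\<close> comes from summing over components and from
    Cauchy-Schwarz, the dimension from the Lipschitz bound, C 2^(n+1) from the gradient estimate on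
    balls of radius r/2, and \<omega> from the volume that relates integrals to averages.\<close>
  define K1 where "K1 = real (card I) * real ?n * C * 2 ^ (?n + 1) * \<omega>"
  \<comment> \<open>For \<rho> > r/2 the volumes of the two balls have ratio at most 2^n; the
    remaining factor 2 compensates \<rho>/r > 1/2.\<close>
  define K2 :: real where "K2 = 2 ^ (?n + 1)"
  have K1: "K1 \<ge> 0" and K2: "K2 \<ge> 0" using C \<omega> by (simp_all add: K1_def K2_def)
  have main: "(\<Sum>c\<in>I. vari (ball x0 \<rho>) (u c)) \<le> ((K1 + K2) * (\<rho> / r))\<^sup>2 * (\<Sum>c\<in>I. vari (ball x0 r) (u c))"
    if h: "elliptic I a l L" "dsol U I a u" "open U" "0 < \<rho>" "\<rho> \<le> r" "cball x0 r \<subseteq> U"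
      "\<forall>c\<in>I. set_integrable lebesgue (ball x0 r) (\<lambda>x. (u c x)\<^sup>2)"
    for a :: "'c \<Rightarrow> 'c \<Rightarrow> 'n \<Rightarrow> 'n \<Rightarrow> real" and U u x0 \<rho> r
  proof -
    have r: "r > 0" using h(4,5) by linarith
    let ?B = "ball x0 r" and ?b = "ball x0 \<rho>"
    have bB: "?b \<subseteq> ?B" using h(5) by auto
    have mB: "measure lebesgue ?B = \<omega> * r ^ ?n" and mb: "measure lebesgue ?b = \<omega> * \<rho> ^ ?n"
      unfolding \<omega>_def by (rule measure_ball_scale[OF r], rule measure_ball_scale[OF h(4)])
    have mpos: "measure lebesgue ?B > 0" "measure lebesgue ?b > 0" unfolding mB mb using \<omega> r h(4) by simp_all
    have uB: "set_integrable lebesgue ?B (u c)" if "c \<in> I" for c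
    proof (rule set_integrable_subset)
      show "set_integrable lebesgue (cball x0 r) (u c)" using h(2,6) that by (simp add: dsol_def loc_int_def)
    qed auto
    have u2B: "set_integrable lebesgue ?B (\<lambda>x. (u c x)\<^sup>2)" if "c \<in> I" for c using h(7) that by blast
    have ub: "set_integrable lebesgue ?b (u c)" "set_integrable lebesgue ?b (\<lambda>x. (u c x)\<^sup>2)" if "c \<in> I" for c
      using set_integrable_subset[OF uB[OF that] _ bB] set_integrable_subset[OF u2B[OF that] _ bB] by simp_all
    define m where "m c = avg ?B (u c)" for c
    let ?S = "\<Sum>c\<in>I. vari ?B (u c)"
    have S0: "?S \<ge> 0" by (intro sum_nonneg vari_nonneg)
    have V: "vari ?B (u c) = (LINT x:?B|lebesgue. (u c x - m c)\<^sup>2) / (\<omega> * r ^ ?n)" for c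
      unfolding vari_def m_def avg_def[of _ "\<lambda>x. (u c x - _)\<^sup>2"] mB ..
    show ?thesis
    proof (cases "\<rho> \<le> r / 2")
      case False
      have "vari ?b (u c) \<le> 2 ^ ?n * vari ?B (u c)" if c: "c \<in> I" for c
      proof -
        have "vari ?b (u c) \<le> (LINT x:?b|lebesgue. (u c x - m c)\<^sup>2) / (\<omega> * \<rho> ^ ?n)"
          using vari_le[OF lmeasurable_ball mpos(2) ub[OF c], of "m c"] unfolding avg_def mb .
        also have "\<dots> \<le> (LINT x:?B|lebesgue. (u c x - m c)\<^sup>2) / (\<omega> * \<rho> ^ ?n)"
          using \<omega> h(4) by (intro divide_right_mono set_integral_subset_le integral_square_diff(2)[OF lmeasurable_ball uB[OF c] u2B[OF c]] bB) auto
        also have "\<dots> = vari ?B (u c) * (r / \<rho>) ^ ?n"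
          unfolding V using \<omega> r h(4) by (simp add: power_divide)
        also have "\<dots> \<le> vari ?B (u c) * 2 ^ ?n"
          using False r h(4) by (intro mult_left_mono power_mono vari_nonneg) (auto simp: pos_divide_le_eq)
        finally show ?thesis by (simp add: mult.commute)
      qed
      then have "(\<Sum>c\<in>I. vari ?b (u c)) \<le> 2 ^ ?n * ?S" unfolding sum_distrib_left by (rule sum_mono)
      also have "\<dots> \<le> ((K1 + K2) * (\<rho> / r))\<^sup>2 * ?S"
      proof (rule mult_right_mono[OF _ S0])
        have "2 ^ ?n * 1 \<le> (2::real) ^ ?n * (2 * (\<rho> / r))" using False r by (intro mult_left_mono) (auto simp: field_simps)
        then have "2 ^ ?n \<le> K2 * (\<rho> / r)" by (simp add: K2_def mult_ac)
        also have "\<dots> \<le> (K1 + K2) * (\<rho> / r)" using K1 r h(4) by (intro mult_right_mono) auto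
        finally have 1: "2 ^ ?n \<le> (K1 + K2) * (\<rho> / r)" .
        have "(2::real) ^ ?n * 1 \<le> 2 ^ ?n * 2 ^ ?n" by (intro mult_left_mono) auto
        also have "\<dots> = (2 ^ ?n)\<^sup>2" by (simp add: power2_eq_square)
        also have "\<dots> \<le> ((K1 + K2) * (\<rho> / r))\<^sup>2" using 1 by (intro power_mono) auto
        finally show "2 ^ ?n \<le> ((K1 + K2) * (\<rho> / r))\<^sup>2" by simp
      qed
      finally show ?thesis .
    next
      case True
      define u' where "u' c x = u c x - m c" for c x
      have u': "dsol U I a u'" unfolding u'_def[abs_def] by (rule dsol_diff_const[OF h(3,2)])
      have u'B: "set_integrable lebesgue ?B (u' c)" "set_integrable lebesgue ?B (\<lambda>x. (u' c x)\<^sup>2)" if "c \<in> I" for c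
        unfolding u'_def
        by (rule set_integral_diff(1)[OF uB[OF that] set_integral_const_lebesgue(1)[OF lmeasurable_ball]],
            rule integral_square_diff(2)[OF lmeasurable_ball uB[OF that] u2B[OF that]])
      obtain v where v: "\<forall>c\<in>I. ae_eq U (u' c) (v c) \<and> (\<forall>x\<in>U. v c differentiable at x) \<and> (\<forall>i. continuous_on U (pd i (v c))) \<and>
        (\<forall>x r. r > 0 \<and> cball x r \<subseteq> U \<longrightarrow>
          \<bar>v c x\<bar> \<le> C / r ^ CARD('n) * (\<Sum>c\<in>I. LINT x:cball x r|lebesgue. \<bar>u' c x\<bar>) \<and>
          (\<forall>i. \<bar>pd i (v c) x\<bar> \<le> C / r ^ (CARD('n) + 1) * (\<Sum>c\<in>I. LINT x:cball x r|lebesgue. \<bar>u' c x\<bar>)))"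
        using C'[rule_format, of a U u'] h(1,3) u' by blast
      define W where "W = (\<Sum>c\<in>I. LINT x:?B|lebesgue. \<bar>u' c x\<bar>)"
      have W0: "W \<ge> 0" unfolding W_def by (intro sum_nonneg set_integral_nonneg_lebesgue) auto
      define G where "G = C / (r/2) ^ (?n + 1) * W"
      have G0: "G \<ge> 0" unfolding G_def using C W0 r by simp
      have G: "\<bar>pd i (v c) x\<bar> \<le> G" if c: "c \<in> I" and x: "x \<in> ?b" for c i x
      proof -
        \<comment> \<open>This is where \<rho> \<le> r/2 is used: every point of the small ball has
          a ball of radius r/2 inside the large one.\<close>
        have sub: "cball x (r/2) \<subseteq> ?B"
        proof
          fix y assume "y \<in> cball x (r/2)"
          then have "dist x0 y < r" using x True dist_triangle[of x0 y x] by simp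
          then show "y \<in> ?B" by simp
        qed
        then have "cball x (r/2) \<subseteq> U" using h(6) ball_subset_cball by blast
        then have "\<bar>pd i (v c) x\<bar> \<le> C / (r/2) ^ (?n + 1) * (\<Sum>c\<in>I. LINT x:cball x (r/2)|lebesgue. \<bar>u' c x\<bar>)"
          using v c r half_gt_zero by blast
        also have "\<dots> \<le> G"
          unfolding G_def W_def using C r
          by (intro mult_left_mono sum_mono set_integral_subset_le sub set_integrable_abs u'B) auto
        finally show ?thesis .
      qed
      have bU: "?b \<subseteq> U" using bB h(6) ball_subset_cball by blast
      define M where "M = real ?n * G * \<rho>"
      have lip: "\<bar>v c x - v c x0\<bar> \<le> M" if c: "c \<in> I" and x: "x \<in> ?b" for c x
        unfolding M_def by (rule pd_lipschitz[OF _ _ x]) (use v c bU G[OF c] in auto)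
      have M0: "M \<ge> 0" using G0 h(4) by (simp add: M_def)
      have vb: "vari ?b (u c) \<le> M\<^sup>2" if c: "c \<in> I" for c
      proof -
        \<comment> \<open>The average over the small ball is replaced by this constant, the value of
          the representative at the centre; minimality of the mean permits it.\<close>
        let ?k = "m c + v c x0"
        have ae: "ae_eq ?b (\<lambda>x. (u c x - ?k)\<^sup>2) (\<lambda>x. (v c x - v c x0)\<^sup>2)"
        proof -
          have "ae_eq ?b (u' c) (v c)" using v c ae_eq_subset bU by blast
          from ae_eq_fun[OF this, of "\<lambda>x t. (t - v c x0)\<^sup>2"] show ?thesis by (simp add: u'_def algebra_simps)
        qed
        have int: "set_integrable lebesgue ?b (\<lambda>x. (u c x - ?k)\<^sup>2)"
          by (rule integral_square_diff(2)[OF lmeasurable_ball ub[OF c]])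
        have "(LINT x:?b|lebesgue. (u c x - ?k)\<^sup>2) = (LINT x:?b|lebesgue. (v c x - v c x0)\<^sup>2)"
          by (rule set_integral_ae_eq[OF ae])
        also have "\<dots> \<le> (LINT x:?b|lebesgue. M\<^sup>2)"
        proof (rule set_integral_le)
          show "set_integrable lebesgue ?b (\<lambda>x. (v c x - v c x0)\<^sup>2)" using int set_integrable_ae_eq[OF ae] by blast
          show "(v c x - v c x0)\<^sup>2 \<le> M\<^sup>2" if "x \<in> ?b" for x
            using power_mono[OF lip[OF c that], of 2] by simp
        qed (rule set_integral_const_lebesgue(1)[OF lmeasurable_ball])
        also have "\<dots> = M\<^sup>2 * measure lebesgue ?b" by (rule set_integral_const_lebesgue(2)[OF lmeasurable_ball])
        finally have "avg ?b (\<lambda>x. (u c x - ?k)\<^sup>2) \<le> M\<^sup>2" unfolding avg_def using mpos(2) by (simp add: pos_divide_le_eq)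
        then show ?thesis using vari_le[OF lmeasurable_ball mpos(2) ub[OF c], of ?k] by linarith
      qed
      have W2: "W\<^sup>2 \<le> real (card I) * ((\<omega> * r ^ ?n)\<^sup>2 * ?S)"
      proof -
        have "W\<^sup>2 \<le> (\<Sum>c\<in>I. (LINT x:?B|lebesgue. \<bar>u' c x\<bar>)\<^sup>2) * real (card I)"
          unfolding W_def by (rule sum_squared_le_sum_of_squares)
        also have "\<dots> \<le> (\<Sum>c\<in>I. (\<omega> * r ^ ?n)\<^sup>2 * vari ?B (u c)) * real (card I)"
        proof (intro mult_right_mono sum_mono)
          fix c assume c: "c \<in> I"
          have "(avg ?B (\<lambda>x. \<bar>u' c x\<bar>))\<^sup>2 \<le> vari ?B (u c)"
            using avg_abs_square_le[OF lmeasurable_ball mpos(1) u'B[OF c]] unfolding vari_def u'_def m_def .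
          then have "(\<omega> * r ^ ?n)\<^sup>2 * (avg ?B (\<lambda>x. \<bar>u' c x\<bar>))\<^sup>2 \<le> (\<omega> * r ^ ?n)\<^sup>2 * vari ?B (u c)"
            by (intro mult_left_mono) auto
          moreover have "(\<omega> * r ^ ?n) * avg ?B (\<lambda>x. \<bar>u' c x\<bar>) = (LINT x:?B|lebesgue. \<bar>u' c x\<bar>)"
            unfolding avg_def mB using \<omega> r by simp
          ultimately show "(LINT x:?B|lebesgue. \<bar>u' c x\<bar>)\<^sup>2 \<le> (\<omega> * r ^ ?n)\<^sup>2 * vari ?B (u c)"
            by (simp only: power_mult_distrib[symmetric])
        qed simp
        finally show ?thesis by (simp only: sum_distrib_left[symmetric] mult.commute[of _ "real (card I)"])
      qed
      have "(\<Sum>c\<in>I. vari ?b (u c)) \<le> real (card I) * M\<^sup>2" using sum_mono[OF vb] by simp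
      also have "\<dots> = real (card I) * (real ?n * \<rho> * C / (r/2) ^ (?n + 1))\<^sup>2 * W\<^sup>2"
        by (simp add: M_def G_def power_mult_distrib power_divide mult_ac)
      also have "\<dots> \<le> real (card I) * (real ?n * \<rho> * C / (r/2) ^ (?n + 1))\<^sup>2 * (real (card I) * ((\<omega> * r ^ ?n)\<^sup>2 * ?S))"
        using W2 by (intro mult_left_mono) auto
      also have "\<dots> = (real (card I) * (real ?n * \<rho> * C / (r/2) ^ (?n + 1)) * (\<omega> * r ^ ?n))\<^sup>2 * ?S"
      proof -
        have "c * X\<^sup>2 * (c * (Y\<^sup>2 * S)) = (c * X * Y)\<^sup>2 * S" for c X Y S :: real
          by (simp add: power2_eq_square)
        then show ?thesis .
      qed
      also have "real (card I) * (real ?n * \<rho> * C / (r/2) ^ (?n + 1)) * (\<omega> * r ^ ?n) = K1 * (\<rho> / r)"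
        unfolding K1_def using r by (simp add: power_divide)
      also have "(K1 * (\<rho> / r))\<^sup>2 * ?S \<le> ((K1 + K2) * (\<rho> / r))\<^sup>2 * ?S"
        using K1 K2 r h(4) by (intro mult_right_mono[OF _ S0] power_mono mult_right_mono[of K1]) auto
      finally show ?thesis .
    qed
  qed
  have "K1 + K2 \<ge> 0" using K1 K2 by simp
  then show ?thesis
    by (intro exI[of _ "K1 + K2"] conjI allI impI, assumption, elim conjE) (rule main; assumption)
qed

lemma dsol_continuous_rep:
  fixes a :: "'c \<Rightarrow> 'c \<Rightarrow> 'n::finite \<Rightarrow> 'n \<Rightarrow> real"
  assumes fin: "finite I" and l: "l > 0" and a: "elliptic I a l L" and U: "open U" and u: "dsol U I a u"
  shows "\<exists>v. \<forall>c\<in>I. ae_eq U (u c) (v c) \<and> continuous_on U (v c)"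
proof -
  from C1_representative[OF fin l, where L = L and 'n = 'n]
  obtain C where C: "C \<ge> 0" and C': "\<forall>(a :: 'c \<Rightarrow> 'c \<Rightarrow> 'n::finite \<Rightarrow> 'n \<Rightarrow> real) U u. elliptic I a l L \<and> dsol U I a u \<and> open U \<longrightarrow>
     (\<exists>v. \<forall>c\<in>I. ae_eq U (u c) (v c) \<and> (\<forall>x\<in>U. v c differentiable at x) \<and> (\<forall>i. continuous_on U (pd i (v c))) \<and>
        (\<forall>x r. r > 0 \<and> cball x r \<subseteq> U \<longrightarrow>
          \<bar>v c x\<bar> \<le> C / r ^ CARD('n) * (\<Sum>c\<in>I. LINT x:cball x r|lebesgue. \<bar>u c x\<bar>) \<and>
          (\<forall>i. \<bar>pd i (v c) x\<bar> \<le> C / r ^ (CARD('n) + 1) * (\<Sum>c\<in>I. LINT x:cball x r|lebesgue. \<bar>u c x\<bar>))))"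
    by (elim exE conjE)
  from C'[rule_format, of a U u] a U u obtain v where v: "\<forall>c\<in>I. ae_eq U (u c) (v c) \<and> (\<forall>x\<in>U. v c differentiable at x)"
    by blast
  have "continuous_on U (v c)" if "c \<in> I" for c
    using v that by (intro continuous_at_imp_continuous_on ballI differentiable_imp_continuous_within) blast
  then show ?thesis using v by blast
qed

text \<open>Only the open ball of radius r is known to lie in U. The closed ball of radius 3r/4 is
  compact inside it, so the integrals there are finite, and balls of radius r/8 around points of the
  half ball stay within it.\<close>

lemma sup_bound:
  fixes I :: "'c set"
  assumes fin: "finite I" and l: "l > 0"
  shows "\<exists>K\<ge>0. \<forall>(a :: 'c \<Rightarrow> 'c \<Rightarrow> 'n::finite \<Rightarrow> 'n \<Rightarrow> real) U u x0 r. elliptic I a l L \<and> dsol U I a u \<and> open U \<and>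
     0 < r \<and> ball x0 r \<subseteq> U \<longrightarrow>
     (\<exists>v. \<forall>c\<in>I. ae_eq (ball x0 (r/2)) (u c) (v c) \<and>
        (\<forall>x\<in>ball x0 (r/2). \<bar>v c x\<bar> \<le> K / r ^ CARD('n) * (\<Sum>c\<in>I. LINT x:ball x0 (3*r/4)|lebesgue. \<bar>u c x\<bar>)))"
proof -
  from C1_representative[OF fin l, where L = L and 'n = 'n]
  obtain C where C: "C \<ge> 0" and C': "\<forall>(a :: 'c \<Rightarrow> 'c \<Rightarrow> 'n::finite \<Rightarrow> 'n \<Rightarrow> real) U u. elliptic I a l L \<and> dsol U I a u \<and> open U \<longrightarrow>
     (\<exists>v. \<forall>c\<in>I. ae_eq U (u c) (v c) \<and> (\<forall>x\<in>U. v c differentiable at x) \<and> (\<forall>i. continuous_on U (pd i (v c))) \<and>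
        (\<forall>x r. r > 0 \<and> cball x r \<subseteq> U \<longrightarrow>
          \<bar>v c x\<bar> \<le> C / r ^ CARD('n) * (\<Sum>c\<in>I. LINT x:cball x r|lebesgue. \<bar>u c x\<bar>) \<and>
          (\<forall>i. \<bar>pd i (v c) x\<bar> \<le> C / r ^ (CARD('n) + 1) * (\<Sum>c\<in>I. LINT x:cball x r|lebesgue. \<bar>u c x\<bar>))))"
    by (elim exE conjE)
  \<comment> \<open>The pointwise bound is used with radius r/8, which is admissible since r/2 + r/8
    < 3r/4; this produces 8^n.\<close>
  let ?K = "C * 8 ^ CARD('n)"
  have main: "\<exists>v. \<forall>c\<in>I. ae_eq (ball x0 (r/2)) (u c) (v c) \<and>
        (\<forall>x\<in>ball x0 (r/2). \<bar>v c x\<bar> \<le> ?K / r ^ CARD('n) * (\<Sum>c\<in>I. LINT x:ball x0 (3*r/4)|lebesgue. \<bar>u c x\<bar>))"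
    if h: "elliptic I a l L" "dsol U I a u" "open U" "0 < r" "ball x0 r \<subseteq> U"
    for a :: "'c \<Rightarrow> 'c \<Rightarrow> 'n \<Rightarrow> 'n \<Rightarrow> real" and U u x0 r
  proof -
    from C'[rule_format, of a U u] h(1-3) obtain v where v: "\<forall>c\<in>I. ae_eq U (u c) (v c) \<and>
        (\<forall>x r. r > 0 \<and> cball x r \<subseteq> U \<longrightarrow>
          \<bar>v c x\<bar> \<le> C / r ^ CARD('n) * (\<Sum>c\<in>I. LINT x:cball x r|lebesgue. \<bar>u c x\<bar>))"
      by blast
    have "cball x0 (3*r/4) \<subseteq> ball x0 r" using h(4) by auto
    then have "cball x0 (3*r/4) \<subseteq> U" using h(5) by blast
    then have uc: "set_integrable lebesgue (cball x0 (3*r/4)) (u c)" if "c \<in> I" for c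
      using h(2) that by (simp add: dsol_def loc_int_def)
    have uB: "set_integrable lebesgue (ball x0 (3*r/4)) (u c)" if "c \<in> I" for c
      by (rule set_integrable_subset[OF uc[OF that]]) auto
    have "\<bar>v c x\<bar> \<le> ?K / r ^ CARD('n) * (\<Sum>c\<in>I. LINT x:ball x0 (3*r/4)|lebesgue. \<bar>u c x\<bar>)"
      if c: "c \<in> I" and x: "x \<in> ball x0 (r/2)" for c x
    proof -
      have sub: "cball x (r/8) \<subseteq> ball x0 (3*r/4)"
      proof
        fix y assume "y \<in> cball x (r/8)"
        then have "dist x0 y < 3*r/4" using x h(4) dist_triangle[of x0 y x] by simp
        then show "y \<in> ball x0 (3*r/4)" by simp
      qed
      have "ball x0 (3*r/4) \<subseteq> ball x0 r" using h(4) by auto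
      then have "cball x (r/8) \<subseteq> U" using sub h(5) by blast
      moreover have "r / 8 > 0" using h(4) by simp
      ultimately have "\<bar>v c x\<bar> \<le> C / (r/8) ^ CARD('n) * (\<Sum>c\<in>I. LINT x:cball x (r/8)|lebesgue. \<bar>u c x\<bar>)"
        using v c by blast
      also have "\<dots> \<le> C / (r/8) ^ CARD('n) * (\<Sum>c\<in>I. LINT x:ball x0 (3*r/4)|lebesgue. \<bar>u c x\<bar>)"
        using C h(4) by (intro mult_left_mono sum_mono set_integral_subset_le sub set_integrable_abs uB) auto
      finally show ?thesis by (simp add: power_divide)
    qed
    moreover have "ball x0 (r/2) \<subseteq> U"
      using h(4) by (intro order_trans[OF _ h(5)] subset_ball) simp
    ultimately show ?thesis using v ae_eq_subset by (intro exI[of _ v]) blast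
  qed
  have "?K \<ge> 0" using C by simp
  then show ?thesis
    by (intro exI[of _ ?K] conjI allI impI, assumption, elim conjE) (rule main; assumption)
qed

text \<open>Integrate \<open>t \<le> M + M powr (1 - p) * t powr p\<close> and optimise in \<open>M\<close>.\<close>

lemma avg_le_powr:
  fixes T :: "real^'n::finite \<Rightarrow> real"
  assumes E: "E \<in> lmeasurable" "measure lebesgue E > 0" and T0: "\<And>x. 0 \<le> T x" and p: "p > 1"
    and I: "set_integrable lebesgue E T" "set_integrable lebesgue E (\<lambda>x. T x powr p)"
  shows "avg E T \<le> 2 * avg E (\<lambda>x. T x powr p) powr (1/p)"
proof -
  define m where "m = measure lebesgue E"
  have m: "m > 0" using E by (simp add: m_def)
  define A where "A = avg E (\<lambda>x. T x powr p)"
  have A0: "A \<ge> 0" unfolding A_def avg_def by (intro divide_nonneg_nonneg set_integral_nonneg_lebesgue) auto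
  have ineq: "t \<le> M + M powr (1 - p) * t powr p" if "M > 0" "t \<ge> 0" for M t :: real
  proof (cases "t \<le> M")
    case True
    then show ?thesis using that by (simp add: add_increasing2)
  next
    case False
    then have t: "t > 0" "M \<le> t" using that by auto
    have "t = t powr (1 - p) * t powr p" using t by (simp flip: powr_add)
    also have "\<dots> \<le> M powr (1 - p) * t powr p"
      using that t p by (intro mult_right_mono powr_mono2') auto
    finally show ?thesis using that by linarith
  qed
  have le: "avg E T \<le> M + M powr (1 - p) * A" if M: "M > 0" for M
  proof -
    note J = set_integral_const_lebesgue[OF E(1), of M] set_integrable_mult_right[OF I(2), of "M powr (1 - p)"]
    have "(LINT x:E|lebesgue. T x) \<le> (LINT x:E|lebesgue. M + M powr (1 - p) * T x powr p)"
      using J ineq[OF M T0] by (intro set_integral_le I set_integral_add(1)) auto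
    also have "\<dots> = M * m + M powr (1 - p) * (LINT x:E|lebesgue. T x powr p)"
      using set_integral_add(2)[OF J(1) J(3)] J(2) by (simp add: m_def)
    finally have "avg E T \<le> (M * m + M powr (1 - p) * (LINT x:E|lebesgue. T x powr p)) / m"
      unfolding avg_def m_def[symmetric] using m by (intro divide_right_mono) auto
    also have "\<dots> = M + M powr (1 - p) * A"
      unfolding A_def avg_def m_def[symmetric] using m by (simp add: field_simps)
    finally show ?thesis .
  qed
  show ?thesis
  proof (cases "A = 0")
    case True
    \<comment> \<open>With A = 0 the bound is M for every positive M.\<close>
    have "avg E T \<le> 0"
      by (rule field_le_epsilon) (use le True in auto)
    then show ?thesis unfolding A_def[symmetric] True by simp
  next
    case False
    then have A: "A > 0" using A0 by simp
    \<comment> \<open>The choice M = A powr (1/p) makes the two terms equal, which explains the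
      factor 2.\<close>
    have "avg E T \<le> A powr (1/p) + (A powr (1/p)) powr (1 - p) * A" using le A by simp
    also have "(A powr (1/p)) powr (1 - p) * A = A powr (1/p)"
    proof -
      have "(A powr (1/p)) powr (1 - p) * A = A powr ((1/p) * (1 - p)) * A powr 1" using A by (simp add: powr_powr)
      also have "\<dots> = A powr ((1/p) * (1 - p) + 1)" by (simp only: powr_add)
      also have "(1/p) * (1 - p) + 1 = 1/p" using p by (simp add: field_simps)
      finally show ?thesis .
    qed
    finally show ?thesis by (simp add: A_def)
  qed
qed

section \<open>Transfer to the Hessian\<close>

lemma set_integral_sum3:
  fixes F :: "'c \<Rightarrow> 'i \<Rightarrow> 'j \<Rightarrow> 'x \<Rightarrow> real"
  assumes "finite I" "finite J" "finite K" "\<And>c i j. c \<in> I \<Longrightarrow> i \<in> J \<Longrightarrow> j \<in> K \<Longrightarrow> set_integrable M E (F c i j)"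
  shows "set_integrable M E (\<lambda>x. \<Sum>c\<in>I. \<Sum>i\<in>J. \<Sum>j\<in>K. F c i j x)"
    "(LINT x:E|M. \<Sum>c\<in>I. \<Sum>i\<in>J. \<Sum>j\<in>K. F c i j x) = (\<Sum>c\<in>I. \<Sum>i\<in>J. \<Sum>j\<in>K. LINT x:E|M. F c i j x)"
proof -
  have 1: "set_integrable M E (\<lambda>x. \<Sum>j\<in>K. F c i j x)" "(LINT x:E|M. \<Sum>j\<in>K. F c i j x) = (\<Sum>j\<in>K. LINT x:E|M. F c i j x)"
    if "c \<in> I" "i \<in> J" for c i
    by (rule set_integral_sum'(1)[OF assms(3)], rule assms(4)[OF that], assumption,
        rule set_integral_sum'(2)[OF assms(3)], rule assms(4)[OF that], assumption)
  have 2: "set_integrable M E (\<lambda>x. \<Sum>i\<in>J. \<Sum>j\<in>K. F c i j x)"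
    "(LINT x:E|M. \<Sum>i\<in>J. \<Sum>j\<in>K. F c i j x) = (\<Sum>i\<in>J. \<Sum>j\<in>K. LINT x:E|M. F c i j x)" if "c \<in> I" for c
  proof -
    show "set_integrable M E (\<lambda>x. \<Sum>i\<in>J. \<Sum>j\<in>K. F c i j x)"
      by (rule set_integral_sum'(1)[OF assms(2)]) (rule 1(1)[OF that])
    have "(LINT x:E|M. \<Sum>i\<in>J. \<Sum>j\<in>K. F c i j x) = (\<Sum>i\<in>J. LINT x:E|M. \<Sum>j\<in>K. F c i j x)"
      by (rule set_integral_sum'(2)[OF assms(2)]) (rule 1(1)[OF that])
    then show "(LINT x:E|M. \<Sum>i\<in>J. \<Sum>j\<in>K. F c i j x) = (\<Sum>i\<in>J. \<Sum>j\<in>K. LINT x:E|M. F c i j x)"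
      using 1(2)[OF that] by simp
  qed
  show "set_integrable M E (\<lambda>x. \<Sum>c\<in>I. \<Sum>i\<in>J. \<Sum>j\<in>K. F c i j x)"
    by (rule set_integral_sum'(1)[OF assms(1)]) (rule 2(1))
  have "(LINT x:E|M. \<Sum>c\<in>I. \<Sum>i\<in>J. \<Sum>j\<in>K. F c i j x) = (\<Sum>c\<in>I. LINT x:E|M. \<Sum>i\<in>J. \<Sum>j\<in>K. F c i j x)"
    by (rule set_integral_sum'(2)[OF assms(1)]) (rule 2(1))
  then show "(LINT x:E|M. \<Sum>c\<in>I. \<Sum>i\<in>J. \<Sum>j\<in>K. F c i j x) = (\<Sum>c\<in>I. \<Sum>i\<in>J. \<Sum>j\<in>K. LINT x:E|M. F c i j x)"
    using 2(2) by simp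
qed

lemma sum_rotate3: "(\<Sum>c\<in>I. \<Sum>i\<in>J. \<Sum>j\<in>K. F c i j) = (\<Sum>i\<in>J. \<Sum>j\<in>K. \<Sum>c\<in>I. (F c i j :: real))"
proof -
  have "(\<Sum>c\<in>I. \<Sum>i\<in>J. \<Sum>j\<in>K. F c i j) = (\<Sum>i\<in>J. \<Sum>c\<in>I. \<Sum>j\<in>K. F c i j)" by (rule sum.swap)
  also have "\<dots> = (\<Sum>i\<in>J. \<Sum>j\<in>K. \<Sum>c\<in>I. F c i j)" by (rule sum.cong[OF refl], rule sum.swap)
  finally show ?thesis .
qed

text \<open>For fixed i and j the family over c solves the original system. Applying the
  differentiation lemma twice also yields the existence of the second weak derivatives, which
  \<open>W12\<close> does not contain.\<close>

lemma dsol_hess: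
  fixes \<alpha> :: "(real, 'n::finite) vec \<Rightarrow> 'n fv"
  assumes l: "l > 0" and a: "elliptic (Ix k N) a l L" and U: "open U" and u: "dsol U (Ix k N) a (\<lambda>c y. \<alpha> y c)"
  shows "dsol U (Ix k N) a (\<lambda>c x. hess U \<alpha> x c i j)"
  unfolding hess_def
  by (rule dsol_wpd[OF finite_Ix l a U dsol_wpd[OF finite_Ix l a U u]])

lemma vari_eq: "vari E f = (LINT x:E|lebesgue. (f x - avg E f)\<^sup>2) / measure lebesgue E"
  unfolding vari_def by (rule avg_def)

lemma avg_nonneg: "(\<And>x. x \<in> E \<Longrightarrow> 0 \<le> f x) \<Longrightarrow> 0 \<le> avg E f"
  unfolding avg_def by (intro divide_nonneg_nonneg set_integral_nonneg_lebesgue) auto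

text \<open>The summation order is changed so that i and j are outermost: the general estimates
  apply to the family over c with i and j fixed.\<close>

lemma hess_osc2_eq:
  fixes \<alpha> :: "(real, 'n::finite) vec \<Rightarrow> 'n fv"
  assumes E: "E \<in> lmeasurable"
    and "\<And>c i j. c \<in> Ix k N \<Longrightarrow> set_integrable lebesgue E (\<lambda>x. hess U \<alpha> x c i j)"
      "\<And>c i j. c \<in> Ix k N \<Longrightarrow> set_integrable lebesgue E (\<lambda>x. (hess U \<alpha> x c i j)\<^sup>2)"
  shows "hess_osc2 U k N \<alpha> E = (\<Sum>i\<in>UNIV. \<Sum>j\<in>UNIV. \<Sum>c\<in>Ix k N. vari E (\<lambda>x. hess U \<alpha> x c i j))"
proof -
  have "hess_osc2 U k N \<alpha> E = (\<Sum>c\<in>Ix k N. \<Sum>i\<in>UNIV. \<Sum>j\<in>UNIV. vari E (\<lambda>x. hess U \<alpha> x c i j))"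
  proof -
    let ?q = "\<lambda>c i j x. (hess U \<alpha> x c i j - avg E (\<lambda>y. hess U \<alpha> y c i j))\<^sup>2"
    have "hess_osc2 U k N \<alpha> E = (LINT x:E|lebesgue. \<Sum>c\<in>Ix k N. \<Sum>i\<in>UNIV. \<Sum>j\<in>UNIV. ?q c i j x) / measure lebesgue E"
      unfolding hess_osc2_def by (rule avg_def)
    also have "(LINT x:E|lebesgue. \<Sum>c\<in>Ix k N. \<Sum>i\<in>UNIV. \<Sum>j\<in>UNIV. ?q c i j x)
        = (\<Sum>c\<in>Ix k N. \<Sum>i\<in>UNIV. \<Sum>j\<in>UNIV. LINT x:E|lebesgue. ?q c i j x)"
      by (rule set_integral_sum3(2)[OF finite_Ix finite finite]) (rule integral_square_diff(2)[OF E assms(2) assms(3)])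
    also have "\<dots> / measure lebesgue E = (\<Sum>c\<in>Ix k N. \<Sum>i\<in>UNIV. \<Sum>j\<in>UNIV. (LINT x:E|lebesgue. ?q c i j x) / measure lebesgue E)"
      by (simp only: sum_divide_distrib)
    finally show ?thesis by (simp only: vari_eq)
  qed
  from trans[OF this sum_rotate3] show ?thesis .
qed

lemma loc_int_ball:
  assumes "loc_int U f" "cball x0 r \<subseteq> U" "s \<le> r"
  shows "set_integrable lebesgue (ball x0 s) f"
proof -
  have "set_integrable lebesgue (cball x0 r) f"
    using assms(1,2) by (simp add: loc_int_def)
  then show ?thesis
    by (rule set_integrable_subset) (use assms(3) in auto)
qed

lemma hess_continuous_rep:
  fixes \<alpha> :: "(real, 'n::finite) vec \<Rightarrow> 'n fv"
  assumes "l > 0" "elliptic (Ix k N) a l L" "open U" "dsol U (Ix k N) a (\<lambda>c y. \<alpha> y c)"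
  shows "\<exists>g. \<forall>c\<in>Ix k N. \<forall>i j. ae_eq U (\<lambda>x. hess U \<alpha> x c i j) (g c i j) \<and> continuous_on U (g c i j)"
proof -
  have "\<forall>i j. \<exists>v. \<forall>c\<in>Ix k N. ae_eq U (\<lambda>x. hess U \<alpha> x c i j) (v c) \<and> continuous_on U (v c)"
    using dsol_continuous_rep[OF finite_Ix assms(1-3) dsol_hess[OF assms]] by blast
  then obtain v where "\<forall>i j. \<forall>c\<in>Ix k N. ae_eq U (\<lambda>x. hess U \<alpha> x c i j) (v i j c) \<and> continuous_on U (v i j c)"
    by metis
  then show ?thesis by (intro exI[of _ "\<lambda>c i j. v i j c"]) blast
qed

text \<open>Every entry of the Hessian agrees almost everywhere with a continuous function, so
  continuous expressions in the entries are locally integrable. The functions \<phi> needed later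
  are \<open>sqrt\<close> and its p-th power.\<close>

lemma loc_int_hess:
  fixes \<alpha> :: "(real, 'n::finite) vec \<Rightarrow> 'n fv" and \<phi> :: "real \<Rightarrow> real"
  assumes "l > 0" "elliptic (Ix k N) a l L" "open U" "dsol U (Ix k N) a (\<lambda>c y. \<alpha> y c)"
  shows "c \<in> Ix k N \<Longrightarrow> loc_int U (\<lambda>x. hess U \<alpha> x c i j)"
    "c \<in> Ix k N \<Longrightarrow> loc_int U (\<lambda>x. (hess U \<alpha> x c i j)\<^sup>2)"
    "continuous_on {0..} \<phi> \<Longrightarrow> loc_int U (\<lambda>x. \<phi> (hess_norm2 U k N \<alpha> x))"
proof -
  from hess_continuous_rep[OF assms] obtain g
    where g': "\<forall>c\<in>Ix k N. \<forall>i j. ae_eq U (\<lambda>x. hess U \<alpha> x c i j) (g c i j) \<and> continuous_on U (g c i j)" ..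
  then have g: "\<And>c i j. c \<in> Ix k N \<Longrightarrow> ae_eq U (\<lambda>x. hess U \<alpha> x c i j) (g c i j)"
    "\<And>c i j. c \<in> Ix k N \<Longrightarrow> continuous_on U (g c i j)" by blast+
  have g2: "ae_eq U (\<lambda>x. (hess U \<alpha> x c i j)\<^sup>2) (\<lambda>x. (g c i j x)\<^sup>2)" if "c \<in> Ix k N" for c i j
    using ae_eq_fun[OF g(1)[OF that], of "\<lambda>_ t. t\<^sup>2"] .
  show "loc_int U (\<lambda>x. hess U \<alpha> x c i j)" if c: "c \<in> Ix k N"
    by (rule loc_int_ae_eq[OF ae_eq_sym[OF g(1)[OF c]] loc_int_continuous[OF g(2)[OF c]]])
  show "loc_int U (\<lambda>x. (hess U \<alpha> x c i j)\<^sup>2)" if c: "c \<in> Ix k N"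
    by (rule loc_int_ae_eq[OF ae_eq_sym[OF g2[OF c]] loc_int_continuous])
      (intro continuous_intros g(2) c)
  define h where "h = (\<lambda>x. \<Sum>c\<in>Ix k N. \<Sum>i\<in>UNIV. \<Sum>j\<in>UNIV. (g c i j x)\<^sup>2)"
  have "ae_eq U (hess_norm2 U k N \<alpha>) h"
    unfolding hess_norm2_def[abs_def] h_def by (intro ae_eq_sum finite_Ix finite g2)
  then have e: "ae_eq U (\<lambda>x. \<phi> (hess_norm2 U k N \<alpha> x)) (\<lambda>x. \<phi> (h x))"
    by (rule ae_eq_fun[where F = "\<lambda>_. \<phi>"])
  have "continuous_on U h"
    unfolding h_def by (intro continuous_intros g(2))
  moreover have "h ` U \<subseteq> {0..}" by (auto simp: h_def intro!: sum_nonneg)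
  ultimately have "continuous_on U (\<lambda>x. \<phi> (h x))" if "continuous_on {0..} \<phi>"
    using continuous_on_compose2[OF that] by blast
  then show "loc_int U (\<lambda>x. \<phi> (hess_norm2 U k N \<alpha> x))" if "continuous_on {0..} \<phi>"
    using that by (intro loc_int_ae_eq[OF ae_eq_sym[OF e] loc_int_continuous])
qed

text \<open>All pairs i, j obey the same system and hence share the constant K, so the componentwise
  estimates can be added without loss.\<close>

lemma hess_osc_decay:
  assumes l: "l > 0"
  shows "\<exists>K\<ge>0. \<forall>U a (\<alpha> :: (real, 'n::finite) vec \<Rightarrow> 'n fv) x0 \<rho> r.
     elliptic (Ix k N) a l L \<and> dsol U (Ix k N) a (\<lambda>c y. \<alpha> y c) \<and> open U \<and> 0 < \<rho> \<and> \<rho> \<le> r \<and> cball x0 r \<subseteq> U \<longrightarrow>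
     hess_osc2 U k N \<alpha> (ball x0 \<rho>) \<le> (K * (\<rho> / r))\<^sup>2 * hess_osc2 U k N \<alpha> (ball x0 r)"
proof -
  let ?I = "Ix k N :: ('n set \<times> nat) set"
  from osc_decay[where I = ?I, OF finite_Ix l, where L = L]
  obtain K where K: "K \<ge> 0" and K': "\<forall>(a :: 'n set \<times> nat \<Rightarrow> 'n set \<times> nat \<Rightarrow> 'n \<Rightarrow> 'n \<Rightarrow> real) U u x0 \<rho> r.
     elliptic ?I a l L \<and> dsol U ?I a u \<and> open U \<and> 0 < \<rho> \<and> \<rho> \<le> r \<and> cball x0 r \<subseteq> U \<and>
     (\<forall>c\<in>?I. set_integrable lebesgue (ball x0 r) (\<lambda>x. (u c x)\<^sup>2)) \<longrightarrow>
     (\<Sum>c\<in>?I. vari (ball x0 \<rho>) (u c)) \<le> (K * (\<rho> / r))\<^sup>2 * (\<Sum>c\<in>?I. vari (ball x0 r) (u c))"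
    by (elim exE conjE)
  have main: "hess_osc2 U k N \<alpha> (ball x0 \<rho>) \<le> (K * (\<rho> / r))\<^sup>2 * hess_osc2 U k N \<alpha> (ball x0 r)"
    if h: "elliptic ?I a l L" "dsol U ?I a (\<lambda>c y. \<alpha> y c)" "open U" "0 < \<rho>" "\<rho> \<le> r" "cball x0 r \<subseteq> U"
    for U a and \<alpha> :: "(real, 'n) vec \<Rightarrow> 'n fv" and x0 \<rho> r
  proof -
    note loc = loc_int_hess(1,2)[OF l h(1,3,2)]
    have eq: "hess_osc2 U k N \<alpha> (ball x0 s) = (\<Sum>i\<in>UNIV. \<Sum>j\<in>UNIV. \<Sum>c\<in>?I. vari (ball x0 s) (\<lambda>x. hess U \<alpha> x c i j))"
      if "s \<le> r" for s
      by (intro hess_osc2_eq lmeasurable_ball loc_int_ball[OF loc(1) h(6) that] loc_int_ball[OF loc(2) h(6) that])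
    have "(\<Sum>c\<in>?I. vari (ball x0 \<rho>) (\<lambda>x. hess U \<alpha> x c i j))
        \<le> (K * (\<rho> / r))\<^sup>2 * (\<Sum>c\<in>?I. vari (ball x0 r) (\<lambda>x. hess U \<alpha> x c i j))" for i j
      by (rule K'[rule_format, of a U "\<lambda>c x. hess U \<alpha> x c i j"], intro conjI ballI h dsol_hess[OF l h(1,3,2)])
        (rule loc_int_ball[OF loc(2) h(6) order_refl])
    then show ?thesis
      unfolding eq[OF h(5)] eq[OF order_refl] sum_distrib_left[of _ _ UNIV] by (intro sum_mono)
  qed
  show ?thesis using K
    by (intro exI[of _ K] conjI allI impI, assumption, elim conjE) (rule main; assumption)
qed

lemma abs_hess_le:
  assumes c: "c \<in> Ix k N"
  shows "\<bar>hess U \<alpha> x c i j\<bar> \<le> sqrt (hess_norm2 U k N \<alpha> x)"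
proof (rule real_le_rsqrt)
  have "(hess U \<alpha> x c i j)\<^sup>2 \<le> (\<Sum>j\<in>UNIV. (hess U \<alpha> x c i j)\<^sup>2)"
    by (rule member_le_sum) auto
  also have "\<dots> \<le> (\<Sum>i\<in>UNIV. \<Sum>j\<in>UNIV. (hess U \<alpha> x c i j)\<^sup>2)"
    by (rule member_le_sum[of i UNIV "\<lambda>i. \<Sum>j\<in>UNIV. (hess U \<alpha> x c i j)\<^sup>2"]) (auto intro!: sum_nonneg)
  also have "\<dots> \<le> hess_norm2 U k N \<alpha> x"
    unfolding hess_norm2_def
    by (rule member_le_sum[of c "Ix k N" "\<lambda>c. \<Sum>i\<in>UNIV. \<Sum>j\<in>UNIV. (hess U \<alpha> x c i j)\<^sup>2"])
      (auto intro!: sum_nonneg finite_Ix c)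
  finally show "\<bar>hess U \<alpha> x c i j\<bar>\<^sup>2 \<le> hess_norm2 U k N \<alpha> x" by simp
qed

text \<open>On the half ball each entry is bounded by the \<open>L^1\<close> norms of entries on the
  larger ball, and each entry is at most the full norm of the Hessian. The exponent on the right is
  1; exponents above 1 follow by comparing averages.\<close>

lemma hess_reverse_holder_1:
  assumes l: "l > 0"
  shows "\<exists>C\<ge>0. \<forall>U a (\<alpha> :: (real, 'n::finite) vec \<Rightarrow> 'n fv) x0 r.
     elliptic (Ix k N) a l L \<and> dsol U (Ix k N) a (\<lambda>c y. \<alpha> y c) \<and> open U \<and> 0 < r \<and> ball x0 r \<subseteq> U \<longrightarrow>
     sqrt (avg (ball x0 (r/2)) (hess_norm2 U k N \<alpha>))
       \<le> C * avg (ball x0 (3*r/4)) (\<lambda>x. sqrt (hess_norm2 U k N \<alpha> x))"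
proof -
  let ?I = "Ix k N :: ('n set \<times> nat) set" and ?n = "CARD('n)"
  from sup_bound[where I = ?I, OF finite_Ix l, where L = L]
  obtain K where K: "K \<ge> 0" and K': "\<forall>(a :: 'n set \<times> nat \<Rightarrow> 'n set \<times> nat \<Rightarrow> 'n \<Rightarrow> 'n \<Rightarrow> real) U u x0 r.
     elliptic ?I a l L \<and> dsol U ?I a u \<and> open U \<and> 0 < r \<and> ball x0 r \<subseteq> U \<longrightarrow>
     (\<exists>v. \<forall>c\<in>?I. ae_eq (ball x0 (r/2)) (u c) (v c) \<and>
        (\<forall>x\<in>ball x0 (r/2). \<bar>v c x\<bar> \<le> K / r ^ ?n * (\<Sum>c\<in>?I. LINT x:ball x0 (3*r/4)|lebesgue. \<bar>u c x\<bar>)))"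
    by (elim exE conjE)
  define \<omega> where "\<omega> = measure lebesgue (ball (0::real^'n) 1)"
  have \<omega>: "\<omega> > 0" unfolding \<omega>_def by (rule measure_unit_ball_pos)
  define s where "s = sqrt (real (card ?I) * (real ?n * real ?n))"
  \<comment> \<open>s is the square root of the number of Hessian entries, K \<open>card I\<close>
    comes from the supremum bound, and \<omega> (3/4)^n turns the integral over the ball of radius
    3r/4 into an average.\<close>
  define C where "C = s * (K * real (card ?I) * \<omega> * (3/4) ^ ?n)"
  have main: "sqrt (avg (ball x0 (r/2)) (hess_norm2 U k N \<alpha>))
       \<le> C * avg (ball x0 (3*r/4)) (\<lambda>x. sqrt (hess_norm2 U k N \<alpha> x))"
    if h: "elliptic ?I a l L" "dsol U ?I a (\<lambda>c y. \<alpha> y c)" "open U" "0 < r" "ball x0 r \<subseteq> U"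
    for U a and \<alpha> :: "(real, 'n) vec \<Rightarrow> 'n fv" and x0 r
  proof -
    let ?b = "ball x0 (r/2)" and ?E = "ball x0 (3*r/4)" and ?h = "\<lambda>c i j x. hess U \<alpha> x c i j"
    define T where "T = (\<lambda>x. sqrt (hess_norm2 U k N \<alpha> x))"
    define W where "W = (LINT x:?E|lebesgue. T x)"
    define G where "G = K / r ^ ?n * (real (card ?I) * W)"
    note loc = loc_int_hess[OF l h(1,3,2)]
    have E: "cball x0 (3*r/4) \<subseteq> U"
      by (rule order_trans[OF _ h(5)]) (use h(4) in auto)
    have bE: "r/2 \<le> 3*r/4" using h(4) by simp
    have mb: "measure lebesgue ?b > 0" "measure lebesgue ?b = \<omega> * (r/2) ^ ?n" "measure lebesgue ?E = \<omega> * (3*r/4) ^ ?n"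
      using measure_ball_scale[of "r/2" x0] measure_ball_scale[of "3*r/4" x0] h(4) \<omega> by (simp_all add: \<omega>_def)
    have T: "set_integrable lebesgue ?E T"
      unfolding T_def by (intro loc_int_ball[OF loc(3) E] continuous_intros) simp
    have W0: "W \<ge> 0" unfolding W_def T_def
      by (intro set_integral_nonneg_lebesgue real_sqrt_ge_zero) (auto simp: hess_norm2_def intro!: sum_nonneg)
    have WE: "W = avg ?E T * (\<omega> * (3*r/4) ^ ?n)"
      unfolding avg_def mb W_def using \<omega> h(4) by simp
    have G0: "G \<ge> 0" unfolding G_def using K W0 h(4) by simp
    have hb: "(LINT x:?b|lebesgue. (?h c i j x)\<^sup>2) \<le> G\<^sup>2 * measure lebesgue ?b" if c: "c \<in> ?I" for c i j
    proof -
      from K'[rule_format, of a U "\<lambda>c. ?h c i j" r x0] dsol_hess[OF l h(1,3,2)] h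
      obtain v where v: "\<forall>c\<in>?I. ae_eq ?b (?h c i j) (v c) \<and>
          (\<forall>x\<in>?b. \<bar>v c x\<bar> \<le> K / r ^ ?n * (\<Sum>c\<in>?I. LINT x:?E|lebesgue. \<bar>?h c i j x\<bar>))"
        by blast
      have "(LINT x:?E|lebesgue. \<bar>?h c' i j x\<bar>) \<le> W" if "c' \<in> ?I" for c'
        unfolding W_def using loc_int_ball[OF loc(1)[OF that] E order_refl] abs_hess_le[OF that]
        by (intro set_integral_le T set_integrable_abs) (auto simp: T_def)
      then have "(\<Sum>c\<in>?I. LINT x:?E|lebesgue. \<bar>?h c i j x\<bar>) \<le> real (card ?I) * W"
        by (rule sum_bounded_above)
      then have "K / r ^ ?n * (\<Sum>c\<in>?I. LINT x:?E|lebesgue. \<bar>?h c i j x\<bar>) \<le> G"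
        unfolding G_def using K h(4) by (intro mult_left_mono) auto
      note GG = this
      have vG: "\<bar>v c x\<bar> \<le> G" if "x \<in> ?b" for x
        by (rule order_trans[OF v[rule_format, OF c, THEN conjunct2, rule_format, OF that] GG])
      have ae: "ae_eq ?b (\<lambda>x. (?h c i j x)\<^sup>2) (\<lambda>x. (v c x)\<^sup>2)"
        using v c by (intro ae_eq_fun[where F = "\<lambda>_ t. t\<^sup>2"]) blast
      have "(LINT x:?b|lebesgue. (?h c i j x)\<^sup>2) = (LINT x:?b|lebesgue. (v c x)\<^sup>2)"
        by (rule set_integral_ae_eq[OF ae])
      also have "\<dots> \<le> (LINT x:?b|lebesgue. G\<^sup>2)"
      proof (rule set_integral_le)
        show "set_integrable lebesgue ?b (\<lambda>x. (v c x)\<^sup>2)"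
          using loc_int_ball[OF loc(2)[OF c] E bE] set_integrable_ae_eq[OF ae] by simp
        show "set_integrable lebesgue ?b (\<lambda>x. G\<^sup>2)" by (rule set_integral_const_lebesgue(1)[OF lmeasurable_ball])
        show "(v c x)\<^sup>2 \<le> G\<^sup>2" if "x \<in> ?b" for x
          using vG[OF that] G0 by (simp add: abs_le_square_iff[symmetric])
      qed
      also have "\<dots> = G\<^sup>2 * measure lebesgue ?b" by (rule set_integral_const_lebesgue(2)[OF lmeasurable_ball])
      finally show ?thesis .
    qed
    have "(LINT x:?b|lebesgue. hess_norm2 U k N \<alpha> x)
        = (\<Sum>c\<in>?I. \<Sum>i\<in>UNIV. \<Sum>j\<in>UNIV. LINT x:?b|lebesgue. (?h c i j x)\<^sup>2)"
      unfolding hess_norm2_def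
      by (intro set_integral_sum3(2) finite_Ix finite loc_int_ball[OF loc(2) E bE])
    also have "\<dots> \<le> (\<Sum>c\<in>?I. \<Sum>i\<in>(UNIV :: 'n set). \<Sum>j\<in>(UNIV :: 'n set). G\<^sup>2 * measure lebesgue ?b)"
      by (intro sum_mono hb)
    also have "\<dots> = (s\<^sup>2 * G\<^sup>2) * measure lebesgue ?b" by (simp add: s_def)
    finally have "avg ?b (hess_norm2 U k N \<alpha>) \<le> (s * G)\<^sup>2"
      unfolding avg_def using mb(1) by (simp add: pos_divide_le_eq power_mult_distrib)
    then have "sqrt (avg ?b (hess_norm2 U k N \<alpha>)) \<le> s * G"
      using G0 by (intro real_le_lsqrt) (auto simp: s_def)
    also have "s * G = C * avg ?E T"
      unfolding C_def G_def WE using h(4) by (simp add: power_mult_distrib power_divide)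
    finally show ?thesis unfolding T_def .
  qed
  have "C \<ge> 0" unfolding C_def s_def using K \<omega> by simp
  then show ?thesis
    by (intro exI[of _ C] conjI allI impI, assumption, elim conjE) (rule main; assumption)
qed

theorem theorem4p2:
  fixes k N :: nat and gA gB nA nB :: real
  assumes "CARD('n::{finite,linorder}) \<ge> 2"
    and "1 \<le> k" and "k \<le> CARD('n) - 1" and "1 \<le> N"
    and "0 < gA" and "gA \<le> 1" and "0 < gB" and "gB \<le> 1"
  shows
   "(\<exists>C>0. \<forall>(U :: ((real, 'n) vec) set) A B \<alpha> (x0 :: (real, 'n) vec) \<rho> r.
       open U \<and> legendre_elliptic (k+1) N gA A \<and> legendre_elliptic k N gB B \<and>
       opnorm (k+1) N A = nA \<and> opnorm k N B = nB \<and>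
       W12 U k N \<alpha> \<and> (sys_i U k N A B \<alpha> \<or> sys_ii U k N A B \<alpha>) \<and>
       0 < \<rho> \<and> \<rho> \<le> r \<and> cball x0 r \<subseteq> U
       \<longrightarrow> sqrt (hess_osc2 U k N \<alpha> (ball x0 \<rho>))
             \<le> C * (\<rho> / r) * sqrt (hess_osc2 U k N \<alpha> (ball x0 r)))
    \<and> (\<forall>p. 1 < p \<and> p < 2 \<longrightarrow>
       (\<exists>C>0. \<forall>(U :: ((real, 'n) vec) set) A B \<alpha> (x0 :: (real, 'n) vec) r.
       open U \<and> legendre_elliptic (k+1) N gA A \<and> legendre_elliptic k N gB B \<and>
       opnorm (k+1) N A = nA \<and> opnorm k N B = nB \<and>
       W12 U k N \<alpha> \<and> (sys_i U k N A B \<alpha> \<or> sys_ii U k N A B \<alpha>) \<and>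
       0 < r \<and> ball x0 r \<subseteq> U
       \<longrightarrow> sqrt (avg (ball x0 (r/2)) (hess_norm2 U k N \<alpha>))
             \<le> C * (avg (ball x0 (3*r/4)) (\<lambda>x. sqrt (hess_norm2 U k N \<alpha> x) powr p)) powr (1/p)))"
proof -
  \<comment> \<open>\<open>l\<close> and \<open>L\<close> are obtained before U, A, B and \<alpha>,
    so every constant built from them depends only on the fixed data.\<close>
  from system_elliptic_dsol[OF assms(2,5-7), where nA = nA and nB = nB and N = N and 'n = 'n]
  obtain l L where l: "l > 0" and sys: "\<forall>(U :: ((real, 'n) vec) set) A B \<alpha>. open U \<and> legendre_elliptic (k+1) N gA A \<and> legendre_elliptic k N gB B \<and>
      opnorm (k+1) N A = nA \<and> opnorm k N B = nB \<and> W12 U k N \<alpha> \<and> (sys_i U k N A B \<alpha> \<or> sys_ii U k N A B \<alpha>) \<longrightarrow>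
      (\<exists>a. elliptic (Ix k N) a l L \<and> dsol U (Ix k N) a (\<lambda>c y. \<alpha> y c))"
    by (elim exE conjE)
  show ?thesis
  proof (intro conjI allI impI)
    from hess_osc_decay[OF l, where 'n = 'n and k = k and N = N and L = L]
    obtain K where K: "K \<ge> 0" and K': "\<forall>U a (\<alpha> :: (real, 'n) vec \<Rightarrow> 'n fv) x0 \<rho> r.
       elliptic (Ix k N) a l L \<and> dsol U (Ix k N) a (\<lambda>c y. \<alpha> y c) \<and> open U \<and> 0 < \<rho> \<and> \<rho> \<le> r \<and> cball x0 r \<subseteq> U \<longrightarrow>
       hess_osc2 U k N \<alpha> (ball x0 \<rho>) \<le> (K * (\<rho> / r))\<^sup>2 * hess_osc2 U k N \<alpha> (ball x0 r)"
      by (elim exE conjE)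
    \<comment> \<open>K may be 0, whereas a positive constant is claimed; hence K + 1.\<close>
    have main: "sqrt (hess_osc2 U k N \<alpha> (ball x0 \<rho>)) \<le> (K + 1) * (\<rho> / r) * sqrt (hess_osc2 U k N \<alpha> (ball x0 r))"
      if h: "open U" "elliptic (Ix k N) a l L" "dsol U (Ix k N) a (\<lambda>c y. \<alpha> y c)" "0 < \<rho>" "\<rho> \<le> r" "cball x0 r \<subseteq> U"
      for U a and \<alpha> :: "(real, 'n) vec \<Rightarrow> 'n fv" and x0 \<rho> r
    proof -
      have "hess_osc2 U k N \<alpha> (ball x0 r) \<ge> 0"
        unfolding hess_osc2_def by (intro avg_nonneg sum_nonneg) auto
      moreover have "sqrt (hess_osc2 U k N \<alpha> (ball x0 \<rho>)) \<le> sqrt ((K * (\<rho> / r))\<^sup>2 * hess_osc2 U k N \<alpha> (ball x0 r))"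
        using K'[rule_format, of a U \<alpha> \<rho> r x0] h by (intro real_sqrt_le_mono) blast
      ultimately have "sqrt (hess_osc2 U k N \<alpha> (ball x0 \<rho>)) \<le> K * (\<rho> / r) * sqrt (hess_osc2 U k N \<alpha> (ball x0 r))"
        using K h(4,5) by (simp add: real_sqrt_mult)
      also have "\<dots> \<le> (K + 1) * (\<rho> / r) * sqrt (hess_osc2 U k N \<alpha> (ball x0 r))"
        using h(4,5) \<open>hess_osc2 U k N \<alpha> (ball x0 r) \<ge> 0\<close> by (intro mult_right_mono) auto
      finally show ?thesis .
    qed
    have main': "sqrt (hess_osc2 U k N \<alpha> (ball x0 \<rho>)) \<le> (K + 1) * (\<rho> / r) * sqrt (hess_osc2 U k N \<alpha> (ball x0 r))"
      if h: "open U \<and> legendre_elliptic (k+1) N gA A \<and> legendre_elliptic k N gB B \<and>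
       opnorm (k+1) N A = nA \<and> opnorm k N B = nB \<and>
       W12 U k N \<alpha> \<and> (sys_i U k N A B \<alpha> \<or> sys_ii U k N A B \<alpha>) \<and>
       0 < \<rho> \<and> \<rho> \<le> r \<and> cball x0 r \<subseteq> U"
      for U A B and \<alpha> :: "(real, 'n) vec \<Rightarrow> 'n fv" and x0 \<rho> r
    proof -
      from h have "\<exists>a. elliptic (Ix k N) a l L \<and> dsol U (Ix k N) a (\<lambda>c y. \<alpha> y c)"
        by (intro sys[rule_format, of U A B \<alpha>] conjI) (elim conjE, assumption)+
      then obtain a where "elliptic (Ix k N) a l L" "dsol U (Ix k N) a (\<lambda>c y. \<alpha> y c)" by blast
      then show ?thesis using h by (intro main[of U a]) auto
    qed
    have "K + 1 > 0" using K by simp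
    then show "\<exists>C>0. \<forall>(U :: ((real, 'n) vec) set) A B \<alpha> (x0 :: (real, 'n) vec) \<rho> r.
       open U \<and> legendre_elliptic (k+1) N gA A \<and> legendre_elliptic k N gB B \<and>
       opnorm (k+1) N A = nA \<and> opnorm k N B = nB \<and>
       W12 U k N \<alpha> \<and> (sys_i U k N A B \<alpha> \<or> sys_ii U k N A B \<alpha>) \<and>
       0 < \<rho> \<and> \<rho> \<le> r \<and> cball x0 r \<subseteq> U
       \<longrightarrow> sqrt (hess_osc2 U k N \<alpha> (ball x0 \<rho>))
             \<le> C * (\<rho> / r) * sqrt (hess_osc2 U k N \<alpha> (ball x0 r))"
      by (intro exI[of _ "K + 1"] conjI allI impI, assumption) (rule main')
  next
    fix p :: real assume p: "1 < p \<and> p < 2"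
    from hess_reverse_holder_1[OF l, where 'n = 'n and k = k and N = N and L = L]
    obtain C where C: "C \<ge> 0" and C': "\<forall>U a (\<alpha> :: (real, 'n) vec \<Rightarrow> 'n fv) x0 r.
       elliptic (Ix k N) a l L \<and> dsol U (Ix k N) a (\<lambda>c y. \<alpha> y c) \<and> open U \<and> 0 < r \<and> ball x0 r \<subseteq> U \<longrightarrow>
       sqrt (avg (ball x0 (r/2)) (hess_norm2 U k N \<alpha>))
         \<le> C * avg (ball x0 (3*r/4)) (\<lambda>x. sqrt (hess_norm2 U k N \<alpha> x))"
      by (elim exE conjE)
    \<comment> \<open>The factor 2 comes from passing to exponent p, and the summand 1 makes the
      constant positive.\<close>
    have main: "sqrt (avg (ball x0 (r/2)) (hess_norm2 U k N \<alpha>))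
        \<le> (2 * C + 1) * (avg (ball x0 (3*r/4)) (\<lambda>x. sqrt (hess_norm2 U k N \<alpha> x) powr p)) powr (1/p)"
      if h: "open U" "elliptic (Ix k N) a l L" "dsol U (Ix k N) a (\<lambda>c y. \<alpha> y c)" "0 < r" "ball x0 r \<subseteq> U"
      for U a and \<alpha> :: "(real, 'n) vec \<Rightarrow> 'n fv" and x0 r
    proof -
      let ?E = "ball x0 (3*r/4)" and ?T = "\<lambda>x. sqrt (hess_norm2 U k N \<alpha> x)"
      note loc = loc_int_hess(3)[OF l h(2,1,3)]
      have E: "cball x0 (3*r/4) \<subseteq> U"
        by (rule order_trans[OF _ h(5)]) (use h(4) in auto)
      have "continuous_on {0..} (\<lambda>t. sqrt t powr p)"
        using p by (intro continuous_on_powr' continuous_intros) auto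
      from loc_int_ball[OF loc[OF this] E order_refl] have Tp: "set_integrable lebesgue ?E (\<lambda>x. ?T x powr p)" .
      have "set_integrable lebesgue ?E ?T"
        by (intro loc_int_ball[OF loc E order_refl] continuous_intros)
      then have "avg ?E ?T \<le> 2 * avg ?E (\<lambda>x. ?T x powr p) powr (1/p)"
        using h(4) p Tp content_ball_pos[of "3*r/4" x0]
        by (intro avg_le_powr) (auto simp: hess_norm2_def intro!: sum_nonneg)
      then have "C * avg ?E ?T \<le> C * (2 * avg ?E (\<lambda>x. ?T x powr p) powr (1/p))"
        using C by (rule mult_left_mono)
      also have "\<dots> \<le> (2 * C + 1) * avg ?E (\<lambda>x. ?T x powr p) powr (1/p)" by (simp add: algebra_simps)
      finally have le: "C * avg ?E ?T \<le> (2 * C + 1) * avg ?E (\<lambda>x. ?T x powr p) powr (1/p)" .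
      show ?thesis by (rule order_trans[OF C'[rule_format, of a] le]) (intro conjI h)
    qed
    have main': "sqrt (avg (ball x0 (r/2)) (hess_norm2 U k N \<alpha>))
        \<le> (2 * C + 1) * (avg (ball x0 (3*r/4)) (\<lambda>x. sqrt (hess_norm2 U k N \<alpha> x) powr p)) powr (1/p)"
      if h: "open U \<and> legendre_elliptic (k+1) N gA A \<and> legendre_elliptic k N gB B \<and>
       opnorm (k+1) N A = nA \<and> opnorm k N B = nB \<and>
       W12 U k N \<alpha> \<and> (sys_i U k N A B \<alpha> \<or> sys_ii U k N A B \<alpha>) \<and>
       0 < r \<and> ball x0 r \<subseteq> U"
      for U A B and \<alpha> :: "(real, 'n) vec \<Rightarrow> 'n fv" and x0 r
    proof -
      from h have "\<exists>a. elliptic (Ix k N) a l L \<and> dsol U (Ix k N) a (\<lambda>c y. \<alpha> y c)"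
        by (intro sys[rule_format, of U A B \<alpha>] conjI) (elim conjE, assumption)+
      then obtain a where "elliptic (Ix k N) a l L" "dsol U (Ix k N) a (\<lambda>c y. \<alpha> y c)" by blast
      then show ?thesis using h by (intro main[of U a]) auto
    qed
    have "2 * C + 1 > 0" using C by simp
    then show "\<exists>C>0. \<forall>(U :: ((real, 'n) vec) set) A B \<alpha> (x0 :: (real, 'n) vec) r.
       open U \<and> legendre_elliptic (k+1) N gA A \<and> legendre_elliptic k N gB B \<and>
       opnorm (k+1) N A = nA \<and> opnorm k N B = nB \<and>
       W12 U k N \<alpha> \<and> (sys_i U k N A B \<alpha> \<or> sys_ii U k N A B \<alpha>) \<and>
       0 < r \<and> ball x0 r \<subseteq> U
       \<longrightarrow> sqrt (avg (ball x0 (r/2)) (hess_norm2 U k N \<alpha>))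
             \<le> C * (avg (ball x0 (3*r/4)) (\<lambda>x. sqrt (hess_norm2 U k N \<alpha> x) powr p)) powr (1/p)"
      by (intro exI[of _ "2 * C + 1"] conjI allI impI, assumption) (rule main')
  qed
qed

end
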